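(* Let $\beta>0$, $L>0$, let $W\in\mathcal{W}(\beta,L)$, and let $z\in\mathbb{R}^{2}$ be a fixed point such that $\mathcal{R}^{\#}\mathcal{R}[W](z)>0$. Let $(X_1,\Phi_1),\dots,(X_n,\Phi_n)$ be i.i.d. random variables with values in $\mathbb{R}\times[0,\pi]$ having density $\mathcal{R}[W](x,\phi)$ with respect to the measure $\pi^{-1}\,d\phi\times dx$, and let $$\widehat W_n(z)=\frac1n\sum_{i=1}^n K_{\delta_n}\big([z,\Phi_i]-X_i\big),\qquad \frac{1}{\delta_n}=\frac{\log n}{2\beta}.$$ Then, as $n\to\infty$, $$\mathbb{E}\left[\big(\widehat W_n(z)-W(z)\big)^2\right]=C^{*}\,\mathcal{R}^{\#}\mathcal{R}[W](z)\,\frac{(\log n)^3}{n}\,(1+o(1)),\qquad C^{*}=\frac{\pi}{3(4\pi\beta)^3}.$$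
   Context: Fourier conventions: $\mathcal{F}[f](t)=\int f(x)e^{-ixt}\,dx$ and $\mathcal{F}^{-1}[g](x)=\frac1{2\pi}\int g(t)e^{ixt}\,dt$ in one dimension; in two dimensions, analogously, $\mathcal{F}_2^{-1}[g](z)=\frac{1}{(2\pi)^2}\int_{\mathbb{R}^2} g(w)e^{i\langle w,z\rangle}dw$. Wigner functions: a density matrix (state) is a selfadjoint, positive, trace-one operator $\rho$ on the complex Hilbert space $L_2(\mathbb{R})$. Let $\mathbf{Q}\psi(x)=x\psi(x)$ and $\mathbf{P}\psi(x)=-i\psi'(x)$ be the usual selfadjoint operators on $L_2(\mathbb R)$. Put $\widetilde W_\rho(u,v)=\mathrm{Tr}\big(\rho\exp(-iu\mathbf{Q}-iv\mathbf{P})\big)$ for $(u,v)\in\mathbb{R}^2$. The Wigner function of $\rho$ is the real function $W_\rho=\mathcal{F}_2^{-1}[\widetilde W_\rho]$ on $\mathbb{R}^2$; a Wigner function is a function of the form $W=W_\rho$ for some state $\rho$, and $\widetilde W=\widetilde W_\rho$ denotes its Fourier transform. Class: $\mathcal{W}(\beta,L)$ is the set of continuous Wigner functions $W$ with $\frac{1}{4\pi^2}\int_{\mathbb{R}^2}|\widetilde W(w)|^2\exp(2\beta|w|)\,dw\le L$. Radon transform: $\mathcal{R}[W](x,\phi)=\int_{-\infty}^{\infty}W(x\cos\phi-t\sin\phi,\;x\sin\phi+t\cos\phi)\,dt$. For a Wigner function $W$, one has $\mathcal F[\mathcal{R}[W](\cdot,\phi)](t)=\widetilde W(t\cos\phi,t\sin\phi)$,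 and $\mathcal{R}[W]$ is a probability density on $\mathbb{R}\times[0,\pi]$ with respect to $\pi^{-1}d\phi\times dx$. For $z=(q,p)\in\mathbb{R}^2$, $[z,\phi]=q\cos\phi+p\sin\phi$. The dual operator is $\mathcal{R}^{\#}[h](z)=\int_0^{2\pi}h([z,\phi],\phi)\,d\phi$, so $\mathcal{R}^{\#}\mathcal{R}[W](z)=\int_0^{2\pi}\mathcal{R}[W]([z,\phi],\phi)\,d\phi$. Kernel: for $\delta>0$, $K_\delta(u)=\frac{1}{4\pi}\int_{-1/\delta}^{1/\delta}|r|e^{iru}\,dr$, i.e. the function with Fourier transform $\widetilde K_\delta(t)=\frac12|t|\,\mathbf{1}\{|t|\le 1/\delta\}$. *)

theory Defs
  imports "HOL-Probability.Probability" "HOL-Library.Landau_Symbols"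
begin

section \<open>The Hilbert space of complex square-integrable functions on the line\<close>

text \<open>
  Vectors are represented by Borel functions; equality of vectors is equality almost everywhere
  (\<open>ae_eq\<close>). The inner product is linear in the second argument.
\<close>

type_synonym wave = "real \<Rightarrow> complex"

definition L2 :: "wave set" where
  "L2 = {f \<in> borel_measurable lborel. integrable lborel (\<lambda>x. (cmod (f x))\<^sup>2)}"

definition ae_eq :: "wave \<Rightarrow> wave \<Rightarrow> bool" where
  "ae_eq f g \<longleftrightarrow> (AE x in lborel. f x = g x)"

definition ip :: "wave \<Rightarrow> wave \<Rightarrow> complex" where
  "ip f g = (LINT x|lborel. cnj (f x) * g x)"

definition l2norm :: "wave \<Rightarrow> real" where
  "l2norm f = sqrt (LINT x|lborel. (cmod (f x))\<^sup>2)"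

definition orthonormal_basis :: "(nat \<Rightarrow> wave) \<Rightarrow> bool" where
  "orthonormal_basis e \<longleftrightarrow>
     (\<forall>k. e k \<in> L2) \<and>
     (\<forall>j k. ip (e j) (e k) = (if j = k then 1 else 0)) \<and>
     (\<forall>f\<in>L2. (\<forall>k. ip (e k) f = 0) \<longrightarrow> ae_eq f (\<lambda>_. 0))"

subsection \<open>Bounded operators, trace, density matrices\<close>

text \<open>
  Linearity is up to null sets, and the values outside \<open>L2\<close> are irrelevant.
  Linearity and boundedness together make the operator respect \<open>ae_eq\<close>.
\<close>

definition bounded_operator :: "(wave \<Rightarrow> wave) \<Rightarrow> bool" where
  "bounded_operator T \<longleftrightarrow>
     (\<forall>f\<in>L2. T f \<in> L2) \<and>
     (\<forall>f\<in>L2. \<forall>g\<in>L2. \<forall>a b. ae_eq (T (\<lambda>x. a * f x + b * g x)) (\<lambda>x. a * T f x + b * T g x)) \<and>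
     (\<exists>C. \<forall>f\<in>L2. l2norm (T f) \<le> C * l2norm f)"

definition selfadjoint_operator :: "(wave \<Rightarrow> wave) \<Rightarrow> bool" where
  "selfadjoint_operator T \<longleftrightarrow> bounded_operator T \<and> (\<forall>f\<in>L2. \<forall>g\<in>L2. ip f (T g) = ip (T f) g)"

text \<open>For a selfadjoint \<open>T\<close> the number \<open>ip f (T f)\<close> is real.\<close>

definition positive_operator :: "(wave \<Rightarrow> wave) \<Rightarrow> bool" where
  "positive_operator T \<longleftrightarrow> (\<forall>f\<in>L2. 0 \<le> Re (ip f (T f)))"

text \<open>
  The trace is the sum of the diagonal entries, required to exist and to agree in every
  orthonormal basis (as it does for trace-class operators).
\<close>

definition has_trace :: "(wave \<Rightarrow> wave) \<Rightarrow> complex \<Rightarrow> bool" where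
  "has_trace T \<tau> \<longleftrightarrow> (\<forall>e. orthonormal_basis e \<longrightarrow> (\<lambda>k. ip (e k) (T (e k))) sums \<tau>)"

definition op_trace :: "(wave \<Rightarrow> wave) \<Rightarrow> complex" where
  "op_trace T = (THE \<tau>. has_trace T \<tau>)"

definition density_matrix :: "(wave \<Rightarrow> wave) \<Rightarrow> bool" where
  "density_matrix \<rho> \<longleftrightarrow> selfadjoint_operator \<rho> \<and> positive_operator \<rho> \<and> has_trace \<rho> 1"

subsection \<open>Position, momentum and the exponential\<close>

text \<open>
  Unbounded operators are given by their graphs: \<open>A \<psi> \<eta>\<close> means that \<open>\<psi>\<close> is in the domain of \<open>A\<close>
  and \<open>A \<psi> = \<eta>\<close>. A linear combination has the intersection of the domains as its domain.
\<close>

type_synonym operator_graph = "wave \<Rightarrow> wave \<Rightarrow> bool"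

definition position_op :: operator_graph where
  "position_op \<psi> \<eta> \<longleftrightarrow> \<psi> \<in> L2 \<and> \<eta> \<in> L2 \<and> (\<forall>x. \<eta> x = of_real x * \<psi> x)"

text \<open>
  \<open>\<eta> = - \<i> \<psi>'\<close>, where \<open>\<psi>\<close> has a locally absolutely continuous representative \<open>\<psi>0\<close>
  whose almost everywhere derivative \<open>\<i> \<eta>\<close> is square-integrable.
\<close>

definition momentum_op :: operator_graph where
  "momentum_op \<psi> \<eta> \<longleftrightarrow> \<psi> \<in> L2 \<and> \<eta> \<in> L2 \<and>
     (\<exists>\<psi>0. ae_eq \<psi>0 \<psi> \<and> (\<forall>a b. a \<le> b \<longrightarrow> \<psi>0 b - \<psi>0 a = (LINT x:{a..b}|lborel. \<i> * \<eta> x)))"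

definition lin_comb_op :: "real \<Rightarrow> operator_graph \<Rightarrow> real \<Rightarrow> operator_graph \<Rightarrow> operator_graph" where
  "lin_comb_op u A v B \<psi> \<eta> \<longleftrightarrow>
     (\<exists>\<eta>1 \<eta>2. A \<psi> \<eta>1 \<and> B \<psi> \<eta>2 \<and> \<eta> = (\<lambda>x. of_real u * \<eta>1 x + of_real v * \<eta>2 x))"

text \<open>Strongly continuous one-parameter unitary groups (surjectivity follows from the group law).\<close>

definition unitary_group :: "(real \<Rightarrow> wave \<Rightarrow> wave) \<Rightarrow> bool" where
  "unitary_group U \<longleftrightarrow>
     (\<forall>s. bounded_operator (U s)) \<and>
     (\<forall>s. \<forall>f\<in>L2. \<forall>g\<in>L2. ip (U s f) (U s g) = ip f g) \<and>
     (\<forall>f\<in>L2. ae_eq (U 0 f) f) \<and>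
     (\<forall>s t. \<forall>f\<in>L2. ae_eq (U (s + t) f) (U s (U t f))) \<and>
     (\<forall>f\<in>L2. ((\<lambda>s. l2norm (\<lambda>x. U s f x - f x)) \<longlongrightarrow> 0) (at 0))"

text \<open>
  \<open>exp (- \<i> A)\<close> in the sense of Stone's theorem: the time-one operator of the unitary group \<open>U\<close>
  with \<open>d/ds (U s \<psi>) = - \<i> A \<psi>\<close> at \<open>s = 0\<close> for all \<open>\<psi>\<close> in the domain of \<open>A\<close>.
  If \<open>A\<close> is essentially selfadjoint, as \<open>u Q + v P\<close> is, then the group is the one generated by the
  closure of \<open>A\<close>, and the operator is determined up to null sets.
\<close>

definition is_exp_minus_i :: "operator_graph \<Rightarrow> (wave \<Rightarrow> wave) \<Rightarrow> bool" where
  "is_exp_minus_i A E \<longleftrightarrow>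
     (\<exists>U. unitary_group U \<and> E = U 1 \<and>
        (\<forall>\<psi> \<eta>. A \<psi> \<eta> \<longrightarrow>
           ((\<lambda>s. l2norm (\<lambda>x. (U s \<psi> x - \<psi> x) / of_real s + \<i> * \<eta> x)) \<longlongrightarrow> 0) (at 0)))"

definition exp_minus_i :: "operator_graph \<Rightarrow> wave \<Rightarrow> wave" where
  "exp_minus_i A = (SOME E. is_exp_minus_i A E)"

section \<open>Wigner functions\<close>

definition W_tilde :: "(wave \<Rightarrow> wave) \<Rightarrow> real \<times> real \<Rightarrow> complex" where
  "W_tilde \<rho> w =
     op_trace (\<lambda>\<psi>. \<rho> (exp_minus_i (lin_comb_op (fst w) position_op (snd w) momentum_op) \<psi>))"

definition inv_fourier2 :: "(real \<times> real \<Rightarrow> complex) \<Rightarrow> real \<times> real \<Rightarrow> complex" where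
  "inv_fourier2 g z = of_real (1 / (2 * pi)\<^sup>2) * (LINT w|lborel. g w * exp (\<i> * of_real (w \<bullet> z)))"

text \<open>
  In \<open>wigner_class\<close> below, the integrability condition forces \<open>W_tilde \<rho>\<close> to be integrable
  (by the Cauchy-Schwarz inequality, since \<open>\<beta> > 0\<close>), so there the inverse Fourier transform is a
  genuine Lebesgue integral. The equation includes that \<open>inv_fourier2 (W_tilde \<rho>)\<close> is real-valued.
\<close>

definition is_wigner_function_of :: "(wave \<Rightarrow> wave) \<Rightarrow> (real \<times> real \<Rightarrow> real) \<Rightarrow> bool" where
  "is_wigner_function_of \<rho> W \<longleftrightarrow> (\<forall>z. complex_of_real (W z) = inv_fourier2 (W_tilde \<rho>) z)"

definition wigner_class :: "real \<Rightarrow> real \<Rightarrow> (real \<times> real \<Rightarrow> real) set" where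
  "wigner_class \<beta> L = {W. continuous_on UNIV W \<and>
     (\<exists>\<rho>. density_matrix \<rho> \<and> is_wigner_function_of \<rho> W \<and>
        ennreal (1 / (4 * pi\<^sup>2)) *
          (\<integral>\<^sup>+ w. ennreal ((cmod (W_tilde \<rho> w))\<^sup>2 * exp (2 * \<beta> * norm w)) \<partial>lborel) \<le> ennreal L)}"

section \<open>Radon transform and the estimator\<close>

definition radon :: "(real \<times> real \<Rightarrow> real) \<Rightarrow> real \<Rightarrow> real \<Rightarrow> real" where
  "radon W x \<phi> = (LINT t|lborel. W (x * cos \<phi> - t * sin \<phi>, x * sin \<phi> + t * cos \<phi>))"

definition proj :: "real \<times> real \<Rightarrow> real \<Rightarrow> real" where
  "proj z \<phi> = fst z * cos \<phi> + snd z * sin \<phi>"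

definition dual_radon :: "(real \<Rightarrow> real \<Rightarrow> real) \<Rightarrow> real \<times> real \<Rightarrow> real" where
  "dual_radon h z = (LINT \<phi>:{0..2 * pi}|lborel. h (proj z \<phi>) \<phi>)"

text \<open>The measure \<open>dx \<times> d\<phi> / \<pi>\<close> on pairs \<open>(x, \<phi>)\<close>, carried by \<open>\<real> \<times> [0, \<pi>]\<close>.\<close>

definition data_measure :: "(real \<times> real) measure" where
  "data_measure = lborel \<Otimes>\<^sub>M uniform_measure lborel {0..pi}"

text \<open>The integral is real-valued (\<open>of_real_kern\<close>); \<open>Re\<close> only adjusts the type.\<close>

definition kern :: "real \<Rightarrow> real \<Rightarrow> real" where
  "kern \<delta> u = Re (of_real (1 / (4 * pi)) *
     (LINT r:{- 1 / \<delta>..1 / \<delta>}|lborel. of_real \<bar>r\<bar> * exp (\<i> * of_real (r * u))))"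

lemma of_real_kern:
  "complex_of_real (kern \<delta> u) =
     of_real (1 / (4 * pi)) *
       (LINT r:{- 1 / \<delta>..1 / \<delta>}|lborel. of_real \<bar>r\<bar> * exp (\<i> * of_real (r * u)))"
proof -
  let ?f = "\<lambda>r::real. indicator {- 1 / \<delta>..1 / \<delta>} r *\<^sub>R (complex_of_real \<bar>r\<bar> * exp (\<i> * of_real (r * u)))"
  define I where "I = (LINT r|lborel. ?f r)"
  have sym: "indicator {- 1 / \<delta>..1 / \<delta>} (- r) = (indicator {- 1 / \<delta>..1 / \<delta>} r :: real)" for r
    by (auto simp: indicator_def)
  have "cnj I = (LINT r|lborel. cnj (?f r))"
    unfolding I_def by (rule Bochner_Integration.integral_cnj [symmetric])
  also have "\<dots> = (LINT r|lborel. ?f (- r))"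
    unfolding sym by (simp add: exp_cnj)
  also have "\<dots> = I"
    unfolding I_def using lborel_integral_real_affine[of "-1" ?f 0] by simp
  finally have "cnj I = I" .
  then have "Im I = 0"
    by (simp add: complex_eq_iff)
  then show ?thesis
    unfolding kern_def set_lebesgue_integral_def I_def [symmetric] by (simp add: complex_eq_iff)
qed

text \<open>The bandwidth solves \<open>1 / \<delta> = ln n / (2 \<beta>)\<close>.\<close>

definition bandwidth :: "real \<Rightarrow> nat \<Rightarrow> real" where
  "bandwidth \<beta> n = 2 * \<beta> / ln (real n)"

definition W_hat ::
  "real \<Rightarrow> nat \<Rightarrow> (nat \<Rightarrow> 'a \<Rightarrow> real) \<Rightarrow> (nat \<Rightarrow> 'a \<Rightarrow> real) \<Rightarrow> real \<times> real \<Rightarrow> 'a \<Rightarrow> real" where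
  "W_hat \<beta> n X \<Phi> z \<omega> =
     (1 / real n) * (\<Sum>i=1..n. kern (bandwidth \<beta> n) (proj z (\<Phi> i \<omega>) - X i \<omega>))"

definition C_star :: "real \<Rightarrow> real" where
  "C_star \<beta> = pi / (3 * (4 * pi * \<beta>) ^ 3)"

end

theory Submission imports Defs begin

text \<open>
  Write \<open>F\<close> for the Fourier transform of \<open>W\<close> and \<open>D = ln n / (2 \<beta>)\<close> for the inverse bandwidth. The variables
  \<open>[z, \<Phi>] - X\<close> have an integrable characteristic function \<open>\<psi>\<close>, an average of \<open>F\<close> over the lines
  through the origin, and the integral of \<open>\<psi>\<close> is the backprojection of the Radon transform at \<open>z\<close>.
  The squared kernel is the Fourier transform of the self-convolution of \<open>|r|\<close> on \<open>[- D, D]\<close>; by scaling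
  its expectation is \<open>D\<^sup>3 / (16 \<pi>\<^sup>2)\<close> times the integral of \<open>\<psi> \<tau> G (\<tau> / D)\<close>, where \<open>G\<close> is bounded,
  continuous at \<open>0\<close>, and \<open>G 0 = 2 / 3\<close>. This gives the leading term of the variance. The bias is a tail
  integral of \<open>F\<close>, of order \<open>D exp (- \<beta> D) = D / sqrt n\<close>, so its square is negligible.

  That \<open>F\<close> is the trace of \<open>\<rho>\<close> against the Weyl operators requires Stone-type uniqueness for the
  unitary group generated by \<open>u Q + v P\<close>. Integrability of \<open>W\<close> on the plane is not known; instead \<open>W\<close> is cut
  into pieces localised in frequency, whose \<open>L1\<close> norms are controlled by the (nonnegative) Husimi
  function of \<open>\<rho>\<close>, so that \<open>W y / (1 + |y|)\<close> is integrable and Fubini applies along almost every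
  direction. The nonnegativity of the Radon transform comes from its total mass being \<open>1\<close>.
\<close>

section \<open>Square-integrable functions\<close>

text \<open>The weight \<open>1 / (1 + |y|)\<close> is forced twice. The mean of
  \<open>1 / (1 + x^2)\<close> over the projections x of y onto all directions is comparable to it,
  and the backprojection at z is twice the integral of \<open>W (z + y) / |y|\<close>. The class
  restricts the size of F but not its smoothness, so decay of W cannot be read off from F; it is
  extracted from the positivity of \<open>\<rho>\<close>. \<open>radon\<close> is a Bochner integral
  with value 0 on lines where W is not integrable, so the slice identity between
  \<open>radon W\<close> and F has to be proved, with Gaussian damping. The sampling hypothesis sees
  the Radon transform only through \<open>ennreal\<close>, that is, its positive part. The damped
  integrals of a slice tend to \<open>F 0 = 1\<close>, so the positive part has mass at least 1 plus
  the mass of a damped negative part, and the total leaves no room for the latter. The bandwidth is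
  tuned to \<open>exp (- 2 \<beta> D) = 1 / n\<close>: the squared bias \<open>D^2 / n\<close> loses
  against the variance \<open>D^3 / n\<close> by one logarithm only. The constant is
  \<open>(2 / 3) / (16 pi^2 (2 \<beta>)^3)\<close>.\<close>

lemma L2_measurable [measurable_dest]: "f \<in> L2 \<Longrightarrow> f \<in> borel_measurable borel"
  by (simp add: L2_def)

lemma L2_integrable: "f \<in> L2 \<Longrightarrow> integrable lborel (\<lambda>x. (cmod (f x))\<^sup>2)"
  by (simp add: L2_def)

lemma L2I:
  assumes "f \<in> borel_measurable borel" "integrable lborel (\<lambda>x. (cmod (f x))\<^sup>2)"
  shows "f \<in> L2"
  using assms by (simp add: L2_def)

lemma cmod_mult_le_half_squares: "cmod (a * b) \<le> ((cmod a)\<^sup>2 + (cmod b)\<^sup>2) / 2"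
proof -
  have "0 \<le> (cmod a - cmod b)\<^sup>2" by simp
  then show ?thesis by (simp add: norm_mult power2_eq_square algebra_simps)
qed

lemma borel_measurable_cnj [measurable (raw)]:
  "f \<in> borel_measurable M \<Longrightarrow> (\<lambda>x. cnj (f x)) \<in> borel_measurable M"
  by (rule borel_measurable_continuous_on[of cnj]) (auto intro!: continuous_intros)

lemma cnj_mult_self: "cnj a * a = of_real ((cmod a)\<^sup>2)"
  by (metis complex_norm_square mult.commute)

lemma L2_product_integrable:
  assumes "f \<in> L2" "g \<in> L2"
  shows "integrable lborel (\<lambda>x. cnj (f x) * g x)"
proof (rule Bochner_Integration.integrable_bound)
  show "integrable lborel (\<lambda>x. ((cmod (f x))\<^sup>2 + (cmod (g x))\<^sup>2) / 2)"
    using assms[THEN L2_integrable] by simp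
  show "(\<lambda>x. cnj (f x) * g x) \<in> borel_measurable lborel"
    using assms[THEN L2_measurable] by simp
  show "AE x in lborel. norm (cnj (f x) * g x) \<le> norm (((cmod (f x))\<^sup>2 + (cmod (g x))\<^sup>2) / 2)"
    using cmod_mult_le_half_squares[of "cnj (f _)" "g _"] by simp
qed

lemma L2_bound:
  assumes "f \<in> borel_measurable borel" "g \<in> L2" "AE x in lborel. cmod (f x) \<le> c * cmod (g x)"
  shows "f \<in> L2"
proof (rule L2I)
  show "integrable lborel (\<lambda>x. (cmod (f x))\<^sup>2)"
  proof (rule Bochner_Integration.integrable_bound)
    show "integrable lborel (\<lambda>x. c\<^sup>2 * (cmod (g x))\<^sup>2)"
      using assms(2) by (auto dest: L2_integrable)
    show "AE x in lborel. norm ((cmod (f x))\<^sup>2) \<le> norm (c\<^sup>2 * (cmod (g x))\<^sup>2)"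
      using assms(3) by eventually_elim
        (auto simp: power_mult_distrib[symmetric] intro!: power_mono order_trans[OF _ abs_ge_self])
  qed (use assms(1) in simp)
qed (use assms in auto)

lemma L2_scale: "f \<in> L2 \<Longrightarrow> (\<lambda>x. a * f x) \<in> L2"
  by (rule L2_bound[where c = "cmod a"]) (auto simp: norm_mult dest: L2_measurable)

lemma L2_add:
  assumes "f \<in> L2" "g \<in> L2" shows "(\<lambda>x. f x + g x) \<in> L2"
proof (rule L2I)
  show "(\<lambda>x. f x + g x) \<in> borel_measurable borel"
    using assms by (auto dest!: L2_measurable)
  show "integrable lborel (\<lambda>x. (cmod (f x + g x))\<^sup>2)"
  proof (rule Bochner_Integration.integrable_bound)
    show "integrable lborel (\<lambda>x. 2 * (cmod (f x))\<^sup>2 + 2 * (cmod (g x))\<^sup>2)"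
      using assms[THEN L2_integrable] by simp
    show "AE x in lborel. norm ((cmod (f x + g x))\<^sup>2) \<le> norm (2 * (cmod (f x))\<^sup>2 + 2 * (cmod (g x))\<^sup>2)"
    proof (rule AE_I2)
      fix x
      have "(cmod (f x + g x))\<^sup>2 \<le> (cmod (f x) + cmod (g x))\<^sup>2"
        by (intro power_mono norm_triangle_ineq) auto
      also have "\<dots> \<le> 2 * (cmod (f x))\<^sup>2 + 2 * (cmod (g x))\<^sup>2"
        using sum_squares_bound[of "cmod (f x)" "cmod (g x)"] by (simp add: power2_sum)
      finally show "norm ((cmod (f x + g x))\<^sup>2) \<le> norm (2 * (cmod (f x))\<^sup>2 + 2 * (cmod (g x))\<^sup>2)"
        by simp
    qed
    show "(\<lambda>x. (cmod (f x + g x))\<^sup>2) \<in> borel_measurable lborel"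
      using assms by (auto dest!: L2_measurable)
  qed
qed

lemma L2_zero: "(\<lambda>_. 0) \<in> L2"
  by (rule L2I) auto

lemma L2_uminus: "f \<in> L2 \<Longrightarrow> (\<lambda>x. - f x) \<in> L2"
  using L2_scale[of f "-1"] by simp

lemma L2_diff: "f \<in> L2 \<Longrightarrow> g \<in> L2 \<Longrightarrow> (\<lambda>x. f x - g x) \<in> L2"
  using L2_add[OF _ L2_uminus, of f g] by simp

lemma L2_sum: "(\<And>j. j \<in> A \<Longrightarrow> f j \<in> L2) \<Longrightarrow> (\<lambda>x. \<Sum>j\<in>A. f j x) \<in> L2"
  by (induction A rule: infinite_finite_induct) (auto intro: L2_zero L2_add)

lemmas L2_intros = L2_scale L2_add L2_zero L2_uminus L2_diff L2_sum

lemma ip_add_right: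
  "f \<in> L2 \<Longrightarrow> g \<in> L2 \<Longrightarrow> h \<in> L2 \<Longrightarrow> ip f (\<lambda>x. g x + h x) = ip f g + ip f h"
  unfolding ip_def by (simp add: distrib_left L2_product_integrable)

lemma ip_diff_right:
  "f \<in> L2 \<Longrightarrow> g \<in> L2 \<Longrightarrow> h \<in> L2 \<Longrightarrow> ip f (\<lambda>x. g x - h x) = ip f g - ip f h"
  unfolding ip_def by (simp add: right_diff_distrib L2_product_integrable)

lemma ip_scale_right: "ip f (\<lambda>x. a * g x) = a * ip f g"
  unfolding ip_def by (simp flip: integral_mult_right_zero add: ac_simps)

lemma ip_zero_right: "ip f (\<lambda>x. 0) = 0"
  unfolding ip_def by simp

lemma ip_sum_right:
  "f \<in> L2 \<Longrightarrow> (\<And>j. j \<in> A \<Longrightarrow> g j \<in> L2) \<Longrightarrow> ip f (\<lambda>x. \<Sum>j\<in>A. g j x) = (\<Sum>j\<in>A. ip f (g j))"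
  by (induction A rule: infinite_finite_induct) (auto simp: ip_zero_right ip_add_right L2_sum)

lemma ip_cnj: "cnj (ip f g) = ip g f"
  unfolding ip_def by (simp add: mult.commute flip: Bochner_Integration.integral_cnj)

lemma ip_mult_swap: "ip f g * ip g f = of_real ((cmod (ip g f))\<^sup>2)"
  by (metis cnj_mult_self ip_cnj)

lemma ip_add_left:
  "f \<in> L2 \<Longrightarrow> g \<in> L2 \<Longrightarrow> h \<in> L2 \<Longrightarrow> ip (\<lambda>x. g x + h x) f = ip g f + ip h f"
  by (metis complex_cnj_add ip_cnj ip_add_right)

lemma ip_diff_left:
  "f \<in> L2 \<Longrightarrow> g \<in> L2 \<Longrightarrow> h \<in> L2 \<Longrightarrow> ip (\<lambda>x. g x - h x) f = ip g f - ip h f"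
  by (metis complex_cnj_diff ip_cnj ip_diff_right)

lemma ip_scale_left: "ip (\<lambda>x. a * g x) f = cnj a * ip g f"
  by (metis complex_cnj_mult ip_cnj ip_scale_right)

lemma ip_sum_left:
  "f \<in> L2 \<Longrightarrow> (\<And>j. j \<in> A \<Longrightarrow> g j \<in> L2) \<Longrightarrow> ip (\<lambda>x. \<Sum>j\<in>A. g j x) f = (\<Sum>j\<in>A. ip (g j) f)"
  by (subst ip_cnj[symmetric], subst ip_sum_right) (auto simp: ip_cnj cnj_sum)

lemma l2norm_nonneg: "0 \<le> l2norm f"
  unfolding l2norm_def by simp

lemma l2norm_square: "(l2norm f)\<^sup>2 = (LINT x|lborel. (cmod (f x))\<^sup>2)"
  unfolding l2norm_def by simp

lemma ip_self: "ip f f = of_real ((l2norm f)\<^sup>2)"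
  unfolding ip_def l2norm_square
  by (simp add: cnj_mult_self del: of_real_power)

lemma ae_eq_refl: "ae_eq f f"
  by (simp add: ae_eq_def)

lemma ae_eq_sym: "ae_eq f g \<Longrightarrow> ae_eq g f"
  unfolding ae_eq_def by (auto elim: AE_mp)

lemma ae_eq_trans: "ae_eq f g \<Longrightarrow> ae_eq g h \<Longrightarrow> ae_eq f h"
  unfolding ae_eq_def by (auto elim: AE_mp)

lemma ip_cong:
  assumes "ae_eq f f'" "ae_eq g g'" "f \<in> L2" "f' \<in> L2" "g \<in> L2" "g' \<in> L2"
  shows "ip f g = ip f' g'"
  unfolding ip_def
proof (rule integral_cong_AE)
  show "AE x in lborel. cnj (f x) * g x = cnj (f' x) * g' x"
    using assms(1,2) unfolding ae_eq_def by eventually_elim simp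
qed (use assms in \<open>auto dest!: L2_measurable\<close>)

lemma l2norm_cong:
  assumes "ae_eq f g" "f \<in> L2" "g \<in> L2"
  shows "l2norm f = l2norm g"
proof -
  have "(LINT x|lborel. (cmod (f x))\<^sup>2) = (LINT x|lborel. (cmod (g x))\<^sup>2)"
  proof (rule integral_cong_AE)
    show "AE x in lborel. (cmod (f x))\<^sup>2 = (cmod (g x))\<^sup>2"
      using assms(1) unfolding ae_eq_def by eventually_elim simp
  qed (use assms in \<open>auto dest!: L2_measurable\<close>)
  then show ?thesis by (simp add: l2norm_def)
qed

lemma l2norm_eq_0_iff:
  assumes "f \<in> L2" shows "l2norm f = 0 \<longleftrightarrow> ae_eq f (\<lambda>_. 0)"
proof -
  have "l2norm f = 0 \<longleftrightarrow> (LINT x|lborel. (cmod (f x))\<^sup>2) = 0"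
    by (simp add: l2norm_def)
  also have "\<dots> \<longleftrightarrow> (AE x in lborel. (cmod (f x))\<^sup>2 = 0)"
    by (rule integral_nonneg_eq_0_iff_AE) (auto intro: L2_integrable assms)
  finally show ?thesis by (simp add: ae_eq_def)
qed

lemma l2norm_scale: "l2norm (\<lambda>x. a * f x) = cmod a * l2norm f"
  by (simp add: l2norm_def norm_mult power_mult_distrib real_sqrt_mult)

text \<open>A discriminant argument shared by two Cauchy-Schwarz inequalities, for \<open>ip\<close>
  and for the form \<open>ip f (\<rho> g)\<close>. Taking \<open>t\<close> proportional to
  \<open>- cnj c\<close> gives a real quadratic in \<open>s\<close>, minimised at
  \<open>s = 1 / q\<close>. The form of \<open>\<rho>\<close> may be degenerate, hence the case
  \<open>q = 0\<close>.\<close>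

lemma nonneg_quadratic_imp_le:
  fixes c :: complex and p q :: real
  assumes "\<And>t. 0 \<le> p + 2 * Re (t * c) + (cmod t)\<^sup>2 * q"
  shows "(cmod c)\<^sup>2 \<le> p * q"
proof -
  have *: "0 \<le> p - 2 * s * (cmod c)\<^sup>2 + s\<^sup>2 * (cmod c)\<^sup>2 * q" for s
  proof -
    have "Re ((- of_real s * cnj c) * c) = - s * (cmod c)\<^sup>2"
      by (simp add: cmod_power2) (simp add: power2_eq_square algebra_simps)
    then show ?thesis
      using assms[of "- of_real s * cnj c"] by (simp add: norm_mult power_mult_distrib)
  qed
  show ?thesis
  proof (cases "q = 0")
    case True
    show ?thesis
    proof (cases "c = 0")
      case False
      \<comment> \<open>For \<open>q = 0\<close> the bound is linear in \<open>s\<close>, and at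
        this \<open>s\<close> it has the value -1.\<close>
      then show ?thesis
        using *[of "(p + 1) / (2 * (cmod c)\<^sup>2)"] True by (simp add: field_simps)
    qed (use True in simp)
  next
    case False
    then have "0 \<le> p - (cmod c)\<^sup>2 / q"
      using *[of "1 / q"] by (simp add: field_simps power2_eq_square)
    moreover have "q \<ge> 0"
    proof (rule ccontr)
      assume "\<not> q \<ge> 0"
      \<comment> \<open>This \<open>t\<close> makes the quadratic term
        \<open>- (\<bar>p\<bar> + 1)\<close>; adding the hypotheses at \<open>t\<close> and
        \<open>- t\<close> cancels the linear term and leaves a negative number.\<close>
      define t where "t = complex_of_real (sqrt ((\<bar>p\<bar> + 1) / - q))"
      have "(\<bar>p\<bar> + 1) / - q \<ge> 0"
        using \<open>\<not> q \<ge> 0\<close> by (intro divide_nonneg_nonneg) auto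
      then have "(cmod t)\<^sup>2 = (\<bar>p\<bar> + 1) / - q"
        by (simp add: t_def)
      then have "(cmod t)\<^sup>2 * q = - (\<bar>p\<bar> + 1)"
        using False by simp
      then show False
        using assms[of t] assms[of "- t"] by simp
    qed
    ultimately show ?thesis
      using False by (simp add: field_simps)
  qed
qed

lemma ip_Cauchy_Schwarz_square:
  assumes "f \<in> L2" "g \<in> L2"
  shows "(cmod (ip f g))\<^sup>2 \<le> (l2norm f)\<^sup>2 * (l2norm g)\<^sup>2"
proof (rule nonneg_quadratic_imp_le)
  fix t :: complex
  let ?h = "\<lambda>x. f x + t * g x"
  have tg: "(\<lambda>x. t * g x) \<in> L2" "?h \<in> L2" using assms by (auto intro!: L2_intros)
  have "ip ?h ?h = ip f ?h + cnj t * ip g ?h"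
    by (simp add: ip_add_left[OF tg(2) assms(1) tg(1)] ip_scale_left)
  also have "\<dots> = ip f f + t * ip f g + (cnj (t * ip f g) + cnj t * t * ip g g)"
    by (simp add: ip_add_right[OF _ assms(1) tg(1)] assms ip_scale_right ip_cnj distrib_left mult.assoc)
  finally have "Re (ip ?h ?h) = Re (ip f f + t * ip f g + (cnj (t * ip f g) + cnj t * t * ip g g))"
    by (rule arg_cong)
  then have "(l2norm ?h)\<^sup>2 = Re (ip f f + t * ip f g + (cnj (t * ip f g) + cnj t * t * ip g g))"
    unfolding ip_self[of ?h] Re_complex_of_real .
  also have "\<dots> = (l2norm f)\<^sup>2 + 2 * Re (t * ip f g) + (cmod t)\<^sup>2 * (l2norm g)\<^sup>2"
    by (simp add: ip_self cmod_power2) (simp add: power2_eq_square algebra_simps)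
  finally show "0 \<le> (l2norm f)\<^sup>2 + 2 * Re (t * ip f g) + (cmod t)\<^sup>2 * (l2norm g)\<^sup>2"
    using zero_le_power2[of "l2norm ?h"] by simp
qed

lemma ip_Cauchy_Schwarz:
  assumes "f \<in> L2" "g \<in> L2"
  shows "cmod (ip f g) \<le> l2norm f * l2norm g"
proof (rule power2_le_imp_le)
  show "(cmod (ip f g))\<^sup>2 \<le> (l2norm f * l2norm g)\<^sup>2"
    using ip_Cauchy_Schwarz_square[OF assms] by (simp add: power_mult_distrib)
qed (simp add: l2norm_nonneg)

lemma l2norm_triangle:
  assumes "f \<in> L2" "g \<in> L2"
  shows "l2norm (\<lambda>x. f x + g x) \<le> l2norm f + l2norm g"
proof (rule power2_le_imp_le)
  let ?h = "\<lambda>x. f x + g x"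
  have "complex_of_real ((l2norm ?h)\<^sup>2) = ip f f + ip f g + cnj (ip f g) + ip g g"
    unfolding ip_self[symmetric] ip_cnj
    using assms by (simp add: ip_add_left ip_add_right L2_intros)
  then have "(l2norm ?h)\<^sup>2 = Re (ip f f + ip f g + cnj (ip f g) + ip g g)"
    by (metis Re_complex_of_real)
  also have "\<dots> = (l2norm f)\<^sup>2 + 2 * Re (ip f g) + (l2norm g)\<^sup>2"
    by (simp add: ip_self)
  also have "\<dots> \<le> (l2norm f + l2norm g)\<^sup>2"
    using ip_Cauchy_Schwarz[OF assms] complex_Re_le_cmod[of "ip f g"]
    by (simp add: power2_sum)
  finally show "(l2norm ?h)\<^sup>2 \<le> (l2norm f + l2norm g)\<^sup>2" .
qed (simp add: l2norm_nonneg)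

lemma l2norm_uminus: "l2norm (\<lambda>x. - f x) = l2norm f"
  by (simp add: l2norm_def)

lemma l2norm_diff_commute: "l2norm (\<lambda>x. f x - g x) = l2norm (\<lambda>x. g x - f x)"
  by (simp add: l2norm_def norm_minus_commute)

lemma l2norm_triangle_diff:
  assumes "f \<in> L2" "g \<in> L2" "h \<in> L2"
  shows "l2norm (\<lambda>x. f x - h x) \<le> l2norm (\<lambda>x. f x - g x) + l2norm (\<lambda>x. g x - h x)"
  using l2norm_triangle[of "\<lambda>x. f x - g x" "\<lambda>x. g x - h x"] assms by (simp add: L2_intros)

text \<open>The limit inherits the majorant almost everywhere, so \<open>4 * (w x)\<^sup>2\<close>
  dominates the squared differences.\<close>

lemma l2norm_dominated_convergence:
  assumes "\<And>i. s i \<in> borel_measurable borel" "f \<in> borel_measurable borel"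
    and w: "integrable lborel (\<lambda>x. (w x)\<^sup>2)"
    and lim: "AE x in lborel. (\<lambda>i. s i x) \<longlonglongrightarrow> f x"
    and bound: "\<And>i. AE x in lborel. cmod (s i x) \<le> w x"
  shows "(\<lambda>i. l2norm (\<lambda>x. s i x - f x)) \<longlonglongrightarrow> 0"
proof -
  have all: "AE x in lborel. \<forall>i. cmod (s i x) \<le> w x"
    using bound by (simp add: AE_all_countable)
  have "(\<lambda>i. LINT x|lborel. (cmod (s i x - f x))\<^sup>2) \<longlonglongrightarrow> (LINT x|(lborel::real measure). 0)"
  proof (rule integral_dominated_convergence)
    show "integrable lborel (\<lambda>x. 4 * (w x)\<^sup>2)" using w by simp
    show "AE x in lborel. (\<lambda>i. (cmod (s i x - f x))\<^sup>2) \<longlonglongrightarrow> 0"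
      using lim by eventually_elim (auto intro!: tendsto_eq_intros)
    show "AE x in lborel. norm ((cmod (s i x - f x))\<^sup>2) \<le> 4 * (w x)\<^sup>2" for i
      using lim all
    proof eventually_elim
      case (elim x)
      have "cmod (f x) \<le> w x"
        using elim by (intro tendsto_upperbound[OF tendsto_norm]) auto
      then have "cmod (s i x - f x) \<le> 2 * w x"
        using elim norm_triangle_ineq4[of "s i x" "f x"] by (smt (verit))
      from power_mono[OF this, of 2] show ?case by (simp add: power_mult_distrib)
    qed
  qed (use assms in auto)
  from tendsto_real_sqrt[OF this] show ?thesis
    by (simp add: l2norm_def)
qed

lemma ip_tendsto_right:
  assumes "f \<in> L2" "\<And>i. s i \<in> L2" "g \<in> L2" "((\<lambda>i. l2norm (\<lambda>x. s i x - g x)) \<longlongrightarrow> 0) F"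
  shows "((\<lambda>i. ip f (s i)) \<longlongrightarrow> ip f g) F"
proof (rule LIM_zero_cancel, rule Lim_null_comparison)
  show "\<forall>\<^sub>F i in F. cmod (ip f (s i) - ip f g) \<le> l2norm f * l2norm (\<lambda>x. s i x - g x)"
    using ip_Cauchy_Schwarz[of f "\<lambda>x. s _ x - g x"] assms
    by (auto simp: ip_diff_right L2_diff)
  show "((\<lambda>i. l2norm f * l2norm (\<lambda>x. s i x - g x)) \<longlongrightarrow> 0) F"
    using tendsto_mult_right_zero[OF assms(4)] by simp
qed

lemma nn_integral_L2:
  "f \<in> L2 \<Longrightarrow> (\<integral>\<^sup>+x. ennreal ((cmod (f x))\<^sup>2) \<partial>lborel) = ennreal ((l2norm f)\<^sup>2)"
  unfolding l2norm_square by (rule nn_integral_eq_integral) (auto intro: L2_integrable)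

lemma l2norm_le_iff:
  assumes "f \<in> borel_measurable borel" "C \<ge> 0" "(\<integral>\<^sup>+x. ennreal ((cmod (f x))\<^sup>2) \<partial>lborel) \<le> ennreal (C\<^sup>2)"
  shows "f \<in> L2 \<and> l2norm f \<le> C"
proof -
  have int: "integrable lborel (\<lambda>x. (cmod (f x))\<^sup>2)"
    using assms(1,3) by (intro integrableI_bounded) (auto intro: le_less_trans)
  then have "f \<in> L2" using assms(1) by (intro L2I)
  moreover have "ennreal ((l2norm f)\<^sup>2) \<le> ennreal (C\<^sup>2)"
    using assms(3) nn_integral_L2[OF \<open>f \<in> L2\<close>] by simp
  then have "l2norm f \<le> C"
    using assms(2) by (simp add: l2norm_nonneg power2_le_iff_abs_le)
  ultimately show ?thesis by simp
qed

text \<open>The weight, a square-integrable function without zeros, turns an absolutely convergent series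
  in \<open>L2\<close> into one in \<open>L1\<close>, which converges almost everywhere.\<close>

lemma L2_series_AE_summable:
  assumes d: "\<And>i. d i \<in> L2" and n: "\<And>i. l2norm (d i) \<le> (1/2) ^ i"
  shows "AE x in lborel. summable (\<lambda>i. d i x)"
proof -
  define \<theta> :: wave where "\<theta> = (\<lambda>x. of_real (sqrt (std_normal_density x)))"
  have \<theta>: "\<theta> \<in> L2"
    by (rule L2I) (auto simp: \<theta>_def normal_density_nonneg)
  have \<theta>0: "\<theta> x \<noteq> 0" for x
    using normal_density_pos[of 1 0 x] by (simp add: \<theta>_def)
  have "(\<integral>\<^sup>+x. ennreal (cmod (\<theta> x * d i x)) \<partial>lborel) \<le> ennreal (l2norm \<theta>) * ennreal ((1/2)^i)" for i
  proof -
    let ?a = "(\<lambda>x. of_real (cmod (\<theta> x))) :: wave" and ?b = "(\<lambda>x. of_real (cmod (d i x))) :: wave"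
    have L: "?a \<in> L2" "?b \<in> L2"
      using \<theta> d[of i] by (auto intro!: L2I simp: L2_integrable dest: L2_measurable)
    have N: "l2norm ?a = l2norm \<theta>" "l2norm ?b = l2norm (d i)"
      by (simp_all add: l2norm_def)
    have i: "integrable lborel (\<lambda>x. cmod (\<theta> x * d i x))"
      using integrable_norm[OF L2_product_integrable[OF L]] by (simp add: norm_mult)
    have "ip ?a ?b = of_real (LINT x|lborel. cmod (\<theta> x * d i x))"
      by (simp add: ip_def norm_mult flip: of_real_mult)
    then have "(LINT x|lborel. cmod (\<theta> x * d i x)) \<le> l2norm \<theta> * l2norm (d i)"
      using ip_Cauchy_Schwarz[OF L] unfolding N by simp
    also have "\<dots> \<le> l2norm \<theta> * (1/2)^i"
      using n by (intro mult_left_mono l2norm_nonneg)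
    finally show ?thesis
      by (subst nn_integral_eq_integral[OF i])
        (auto simp flip: ennreal_mult simp: l2norm_nonneg intro!: ennreal_leI)
  qed
  then have "(\<Sum>i. \<integral>\<^sup>+x. ennreal (cmod (\<theta> x * d i x)) \<partial>lborel) \<le> (\<Sum>i. ennreal (l2norm \<theta>) * ennreal ((1/2)^i))"
    by (intro suminf_le) auto
  also have "\<dots> < \<infinity>"
    by (subst ennreal_suminf_cmult, subst suminf_ennreal2) (auto intro!: ennreal_mult_less_top[THEN iffD2])
  finally have "(\<integral>\<^sup>+x. (\<Sum>i. ennreal (cmod (\<theta> x * d i x))) \<partial>lborel) < \<infinity>"
    using \<theta> d by (subst nn_integral_suminf) (auto dest!: L2_measurable)
  then have "AE x in lborel. (\<Sum>i. ennreal (cmod (\<theta> x * d i x))) \<noteq> \<infinity>"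
    using \<theta> d by (intro nn_integral_PInf_AE) (auto dest!: L2_measurable)
  then show ?thesis
  proof eventually_elim
    case (elim x)
    then have "summable (\<lambda>i. cmod (\<theta> x * d i x))"
      by (intro summable_suminf_not_top) auto
    then have "summable (\<lambda>i. \<theta> x * d i x)"
      by (rule summable_norm_cancel)
    then show ?case using \<theta>0[of x] by (simp add: summable_cmult_iff)
  qed
qed

text \<open>The Riesz-Fischer argument: a subsequence with geometric gaps converges almost
  everywhere, and Fatou's lemma bounds the distance of every later term to the pointwise limit. This
  gives membership in \<open>L2\<close> and convergence at once.\<close>

lemma L2_complete:
  assumes s: "\<And>i. s i \<in> L2"
    and Cauchy: "\<And>e. e > 0 \<Longrightarrow> \<exists>N. \<forall>m\<ge>N. \<forall>n\<ge>N. l2norm (\<lambda>x. s m x - s n x) \<le> e"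
  obtains t where "t \<in> L2" "(\<lambda>i. l2norm (\<lambda>x. s i x - t x)) \<longlonglongrightarrow> 0"
proof -
  have [measurable]: "s i \<in> borel_measurable borel" for i using s by (rule L2_measurable)
  have "\<exists>N. \<forall>k. (\<forall>m\<ge>N k. \<forall>n\<ge>N k. l2norm (\<lambda>x. s m x - s n x) \<le> (1/2)^k)"
    using Cauchy[of "(1/2)^_"] by (intro choice allI) auto
  then obtain N0 where N0: "\<And>k m n. m \<ge> N0 k \<Longrightarrow> n \<ge> N0 k \<Longrightarrow> l2norm (\<lambda>x. s m x - s n x) \<le> (1/2)^k"
    by blast
  \<comment> \<open>Partial sums of the thresholds are monotone and still at least
    \<open>N0 k\<close>.\<close>
  define N where "N k = (\<Sum>i\<le>k. N0 i)" for k
  have N_ge: "N0 k \<le> N k" for k unfolding N_def by (rule member_le_sum) auto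
  have N_mono: "N j \<le> N k" if "j \<le> k" for j k
    unfolding N_def using that by (intro sum_mono2) auto
  have N: "l2norm (\<lambda>x. s m x - s n x) \<le> (1/2)^k" if "m \<ge> N k" "n \<ge> N k" for k m n
    using N0 N_ge that order_trans by blast
  define d where "d i x = s (N (Suc i)) x - s (N i) x" for i x
  have "d i \<in> L2" for i unfolding d_def by (intro L2_diff s)
  moreover have "l2norm (d i) \<le> (1/2)^i" for i unfolding d_def by (intro N N_mono) auto
  ultimately have sm: "AE x in lborel. summable (\<lambda>i. d i x)"
    by (rule L2_series_AE_summable)
  \<comment> \<open>Where the subsequence diverges, \<open>lim\<close> has an unspecified value.
    That set is null, and \<open>t\<close> is Borel all the same.\<close>
  define t where "t x = lim (\<lambda>i. s (N i) x)" for x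
  have t_meas [measurable]: "t \<in> borel_measurable borel" unfolding t_def by measurable
  have conv: "AE x in lborel. (\<lambda>i. s (N i) x) \<longlonglongrightarrow> t x"
    using sm
  proof eventually_elim
    case (elim x)
    have "(\<Sum>i<n. d i x) = s (N n) x - s (N 0) x" for n
      unfolding d_def by (rule sum_lessThan_telescope)
    then have "convergent (\<lambda>n. s (N n) x - s (N 0) x)"
      using elim by (simp add: summable_iff_convergent)
    then have "convergent (\<lambda>n. s (N n) x)"
      using convergent_add[OF _ convergent_const[of "s (N 0) x"]] by fastforce
    then show ?case unfolding t_def by (simp add: convergent_LIMSEQ_iff)
  qed
  have key: "(\<lambda>x. s m x - t x) \<in> L2 \<and> l2norm (\<lambda>x. s m x - t x) \<le> (1/2)^k" if "m \<ge> N k" for m k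
  proof (rule l2norm_le_iff)
    have "(\<integral>\<^sup>+x. ennreal ((cmod (s m x - t x))\<^sup>2) \<partial>lborel)
        = (\<integral>\<^sup>+x. liminf (\<lambda>i. ennreal ((cmod (s m x - s (N i) x))\<^sup>2)) \<partial>lborel)"
    proof (rule nn_integral_cong_AE, use conv in eventually_elim)
      case (elim x)
      then have "(\<lambda>i. ennreal ((cmod (s m x - s (N i) x))\<^sup>2)) \<longlonglongrightarrow> ennreal ((cmod (s m x - t x))\<^sup>2)"
        by (intro tendsto_intros)
      then show ?case by (metis lim_imp_Liminf trivial_limit_sequentially)
    qed
    also have "\<dots> \<le> liminf (\<lambda>i. \<integral>\<^sup>+x. ennreal ((cmod (s m x - s (N i) x))\<^sup>2) \<partial>lborel)"
      by (rule nn_integral_liminf) measurable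
    also have "\<dots> \<le> ennreal (((1/2)^k)\<^sup>2)"
    proof (rule Liminf_le[OF _ eventually_sequentiallyI[of k]])
      fix i assume "k \<le> i"
      then have "l2norm (\<lambda>x. s m x - s (N i) x) \<le> (1/2)^k"
        using that N_mono by (intro N) auto
      then show "(\<integral>\<^sup>+x. ennreal ((cmod (s m x - s (N i) x))\<^sup>2) \<partial>lborel) \<le> ennreal (((1/2)^k)\<^sup>2)"
        by (subst nn_integral_L2) (auto intro!: L2_diff s ennreal_leI power_mono simp: l2norm_nonneg)
    qed simp
    finally show "(\<integral>\<^sup>+x. ennreal ((cmod (s m x - t x))\<^sup>2) \<partial>lborel) \<le> ennreal (((1/2)^k)\<^sup>2)" .
  qed auto
  show thesis
  proof
    have "(\<lambda>x. s (N 0) x - (s (N 0) x - t x)) \<in> L2"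
      using key[OF order_refl, THEN conjunct1] by (rule L2_diff[OF s])
    then show "t \<in> L2" by simp
    show "(\<lambda>i. l2norm (\<lambda>x. s i x - t x)) \<longlonglongrightarrow> 0"
    proof (rule LIMSEQ_I)
      fix r :: real assume "r > 0"
      then obtain k where "(1/2::real)^k < r" using real_arch_pow_inv[of r "1/2"] by auto
      then show "\<exists>no. \<forall>n\<ge>no. norm (l2norm (\<lambda>x. s n x - t x) - 0) < r"
        using key l2norm_nonneg by (intro exI[of _ "N k"]) (auto intro: le_less_trans)
    qed
  qed
qed

section \<open>Orthonormal bases\<close>

context
  fixes e :: "nat \<Rightarrow> wave"
  assumes onb: "orthonormal_basis e"
begin

lemma onb_L2: "e k \<in> L2"
  using onb by (simp add: orthonormal_basis_def)

lemma onb_ip: "ip (e j) (e k) = (if j = k then 1 else 0)"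
  using onb by (simp add: orthonormal_basis_def)

lemma onb_total: "f \<in> L2 \<Longrightarrow> (\<And>k. ip (e k) f = 0) \<Longrightarrow> ae_eq f (\<lambda>_. 0)"
  using onb by (simp add: orthonormal_basis_def)

lemma onb_norm_sum:
  assumes "finite A"
  shows "(l2norm (\<lambda>x. \<Sum>j\<in>A. c j * e j x))\<^sup>2 = (\<Sum>j\<in>A. (cmod (c j))\<^sup>2)"
proof -
  let ?s = "\<lambda>x. \<Sum>j\<in>A. c j * e j x"
  have "ip ?s ?s = (\<Sum>j\<in>A. \<Sum>k\<in>A. cnj (c j) * (c k * ip (e j) (e k)))"
    by (simp add: ip_sum_left ip_sum_right L2_intros onb_L2 ip_scale_left ip_scale_right sum_distrib_left)
  also have "\<dots> = (\<Sum>j\<in>A. of_real ((cmod (c j))\<^sup>2))"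
    using assms by (intro sum.cong refl)
      (simp add: onb_ip if_distrib complex_norm_square mult.commute del: of_real_power cong: if_cong)
  finally show ?thesis
    by (simp add: ip_self del: of_real_power of_real_sum flip: of_real_sum)
qed

text \<open>For the partial projection \<open>s\<close> of \<open>f\<close> the number
  \<open>ip s f\<close> equals the squared norm of \<open>s\<close>, so Cauchy-Schwarz bounds the
  fourth power of the norm of \<open>s\<close> by the product of both squared norms, and one square
  cancels.\<close>

lemma Bessel:
  assumes f: "f \<in> L2"
  shows "(\<Sum>j<n. (cmod (ip (e j) f))\<^sup>2) \<le> (l2norm f)\<^sup>2"
proof -
  define s where "s = (\<lambda>x. \<Sum>j<n. ip (e j) f * e j x)"
  have s: "s \<in> L2" unfolding s_def by (intro L2_intros onb_L2)
  have "ip s f = of_real (\<Sum>j<n. (cmod (ip (e j) f))\<^sup>2)"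
    unfolding s_def using f by (simp add: ip_sum_left L2_intros onb_L2 ip_scale_left ip_cnj ip_mult_swap del: of_real_power)
  moreover have "(l2norm s)\<^sup>2 = (\<Sum>j<n. (cmod (ip (e j) f))\<^sup>2)"
    unfolding s_def by (rule onb_norm_sum) simp
  ultimately have "cmod (ip s f) = (l2norm s)\<^sup>2"
    by (simp add: sum_nonneg del: of_real_sum of_real_power)
  then have *: "(l2norm s)\<^sup>2 * (l2norm s)\<^sup>2 \<le> (l2norm s)\<^sup>2 * (l2norm f)\<^sup>2"
    using ip_Cauchy_Schwarz_square[OF s f] by (simp add: power2_eq_square)
  have "(l2norm s)\<^sup>2 \<le> (l2norm f)\<^sup>2"
  proof (cases "l2norm s = 0")
    case False
    then have "(l2norm s)\<^sup>2 > 0" by simp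
    with * show ?thesis by (simp only: mult_le_cancel_left_pos)
  qed simp
  then show ?thesis
    by (simp add: \<open>(l2norm s)\<^sup>2 = _\<close>)
qed

text \<open>\<open>orthonormal_basis\<close> demands only that a vector orthogonal to every
  \<open>e k\<close> is null. Bessel makes the partial sums Cauchy, completeness gives a limit
  \<open>t\<close> with the same coefficients as \<open>f\<close>, and totality identifies
  \<open>t\<close> with \<open>f\<close>.\<close>

lemma onb_expansion:
  assumes f: "f \<in> L2"
  shows "(\<lambda>n. l2norm (\<lambda>x. (\<Sum>j<n. ip (e j) f * e j x) - f x)) \<longlonglongrightarrow> 0"
proof -
  define c where "c j = ip (e j) f" for j
  define s where "s n = (\<lambda>x. \<Sum>j<n. c j * e j x)" for n
  have s: "s n \<in> L2" for n unfolding s_def by (intro L2_intros onb_L2)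
  have sm: "summable (\<lambda>j. (cmod (c j))\<^sup>2)"
    using Bessel[OF f] unfolding c_def by (intro summableI_nonneg_bounded) auto
  have diff: "(l2norm (\<lambda>x. s m x - s n x))\<^sup>2 = (\<Sum>j=n..<m. (cmod (c j))\<^sup>2)" if "n \<le> m" for m n
  proof -
    have "(\<lambda>x. s m x - s n x) = (\<lambda>x. \<Sum>j=n..<m. c j * e j x)"
      unfolding s_def using that
      by (auto simp: fun_eq_iff lessThan_atLeast0 sum_diff_nat_ivl)
    then show ?thesis by (simp add: onb_norm_sum)
  qed
  have C1: "\<exists>N. \<forall>n\<ge>N. \<forall>m\<ge>n. l2norm (\<lambda>x. s m x - s n x) \<le> \<epsilon>" if "\<epsilon> > 0" for \<epsilon>
  proof -
    have "\<exists>N. \<forall>m\<ge>N. \<forall>n. norm (\<Sum>j=m..<n. (cmod (c j))\<^sup>2) < \<epsilon>\<^sup>2"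
      using sm that unfolding summable_Cauchy by auto
    then obtain N where N: "\<And>m n. m \<ge> N \<Longrightarrow> norm (\<Sum>j=m..<n. (cmod (c j))\<^sup>2) < \<epsilon>\<^sup>2"
      by blast
    show ?thesis
    proof (intro exI[of _ N] allI impI)
      fix m n assume "N \<le> n" "n \<le> m"
      then have "(l2norm (\<lambda>x. s m x - s n x))\<^sup>2 \<le> \<epsilon>\<^sup>2"
        unfolding diff[OF \<open>n \<le> m\<close>] using N[OF \<open>N \<le> n\<close>, of m]
        by (intro order_trans[OF abs_ge_self less_imp_le]) (simp only: real_norm_def)
      then show "l2norm (\<lambda>x. s m x - s n x) \<le> \<epsilon>" using that by (simp add: l2norm_nonneg power2_le_iff_abs_le)
    qed
  qed
  have "\<exists>N. \<forall>m\<ge>N. \<forall>n\<ge>N. l2norm (\<lambda>x. s m x - s n x) \<le> \<epsilon>" if pos: "\<epsilon> > 0" for \<epsilon>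
  proof -
    obtain N where N: "\<And>m n. n \<ge> N \<Longrightarrow> m \<ge> n \<Longrightarrow> l2norm (\<lambda>x. s m x - s n x) \<le> \<epsilon>"
      using C1[OF pos] by blast
    show ?thesis
    proof (intro exI[of _ N] allI impI)
      fix m n assume "N \<le> m" "N \<le> n"
      then show "l2norm (\<lambda>x. s m x - s n x) \<le> \<epsilon>"
        using N[of n m] N[of m n] l2norm_diff_commute[of "s m" "s n"] by (cases "n \<le> m") auto
    qed
  qed
  then obtain t where t: "t \<in> L2" and lim: "(\<lambda>i. l2norm (\<lambda>x. s i x - t x)) \<longlonglongrightarrow> 0"
    using L2_complete[of s] s by blast
  have "ip (e k) t = c k" for k
  proof (rule LIMSEQ_unique)
    show "(\<lambda>i. ip (e k) (s i)) \<longlonglongrightarrow> ip (e k) t"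
      by (rule ip_tendsto_right[OF onb_L2 s t lim])
    have "ip (e k) (s i) = (\<Sum>j<i. c j * (if k = j then 1 else 0))" for i
      unfolding s_def by (simp add: ip_sum_right L2_intros onb_L2 ip_scale_right onb_ip)
    then have "ip (e k) (s i) = c k" if "i > k" for i
      using that by (simp add: if_distrib cong: if_cong)
    then show "(\<lambda>i. ip (e k) (s i)) \<longlonglongrightarrow> c k"
      by (intro tendsto_eventually eventually_sequentiallyI[of "Suc k"]) auto
  qed
  then have "ae_eq (\<lambda>x. t x - f x) (\<lambda>_. 0)"
    by (intro onb_total L2_diff t f) (simp add: ip_diff_right onb_L2 t f c_def)
  then have "ae_eq (\<lambda>x. s i x - t x) (\<lambda>x. s i x - f x)" for i
    unfolding ae_eq_def by (auto elim!: AE_mp)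
  then have "l2norm (\<lambda>x. s i x - t x) = l2norm (\<lambda>x. s i x - f x)" for i
    by (rule l2norm_cong) (intro L2_diff s t f)+
  with lim show ?thesis by (simp add: s_def c_def)
qed

text \<open>The resolution of the identity behind all trace computations: a product of two inner
  products, summed over the intermediate basis index, collapses to one.\<close>

lemma Parseval:
  assumes f: "f \<in> L2" and g: "g \<in> L2"
  shows "(\<lambda>j. ip f (e j) * ip (e j) g) sums ip f g"
proof -
  have "(\<lambda>n. ip f (\<lambda>x. \<Sum>j<n. ip (e j) g * e j x)) \<longlonglongrightarrow> ip f g"
    by (rule ip_tendsto_right[OF f _ g onb_expansion[OF g]]) (intro L2_intros onb_L2)
  moreover have "ip f (\<lambda>x. \<Sum>j<n. ip (e j) g * e j x) = (\<Sum>j<n. ip f (e j) * ip (e j) g)" for n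
    using f by (simp add: ip_sum_right L2_intros onb_L2 ip_scale_right mult.commute[of "ip f (e _)"])
  ultimately show ?thesis by (simp add: sums_def)
qed

end

section \<open>Phases and translations\<close>

lemma borel_measurable_cis [measurable]: "cis \<in> borel_measurable borel"
  by (intro borel_measurable_continuous_onI continuous_intros)

text \<open>A chord is no longer than its arc: the left side is
  \<open>2 * \<bar>sin (a / 2)\<bar>\<close>.\<close>

lemma norm_cis_diff_one_le: "cmod (cis a - 1) \<le> \<bar>a\<bar>"
proof -
  have "(cmod (cis a - 1))\<^sup>2 = (cos a - 1)\<^sup>2 + (sin a)\<^sup>2"
    by (simp add: cmod_power2)
  also have "\<dots> = 2 - 2 * cos (2 * (a / 2))"
    using sin_cos_squared_add[of a] by (simp add: power2_diff)
  also have "\<dots> = (2 * sin (a / 2))\<^sup>2"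
    by (subst cos_double_sin) (simp add: power_mult_distrib)
  also have "\<dots> \<le> \<bar>a\<bar>\<^sup>2"
    using power_mono[of "\<bar>2 * sin (a / 2)\<bar>" "\<bar>a\<bar>" 2] abs_sin_x_le_abs_x[of "a / 2"]
    by (simp add: abs_mult)
  finally show ?thesis by (rule power2_le_imp_le) simp
qed

text \<open>\<open>P\<close> may fail to be measurable, so a Borel null set covering its exceptions
  is translated instead of \<open>P\<close>.\<close>

lemma AE_lborel_shift:
  fixes P :: "real \<Rightarrow> bool"
  assumes "AE x in lborel. P x" shows "AE x in lborel. P (x - h)"
proof -
  obtain N where N: "{x. \<not> P x} \<subseteq> N" "N \<in> null_sets lborel"
    using assms by (auto simp: eventually_ae_filter)
  then have [measurable]: "N \<in> sets borel" by auto
  have "AE x in lborel. x \<notin> N" using N by (simp add: AE_not_in)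
  then have "AE x in lborel. - h + 1 * x \<notin> N"
    by (intro AE_borel_affine[where P = "\<lambda>x. x \<notin> N"]) auto
  then show ?thesis using N by (auto elim!: AE_mp simp: algebra_simps)
qed

section \<open>Weyl operators\<close>

text \<open>The explicit form of \<open>exp (- i (u Q + v P))\<close>: the translation
  \<open>exp (- i v P)\<close>, then the multiplication \<open>exp (- i u Q)\<close>, with the
  Baker-Campbell-Hausdorff correction \<open>u * v / 2\<close> in the phase.\<close>

definition weyl :: "real \<Rightarrow> real \<Rightarrow> wave \<Rightarrow> wave" where
  "weyl u v f = (\<lambda>x. cis (- u * x + u * v / 2) * f (x - v))"

lemma weyl_measurable [measurable (raw)]:
  assumes [measurable]: "f \<in> borel_measurable borel"
  shows "weyl u v f \<in> borel_measurable borel"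
  unfolding weyl_def by measurable

lemma weyl_L2:
  assumes "f \<in> L2" shows "weyl u v f \<in> L2"
proof (rule L2I)
  show "weyl u v f \<in> borel_measurable borel" using assms by (simp add: L2_measurable weyl_measurable)
  show "integrable lborel (\<lambda>x. (cmod (weyl u v f x))\<^sup>2)"
    using lborel_integrable_real_affine[OF L2_integrable[OF assms], of 1 "- v"]
    by (simp add: weyl_def norm_mult)
qed

lemma weyl_isometry: "ip (weyl u v f) (weyl u v g) = ip f g"
proof -
  have "ip (weyl u v f) (weyl u v g) = (LINT x|lborel. cnj (f (- v + 1 * x)) * g (- v + 1 * x))"
    unfolding ip_def weyl_def
    by (intro Bochner_Integration.integral_cong refl)
      (simp add: cis_cnj cis_mult mult.assoc mult.left_commute[of _ "cis _"] flip: mult.assoc)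
  also have "\<dots> = ip f g"
    using lborel_integral_real_affine[of 1 "\<lambda>x. cnj (f x) * g x" "- v"] by (simp add: ip_def)
  finally show ?thesis .
qed

text \<open>The commutation relations in Weyl form; the phase is half the symplectic product of the
  two vectors. It vanishes for parallel vectors, so every line through the origin yields a
  one-parameter group, and inverses are exact rather than up to a phase.\<close>

lemma weyl_weyl:
  "weyl u v (weyl u' v' f) = (\<lambda>x. cis ((u' * v - u * v') / 2) * weyl (u + u') (v + v') f x)"
proof
  fix x
  have "weyl u v (weyl u' v' f) x = cis (- u * x + u * v / 2 + (- u' * (x - v) + u' * v' / 2)) * f (x - v - v')"
    by (simp add: weyl_def cis_mult mult.assoc)
  also have "- u * x + u * v / 2 + (- u' * (x - v) + u' * v' / 2)
      = (u' * v - u * v') / 2 + (- (u + u') * x + (u + u') * (v + v') / 2)"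
    by (simp add: algebra_simps add_divide_distrib diff_divide_distrib)
  also have "cis \<dots> * f (x - v - v') = cis ((u' * v - u * v') / 2) * weyl (u + u') (v + v') f x"
    by (simp add: weyl_def cis_mult[symmetric] mult.assoc diff_diff_eq)
  finally show "weyl u v (weyl u' v' f) x = cis ((u' * v - u * v') / 2) * weyl (u + u') (v + v') f x" .
qed

lemma weyl_0: "weyl 0 0 f = f"
  by (simp add: weyl_def)

lemma weyl_inverse: "weyl (- u) (- v) (weyl u v f) = f" "weyl u v (weyl (- u) (- v) f) = f"
  by (simp_all add: weyl_weyl weyl_0)

lemma weyl_adjoint: "ip (weyl u v f) g = ip f (weyl (- u) (- v) g)"
  using weyl_isometry[of u v f "weyl (- u) (- v) g"] by (simp add: weyl_inverse)

lemma weyl_lincomb: "weyl u v (\<lambda>x. a * f x + b * g x) = (\<lambda>x. a * weyl u v f x + b * weyl u v g x)"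
  by (simp add: weyl_def fun_eq_iff algebra_simps)

lemma weyl_diff: "weyl u v (\<lambda>x. f x - g x) = (\<lambda>x. weyl u v f x - weyl u v g x)"
  by (simp add: weyl_def fun_eq_iff algebra_simps)

lemma l2norm_eqI: "ip f f = ip g g \<Longrightarrow> l2norm f = l2norm g"
  unfolding ip_self by (metis l2norm_nonneg of_real_eq_iff power2_eq_iff_nonneg)

lemma l2norm_weyl: "l2norm (weyl u v f) = l2norm f"
  by (rule l2norm_eqI) (rule weyl_isometry)

lemma weyl_cong: "ae_eq f g \<Longrightarrow> ae_eq (weyl u v f) (weyl u v g)"
  unfolding ae_eq_def weyl_def by (auto elim!: AE_mp dest!: AE_lborel_shift[where h = v])

subsection \<open>Strong continuity\<close>

lemma integrable_indicator_square:
  fixes k :: real shows "integrable lborel (\<lambda>x. (k * indicator {a..b::real} x)\<^sup>2)"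
proof -
  have "(\<lambda>x. (k * indicator {a..b} x)\<^sup>2) = (\<lambda>x. k\<^sup>2 * indicator {a..b} x)"
    by (auto simp: indicator_def)
  then show ?thesis by (auto intro!: integrable_mult_right integrable_real_indicator simp: emeasure_lborel_Icc_eq)
qed

lemma continuous_compact_support_bounded:
  fixes g :: wave
  assumes "continuous_on UNIV g" "\<And>x. \<bar>x\<bar> > R \<Longrightarrow> g x = 0"
  obtains B where "B \<ge> 0" "\<And>x. cmod (g x) \<le> B"
proof -
  have "bounded (g ` {-R..R})"
    using assms(1) by (intro compact_imp_bounded compact_continuous_image) (auto intro: continuous_on_subset)
  then obtain B where B: "\<And>x. x \<in> {-R..R} \<Longrightarrow> cmod (g x) \<le> B"
    unfolding bounded_iff by blast
  have "cmod (g x) \<le> max 0 B" for x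
  proof (cases "\<bar>x\<bar> > R")
    case False
    then have "x \<in> {-R..R}" by auto
    from B[OF this] show ?thesis by simp
  qed (use assms(2)[of x] in simp)
  then show thesis using that[of "max 0 B"] by simp
qed

lemma continuous_compact_support_L2:
  fixes g :: wave
  assumes "continuous_on UNIV g" "\<And>x. \<bar>x\<bar> > R \<Longrightarrow> g x = 0"
  shows "g \<in> L2"
proof -
  obtain B where B: "B \<ge> 0" "\<And>x. cmod (g x) \<le> B"
    using continuous_compact_support_bounded[OF assms] by blast
  have m: "g \<in> borel_measurable borel" using assms(1) by (rule borel_measurable_continuous_onI)
  show ?thesis
  proof (rule L2I[OF m], rule Bochner_Integration.integrable_bound[OF integrable_indicator_square[of B "-R" R]])
    show "AE x in lborel. norm ((cmod (g x))\<^sup>2) \<le> norm ((B * indicator {- R..R} x)\<^sup>2)"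
      using assms(2) B by (intro AE_I2) (auto simp: indicator_def power_mono abs_le_iff not_less)
  qed (use m in simp)
qed

text \<open>Measurability provides continuous functions that converge almost everywhere, without
  control of size or support. A continuous cut in space and in modulus supplies both: the cut of
  \<open>f\<close> is close to \<open>f\<close>, and the cuts of the approximants share one bounded,
  compactly supported majorant.\<close>

lemma L2_approx_continuous:
  assumes f: "f \<in> L2" and "\<epsilon> > 0"
  obtains g R where "continuous_on UNIV g" "\<And>x. \<bar>x\<bar> > R \<Longrightarrow> g x = 0" "l2norm (\<lambda>x. f x - g x) < \<epsilon>"
proof -
  have fm [measurable]: "f \<in> borel_measurable borel" using f by (rule L2_measurable)
  have "f \<in> borel_measurable lebesgue" by (rule measurable_completion) simp
  then have "f measurable_on UNIV"
    by (intro lebesgue_measurable_imp_measurable_on) auto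
  then obtain N g where N: "negligible N" and g: "\<And>n. continuous_on UNIV (g n)"
    and lim: "\<And>x. x \<notin> N \<Longrightarrow> (\<lambda>n. g n x) \<longlonglongrightarrow> f x"
    unfolding measurable_on_def by auto
  have "AE x in lebesgue. x \<notin> N"
    using N by (simp add: negligible_iff_null_sets AE_not_in)
  then have aeN: "AE x in lborel. x \<notin> N" by (simp add: AE_completion_iff)
  have [measurable]: "g n \<in> borel_measurable borel" for n
    using g by (intro borel_measurable_continuous_onI)
  \<comment> \<open>The first factor is a plateau in \<open>x\<close>, equal to 1 up to
    \<open>k\<close> and 0 beyond \<open>Suc k\<close>; the second pulls values of modulus above
    \<open>Suc k\<close> back to that modulus.\<close>
  define cut :: "nat \<Rightarrow> real \<Rightarrow> complex \<Rightarrow> complex" where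
    "cut k x z = of_real (max 0 (min 1 (real (Suc k) - \<bar>x\<bar>)) * (Suc k / max (Suc k) (cmod z))) * z" for k x z
  have cut_le: "cmod (cut k x z) \<le> cmod z" for k x z
  proof -
    have "max 0 (min 1 (real (Suc k) - \<bar>x\<bar>)) * (Suc k / max (Suc k) (cmod z)) \<le> 1 * 1"
      by (intro mult_mono) (auto simp: divide_le_eq_1_pos less_max_iff_disj intro: divide_nonneg_nonneg)
    moreover have "0 \<le> max 0 (min 1 (real (Suc k) - \<bar>x\<bar>)) * (Suc k / max (Suc k) (cmod z))"
      by (auto simp: max_def)
    ultimately show ?thesis
      unfolding cut_def norm_mult norm_of_real by (metis abs_of_nonneg mult_left_le_one_le mult_1 norm_ge_zero)
  qed
  have cut_bound: "cmod (cut k x z) \<le> real (Suc k) * indicat_real {- real (Suc k)..real (Suc k)} x" for k x z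
  proof (cases "\<bar>x\<bar> \<le> Suc k")
    case True
    have "cmod z / max (Suc k) (cmod z) \<le> 1"
      by (simp add: divide_le_eq_1_pos less_max_iff_disj)
    from mult_left_mono[OF this, of "Suc k"]
    have "(Suc k / max (Suc k) (cmod z)) * cmod z \<le> Suc k" by simp
    then have "max 0 (min 1 (real (Suc k) - \<bar>x\<bar>)) * ((Suc k / max (Suc k) (cmod z)) * cmod z) \<le> 1 * real (Suc k)"
      by (intro mult_mono) (auto simp: max_def)
    moreover have "indicat_real {- real (Suc k)..real (Suc k)} x = 1" using True by (auto simp: indicator_def abs_le_iff)
    moreover have "\<bar>max 0 (min 1 (real (Suc k) - \<bar>x\<bar>)) * (Suc k / max (Suc k) (cmod z))\<bar>
        = max 0 (min 1 (real (Suc k) - \<bar>x\<bar>)) * (Suc k / max (Suc k) (cmod z))"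
      by (rule abs_of_nonneg) (auto simp: max_def)
    ultimately show ?thesis
      unfolding cut_def norm_mult norm_of_real by (simp only: mult.assoc mult_1_left mult_1_right)
  qed (auto simp: cut_def)
  have cut_cont: "continuous_on UNIV (\<lambda>x. cut k x (h x))" if "continuous_on UNIV h" for h k
    unfolding cut_def using that
    by (intro continuous_intros) (auto simp: max_def)
  have cut_meas [measurable]: "(\<lambda>x. cut k x (h x)) \<in> borel_measurable borel"
    if [measurable]: "h \<in> borel_measurable borel" for h k
    unfolding cut_def by measurable
  have "(\<lambda>k. l2norm (\<lambda>x. cut k x (f x) - f x)) \<longlonglongrightarrow> 0"
  proof (rule l2norm_dominated_convergence[where w = "\<lambda>x. cmod (f x)"])
    show "AE x in lborel. (\<lambda>k. cut k x (f x)) \<longlonglongrightarrow> f x"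
    proof (rule AE_I2, rule tendsto_eventually)
      fix x
      obtain K where K: "real K \<ge> \<bar>x\<bar> + cmod (f x)" by (meson real_arch_simple)
      show "\<forall>\<^sub>F k in sequentially. cut k x (f x) = f x"
      proof (rule eventually_sequentiallyI[of K])
        fix k assume "K \<le> k"
        then have "\<bar>x\<bar> + cmod (f x) \<le> real k" using K by linarith
        then have "\<bar>x\<bar> \<le> real k" "cmod (f x) \<le> real k"
          using norm_ge_zero[of "f x"] abs_ge_zero[of x] by linarith+
        then have "min 1 (real (Suc k) - \<bar>x\<bar>) = 1" "max (real (Suc k)) (cmod (f x)) = Suc k"
          by (auto simp: min_def max_def)
        then show "cut k x (f x) = f x" unfolding cut_def by simp
      qed
    qed
  qed (use cut_le f in \<open>auto simp: L2_integrable\<close>)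
  then obtain k where k: "l2norm (\<lambda>x. cut k x (f x) - f x) < \<epsilon> / 2"
    using \<open>\<epsilon> > 0\<close> by (metis (no_types, lifting) LIMSEQ_D abs_of_nonneg diff_zero half_gt_zero l2norm_nonneg order_refl real_norm_def)
  have "(\<lambda>n. l2norm (\<lambda>x. cut k x (g n x) - cut k x (f x))) \<longlonglongrightarrow> 0"
  proof (rule l2norm_dominated_convergence[where w = "\<lambda>x. real (Suc k) * indicat_real {- real (Suc k)..real (Suc k)} x"])
    show "AE x in lborel. (\<lambda>n. cut k x (g n x)) \<longlonglongrightarrow> cut k x (f x)"
      using aeN
    proof eventually_elim
      case (elim x)
      have "isCont (cut k x) (f x)"
        unfolding cut_def by (intro continuous_intros) (auto simp: max_def)
      then show ?case using lim[OF elim] by (rule isCont_tendsto_compose)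
    qed
  qed (use cut_bound integrable_indicator_square in auto)
  then obtain n where n: "l2norm (\<lambda>x. cut k x (g n x) - cut k x (f x)) < \<epsilon> / 2"
    using \<open>\<epsilon> > 0\<close> by (metis (no_types, lifting) LIMSEQ_D abs_of_nonneg diff_zero half_gt_zero l2norm_nonneg order_refl real_norm_def)
  show thesis
  proof (rule that)
    show cont: "continuous_on UNIV (\<lambda>x. cut k x (g n x))" by (rule cut_cont[OF g])
    have supp: "cut k x (g n x) = 0" if "\<bar>x\<bar> > real (Suc k)" for x
      using that by (simp add: cut_def)
    have L: "(\<lambda>x. cut k x (g n x)) \<in> L2"
      using cont supp by (rule continuous_compact_support_L2)
    have L': "(\<lambda>x. cut k x (f x)) \<in> L2"
      by (rule L2_bound[where c = 1, OF _ f]) (auto simp: cut_le)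
    show "\<And>x. \<bar>x\<bar> > real (Suc k) \<Longrightarrow> cut k x (g n x) = 0" by (rule supp)
    show "l2norm (\<lambda>x. f x - cut k x (g n x)) < \<epsilon>"
      using l2norm_triangle_diff[OF f L' L] k n
      by (simp add: l2norm_diff_commute[of f] l2norm_diff_commute[of _ "\<lambda>x. cut k x (g n x)"])
  qed
qed

text \<open>Isometry makes the approximation of \<open>f\<close> by a compactly supported continuous
  \<open>g\<close> uniform in the parameters. For \<open>g\<close> the convergence is pointwise, and
  the translates have a common support of radius \<open>R + S\<close>.\<close>

lemma weyl_continuous:
  assumes f: "f \<in> L2" and u: "a \<longlonglongrightarrow> u" and v: "b \<longlonglongrightarrow> v"
  shows "(\<lambda>n. l2norm (\<lambda>x. weyl (a n) (b n) f x - weyl u v f x)) \<longlonglongrightarrow> 0"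
proof (rule LIMSEQ_I)
  fix \<epsilon> :: real assume "\<epsilon> > 0"
  then obtain g R where g: "continuous_on UNIV g" "\<And>x. \<bar>x\<bar> > R \<Longrightarrow> g x = 0"
    and fg: "l2norm (\<lambda>x. f x - g x) < \<epsilon> / 3"
    using L2_approx_continuous[OF f, of "\<epsilon> / 3"] by (metis divide_pos_pos zero_less_numeral)
  have gL: "g \<in> L2" using g by (rule continuous_compact_support_L2)
  obtain B where B: "B \<ge> 0" "\<And>x. cmod (g x) \<le> B"
    using continuous_compact_support_bounded[OF g] by blast
  obtain S where S: "\<And>n. \<bar>b n\<bar> \<le> S"
    using Bseq_def v convergentI convergent_imp_Bseq by (metis real_norm_def)
  have [measurable]: "g \<in> borel_measurable borel" using gL by (rule L2_measurable)
  have "(\<lambda>n. l2norm (\<lambda>x. weyl (a n) (b n) g x - weyl u v g x)) \<longlonglongrightarrow> 0"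
  proof (rule l2norm_dominated_convergence[where w = "\<lambda>x. B * indicator {- (R + S)..R + S} x"])
    show "AE x in lborel. (\<lambda>n. weyl (a n) (b n) g x) \<longlonglongrightarrow> weyl u v g x"
    proof (rule AE_I2)
      fix x
      have "isCont g (x - v)" using g(1) by (simp add: continuous_on_eq_continuous_at)
      then have "(\<lambda>n. g (x - b n)) \<longlonglongrightarrow> g (x - v)"
        by (rule isCont_tendsto_compose) (intro tendsto_intros v)
      then show "(\<lambda>n. weyl (a n) (b n) g x) \<longlonglongrightarrow> weyl u v g x"
        unfolding weyl_def by (intro tendsto_intros u v) auto
    qed
    show "AE x in lborel. cmod (weyl (a n) (b n) g x) \<le> B * indicator {- (R + S)..R + S} x" for n
    proof (rule AE_I2)
      fix x
      show "cmod (weyl (a n) (b n) g x) \<le> B * indicator {- (R + S)..R + S} x"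
        using B g(2)[of "x - b n"] S[of n] by (auto simp: weyl_def norm_mult indicator_def abs_if split: if_splits)
    qed
  qed (auto simp: integrable_indicator_square)
  then obtain N where N: "\<And>n. n \<ge> N \<Longrightarrow> l2norm (\<lambda>x. weyl (a n) (b n) g x - weyl u v g x) < \<epsilon> / 3"
    using LIMSEQ_D[of _ 0 "\<epsilon> / 3"] \<open>\<epsilon> > 0\<close> by (fastforce simp: l2norm_nonneg)
  show "\<exists>N. \<forall>n\<ge>N. norm (l2norm (\<lambda>x. weyl (a n) (b n) f x - weyl u v f x) - 0) < \<epsilon>"
  proof (intro exI[of _ N] allI impI)
    fix n assume "n \<ge> N"
    have 1: "l2norm (\<lambda>x. weyl s t f x - weyl s t g x) < \<epsilon> / 3" for s t
      using fg l2norm_weyl[of s t "\<lambda>x. f x - g x"] by (simp add: weyl_diff)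
    have "l2norm (\<lambda>x. weyl (a n) (b n) f x - weyl u v f x)
        \<le> l2norm (\<lambda>x. weyl (a n) (b n) f x - weyl (a n) (b n) g x)
          + (l2norm (\<lambda>x. weyl (a n) (b n) g x - weyl u v g x) + l2norm (\<lambda>x. weyl u v g x - weyl u v f x))"
      by (intro order_trans[OF l2norm_triangle_diff add_left_mono[OF l2norm_triangle_diff]] weyl_L2 f gL)
    also have "\<dots> < \<epsilon>"
      using 1[of "a n" "b n"] 1[of u v] N[OF \<open>n \<ge> N\<close>] l2norm_diff_commute[of "weyl u v g" "weyl u v f"] by linarith
    finally show "norm (l2norm (\<lambda>x. weyl (a n) (b n) f x - weyl u v f x) - 0) < \<epsilon>"
      by (simp add: l2norm_nonneg)
  qed
qed

lemma weyl_bounded_operator: "bounded_operator (weyl u v)"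
  unfolding bounded_operator_def
  by (auto simp: weyl_L2 weyl_lincomb ae_eq_refl l2norm_weyl intro: exI[of _ 1])

lemma weyl_unitary_group: "unitary_group (\<lambda>s. weyl (s * u) (s * v))"
  unfolding unitary_group_def
proof (intro conjI allI ballI)
  fix f s t assume "f \<in> L2"
  show "ae_eq (weyl ((s + t) * u) ((s + t) * v) f) (weyl (s * u) (s * v) (weyl (t * u) (t * v) f))"
    by (simp add: weyl_weyl distrib_right ae_eq_refl)
next
  fix f assume f: "f \<in> L2"
  show "((\<lambda>s. l2norm (\<lambda>x. weyl (s * u) (s * v) f x - f x)) \<longlongrightarrow> 0) (at 0)"
    unfolding tendsto_at_iff_sequentially comp_def
  proof (intro allI impI)
    fix X :: "nat \<Rightarrow> real" assume "X \<longlonglongrightarrow> 0"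
    then have "(\<lambda>n. X n * u) \<longlonglongrightarrow> 0" "(\<lambda>n. X n * v) \<longlonglongrightarrow> 0"
      by (auto intro: tendsto_mult_left_zero)
    from weyl_continuous[OF f this] show "(\<lambda>n. l2norm (\<lambda>x. weyl (X n * u) (X n * v) f x - f x)) \<longlonglongrightarrow> 0"
      by (simp add: weyl_0)
  qed
qed (auto simp: weyl_bounded_operator weyl_isometry weyl_0 ae_eq_refl)

subsection \<open>The generator of the Weyl group\<close>

text \<open>A sequence of bad shifts tending to 0 would contradict \<open>weyl_continuous\<close>
  with \<open>u = 0\<close>. The form with a radius \<open>d\<close> is needed because a whole
  interval of shifts is averaged below.\<close>

lemma weyl_uniformly_continuous_shift:
  assumes f: "f \<in> L2" and "\<epsilon> > 0"
  obtains d where "d > 0" "\<And>h. \<bar>h\<bar> \<le> d \<Longrightarrow> l2norm (\<lambda>x. f (x - h) - f x) \<le> \<epsilon>"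
proof -
  have "\<exists>d>0. \<forall>h. \<bar>h\<bar> \<le> d \<longrightarrow> l2norm (\<lambda>x. weyl 0 h f x - f x) \<le> \<epsilon>"
  proof (rule ccontr)
    assume "\<not> ?thesis"
    then have "\<forall>n. \<exists>h. \<bar>h\<bar> \<le> inverse (real (Suc n)) \<and> \<not> l2norm (\<lambda>x. weyl 0 h f x - f x) \<le> \<epsilon>"
      by (meson inverse_positive_iff_positive of_nat_0_less_iff zero_less_Suc)
    then obtain h where h: "\<And>n. \<bar>h n\<bar> \<le> inverse (real (Suc n))"
      "\<And>n. \<not> l2norm (\<lambda>x. weyl 0 (h n) f x - f x) \<le> \<epsilon>" by metis
    have "h \<longlonglongrightarrow> 0"
      by (rule Lim_null_comparison[OF _ LIMSEQ_inverse_real_of_nat]) (use h(1) in auto)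
    then have "(\<lambda>n. l2norm (\<lambda>x. weyl 0 (h n) f x - weyl 0 0 f x)) \<longlonglongrightarrow> 0"
      by (intro weyl_continuous f) auto
    then have "eventually (\<lambda>n. l2norm (\<lambda>x. weyl 0 (h n) f x - f x) < \<epsilon>) sequentially"
      using \<open>\<epsilon> > 0\<close> by (intro order_tendstoD) (simp add: weyl_0)
    with h(2) show False
      by (metis (mono_tags, lifting) eventually_sequentially less_imp_le order_refl)
  qed
  then show thesis using that by (auto simp: weyl_def)
qed

text \<open>The substitution \<open>y = x - \<theta> * h\<close> covers both orientations of the
  interval between \<open>x - h\<close> and \<open>x\<close>, and turns the difference quotient into
  an average of shifts.\<close>

lemma absolutely_continuous_shift:
  fixes f0 g :: wave
  assumes "\<And>a b. a \<le> b \<Longrightarrow> f0 b - f0 a = (LINT x:{a..b}|lborel. g x)"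
  shows "f0 (x - h) - f0 x = - of_real h * (LINT \<theta>:{0..1}|lborel. g (x - \<theta> * h))"
proof -
  have *: "f0 (x - h) - f0 x = - of_real h * (LINT \<theta>|lborel. indicator {0..1} \<theta> *\<^sub>R g (x - \<theta> * h))" if "h \<noteq> 0"
  proof (cases "h > 0")
    case True
    have "f0 x - f0 (x - h) = (LINT y|lborel. indicator {x - h..x} y *\<^sub>R g y)"
      using True assms[of "x - h" x] by (simp add: set_lebesgue_integral_def)
    also have "\<dots> = \<bar>- h\<bar> *\<^sub>R (LINT \<theta>|lborel. indicator {x - h..x} (x + - h * \<theta>) *\<^sub>R g (x + - h * \<theta>))"
      using \<open>h \<noteq> 0\<close> by (intro lborel_integral_real_affine) simp
    also have "(\<lambda>\<theta>. indicator {x - h..x} (x + - h * \<theta>) *\<^sub>R g (x + - h * \<theta>)) = (\<lambda>\<theta>. indicator {0..1} \<theta> *\<^sub>R g (x - \<theta> * h))"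
      using True by (auto simp: indicator_def fun_eq_iff mult.commute zero_le_mult_iff)
    finally show ?thesis using True by (simp add: scaleR_conv_of_real algebra_simps)
  next
    case False
    with that have "h < 0" by simp
    have "f0 (x - h) - f0 x = (LINT y|lborel. indicator {x..x - h} y *\<^sub>R g y)"
      using \<open>h < 0\<close> assms[of x "x - h"] by (simp add: set_lebesgue_integral_def)
    also have "\<dots> = \<bar>- h\<bar> *\<^sub>R (LINT \<theta>|lborel. indicator {x..x - h} (x + - h * \<theta>) *\<^sub>R g (x + - h * \<theta>))"
      using \<open>h \<noteq> 0\<close> by (intro lborel_integral_real_affine) simp
    also have "(\<lambda>\<theta>. indicator {x..x - h} (x + - h * \<theta>) *\<^sub>R g (x + - h * \<theta>)) = (\<lambda>\<theta>. indicator {0..1} \<theta> *\<^sub>R g (x - \<theta> * h))"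
      using \<open>h < 0\<close> by (auto simp: indicator_def fun_eq_iff mult.commute mult_le_0_iff)
    finally show ?thesis using \<open>h < 0\<close> by (simp add: scaleR_conv_of_real algebra_simps)
  qed
  then show ?thesis by (cases "h = 0") (auto simp: set_lebesgue_integral_def)
qed

lemma L2_shift: "f \<in> L2 \<Longrightarrow> (\<lambda>x. f (x - h)) \<in> L2"
  using weyl_L2[of f 0 h] by (simp add: weyl_def)

lemma L2_integrable_shift_unit:
  assumes f: "f \<in> L2" and "h \<noteq> 0"
  shows "integrable lborel (\<lambda>\<theta>. indicator {0..1} \<theta> *\<^sub>R f (x - \<theta> * h))"
proof -
  have "integrable lborel (\<lambda>\<theta>. (cmod (f (x + - h * \<theta>)))\<^sup>2)"
    using \<open>h \<noteq> 0\<close> by (intro lborel_integrable_real_affine L2_integrable f) simp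
  then have "(\<lambda>\<theta>. f (x - h * \<theta>)) \<in> L2"
    using L2_measurable[OF f] by (intro L2I) auto
  moreover have "(\<lambda>\<theta>. indicator {0..1} \<theta>) \<in> L2"
  proof (rule L2I)
    have "(\<lambda>\<theta>. (cmod (indicator {0..1::real} \<theta>))\<^sup>2) = (\<lambda>\<theta>. (1 * indicat_real {0..1} \<theta>)\<^sup>2)"
      by (auto simp: indicator_def)
    then show "integrable lborel (\<lambda>\<theta>. (cmod (indicator {0..1::real} \<theta>))\<^sup>2)"
      using integrable_indicator_square[of 1 0 1] by simp
  qed simp
  ultimately have "integrable lborel (\<lambda>\<theta>. cnj (indicator {0..1} \<theta>) * f (x - h * \<theta>))"
    by (rule L2_product_integrable[rotated])
  moreover have "(\<lambda>\<theta>. indicator {0..1} \<theta> *\<^sub>R f (x - \<theta> * h)) = (\<lambda>\<theta>. cnj (indicator {0..1} \<theta>) * f (x - h * \<theta>))"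
    by (auto simp: fun_eq_iff indicator_def mult.commute)
  ultimately show ?thesis by simp
qed

text \<open>Jensen's inequality in \<open>\<theta>\<close>, then Tonelli: for fixed
  \<open>\<theta>\<close> the inner integral is the squared norm of a difference under a shift of
  size at most \<open>\<bar>h\<bar>\<close>.\<close>

lemma average_shift_bound:
  assumes f: "f \<in> L2" and d: "\<And>h. \<bar>h\<bar> \<le> d \<Longrightarrow> l2norm (\<lambda>x. f (x - h) - f x) \<le> \<epsilon>"
    and h: "\<bar>h\<bar> \<le> d" "h \<noteq> 0" and "\<epsilon> \<ge> 0"
  shows "(\<lambda>x. (LINT \<theta>:{0..1}|lborel. f (x - \<theta> * h)) - f x) \<in> L2 \<and>
    l2norm (\<lambda>x. (LINT \<theta>:{0..1}|lborel. f (x - \<theta> * h)) - f x) \<le> \<epsilon>"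
proof (rule l2norm_le_iff)
  have [measurable]: "f \<in> borel_measurable borel" using f by (rule L2_measurable)
  show "(\<lambda>x. (LINT \<theta>:{0..1}|lborel. f (x - \<theta> * h)) - f x) \<in> borel_measurable borel"
    unfolding set_lebesgue_integral_def by measurable
  have pt: "ennreal ((cmod ((LINT \<theta>:{0..1}|lborel. f (x - \<theta> * h)) - f x))\<^sup>2)
      \<le> (\<integral>\<^sup>+\<theta>. indicator {0..1} \<theta> * ennreal ((cmod (f (x - \<theta> * h) - f x))\<^sup>2) \<partial>lborel)" for x
  proof -
    let ?g = "\<lambda>\<theta>. indicator {0..1} \<theta> *\<^sub>R (f (x - \<theta> * h) - f x)"
    have i1: "integrable lborel (\<lambda>\<theta>. indicator {0..1} \<theta> *\<^sub>R f (x - \<theta> * h))"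
      using f h(2) by (rule L2_integrable_shift_unit)
    have i2: "integrable lborel (\<lambda>\<theta>::real. indicator {0..1} \<theta> *\<^sub>R f x)"
      by (intro integrable_scaleR_left integrable_real_indicator) auto
    have "(LINT \<theta>:{0..1}|lborel. f (x - \<theta> * h)) - f x = (LINT \<theta>|lborel. ?g \<theta>)"
      unfolding set_lebesgue_integral_def scaleR_diff_right Bochner_Integration.integral_diff[OF i1 i2] by simp
    then have "ennreal (cmod ((LINT \<theta>:{0..1}|lborel. f (x - \<theta> * h)) - f x)) \<le> (\<integral>\<^sup>+\<theta>. ennreal (cmod (?g \<theta>)) \<partial>lborel)"
      using integral_norm_bound_ennreal[of lborel ?g] i1 i2 by (simp add: scaleR_diff_right)
    \<comment> \<open>The indicator is idempotent; one copy becomes the constant factor in the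
      Cauchy-Schwarz inequality on the unit interval.\<close>
    also have "\<dots> = (\<integral>\<^sup>+\<theta>. indicator {0..1} \<theta> * (indicator {0..1} \<theta> * ennreal (cmod (f (x - \<theta> * h) - f x))) \<partial>lborel)"
      by (intro nn_integral_cong) (auto simp: indicator_def)
    finally have "(ennreal (cmod ((LINT \<theta>:{0..1}|lborel. f (x - \<theta> * h)) - f x)))\<^sup>2
        \<le> (\<integral>\<^sup>+\<theta>. indicator {0..1} \<theta> * (indicator {0..1} \<theta> * ennreal (cmod (f (x - \<theta> * h) - f x))) \<partial>lborel)\<^sup>2"
      by (rule power_mono) simp
    also have "\<dots> \<le> (\<integral>\<^sup>+\<theta>. (indicator {0..1::real} \<theta>)\<^sup>2 \<partial>lborel) *
        (\<integral>\<^sup>+\<theta>. (indicator {0..1} \<theta> * ennreal (cmod (f (x - \<theta> * h) - f x)))\<^sup>2 \<partial>lborel)"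
      by (rule Cauchy_Schwarz_nn_integral) measurable
    also have "(\<integral>\<^sup>+\<theta>. (indicator {0..1::real} \<theta>)\<^sup>2 \<partial>lborel) = (\<integral>\<^sup>+\<theta>. (indicator {0..1::real} \<theta>) \<partial>lborel)"
      by (intro nn_integral_cong) (auto simp: indicator_def)
    also have "\<dots> = 1" by simp
    also have "(\<integral>\<^sup>+\<theta>. (indicator {0..1} \<theta> * ennreal (cmod (f (x - \<theta> * h) - f x)))\<^sup>2 \<partial>lborel)
      = (\<integral>\<^sup>+\<theta>. indicator {0..1} \<theta> * ennreal ((cmod (f (x - \<theta> * h) - f x))\<^sup>2) \<partial>lborel)"
      by (intro nn_integral_cong) (auto simp: indicator_def ennreal_power)
    finally show ?thesis by (simp add: ennreal_power)
  qed
  have "(\<integral>\<^sup>+x. ennreal ((cmod ((LINT \<theta>:{0..1}|lborel. f (x - \<theta> * h)) - f x))\<^sup>2) \<partial>lborel)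
      \<le> (\<integral>\<^sup>+x. \<integral>\<^sup>+\<theta>. indicator {0..1} \<theta> * ennreal ((cmod (f (x - \<theta> * h) - f x))\<^sup>2) \<partial>lborel \<partial>lborel)"
    by (intro nn_integral_mono pt)
  also have "\<dots> = (\<integral>\<^sup>+\<theta>. \<integral>\<^sup>+x. indicator {0..1} \<theta> * ennreal ((cmod (f (x - \<theta> * h) - f x))\<^sup>2) \<partial>lborel \<partial>lborel)"
    by (intro lborel_pair.Fubini') measurable
  also have "\<dots> \<le> (\<integral>\<^sup>+\<theta>. indicator {0..1::real} \<theta> * ennreal (\<epsilon>\<^sup>2) \<partial>lborel)"
  proof (rule nn_integral_mono)
    fix \<theta> :: real
    show "(\<integral>\<^sup>+x. indicator {0..1} \<theta> * ennreal ((cmod (f (x - \<theta> * h) - f x))\<^sup>2) \<partial>lborel)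
      \<le> indicator {0..1::real} \<theta> * ennreal (\<epsilon>\<^sup>2)"
    proof (cases "\<theta> \<in> {0..1}")
      case True
      then have "\<bar>\<theta> * h\<bar> \<le> 1 * d" unfolding abs_mult by (intro mult_mono) (use h in auto)
      then have "l2norm (\<lambda>x. f (x - \<theta> * h) - f x) \<le> \<epsilon>" by (intro d) simp
      then show ?thesis using True
        by (subst nn_integral_cmult)
          (auto simp: nn_integral_L2 L2_diff L2_shift f l2norm_nonneg intro!: ennreal_leI power_mono)
    qed simp
  qed
  also have "\<dots> = ennreal (\<epsilon>\<^sup>2)" by (subst nn_integral_multc) auto
  finally show "(\<integral>\<^sup>+x. ennreal ((cmod ((LINT \<theta>:{0..1}|lborel. f (x - \<theta> * h)) - f x))\<^sup>2) \<partial>lborel) \<le> ennreal (\<epsilon>\<^sup>2)" .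
qed fact

lemma has_vector_derivative_quotient_tendsto:
  fixes f :: "real \<Rightarrow> complex"
  assumes "(f has_vector_derivative D) (at a)"
  shows "((\<lambda>t. (f t - f a) / of_real (t - a)) \<longlongrightarrow> D) (at a)"
proof (rule LIM_zero_cancel, rule tendsto_norm_zero_cancel)
  have "((\<lambda>t. (1 / norm (t - a)) *\<^sub>R (f t - (f a + (t - a) *\<^sub>R D))) \<longlongrightarrow> 0) (at a)"
    using assms unfolding has_vector_derivative_def has_derivative_within by simp
  then have "((\<lambda>t. norm ((1 / norm (t - a)) *\<^sub>R (f t - (f a + (t - a) *\<^sub>R D)))) \<longlongrightarrow> 0) (at a)"
    by (rule tendsto_norm_zero)
  moreover have "\<forall>\<^sub>F t in at a. norm ((1 / norm (t - a)) *\<^sub>R (f t - (f a + (t - a) *\<^sub>R D)))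
      = norm ((f t - f a) / of_real (t - a) - D)"
    unfolding eventually_at_filter
  proof (intro always_eventually allI impI)
    fix t assume "t \<noteq> a"
    then have "(f t - f a) / of_real (t - a) - D = (f t - (f a + (t - a) *\<^sub>R D)) / of_real (t - a)"
      by (simp add: diff_divide_distrib scaleR_conv_of_real add_divide_distrib)
    then show "norm ((1 / norm (t - a)) *\<^sub>R (f t - (f a + (t - a) *\<^sub>R D)))
      = norm ((f t - f a) / of_real (t - a) - D)"
      by (simp add: norm_divide del: of_real_diff)
  qed
  ultimately show "((\<lambda>t. norm ((f t - f a) / of_real (t - a) - D)) \<longlongrightarrow> 0) (at a)"
    by (rule Lim_transform_eventually)
qed

text \<open>Of \<open>\<psi>\<close> only membership in both domains is known. Translation and phase
  are therefore treated separately: the translation quotient through absolute continuity, the phase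
  quotient by dominated convergence.\<close>

lemma weyl_generator:
  assumes "lin_comb_op u position_op v momentum_op \<psi> \<eta>"
  shows "((\<lambda>s. l2norm (\<lambda>x. (weyl (s * u) (s * v) \<psi> x - \<psi> x) / of_real s + \<i> * \<eta> x)) \<longlongrightarrow> 0) (at 0)"
  unfolding tendsto_at_iff_sequentially comp_def
proof (intro allI impI)
  fix s :: "nat \<Rightarrow> real"
  assume "\<forall>n. s n \<in> UNIV - {0}" and s: "s \<longlonglongrightarrow> 0"
  then have s0: "s n \<noteq> 0" for n by simp
  obtain \<eta>1 \<eta>2 \<psi>0 where psi: "\<psi> \<in> L2" and e1: "\<eta>1 \<in> L2" "\<And>x. \<eta>1 x = of_real x * \<psi> x"
    and e2: "\<eta>2 \<in> L2" and p0: "ae_eq \<psi>0 \<psi>"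
    and p0': "\<And>a b. a \<le> b \<Longrightarrow> \<psi>0 b - \<psi>0 a = (LINT x:{a..b}|lborel. \<i> * \<eta>2 x)"
    and eta: "\<eta> = (\<lambda>x. of_real u * \<eta>1 x + of_real v * \<eta>2 x)"
    using assms unfolding lin_comb_op_def position_op_def momentum_op_def by blast
  have [measurable]: "\<psi> \<in> borel_measurable borel" "\<eta>1 \<in> borel_measurable borel" "\<eta>2 \<in> borel_measurable borel"
    using psi e1(1) e2 by (auto dest: L2_measurable)
  define c where "c n x = cis (- (s n * u) * x + s n * u * (s n * v) / 2)" for n x
  have [measurable]: "c n \<in> borel_measurable borel" for n unfolding c_def by measurable
  have c1: "cmod (c n x) = 1" for n x by (simp add: c_def)
  have clim: "(\<lambda>n. c n x) \<longlonglongrightarrow> 1" for x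
  proof -
    have "(\<lambda>n. c n x) \<longlonglongrightarrow> cis (- (0 * u) * x + 0 * u * (0 * v) / 2)"
      unfolding c_def by (intro tendsto_intros s) auto
    then show ?thesis by simp
  qed
  obtain S where S: "\<And>n. \<bar>s n\<bar> \<le> S" "S > 0"
    using convergent_imp_Bseq[OF convergentI[OF s]] by (auto simp: Bseq_def)
  \<comment> \<open>\<open>A\<close> is the error of the translation quotient, \<open>B\<close> that
    of the phase quotient, and \<open>D\<close> the price of the phase \<open>c\<close> in front of
    the former. The total error is \<open>c * A + B - D\<close>.\<close>
  define A where "A n x = (\<psi> (x - s n * v) - \<psi> x) / of_real (s n) + \<i> * of_real v * \<eta>2 x" for n x
  define B where "B n x = (c n x - 1) / of_real (s n) * \<psi> x - (- \<i> * of_real u * \<eta>1 x)" for n x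
  define D where "D n x = c n x * (\<i> * of_real v * \<eta>2 x) - \<i> * of_real v * \<eta>2 x" for n x
  have AL: "A n \<in> L2" for n
    unfolding A_def by (rule L2_add, use L2_scale[OF L2_diff[OF L2_shift[OF psi] psi], of "1 / of_real (s n)"] in simp)
      (intro L2_scale e2)
  have A: "(\<lambda>n. l2norm (A n)) \<longlonglongrightarrow> 0"
  proof (cases "v = 0")
    case True
    then show ?thesis by (simp add: A_def l2norm_def)
  next
    case False
    show ?thesis
    proof (rule LIMSEQ_I)
      fix \<epsilon> :: real assume "\<epsilon> > 0"
      define \<epsilon>' where "\<epsilon>' = \<epsilon> / (2 * \<bar>v\<bar>)"
      have e': "\<epsilon>' > 0" "\<bar>v\<bar> * \<epsilon>' < \<epsilon>" using \<open>\<epsilon> > 0\<close> False by (auto simp: \<epsilon>'_def)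
      obtain d where d: "d > 0" "\<And>h. \<bar>h\<bar> \<le> d \<Longrightarrow> l2norm (\<lambda>x. \<eta>2 (x - h) - \<eta>2 x) \<le> \<epsilon>'"
        using weyl_uniformly_continuous_shift[OF e2 e'(1)] by blast
      have "(\<lambda>n. s n * v) \<longlonglongrightarrow> 0" using s by (rule tendsto_mult_left_zero)
      then obtain N where N: "\<And>n. n \<ge> N \<Longrightarrow> \<bar>s n * v\<bar> < d"
        using LIMSEQ_D[OF _ d(1)] by fastforce
      have "l2norm (A n) < \<epsilon>" if "n \<ge> N" for n
      proof -
        define h where "h = s n * v"
        have h: "\<bar>h\<bar> \<le> d" "h \<noteq> 0" using N[OF that] s0 False by (auto simp: h_def)
        define J where "J x = (LINT \<theta>:{0..1}|lborel. \<eta>2 (x - \<theta> * h)) - \<eta>2 x" for x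
        have J: "J \<in> L2" "l2norm J \<le> \<epsilon>'"
          using average_shift_bound[OF e2 d(2) h] e' unfolding J_def by auto
        have "AE x in lborel. \<psi>0 x = \<psi> x" using p0 by (simp add: ae_eq_def)
        then have "AE x in lborel. A n x = - \<i> * of_real v * J x"
          using AE_lborel_shift[OF \<open>AE x in lborel. \<psi>0 x = \<psi> x\<close>, of h]
        proof eventually_elim
          case (elim x)
          have "\<psi> (x - h) - \<psi> x = - of_real h * (LINT \<theta>:{0..1}|lborel. \<i> * \<eta>2 (x - \<theta> * h))"
            using absolutely_continuous_shift[of \<psi>0 "\<lambda>x. \<i> * \<eta>2 x" x h] p0' elim by simp
          also have "\<dots> = - of_real (s n) * (\<i> * of_real v * (J x + \<eta>2 x))"
            by (simp add: J_def h_def mult_ac)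
          finally show ?case
            using s0[of n] by (simp add: A_def h_def field_simps)
        qed
        then have "l2norm (A n) = l2norm (\<lambda>x. - \<i> * of_real v * J x)"
          by (intro l2norm_cong AL L2_scale J) (simp add: ae_eq_def)
        also have "\<dots> = \<bar>v\<bar> * l2norm J" using l2norm_scale[of "- \<i> * of_real v" J] by (simp add: norm_mult)
        also have "\<dots> \<le> \<bar>v\<bar> * \<epsilon>'" using J by (intro mult_left_mono) auto
        finally show ?thesis using e' by simp
      qed
      then show "\<exists>no. \<forall>n\<ge>no. norm (l2norm (A n) - 0) < \<epsilon>"
        by (auto simp: l2norm_nonneg)
    qed
  qed
  have Bl: "(\<lambda>n. l2norm (B n)) \<longlonglongrightarrow> 0"
    unfolding B_def
  \<comment> \<open>Dividing \<open>cmod (c n x - 1)\<close> by \<open>\<bar>s n\<bar>\<close>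
    leaves at most \<open>\<bar>u\<bar> * \<bar>x\<bar> + S * \<bar>u * v\<bar> / 2\<close>; the
    growth in \<open>x\<close> is harmless because \<open>\<psi>\<close> lies in the domain of the
    position operator.\<close>
  proof (rule l2norm_dominated_convergence[where w = "\<lambda>x. \<bar>u\<bar> * cmod (\<eta>1 x) + S * \<bar>u * v\<bar> / 2 * cmod (\<psi> x)"])
    show "integrable lborel (\<lambda>x. (\<bar>u\<bar> * cmod (\<eta>1 x) + S * \<bar>u * v\<bar> / 2 * cmod (\<psi> x))\<^sup>2)"
    proof -
      have L: "(\<lambda>x. complex_of_real (cmod (\<eta>1 x))) \<in> L2" "(\<lambda>x. complex_of_real (cmod (\<psi> x))) \<in> L2"
        using L2_integrable[OF e1(1)] L2_integrable[OF psi] by (auto intro!: L2I simp del: e1(2))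
      have "(\<lambda>x. of_real \<bar>u\<bar> * of_real (cmod (\<eta>1 x)) + of_real (S * \<bar>u * v\<bar> / 2) * of_real (cmod (\<psi> x))) \<in> L2"
        by (intro L2_add L2_scale L)
      from L2_integrable[OF this] show ?thesis
        by (simp only: of_real_mult[symmetric] of_real_add[symmetric] norm_of_real power2_abs)
    qed
    show "AE x in lborel. (\<lambda>n. (c n x - 1) / of_real (s n) * \<psi> x) \<longlonglongrightarrow> - \<i> * of_real u * \<eta>1 x"
    proof (rule AE_I2)
      fix x
      have "((\<lambda>t. cis (- (t * u) * x + t * u * (t * v) / 2)) has_vector_derivative (- \<i> * of_real (u * x))) (at 0)"
        unfolding has_vector_derivative_def
        by (auto intro!: derivative_eq_intros simp: scaleR_conv_of_real algebra_simps)
      then have "((\<lambda>t. (cis (- (t * u) * x + t * u * (t * v) / 2) - 1) / of_real t) \<longlongrightarrow> - \<i> * of_real (u * x)) (at 0)"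
        by (drule_tac has_vector_derivative_quotient_tendsto) simp
      then have "(\<lambda>n. (c n x - 1) / of_real (s n)) \<longlonglongrightarrow> - \<i> * of_real (u * x)"
        unfolding tendsto_at_iff_sequentially comp_def c_def using s s0 by blast
      then have "(\<lambda>n. (c n x - 1) / of_real (s n) * \<psi> x) \<longlonglongrightarrow> - \<i> * of_real (u * x) * \<psi> x"
        by (intro tendsto_intros)
      then show "(\<lambda>n. (c n x - 1) / of_real (s n) * \<psi> x) \<longlonglongrightarrow> - \<i> * of_real u * \<eta>1 x"
        by (simp add: e1(2) mult.assoc)
    qed
    show "AE x in lborel. cmod ((c n x - 1) / of_real (s n) * \<psi> x) \<le> \<bar>u\<bar> * cmod (\<eta>1 x) + S * \<bar>u * v\<bar> / 2 * cmod (\<psi> x)" for n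
    proof (rule AE_I2)
      fix x
      have "cmod (c n x - 1) \<le> \<bar>s n * (- u * x + s n * (u * v) / 2)\<bar>"
        using norm_cis_diff_one_le[of "- (s n * u) * x + s n * u * (s n * v) / 2"]
        by (simp add: c_def algebra_simps)
      also have "\<dots> = \<bar>s n\<bar> * \<bar>- u * x + s n * (u * v) / 2\<bar>" by (rule abs_mult)
      also have "\<dots> \<le> \<bar>s n\<bar> * (\<bar>u\<bar> * \<bar>x\<bar> + S * \<bar>u * v\<bar> / 2)"
      proof (rule mult_left_mono)
        have "\<bar>- u * x + s n * (u * v) / 2\<bar> \<le> \<bar>- u * x\<bar> + \<bar>s n * (u * v) / 2\<bar>" by (rule abs_triangle_ineq)
        also have "\<dots> \<le> \<bar>u\<bar> * \<bar>x\<bar> + S * \<bar>u * v\<bar> / 2"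
          using mult_right_mono[OF S(1)[of n], of "\<bar>u * v\<bar>"] by (simp add: abs_mult)
        finally show "\<bar>- u * x + s n * (u * v) / 2\<bar> \<le> \<bar>u\<bar> * \<bar>x\<bar> + S * \<bar>u * v\<bar> / 2" .
      qed simp
      finally have "cmod (c n x - 1) / \<bar>s n\<bar> \<le> \<bar>u\<bar> * \<bar>x\<bar> + S * \<bar>u * v\<bar> / 2"
        using s0[of n] by (simp add: field_simps)
      then have "cmod (c n x - 1) / \<bar>s n\<bar> * cmod (\<psi> x) \<le> (\<bar>u\<bar> * \<bar>x\<bar> + S * \<bar>u * v\<bar> / 2) * cmod (\<psi> x)"
        by (rule mult_right_mono) simp
      then show "cmod ((c n x - 1) / of_real (s n) * \<psi> x) \<le> \<bar>u\<bar> * cmod (\<eta>1 x) + S * \<bar>u * v\<bar> / 2 * cmod (\<psi> x)"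
        by (simp add: norm_mult norm_divide e1(2) distrib_right mult.assoc)
    qed
  qed measurable
  have Dl: "(\<lambda>n. l2norm (D n)) \<longlonglongrightarrow> 0"
    unfolding D_def
  proof (rule l2norm_dominated_convergence[where w = "\<lambda>x. \<bar>v\<bar> * cmod (\<eta>2 x)"])
    show "AE x in lborel. (\<lambda>n. c n x * (\<i> * of_real v * \<eta>2 x)) \<longlonglongrightarrow> \<i> * of_real v * \<eta>2 x"
      using tendsto_mult_right[OF clim] by (intro AE_I2) fastforce
  qed (auto simp: power_mult_distrib L2_integrable e2 norm_mult c1)
  have BL: "B n \<in> L2" for n
    unfolding B_def
  proof (rule L2_diff)
    show "(\<lambda>x. (c n x - 1) / of_real (s n) * \<psi> x) \<in> L2"
    proof (rule L2_bound[OF _ psi, where c = "2 / \<bar>s n\<bar>"])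
      show "AE x in lborel. cmod ((c n x - 1) / complex_of_real (s n) * \<psi> x) \<le> 2 / \<bar>s n\<bar> * cmod (\<psi> x)"
        using norm_triangle_ineq4[of "c n _" 1] c1
        by (intro AE_I2) (auto simp: norm_mult norm_divide intro!: mult_right_mono divide_right_mono)
    qed measurable
  qed (intro L2_scale e1)
  have DL: "D n \<in> L2" for n
    unfolding D_def
    by (intro L2_diff L2_scale e2 L2_bound[OF _ L2_scale[OF e2, of "\<i> * of_real v"], where c = 1])
      (auto simp: norm_mult c1)
  have cAL: "(\<lambda>x. c n x * A n x) \<in> L2" for n
    using L2_measurable[OF AL[of n]] by (intro L2_bound[OF _ AL[of n], where c = 1]) (auto simp: norm_mult c1)
  have cA: "l2norm (\<lambda>x. c n x * A n x) = l2norm (A n)" for n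
    by (simp add: l2norm_def norm_mult c1)
  have eq: "(\<lambda>x. (weyl (s n * u) (s n * v) \<psi> x - \<psi> x) / of_real (s n) + \<i> * \<eta> x)
      = (\<lambda>x. c n x * A n x + (B n x - D n x))" for n
    using s0[of n] by (simp add: fun_eq_iff weyl_def A_def B_def D_def eta c_def field_simps)
  show "(\<lambda>n. l2norm (\<lambda>x. (weyl (s n * u) (s n * v) \<psi> x - \<psi> x) / of_real (s n) + \<i> * \<eta> x)) \<longlonglongrightarrow> 0"
  proof (rule Lim_null_comparison)
    show "(\<lambda>n. l2norm (A n) + (l2norm (B n) + l2norm (D n))) \<longlonglongrightarrow> 0"
      using tendsto_add[OF A tendsto_add[OF Bl Dl]] by simp
    show "\<forall>\<^sub>F n in sequentially. norm (l2norm (\<lambda>x. (weyl (s n * u) (s n * v) \<psi> x - \<psi> x) / of_real (s n) + \<i> * \<eta> x))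
      \<le> l2norm (A n) + (l2norm (B n) + l2norm (D n))"
    proof (rule always_eventually, rule allI)
      fix n
      have "l2norm (\<lambda>x. c n x * A n x + (B n x - D n x)) \<le> l2norm (A n) + l2norm (\<lambda>x. B n x - D n x)"
        using l2norm_triangle[OF cAL[of n] L2_diff[OF BL DL]] by (simp add: cA)
      also have "l2norm (\<lambda>x. B n x - D n x) \<le> l2norm (B n) + l2norm (D n)"
        using l2norm_triangle[OF BL L2_uminus[OF DL], of n n] by (simp add: l2norm_uminus)
      finally show "norm (l2norm (\<lambda>x. (weyl (s n * u) (s n * v) \<psi> x - \<psi> x) / of_real (s n) + \<i> * \<eta> x))
        \<le> l2norm (A n) + (l2norm (B n) + l2norm (D n))"
        unfolding eq by (simp add: l2norm_nonneg)
    qed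
  qed
qed

subsection \<open>Uniqueness of the Weyl group\<close>

text \<open>Compactly supported functions of class C1, paired with their derivative: a common core
  of all \<open>u Q + v P\<close>, on which the generator is explicit.\<close>

definition smooth_core :: "wave \<Rightarrow> wave \<Rightarrow> bool" where
  "smooth_core \<psi> \<psi>' \<longleftrightarrow> (\<forall>x. (\<psi> has_vector_derivative \<psi>' x) (at x)) \<and> continuous_on UNIV \<psi>' \<and>
     (\<exists>R. \<forall>x. \<bar>x\<bar> > R \<longrightarrow> \<psi> x = 0 \<and> \<psi>' x = 0)"

lemma smooth_core_continuous: "smooth_core \<psi> \<psi>' \<Longrightarrow> continuous_on UNIV \<psi>"
  unfolding smooth_core_def
  by (auto simp: continuous_on_eq_continuous_at intro: has_vector_derivative_continuous)

lemma smooth_core_L2: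
  assumes "smooth_core \<psi> \<psi>'" shows "\<psi> \<in> L2"
proof -
  obtain R where "\<And>x. \<bar>x\<bar> > R \<Longrightarrow> \<psi> x = 0"
    using assms unfolding smooth_core_def by blast
  with smooth_core_continuous[OF assms] show ?thesis
    by (rule continuous_compact_support_L2)
qed

lemma smooth_core_generator:
  assumes core: "smooth_core \<psi> \<psi>'"
  shows "lin_comb_op u position_op v momentum_op \<psi>
    (\<lambda>x. of_real u * (of_real x * \<psi> x) + of_real v * (- \<i> * \<psi>' x))"
proof -
  obtain R where R: "\<And>x. \<bar>x\<bar> > R \<Longrightarrow> \<psi> x = 0" "\<And>x. \<bar>x\<bar> > R \<Longrightarrow> \<psi>' x = 0"
    using core unfolding smooth_core_def by blast
  have c: "continuous_on UNIV \<psi>'" and d: "\<And>x. (\<psi> has_vector_derivative \<psi>' x) (at x)"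
    using core unfolding smooth_core_def by auto
  have "(\<lambda>x. of_real x * \<psi> x) \<in> L2"
    using R by (intro continuous_compact_support_L2[of _ R] continuous_intros smooth_core_continuous[OF core]) auto
  then have "position_op \<psi> (\<lambda>x. of_real x * \<psi> x)"
    unfolding position_op_def using smooth_core_L2[OF core] by simp
  moreover have "momentum_op \<psi> (\<lambda>x. - \<i> * \<psi>' x)"
    unfolding momentum_op_def
  proof (intro conjI exI[of _ \<psi>] allI impI smooth_core_L2[OF core] ae_eq_refl)
    show "(\<lambda>x. - \<i> * \<psi>' x) \<in> L2"
      using R by (intro continuous_compact_support_L2[of _ R] continuous_intros c) auto
    fix a b :: real assume "a \<le> b"
    then show "\<psi> b - \<psi> a = (LINT x:{a..b}|lborel. \<i> * (- \<i> * \<psi>' x))"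
      unfolding set_lebesgue_integral_def
      using integral_FTC_atLeastAtMost[OF \<open>a \<le> b\<close>, of \<psi> \<psi>'] d c
      by (simp add: has_vector_derivative_at_within continuous_on_subset)
  qed
  ultimately show ?thesis unfolding lin_comb_op_def by blast
qed

text \<open>Invariance of the core is what allows differentiation along the Weyl orbit at every time
  and not only at 0.\<close>

lemma smooth_core_weyl:
  assumes core: "smooth_core \<psi> \<psi>'"
  obtains \<xi> where "smooth_core (weyl u v \<psi>) \<xi>"
proof -
  obtain R where R: "\<And>x. \<bar>x\<bar> > R \<Longrightarrow> \<psi> x = 0" "\<And>x. \<bar>x\<bar> > R \<Longrightarrow> \<psi>' x = 0"
    using core unfolding smooth_core_def by blast
  have c: "continuous_on UNIV \<psi>'" and d: "\<And>x. (\<psi> has_vector_derivative \<psi>' x) (at x)"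
    using core unfolding smooth_core_def by auto
  have c0: "continuous_on UNIV \<psi>" using core by (rule smooth_core_continuous)
  define \<xi> where "\<xi> x = cis (- u * x + u * v / 2) * \<psi>' (x - v) + (- u *\<^sub>R (\<i> * cis (- u * x + u * v / 2))) * \<psi> (x - v)" for x
  have "smooth_core (weyl u v \<psi>) \<xi>"
    unfolding smooth_core_def
  proof (intro conjI allI exI[of _ "R + \<bar>v\<bar>"] impI)
    fix x
    have "((\<lambda>x. x - v) has_vector_derivative 1) (at x)"
      by (auto intro!: derivative_eq_intros)
    from vector_diff_chain_at[OF this d]
    have 1: "((\<lambda>x. \<psi> (x - v)) has_vector_derivative \<psi>' (x - v)) (at x)"
      by (simp add: comp_def)
    have 2: "((\<lambda>x. cis (- u * x + u * v / 2)) has_vector_derivative (- u *\<^sub>R (\<i> * cis (- u * x + u * v / 2)))) (at x)"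
      unfolding has_vector_derivative_def by (auto intro!: derivative_eq_intros)
    show "(weyl u v \<psi> has_vector_derivative \<xi> x) (at x)"
      unfolding weyl_def \<xi>_def by (rule has_vector_derivative_mult[OF 2 1])
  next
    show "continuous_on UNIV \<xi>"
      unfolding \<xi>_def
      by (intro continuous_intros continuous_on_compose2[OF c] continuous_on_compose2[OF c0]) auto
  next
    fix x assume "R + \<bar>v\<bar> < \<bar>x\<bar>"
    then have "R < \<bar>x - v\<bar>" by linarith
    then show "weyl u v \<psi> x = 0" "\<xi> x = 0" by (simp_all add: weyl_def \<xi>_def R)
  qed
  then show thesis by (rule that)
qed

text \<open>Continuous functions are limits of the averages \<open>(G (x + h) - G x) / h\<close> of their antiderivative.\<close>

lemma smooth_core_total:
  assumes f: "f \<in> L2" and orth: "\<And>\<psi> \<psi>'. smooth_core \<psi> \<psi>' \<Longrightarrow> ip \<psi> f = 0"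
  shows "ae_eq f (\<lambda>_. 0)"
proof -
  have cont: "ip g f = 0" if g: "continuous_on UNIV g" "\<And>x. \<bar>x\<bar> > R \<Longrightarrow> g x = 0" for g R
  proof -
    obtain B where B: "B \<ge> 0" "\<And>x. cmod (g x) \<le> B"
      using continuous_compact_support_bounded[OF g] by blast
    have gL: "g \<in> L2" using g by (rule continuous_compact_support_L2)
    obtain G where G: "\<And>x. (G has_vector_derivative g x) (at x)"
      using einterval_antiderivative[of "-\<infinity>" \<infinity> g] g(1) by (auto simp: continuous_on_eq_continuous_at)
    have Gc: "continuous_on UNIV G"
      using G by (auto simp: continuous_on_eq_continuous_at intro: has_vector_derivative_continuous)
    have G_bound: "cmod (G y - G x) \<le> C * \<bar>y - x\<bar>" if "\<And>t. t \<in> closed_segment x y \<Longrightarrow> cmod (g t) \<le> C" for x y C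
    proof -
      have "norm (G y - G x) \<le> C * norm (y - x)"
      proof (rule differentiable_bound)
        show "(G has_derivative (\<lambda>h. h *\<^sub>R g t)) (at t within closed_segment x y)" for t
          using G[of t] unfolding has_vector_derivative_def by (rule has_derivative_at_withinI)
        show "onorm (\<lambda>h. h *\<^sub>R g t) \<le> C" if "t \<in> closed_segment x y" for t
          using that \<open>\<And>t. t \<in> closed_segment x y \<Longrightarrow> cmod (g t) \<le> C\<close>
          by (intro onorm_le) (simp add: mult.commute[of C] mult_left_mono)
      qed auto
      then show ?thesis by simp
    qed
    define h where "h n = inverse (real (Suc n))" for n
    have h: "h n > 0" "h n \<le> 1" for n by (auto simp: h_def inverse_le_1_iff)
    have h0: "h \<longlonglongrightarrow> 0" unfolding h_def by (rule LIMSEQ_inverse_real_of_nat)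
    define p where "p n x = (G (x + h n) - G x) / of_real (h n)" for n x
    have p_bound: "cmod (p n x) \<le> C" if "\<And>t. t \<in> {x..x + h n} \<Longrightarrow> cmod (g t) \<le> C" for n x C
    proof -
      have "cmod (G (x + h n) - G x) \<le> C * h n"
        using G_bound[of x "x + h n" C] that h[of n] by (simp add: closed_segment_eq_real_ivl)
      then show ?thesis using h[of n] by (simp add: p_def norm_divide field_simps)
    qed
    have p_supp: "p n x = 0" if "\<bar>x\<bar> > R + 1" for n x
      using p_bound[where C = 0 and n = n and x = x] g(2) h(2)[of n] that by force
    have core: "smooth_core (p n) (\<lambda>x. (g (x + h n) - g x) / of_real (h n))" for n
      unfolding smooth_core_def
    proof (intro conjI allI exI[of _ "R + 1"] impI)
      fix x
      have "((\<lambda>x. x + h n) has_vector_derivative 1) (at x)"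
        by (auto intro!: derivative_eq_intros)
      from vector_diff_chain_at[OF this G]
      have "((\<lambda>x. G (x + h n)) has_vector_derivative g (x + h n)) (at x)"
        by (simp add: comp_def)
      then show "(p n has_vector_derivative (g (x + h n) - g x) / of_real (h n)) (at x)"
        unfolding p_def by (intro has_vector_derivative_divide has_vector_derivative_diff G)
    next
      show "continuous_on UNIV (\<lambda>x. (g (x + h n) - g x) / of_real (h n))"
        using h(1)[of n] by (intro continuous_intros continuous_on_compose2[OF g(1)]) auto
    next
      fix x assume x: "R + 1 < \<bar>x\<bar>"
      then show "p n x = 0" by (rule p_supp)
      have "\<bar>x + h n\<bar> > R" "\<bar>x\<bar> > R" using x h[of n] by linarith+
      then show "(g (x + h n) - g x) / of_real (h n) = 0" by (simp add: g(2))
    qed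
    have pL: "p n \<in> L2" for n using core by (rule smooth_core_L2)
    have "(\<lambda>n. l2norm (\<lambda>x. p n x - g x)) \<longlonglongrightarrow> 0"
    proof (rule l2norm_dominated_convergence[where w = "\<lambda>x. B * indicator {- (R + 1)..R + 1} x"])
      show "AE x in lborel. (\<lambda>n. p n x) \<longlonglongrightarrow> g x"
      proof (rule AE_I2)
        fix x
        have lim: "(\<lambda>n. x + h n) \<longlonglongrightarrow> x" using tendsto_add[OF tendsto_const h0, of x] by simp
        have "\<forall>\<^sub>F n in sequentially. x + h n \<noteq> x"
          by (rule always_eventually) (use h(1) in \<open>simp add: less_imp_neq[symmetric]\<close>)
        with lim have "filterlim (\<lambda>n. x + h n) (at x) sequentially" by (rule filterlim_atI)
        from filterlim_compose[OF has_vector_derivative_quotient_tendsto[OF G] this]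
        have "(\<lambda>n. (G (x + h n) - G x) / of_real (x + h n - x)) \<longlonglongrightarrow> g x" .
        then show "(\<lambda>n. p n x) \<longlonglongrightarrow> g x" by (simp add: p_def)
      qed
      show "AE x in lborel. cmod (p n x) \<le> B * indicator {- (R + 1)..R + 1} x" for n
      proof (rule AE_I2)
        fix x
        show "cmod (p n x) \<le> B * indicator {- (R + 1)..R + 1} x"
        proof (cases "\<bar>x\<bar> > R + 1")
          case False
          then have "x \<in> {- (R + 1)..R + 1}" by auto
          then show ?thesis using p_bound[where C = B] B by simp
        qed (use p_supp B in simp)
      qed
      show "integrable lborel (\<lambda>x. (B * indicat_real {- (R + 1)..R + 1} x)\<^sup>2)"
        by (rule integrable_indicator_square)
    qed (use pL gL in \<open>auto dest: L2_measurable\<close>)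
    then have "(\<lambda>n. ip f (p n)) \<longlonglongrightarrow> ip f g"
      by (intro ip_tendsto_right f pL gL)
    moreover have "ip f (p n) = 0" for n using orth[OF core] by (metis complex_cnj_zero ip_cnj)
    ultimately have "ip f g = 0" by (simp add: LIMSEQ_const_iff)
    then show ?thesis by (metis complex_cnj_zero ip_cnj)
  qed
  have "(l2norm f)\<^sup>2 \<le> 0"
  proof (rule field_le_epsilon)
    fix \<epsilon> :: real assume "\<epsilon> > 0"
    then have "\<epsilon> / (l2norm f + 1) > 0" using l2norm_nonneg[of f] by simp
    then obtain g R where g: "continuous_on UNIV g" "\<And>x. \<bar>x\<bar> > R \<Longrightarrow> g x = 0"
      and fg: "l2norm (\<lambda>x. f x - g x) < \<epsilon> / (l2norm f + 1)"
      using L2_approx_continuous[OF f] by metis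
    have gL: "g \<in> L2" using g by (rule continuous_compact_support_L2)
    have "complex_of_real ((l2norm f)\<^sup>2) = ip (\<lambda>x. f x - g x) f"
      using cont[OF g] by (simp add: ip_diff_left f gL ip_self)
    then have "(l2norm f)\<^sup>2 = cmod (ip (\<lambda>x. f x - g x) f)"
      by (metis norm_of_real abs_of_nonneg zero_le_power2)
    also have "\<dots> \<le> l2norm (\<lambda>x. f x - g x) * l2norm f"
      by (rule ip_Cauchy_Schwarz) (intro L2_diff f gL)+
    also have "\<dots> \<le> \<epsilon> / (l2norm f + 1) * (l2norm f + 1)"
      using fg l2norm_nonneg[of f] l2norm_nonneg[of "\<lambda>x. f x - g x"] by (intro mult_mono) auto
    finally show "(l2norm f)\<^sup>2 \<le> 0 + \<epsilon>" using l2norm_nonneg[of f] by simp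
  qed
  then show ?thesis using l2norm_eq_0_iff[OF f] by simp
qed

lemma bounded_operator_L2: "bounded_operator T \<Longrightarrow> f \<in> L2 \<Longrightarrow> T f \<in> L2"
  by (simp add: bounded_operator_def)

lemma bounded_operator_lincomb:
  "bounded_operator T \<Longrightarrow> f \<in> L2 \<Longrightarrow> g \<in> L2 \<Longrightarrow>
    ae_eq (T (\<lambda>x. a * f x + b * g x)) (\<lambda>x. a * T f x + b * T g x)"
  by (simp add: bounded_operator_def)

lemma bounded_operator_diff:
  "bounded_operator T \<Longrightarrow> f \<in> L2 \<Longrightarrow> g \<in> L2 \<Longrightarrow> ae_eq (T (\<lambda>x. f x - g x)) (\<lambda>x. T f x - T g x)"
  using bounded_operator_lincomb[of T f g 1 "-1"] by simp

lemma bounded_operator_cong: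
  assumes T: "bounded_operator T" and "f \<in> L2" "g \<in> L2" "ae_eq f g"
  shows "ae_eq (T f) (T g)"
proof -
  obtain C where C: "\<And>f. f \<in> L2 \<Longrightarrow> l2norm (T f) \<le> C * l2norm f"
    using T unfolding bounded_operator_def by blast
  have d: "(\<lambda>x. f x - g x) \<in> L2" using assms by (intro L2_diff)
  have "ae_eq (\<lambda>x. f x - g x) (\<lambda>_. 0)" using assms(4) unfolding ae_eq_def by (auto elim!: AE_mp)
  then have "l2norm (\<lambda>x. f x - g x) = 0" using d by (simp add: l2norm_eq_0_iff)
  then have "l2norm (T (\<lambda>x. f x - g x)) = 0"
    using C[OF d] l2norm_nonneg[of "T (\<lambda>x. f x - g x)"] by simp
  then have "ae_eq (T (\<lambda>x. f x - g x)) (\<lambda>_. 0)"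
    using bounded_operator_L2[OF T d] by (simp add: l2norm_eq_0_iff)
  then have "ae_eq (\<lambda>x. T f x - T g x) (\<lambda>_. 0)"
    using bounded_operator_diff[OF T assms(2,3)] by (blast intro: ae_eq_trans ae_eq_sym)
  then show ?thesis unfolding ae_eq_def by (auto elim!: AE_mp)
qed

context
  fixes U :: "real \<Rightarrow> wave \<Rightarrow> wave"
  assumes U: "unitary_group U"
begin

lemma unitary_group_bounded: "bounded_operator (U s)"
  using U by (simp add: unitary_group_def)

lemma unitary_group_L2: "f \<in> L2 \<Longrightarrow> U s f \<in> L2"
  using unitary_group_bounded bounded_operator_L2 by blast

lemma unitary_group_isometry: "f \<in> L2 \<Longrightarrow> g \<in> L2 \<Longrightarrow> ip (U s f) (U s g) = ip f g"
  using U by (simp add: unitary_group_def)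

lemma unitary_group_norm: "f \<in> L2 \<Longrightarrow> l2norm (U s f) = l2norm f"
  by (rule l2norm_eqI) (rule unitary_group_isometry)

lemma unitary_group_add: "f \<in> L2 \<Longrightarrow> ae_eq (U (s + t) f) (U s (U t f))"
  using U by (simp add: unitary_group_def)

lemma unitary_group_zero: "f \<in> L2 \<Longrightarrow> ae_eq (U 0 f) f"
  using U by (simp add: unitary_group_def)

lemma unitary_group_adjoint:
  assumes "f \<in> L2" "g \<in> L2" shows "ip (U (- s) f) g = ip f (U s g)"
proof -
  have "ip (U (- s) f) g = ip (U s (U (- s) f)) (U s g)"
    using assms by (simp add: unitary_group_isometry unitary_group_L2)
  also have "\<dots> = ip f (U s g)"
  proof (rule ip_cong[OF _ ae_eq_refl])
    show "ae_eq (U s (U (- s) f)) f"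
      using unitary_group_add[OF assms(1), of s "- s"] unitary_group_zero[OF assms(1)]
      by (simp, blast intro: ae_eq_trans ae_eq_sym)
  qed (intro unitary_group_L2 assms)+
  finally show ?thesis .
qed

end

text \<open>The uniqueness half of Stone's theorem by differentiation: for \<open>\<psi>\<close> in
  the core, \<open>ip g (V (- t) (U t \<psi>))\<close> has derivative 0 in \<open>t\<close>, since
  \<open>U t \<psi>\<close> stays in the core and both groups agree there to first order. Duality
  then extends the equality from the core to every \<open>f\<close>.\<close>

lemma unitary_group_eq_weyl:
  assumes V: "unitary_group V"
    and gen: "\<And>\<psi> \<eta>. lin_comb_op u position_op v momentum_op \<psi> \<eta> \<Longrightarrow>
      ((\<lambda>s. l2norm (\<lambda>x. (V s \<psi> x - \<psi> x) / of_real s + \<i> * \<eta> x)) \<longlongrightarrow> 0) (at 0)"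
    and f: "f \<in> L2"
  shows "ae_eq (V s f) (weyl (s * u) (s * v) f)"
proof -
  define U where "U s = weyl (s * u) (s * v)" for s
  have Ug: "unitary_group U" unfolding U_def[abs_def] by (rule weyl_unitary_group)
  have U_add: "U (s + t) f = U s (U t f)" for s t f
    by (simp add: U_def weyl_weyl distrib_right)
  note UL = unitary_group_L2[OF Ug] and VL = unitary_group_L2[OF V]
  \<comment> \<open>Both groups have the derivative \<open>- i\<close> times the generator on the
    core, so their difference is of smaller order than \<open>r\<close>.\<close>
  have small: "((\<lambda>r. l2norm (\<lambda>x. U r \<xi> x - V r \<xi> x) / r) \<longlongrightarrow> 0) (at 0)"
    if core: "smooth_core \<xi> \<xi>'" for \<xi> \<xi>'
  proof -
    let ?\<eta> = "\<lambda>x. of_real u * (of_real x * \<xi> x) + of_real v * (- \<i> * \<xi>' x)"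
    have g: "lin_comb_op u position_op v momentum_op \<xi> ?\<eta>" by (rule smooth_core_generator[OF core])
    have L: "\<xi> \<in> L2" "?\<eta> \<in> L2"
      using smooth_core_L2[OF core] g by (auto simp: lin_comb_op_def position_op_def momentum_op_def intro!: L2_add L2_scale)
    have a: "((\<lambda>r. l2norm (\<lambda>x. (U r \<xi> x - \<xi> x) / of_real r + \<i> * ?\<eta> x)) \<longlongrightarrow> 0) (at 0)"
      unfolding U_def by (rule weyl_generator[OF g])
    have "((\<lambda>r. l2norm (\<lambda>x. (U r \<xi> x - \<xi> x) / of_real r + \<i> * ?\<eta> x)
         + l2norm (\<lambda>x. (V r \<xi> x - \<xi> x) / of_real r + \<i> * ?\<eta> x)) \<longlongrightarrow> 0) (at 0)"
      using tendsto_add[OF a gen[OF g]] by simp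
    then show ?thesis
    proof (rule Lim_null_comparison[rotated], intro always_eventually allI)
      fix r
      have q: "(\<lambda>x. (g x - \<xi> x) / of_real r + \<i> * ?\<eta> x) \<in> L2" if "g \<in> L2" for g
        using L2_add[OF L2_scale[OF L2_diff[OF that L(1)], of "1 / of_real r"] L2_scale[OF L(2), of \<i>]] by simp
      have "l2norm (\<lambda>x. U r \<xi> x - V r \<xi> x) / \<bar>r\<bar> = l2norm (\<lambda>x. (1 / of_real r) * (U r \<xi> x - V r \<xi> x))"
        by (subst l2norm_scale) (simp add: norm_divide)
      also have "(\<lambda>x. (1 / of_real r) * (U r \<xi> x - V r \<xi> x))
          = (\<lambda>x. ((U r \<xi> x - \<xi> x) / of_real r + \<i> * ?\<eta> x) + - ((V r \<xi> x - \<xi> x) / of_real r + \<i> * ?\<eta> x))"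
        by (simp add: fun_eq_iff diff_divide_distrib)
      also have "l2norm \<dots> \<le> l2norm (\<lambda>x. (U r \<xi> x - \<xi> x) / of_real r + \<i> * ?\<eta> x)
          + l2norm (\<lambda>x. - ((V r \<xi> x - \<xi> x) / of_real r + \<i> * ?\<eta> x))"
        by (rule l2norm_triangle[OF q[OF UL[OF L(1)]] L2_uminus[OF q[OF VL[OF L(1)]]]])
      finally show "norm (l2norm (\<lambda>x. U r \<xi> x - V r \<xi> x) / r)
        \<le> l2norm (\<lambda>x. (U r \<xi> x - \<xi> x) / of_real r + \<i> * ?\<eta> x)
          + l2norm (\<lambda>x. (V r \<xi> x - \<xi> x) / of_real r + \<i> * ?\<eta> x)"
        by (simp only: l2norm_uminus real_norm_def abs_divide abs_of_nonneg[OF l2norm_nonneg])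
    qed
  qed
  have const: "ip g (V (- s) (U s \<psi>)) = ip g \<psi>" if core: "smooth_core \<psi> \<psi>'" and g: "g \<in> L2" for g \<psi> \<psi>' s
  proof -
    define H where "H s = ip g (V (- s) (U s \<psi>))" for s
    have \<psi>: "\<psi> \<in> L2" using core by (rule smooth_core_L2)
    have "(H has_vector_derivative 0) (at t)" for t
    proof -
      obtain \<xi>' where core': "smooth_core (U t \<psi>) \<xi>'"
        unfolding U_def using smooth_core_weyl[OF core] by blast
      have \<xi>: "U t \<psi> \<in> L2" using \<psi> by (rule UL)
      have bound: "cmod (H (t + r) - H t) \<le> l2norm g * l2norm (\<lambda>x. U r (U t \<psi>) x - V r (U t \<psi>) x)" for r
      proof -
        \<comment> \<open>Splitting \<open>V (- t)\<close> as \<open>V (- (t + r))\<close> after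
          \<open>V r\<close> turns the increment of \<open>H\<close> into an isometry applied to
          \<open>U r - V r\<close> on the vector \<open>U t \<psi>\<close>.\<close>
        have e1: "ae_eq (V (- t) (U t \<psi>)) (V (- (t + r)) (V r (U t \<psi>)))"
          using unitary_group_add[OF V \<xi>, of "- (t + r)" r] by simp
        have e2: "U (t + r) \<psi> = U r (U t \<psi>)" using U_add[of r t \<psi>] by (simp add: add.commute)
        have dL: "(\<lambda>x. U r (U t \<psi>) x - V r (U t \<psi>) x) \<in> L2"
          by (rule L2_diff[OF UL[OF \<xi>] VL[OF \<xi>]])
        have "H (t + r) - H t = ip g (V (- (t + r)) (U r (U t \<psi>))) - ip g (V (- (t + r)) (V r (U t \<psi>)))"
          unfolding H_def e2 using ip_cong[OF ae_eq_refl e1] by (simp add: g VL UL \<xi>)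
        also have "\<dots> = ip g (\<lambda>x. V (- (t + r)) (U r (U t \<psi>)) x - V (- (t + r)) (V r (U t \<psi>)) x)"
          by (simp add: ip_diff_right g VL UL \<xi>)
        also have "\<dots> = ip g (V (- (t + r)) (\<lambda>x. U r (U t \<psi>) x - V r (U t \<psi>) x))"
          by (rule ip_cong[OF ae_eq_refl ae_eq_sym[OF bounded_operator_diff[OF unitary_group_bounded[OF V]]]])
            (rule g \<xi> VL[OF dL] L2_diff[OF VL[OF UL[OF \<xi>]] VL[OF VL[OF \<xi>]]] UL[OF \<xi>] VL[OF \<xi>])+
        finally have "cmod (H (t + r) - H t) = cmod (ip g (V (- (t + r)) (\<lambda>x. U r (U t \<psi>) x - V r (U t \<psi>) x)))"
          by (rule arg_cong)
        also have "\<dots> \<le> l2norm g * l2norm (V (- (t + r)) (\<lambda>x. U r (U t \<psi>) x - V r (U t \<psi>) x))"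
          by (rule ip_Cauchy_Schwarz[OF g VL[OF dL]])
        also have "\<dots> = l2norm g * l2norm (\<lambda>x. U r (U t \<psi>) x - V r (U t \<psi>) x)"
          unfolding unitary_group_norm[OF V dL] by (rule refl)
        finally show ?thesis .
      qed
      have "((\<lambda>r. l2norm g * \<bar>l2norm (\<lambda>x. U r (U t \<psi>) x - V r (U t \<psi>) x) / r\<bar>) \<longlongrightarrow> 0) (at 0)"
        using tendsto_mult_right_zero[OF tendsto_rabs_zero[OF small[OF core']]] by simp
      then have "((\<lambda>r. (1 / norm r) *\<^sub>R (H (t + r) - H t)) \<longlongrightarrow> 0) (at 0)"
      proof (rule Lim_null_comparison[rotated], intro always_eventually allI)
        fix r
        show "norm ((1 / norm r) *\<^sub>R (H (t + r) - H t)) \<le> l2norm g * \<bar>l2norm (\<lambda>x. U r (U t \<psi>) x - V r (U t \<psi>) x) / r\<bar>"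
          using divide_right_mono[OF bound[of r], of "\<bar>r\<bar>"] by (simp add: abs_divide l2norm_nonneg)
      qed
      from tendsto_norm_zero[OF this] show ?thesis
        unfolding has_vector_derivative_def has_derivative_at
        by (simp add: bounded_linear_zero divide_inverse mult.commute)
    qed
    then have "H s = H 0"
      using has_derivative_zero_unique[of UNIV H s 0] by (simp add: has_vector_derivative_def)
    also have "\<dots> = ip g \<psi>"
      unfolding H_def U_def using ip_cong[OF ae_eq_refl unitary_group_zero[OF V \<psi>]]
      by (simp add: weyl_0 g \<psi> VL)
    finally show ?thesis by (simp add: H_def)
  qed
  have core_eq: "ae_eq (V (- s) (U s \<psi>)) \<psi>" if core: "smooth_core \<psi> \<psi>'" for \<psi> \<psi>' s
  proof -
    have \<psi>: "\<psi> \<in> L2" using core by (rule smooth_core_L2)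
    have d: "(\<lambda>x. V (- s) (U s \<psi>) x - \<psi> x) \<in> L2" by (intro L2_diff VL UL \<psi>)
    have "ip (\<lambda>x. V (- s) (U s \<psi>) x - \<psi> x) (\<lambda>x. V (- s) (U s \<psi>) x - \<psi> x) = 0"
      using const[OF core d] by (simp add: ip_diff_right d VL UL \<psi>)
    then have "l2norm (\<lambda>x. V (- s) (U s \<psi>) x - \<psi> x) = 0" by (simp add: ip_self)
    then have "ae_eq (\<lambda>x. V (- s) (U s \<psi>) x - \<psi> x) (\<lambda>_. 0)" using l2norm_eq_0_iff[OF d] by blast
    then show ?thesis unfolding ae_eq_def by (auto elim!: AE_mp)
  qed
  have "ae_eq (\<lambda>x. V s f x - U s f x) (\<lambda>_. 0)"
  \<comment> \<open>Moved to the other side of the inner product, the two operators become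
    \<open>V (- s)\<close> and \<open>U (- s)\<close> on the core, where they already agree; the
    core is total.\<close>
  proof (rule smooth_core_total)
    show "(\<lambda>x. V s f x - U s f x) \<in> L2" by (intro L2_diff VL UL f)
    fix \<psi> \<psi>' assume core: "smooth_core \<psi> \<psi>'"
    then have \<psi>: "\<psi> \<in> L2" by (rule smooth_core_L2)
    obtain \<xi>' where core': "smooth_core (U (- s) \<psi>) \<xi>'"
      unfolding U_def using smooth_core_weyl[OF core] by blast
    have "U s (U (- s) \<psi>) = \<psi>" using U_add[of s "- s" \<psi>] by (simp add: U_def weyl_0)
    then have "ae_eq (V (- s) \<psi>) (U (- s) \<psi>)" using core_eq[OF core', of s] by simp
    then have "ip (V (- s) \<psi>) f = ip (U (- s) \<psi>) f"
      by (intro ip_cong ae_eq_refl VL UL \<psi> f)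
    then show "ip \<psi> (\<lambda>x. V s f x - U s f x) = 0"
      by (simp add: ip_diff_right \<psi> VL UL f unitary_group_adjoint[OF V \<psi> f] unitary_group_adjoint[OF Ug \<psi> f])
  qed
  then show ?thesis unfolding ae_eq_def U_def by (auto elim!: AE_mp)
qed

text \<open>The Weyl operator is a witness for the choice operator in \<open>exp_minus_i\<close>, so
  the chosen operator satisfies the specification, and uniqueness pins it down up to null
  sets.\<close>

lemma exp_minus_i_eq_weyl:
  fixes u v :: real
  defines "E \<equiv> exp_minus_i (lin_comb_op u position_op v momentum_op)"
  assumes f: "f \<in> L2"
  shows "ae_eq (E f) (weyl u v f)" "E f \<in> L2"
proof -
  let ?A = "lin_comb_op u position_op v momentum_op"
  have "is_exp_minus_i ?A (weyl u v)"
    unfolding is_exp_minus_i_def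
    by (rule exI[of _ "\<lambda>s. weyl (s * u) (s * v)"]) (simp add: weyl_unitary_group weyl_generator)
  then have "is_exp_minus_i ?A E" unfolding E_def exp_minus_i_def by (rule someI[of "is_exp_minus_i ?A"])
  then obtain V where V: "unitary_group V" "E = V 1" and
    gen: "\<And>\<psi> \<eta>. ?A \<psi> \<eta> \<Longrightarrow> ((\<lambda>s. l2norm (\<lambda>x. (V s \<psi> x - \<psi> x) / of_real s + \<i> * \<eta> x)) \<longlongrightarrow> 0) (at 0)"
    unfolding is_exp_minus_i_def by blast
  show "ae_eq (E f) (weyl u v f)"
    using unitary_group_eq_weyl[where u = u and v = v and s = 1, OF V(1) gen f] by (simp add: V(2))
  show "E f \<in> L2" using unitary_group_L2[OF V(1) f] by (simp add: V(2))
qed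

section \<open>The trace against Weyl operators\<close>

lemma has_trace_unique: "orthonormal_basis e \<Longrightarrow> has_trace T a \<Longrightarrow> has_trace T b \<Longrightarrow> a = b"
  unfolding has_trace_def using sums_unique2 by blast

lemma op_trace_eq: "orthonormal_basis e \<Longrightarrow> has_trace T a \<Longrightarrow> op_trace T = a"
  unfolding op_trace_def using has_trace_unique by blast

lemma weyl_orthonormal_basis:
  assumes e: "orthonormal_basis e" shows "orthonormal_basis (\<lambda>k. weyl u v (e k))"
  unfolding orthonormal_basis_def
proof (intro conjI allI ballI impI)
  show "weyl u v (e k) \<in> L2" for k by (intro weyl_L2 onb_L2[OF e])
  show "ip (weyl u v (e j)) (weyl u v (e k)) = (if j = k then 1 else 0)" for j k
    by (simp add: weyl_isometry onb_ip[OF e])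
  fix f assume f: "f \<in> L2" and "\<forall>k. ip (weyl u v (e k)) f = 0"
  then have "ae_eq (weyl (- u) (- v) f) (\<lambda>_. 0)"
    by (intro onb_total[OF e] weyl_L2) (simp_all add: weyl_adjoint)
  from weyl_cong[OF this, of u v] show "ae_eq f (\<lambda>_. 0)"
    by (simp add: weyl_inverse) (simp add: weyl_def)
qed

text \<open>Interchange of two limits with an error uniform in \<open>K\<close>. The bound is kept
  in the conclusion because the same approximants later identify the limits obtained from different
  bases.\<close>

lemma convergent_by_approximation:
  fixes S :: "nat \<Rightarrow> complex"
  assumes A: "\<And>N. A N \<longlonglongrightarrow> a N" and bound: "\<And>N K. cmod (S K - A N K) \<le> \<delta> N" and \<delta>: "\<delta> \<longlonglongrightarrow> 0"
  obtains L where "S \<longlonglongrightarrow> L" "\<And>N. cmod (L - a N) \<le> \<delta> N"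
proof -
  have "Cauchy S"
  proof (rule metric_CauchyI)
    fix \<epsilon> :: real assume "\<epsilon> > 0"
    then obtain N where N: "\<delta> N < \<epsilon> / 3"
      using order_tendstoD(2)[OF \<delta>, of "\<epsilon> / 3"] by (auto simp: eventually_sequentially)
    have "Cauchy (A N)" using A by (rule LIMSEQ_imp_Cauchy)
    then obtain M where M: "\<And>m n. m \<ge> M \<Longrightarrow> n \<ge> M \<Longrightarrow> dist (A N m) (A N n) < \<epsilon> / 3"
      using metric_CauchyD[of "A N" "\<epsilon> / 3"] \<open>\<epsilon> > 0\<close> by auto
    show "\<exists>M. \<forall>m\<ge>M. \<forall>n\<ge>M. dist (S m) (S n) < \<epsilon>"
    proof (intro exI[of _ M] allI impI)
      fix m n assume "M \<le> m" "M \<le> n"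
      have "dist (S m) (S n) \<le> dist (S m) (A N m) + (dist (A N m) (A N n) + dist (A N n) (S n))"
        by (intro order_trans[OF dist_triangle add_left_mono[OF dist_triangle]])
      also have "\<dots> < \<epsilon>"
        using bound[of m N] bound[of n N] N M[OF \<open>M \<le> m\<close> \<open>M \<le> n\<close>]
        by (simp add: dist_norm norm_minus_commute)
      finally show "dist (S m) (S n) < \<epsilon>" .
    qed
  qed
  then obtain L where L: "S \<longlonglongrightarrow> L" using Cauchy_convergent_iff convergent_def by blast
  have "cmod (L - a N) \<le> \<delta> N" for N
    by (rule tendsto_upperbound[OF tendsto_norm[OF tendsto_diff[OF L A]]]) (auto simp: bound)
  with L show thesis by (rule that)
qed

context
  fixes \<rho> :: "wave \<Rightarrow> wave"
  assumes dm: "density_matrix \<rho>"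
begin

lemma density_bounded: "bounded_operator \<rho>"
  using dm by (simp add: density_matrix_def selfadjoint_operator_def)

lemma density_L2: "f \<in> L2 \<Longrightarrow> \<rho> f \<in> L2"
  using density_bounded bounded_operator_L2 by blast

lemma density_selfadjoint: "f \<in> L2 \<Longrightarrow> g \<in> L2 \<Longrightarrow> ip (\<rho> f) g = ip f (\<rho> g)"
  using dm by (simp add: density_matrix_def selfadjoint_operator_def)

lemma density_nonneg: "f \<in> L2 \<Longrightarrow> 0 \<le> Re (ip f (\<rho> f))"
  using dm by (simp add: density_matrix_def positive_operator_def)

lemma density_trace: "orthonormal_basis e \<Longrightarrow> (\<lambda>k. ip (e k) (\<rho> (e k))) sums 1"
  using dm by (simp add: density_matrix_def has_trace_def)

lemma density_lincomb:
  assumes "h \<in> L2" "f \<in> L2" "g \<in> L2"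
  shows "ip h (\<rho> (\<lambda>x. a * f x + b * g x)) = a * ip h (\<rho> f) + b * ip h (\<rho> g)"
proof -
  have "ip h (\<rho> (\<lambda>x. a * f x + b * g x)) = ip h (\<lambda>x. a * \<rho> f x + b * \<rho> g x)"
    using assms
    by (intro ip_cong ae_eq_refl bounded_operator_lincomb density_bounded density_L2 L2_add L2_scale)
  also have "\<dots> = a * ip h (\<rho> f) + b * ip h (\<rho> g)"
    using assms by (simp add: ip_add_right ip_scale_right L2_scale density_L2)
  finally show ?thesis .
qed

lemma density_cnj: "f \<in> L2 \<Longrightarrow> g \<in> L2 \<Longrightarrow> cnj (ip f (\<rho> g)) = ip g (\<rho> f)"
  by (simp add: ip_cnj density_selfadjoint)

lemma density_real: "f \<in> L2 \<Longrightarrow> ip f (\<rho> f) = of_real (Re (ip f (\<rho> f)))"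
  using density_cnj[of f f] by (simp add: complex_eq_iff)

lemma density_sum:
  assumes "h \<in> L2" "\<And>j. j \<in> A \<Longrightarrow> f j \<in> L2" "finite A"
  shows "ip h (\<rho> (\<lambda>x. \<Sum>j\<in>A. c j * f j x)) = (\<Sum>j\<in>A. c j * ip h (\<rho> (f j)))"
  using assms(3,2)
proof (induction A rule: finite_induct)
  case empty
  show ?case using density_lincomb[OF assms(1) L2_zero L2_zero, of 0 0] by simp
next
  case (insert i A)
  then show ?case
    using density_lincomb[OF assms(1), of "f i" "\<lambda>x. \<Sum>j\<in>A. c j * f j x" "c i" 1]
    by (simp add: L2_intros)
qed

lemma density_diff:
  assumes "h \<in> L2" "f \<in> L2" "g \<in> L2"
  shows "ip h (\<rho> (\<lambda>x. f x - g x)) = ip h (\<rho> f) - ip h (\<rho> g)"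
  using density_lincomb[OF assms, of 1 "-1"] by simp

text \<open>Positivity makes \<open>ip f (\<rho> g)\<close> a semi-inner product. This inequality
  plays the role of factoring \<open>\<rho>\<close> through its square root.\<close>

lemma density_Cauchy_Schwarz:
  assumes "f \<in> L2" "g \<in> L2"
  shows "(cmod (ip f (\<rho> g)))\<^sup>2 \<le> Re (ip f (\<rho> f)) * Re (ip g (\<rho> g))"
proof (rule nonneg_quadratic_imp_le)
  fix t :: complex
  let ?h = "\<lambda>x. 1 * f x + t * g x"
  have L: "?h \<in> L2" "(\<lambda>x. t * g x) \<in> L2" using assms by (auto intro!: L2_intros)
  have "ip ?h (\<rho> ?h) = ip ?h (\<rho> f) + t * ip ?h (\<rho> g)"
    using density_lincomb[OF L(1) assms, of 1 t] by simp
  also have "\<dots> = ip f (\<rho> f) + cnj (t * ip f (\<rho> g)) + (t * ip f (\<rho> g) + (t * cnj t) * ip g (\<rho> g))"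
    using assms L by (simp add: ip_add_left ip_scale_left density_L2 density_cnj distrib_left mult.assoc)
  finally have "Re (ip ?h (\<rho> ?h)) = Re (ip f (\<rho> f)) + 2 * Re (t * ip f (\<rho> g)) + Re ((t * cnj t) * ip g (\<rho> g))"
    by simp
  also have "Re ((t * cnj t) * ip g (\<rho> g)) = (cmod t)\<^sup>2 * Re (ip g (\<rho> g))"
    by (subst complex_norm_square[symmetric]) simp
  finally show "0 \<le> Re (ip f (\<rho> f)) + 2 * Re (t * ip f (\<rho> g)) + (cmod t)\<^sup>2 * Re (ip g (\<rho> g))"
    using density_nonneg[OF L(1)] by simp
qed

section \<open>The transform as a uniform limit of finite traces\<close>

context
  fixes f :: "nat \<Rightarrow> wave"
  assumes f: "orthonormal_basis f"
begin

text \<open>With \<open>P\<close> the projection onto the span of \<open>f 0\<close>, ...,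
  \<open>f (N - 1)\<close>, this is the trace of \<open>(1 - P) \<rho> (1 - P)\<close>.\<close>

definition trace_tail :: "nat \<Rightarrow> real" where
  "trace_tail N = 1 - (\<Sum>j<N. Re (ip (f j) (\<rho> (f j))))"

lemma density_trace_Re: "orthonormal_basis e \<Longrightarrow> (\<lambda>k. Re (ip (e k) (\<rho> (e k)))) sums 1"
  using sums_Re[OF density_trace] by simp

lemma density_trace_partial:
  assumes "orthonormal_basis e" shows "(\<Sum>k<K. Re (ip (e k) (\<rho> (e k)))) \<le> 1"
proof -
  have "(\<Sum>k<K. Re (ip (e k) (\<rho> (e k)))) \<le> (\<Sum>k. Re (ip (e k) (\<rho> (e k))))"
    using density_trace_Re[OF assms] density_nonneg onb_L2[OF assms]
    by (intro sum_le_suminf) (auto simp: sums_iff)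
  then show ?thesis using density_trace_Re[OF assms] by (simp add: sums_iff)
qed

lemma trace_tail_tendsto: "trace_tail \<longlonglongrightarrow> 0"
  using tendsto_diff[OF tendsto_const, of _ 1 sequentially 1] density_trace_Re[OF f]
  by (auto simp: trace_tail_def[abs_def] sums_def)

text \<open>Expanding both projections gives four sums. The first is the trace of
  \<open>\<rho>\<close> in the basis \<open>g\<close>, equal to 1 in every basis by definition; the
  others involve finitely many \<open>f j\<close> and are summed by Parseval in \<open>g\<close>.
  The signs leave 1 minus the partial trace.\<close>

lemma trace_remainder_sums:
  assumes g: "orthonormal_basis g"
  shows "(\<lambda>k. Re (ip (\<lambda>x. g k x - (\<Sum>j<N. ip (f j) (g k) * f j x)) (\<rho> (\<lambda>x. g k x - (\<Sum>j<N. ip (f j) (g k) * f j x))))) sums trace_tail N"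
proof -
  define P where "P k = (\<lambda>x. \<Sum>j<N. ip (f j) (g k) * f j x)" for k
  note fL = onb_L2[OF f] and gL = onb_L2[OF g]
  have PL: "P k \<in> L2" for k unfolding P_def by (intro L2_intros fL)
  have hL: "(\<lambda>x. g k x - P k x) \<in> L2" for k by (intro L2_diff gL PL)
  have expand: "ip (\<lambda>x. g k x - P k x) (\<rho> (\<lambda>x. g k x - P k x))
      = ip (g k) (\<rho> (g k)) - (\<Sum>j<N. ip (f j) (g k) * ip (g k) (\<rho> (f j)))
        - (\<Sum>j<N. ip (g k) (f j) * ip (\<rho> (f j)) (g k))
        + (\<Sum>j<N. \<Sum>i<N. (ip (f i) (g k) * ip (g k) (f j)) * ip (f j) (\<rho> (f i)))" for k
  proof -
    have "ip (\<lambda>x. g k x - P k x) (\<rho> (\<lambda>x. g k x - P k x))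
      = ip (g k) (\<rho> (g k)) - ip (P k) (\<rho> (g k)) - (ip (g k) (\<rho> (P k)) - ip (P k) (\<rho> (P k)))"
      by (subst density_diff[OF hL gL PL]) (simp add: ip_diff_left density_L2 gL PL)
    moreover have "ip (g k) (\<rho> (P k)) = (\<Sum>j<N. ip (f j) (g k) * ip (g k) (\<rho> (f j)))"
      unfolding P_def by (rule density_sum) (auto intro: gL fL)
    moreover have Pl: "ip (P k) h = (\<Sum>j<N. ip (g k) (f j) * ip (f j) h)" if "h \<in> L2" for h
      unfolding P_def using that by (simp add: ip_sum_left L2_intros fL ip_scale_left ip_cnj)
    moreover have "ip (P k) (\<rho> (g k)) = (\<Sum>j<N. ip (g k) (f j) * ip (\<rho> (f j)) (g k))"
      by (simp add: Pl density_L2 gL fL density_selfadjoint)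
    moreover have "ip (P k) (\<rho> (P k)) = (\<Sum>j<N. ip (g k) (f j) * (\<Sum>i<N. ip (f i) (g k) * ip (f j) (\<rho> (f i))))"
      unfolding Pl[OF density_L2[OF PL]] unfolding P_def
      by (intro sum.cong refl arg_cong2[where f = "(*)"] density_sum) (auto intro: fL)
    ultimately show ?thesis
      by (simp add: sum_distrib_left mult_ac)
  qed
  have s1: "(\<lambda>k. ip (f i) (g k) * ip (g k) (f j)) sums (if i = j then 1 else 0)" for i j
    using Parseval[OF g fL fL, of i j] by (simp add: onb_ip[OF f])
  have s2: "(\<lambda>k. ip (f j) (g k) * ip (g k) (\<rho> (f j))) sums ip (f j) (\<rho> (f j))" for j
    by (rule Parseval[OF g fL density_L2[OF fL]])
  have s3: "(\<lambda>k. ip (g k) (f j) * ip (\<rho> (f j)) (g k)) sums ip (f j) (\<rho> (f j))" for j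
    using Parseval[OF g density_L2[OF fL] fL, of j j] by (simp add: mult.commute density_selfadjoint fL)
  have "(\<lambda>k. ip (\<lambda>x. g k x - P k x) (\<rho> (\<lambda>x. g k x - P k x)))
     sums (1 - (\<Sum>j<N. ip (f j) (\<rho> (f j))) - (\<Sum>j<N. ip (f j) (\<rho> (f j)))
      + (\<Sum>j<N. \<Sum>i<N. (if i = j then 1 else 0) * ip (f j) (\<rho> (f i))))"
    unfolding expand
    by (intro sums_add sums_diff sums_sum sums_mult2 density_trace[OF g] s1 s2 s3)
  also have "(\<Sum>j<N. \<Sum>i<N. (if i = j then 1 else 0) * ip (f j) (\<rho> (f i))) = (\<Sum>j<N. ip (f j) (\<rho> (f j)))"
    by (intro sum.cong refl) (simp add: if_distrib[of "\<lambda>x. x * _"] cong: if_cong)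
  finally have "(\<lambda>k. ip (\<lambda>x. g k x - P k x) (\<rho> (\<lambda>x. g k x - P k x))) sums (1 - (\<Sum>j<N. ip (f j) (\<rho> (f j))))"
    by simp
  from sums_Re[OF this] show ?thesis
    by (simp add: trace_tail_def P_def)
qed

text \<open>A truncation of the inner operator by the projection onto \<open>f 0, \<dots>, f (N - 1)\<close> has
  basis-independent diagonal sums, and by the Cauchy-Schwarz inequality for the form
  \<open>ip g (\<rho> h)\<close> the error is bounded uniformly in the other basis and in the Weyl operator.\<close>

lemma trace_weyl_approx:
  assumes e: "orthonormal_basis e"
  obtains A where "(\<lambda>k. ip (e k) (\<rho> (weyl u v (e k)))) sums A"
    "\<And>N. cmod (A - (\<Sum>j<N. ip (weyl (- u) (- v) (f j)) (\<rho> (f j)))) \<le> sqrt (trace_tail N)"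
proof -
  define g where "g k = weyl u v (e k)" for k
  have g: "orthonormal_basis g" unfolding g_def by (rule weyl_orthonormal_basis[OF e])
  note fL = onb_L2[OF f] and gL = onb_L2[OF g] and eL = onb_L2[OF e]
  define P where "P N k = (\<lambda>x. \<Sum>j<N. ip (f j) (g k) * f j x)" for N k
  have PL: "P N k \<in> L2" for N k unfolding P_def by (intro L2_intros fL)
  have hL: "(\<lambda>x. g k x - P N k x) \<in> L2" for N k by (intro L2_diff gL PL)
  have 1: "(\<lambda>K. \<Sum>k<K. \<Sum>j<N. ip (f j) (g k) * ip (e k) (\<rho> (f j)))
      \<longlonglongrightarrow> (\<Sum>j<N. ip (weyl (- u) (- v) (f j)) (\<rho> (f j)))" for N
    unfolding sums_def[symmetric]
  proof (rule sums_sum)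
    fix j
    have "ip (f j) (g k) = ip (weyl (- u) (- v) (f j)) (e k)" for k
      unfolding g_def using weyl_adjoint[of "- u" "- v" "f j" "e k"] by simp
    then show "(\<lambda>k. ip (f j) (g k) * ip (e k) (\<rho> (f j))) sums ip (weyl (- u) (- v) (f j)) (\<rho> (f j))"
      using Parseval[OF e weyl_L2[OF fL] density_L2[OF fL], of "- u" "- v" j j] by simp
  qed
  have 2: "cmod ((\<Sum>k<K. ip (e k) (\<rho> (g k))) - (\<Sum>k<K. \<Sum>j<N. ip (f j) (g k) * ip (e k) (\<rho> (f j)))) \<le> sqrt (trace_tail N)" for K N
  proof -
    define p where "p k = Re (ip (e k) (\<rho> (e k)))" for k
    define q where "q k = Re (ip (\<lambda>x. g k x - P N k x) (\<rho> (\<lambda>x. g k x - P N k x)))" for k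
    have pq: "p k \<ge> 0" "q k \<ge> 0" for k unfolding p_def q_def by (intro density_nonneg eL hL)+
    have "ip (e k) (\<rho> (g k)) - (\<Sum>j<N. ip (f j) (g k) * ip (e k) (\<rho> (f j))) = ip (e k) (\<rho> (\<lambda>x. g k x - P N k x))" for k
    proof -
      have "ip (e k) (\<rho> (P N k)) = (\<Sum>j<N. ip (f j) (g k) * ip (e k) (\<rho> (f j)))"
        unfolding P_def by (rule density_sum) (auto intro: eL fL)
      then show ?thesis by (simp add: density_diff eL gL PL)
    qed
    then have "cmod ((\<Sum>k<K. ip (e k) (\<rho> (g k))) - (\<Sum>k<K. \<Sum>j<N. ip (f j) (g k) * ip (e k) (\<rho> (f j))))
        = cmod (\<Sum>k<K. ip (e k) (\<rho> (\<lambda>x. g k x - P N k x)))"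
      by (simp add: sum_subtractf[symmetric])
    also have "\<dots> \<le> (\<Sum>k<K. cmod (ip (e k) (\<rho> (\<lambda>x. g k x - P N k x))))"
      by (rule norm_sum)
    also have "\<dots> \<le> (\<Sum>k<K. \<bar>sqrt (p k)\<bar> * \<bar>sqrt (q k)\<bar>)"
    proof (rule sum_mono)
      fix k
      have "(cmod (ip (e k) (\<rho> (\<lambda>x. g k x - P N k x))))\<^sup>2 \<le> p k * q k"
        unfolding p_def q_def by (rule density_Cauchy_Schwarz[OF eL hL])
      from real_sqrt_le_mono[OF this]
      show "cmod (ip (e k) (\<rho> (\<lambda>x. g k x - P N k x))) \<le> \<bar>sqrt (p k)\<bar> * \<bar>sqrt (q k)\<bar>"
        using pq by (simp add: real_sqrt_mult)
    qed
    also have "\<dots> \<le> L2_set (\<lambda>k. sqrt (p k)) {..<K} * L2_set (\<lambda>k. sqrt (q k)) {..<K}"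
      by (rule L2_set_mult_ineq)
    also have "\<dots> = sqrt (\<Sum>k<K. p k) * sqrt (\<Sum>k<K. q k)"
      using pq by (simp add: L2_set_def)
    also have "\<dots> \<le> 1 * sqrt (trace_tail N)"
    proof (rule mult_mono)
      show "sqrt (\<Sum>k<K. p k) \<le> 1" using density_trace_partial[OF e, of K] by (simp add: p_def)
      \<comment> \<open>The image \<open>g\<close> of the basis \<open>e\<close> under the Weyl
        operator is itself a basis, which makes the remainder independent of \<open>u\<close> and
        \<open>v\<close>.\<close>
      have "q sums trace_tail N" unfolding q_def P_def by (rule trace_remainder_sums[OF g])
      then have "(\<Sum>k<K. q k) \<le> trace_tail N"
        using sum_le_suminf[of q "{..<K}"] pq by (auto simp: sums_iff)
      then show "sqrt (\<Sum>k<K. q k) \<le> sqrt (trace_tail N)" by simp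
    qed (auto simp: pq sum_nonneg)
    finally show ?thesis by simp
  qed
  have 3: "(\<lambda>N. sqrt (trace_tail N)) \<longlonglongrightarrow> 0"
    using tendsto_real_sqrt[OF trace_tail_tendsto] by simp
  obtain L where "(\<lambda>K. \<Sum>k<K. ip (e k) (\<rho> (g k))) \<longlonglongrightarrow> L"
     "\<And>N. cmod (L - (\<Sum>j<N. ip (weyl (- u) (- v) (f j)) (\<rho> (f j)))) \<le> sqrt (trace_tail N)"
    using convergent_by_approximation[OF 1 2 3] by metis
  then show thesis by (intro that) (auto simp: sums_def g_def)
qed

text \<open>The approximating sums do not mention \<open>e\<close>, so the diagonal sums in all
  bases have the same value and \<open>has_trace\<close> holds. The exponential in the definition
  differs from \<open>weyl\<close> only on null sets, which \<open>\<rho>\<close> respects by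
  boundedness.\<close>

lemma W_tilde_approx:
  "cmod (W_tilde \<rho> (u, v) - (\<Sum>j<N. ip (weyl (- u) (- v) (f j)) (\<rho> (f j)))) \<le> sqrt (trace_tail N)"
proof -
  define E where "E = exp_minus_i (lin_comb_op u position_op v momentum_op)"
  obtain A where A: "\<And>N. cmod (A - (\<Sum>j<N. ip (weyl (- u) (- v) (f j)) (\<rho> (f j)))) \<le> sqrt (trace_tail N)"
    using trace_weyl_approx[OF f] by metis
  have "has_trace (\<lambda>\<psi>. \<rho> (E \<psi>)) A"
    unfolding has_trace_def
  proof (intro allI impI)
    fix e assume e: "orthonormal_basis e"
    obtain A' where A': "(\<lambda>k. ip (e k) (\<rho> (weyl u v (e k)))) sums A'"
      "\<And>N. cmod (A' - (\<Sum>j<N. ip (weyl (- u) (- v) (f j)) (\<rho> (f j)))) \<le> sqrt (trace_tail N)"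
      using trace_weyl_approx[OF e] by metis
    have "cmod (A' - A) \<le> sqrt (trace_tail N) + sqrt (trace_tail N)" for N
      using norm_triangle_ineq4[of "A' - (\<Sum>j<N. ip (weyl (- u) (- v) (f j)) (\<rho> (f j)))" "A - (\<Sum>j<N. ip (weyl (- u) (- v) (f j)) (\<rho> (f j)))"]
        A[of N] A'(2)[of N] by simp
    moreover have "(\<lambda>N. sqrt (trace_tail N) + sqrt (trace_tail N)) \<longlonglongrightarrow> 0"
      using tendsto_add[OF tendsto_real_sqrt[OF trace_tail_tendsto] tendsto_real_sqrt[OF trace_tail_tendsto]] by simp
    ultimately have "cmod (A' - A) \<le> 0"
      using LIMSEQ_le_const by blast
    moreover have "ip (e k) (\<rho> (E (e k))) = ip (e k) (\<rho> (weyl u v (e k)))" for k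
    proof (rule ip_cong[OF ae_eq_refl bounded_operator_cong[OF density_bounded]])
      show *: "E (e k) \<in> L2" "weyl u v (e k) \<in> L2" "ae_eq (E (e k)) (weyl u v (e k))"
        unfolding E_def by (rule exp_minus_i_eq_weyl weyl_L2 onb_L2[OF e])+
      show "\<rho> (E (e k)) \<in> L2" "\<rho> (weyl u v (e k)) \<in> L2"
        by (rule density_L2 *)+
    qed (rule onb_L2[OF e])+
    ultimately show "(\<lambda>k. ip (e k) (\<rho> (E (e k)))) sums A"
      using A'(1) by simp
  qed
  then have "W_tilde \<rho> (u, v) = A"
    unfolding W_tilde_def E_def by (simp add: op_trace_eq[OF f])
  with A show ?thesis by simp
qed

text \<open>The case \<open>N = 0\<close>: the sum is empty and the tail is the full trace
  1.\<close>

lemma W_tilde_bound: "cmod (W_tilde \<rho> w) \<le> 1"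
  using W_tilde_approx[of "fst w" "snd w" 0] by (simp add: trace_tail_def)

lemma W_tilde_0: "W_tilde \<rho> 0 = 1"
proof -
  have s: "(\<lambda>N. \<Sum>j<N. ip (f j) (\<rho> (f j))) \<longlonglongrightarrow> 1"
    using density_trace[OF f] by (simp add: sums_def)
  have "cmod (W_tilde \<rho> (0, 0) - 1) \<le> 0"
  proof (rule LIMSEQ_le)
    show "(\<lambda>N. cmod (W_tilde \<rho> (0, 0) - (\<Sum>j<N. ip (f j) (\<rho> (f j))))) \<longlonglongrightarrow> cmod (W_tilde \<rho> (0, 0) - 1)"
      by (intro tendsto_intros s)
    show "(\<lambda>N. sqrt (trace_tail N)) \<longlonglongrightarrow> 0"
      using tendsto_real_sqrt[OF trace_tail_tendsto] by simp
    show "\<exists>N. \<forall>n\<ge>N. cmod (W_tilde \<rho> (0, 0) - (\<Sum>j<n. ip (f j) (\<rho> (f j)))) \<le> sqrt (trace_tail n)"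
      using W_tilde_approx[of 0 0] by (simp add: weyl_0)
  qed
  then show ?thesis by (simp add: zero_prod_def)
qed

lemma continuous_on_ip_weyl:
  assumes "h \<in> L2" "g \<in> L2"
  shows "continuous_on UNIV (\<lambda>w. ip (weyl (- fst w) (- snd w) h) g)"
  unfolding continuous_on_sequentially comp_def
proof (intro ballI allI impI)
  fix w :: "real \<times> real" and X assume "(\<forall>n. X n \<in> UNIV) \<and> X \<longlonglongrightarrow> w"
  then have X: "(\<lambda>n. - fst (X n)) \<longlonglongrightarrow> - fst w" "(\<lambda>n. - snd (X n)) \<longlonglongrightarrow> - snd w"
    by (auto intro!: tendsto_intros)
  have "(\<lambda>n. ip g (weyl (- fst (X n)) (- snd (X n)) h)) \<longlonglongrightarrow> ip g (weyl (- fst w) (- snd w) h)"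
    by (intro ip_tendsto_right weyl_continuous X assms weyl_L2)
  from tendsto_cnj[OF this]
  show "(\<lambda>n. ip (weyl (- fst (X n)) (- snd (X n)) h) g) \<longlonglongrightarrow> ip (weyl (- fst w) (- snd w) h) g"
    by (simp add: ip_cnj)
qed

lemma W_tilde_continuous: "continuous_on UNIV (W_tilde \<rho>)"
proof (rule uniform_limit_theorem)
  show "\<forall>\<^sub>F N in sequentially. continuous_on UNIV (\<lambda>w. \<Sum>j<N. ip (weyl (- fst w) (- snd w) (f j)) (\<rho> (f j)))"
    by (intro always_eventually allI continuous_on_sum continuous_on_ip_weyl density_L2 onb_L2[OF f])
  show "uniform_limit UNIV (\<lambda>N w. \<Sum>j<N. ip (weyl (- fst w) (- snd w) (f j)) (\<rho> (f j))) (W_tilde \<rho>) sequentially"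
  proof (rule uniform_limitI)
    fix \<epsilon> :: real assume "\<epsilon> > 0"
    then have "\<forall>\<^sub>F N in sequentially. sqrt (trace_tail N) < \<epsilon>"
      using order_tendstoD(2)[OF tendsto_real_sqrt[OF trace_tail_tendsto], of \<epsilon>] by simp
    then show "\<forall>\<^sub>F N in sequentially. \<forall>w\<in>UNIV. dist (\<Sum>j<N. ip (weyl (- fst w) (- snd w) (f j)) (\<rho> (f j))) (W_tilde \<rho> w) < \<epsilon>"
    proof eventually_elim
      case (elim N)
      show ?case
      proof
        fix w
        show "dist (\<Sum>j<N. ip (weyl (- fst w) (- snd w) (f j)) (\<rho> (f j))) (W_tilde \<rho> w) < \<epsilon>"
          using W_tilde_approx[of "fst w" "snd w" N] elim by (simp add: dist_norm norm_minus_commute)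
      qed
    qed
  qed
qed simp

end

end

section \<open>Gaussian integrals\<close>

lemma borel_measurable_fst [measurable]:
  "fst \<in> borel_measurable (borel :: ('a::second_countable_topology \<times> 'b::second_countable_topology) measure)"
  by (simp add: borel_prod[symmetric])

lemma borel_measurable_snd [measurable]:
  "snd \<in> borel_measurable (borel :: ('a::second_countable_topology \<times> 'b::second_countable_topology) measure)"
  by (simp add: borel_prod[symmetric])

lemma gaussian_affine:
  assumes "s > 0"
  shows "std_normal_density (0 + sqrt (2 * s) * x) = exp (- s * x\<^sup>2) / sqrt (2 * pi)"
  using assms by (simp add: std_normal_density_def power_mult_distrib)

lemma integrable_gaussian:
  fixes s :: real
  assumes "s > 0" shows "integrable lborel (\<lambda>x. exp (- s * x\<^sup>2))"
proof -
  have "integrable lborel (\<lambda>x. std_normal_density (0 + sqrt (2 * s) * x))"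
    using assms by (intro lborel_integrable_real_affine) auto
  then have "integrable lborel (\<lambda>x. exp (- s * x\<^sup>2) / sqrt (2 * pi))"
    unfolding gaussian_affine[OF assms] .
  from integrable_mult_right[OF this, of "sqrt (2 * pi)"] show ?thesis by simp
qed

text \<open>The characteristic function of the standard normal distribution, rescaled by
  \<open>sqrt (2 * s)\<close>.\<close>

lemma integral_gaussian_cis:
  fixes s k :: real
  assumes "s > 0"
  shows "(LINT x|lborel. of_real (exp (- s * x\<^sup>2)) * cis (k * x)) = of_real (sqrt (pi / s) * exp (- k\<^sup>2 / (4 * s)))"
proof -
  define c where "c = sqrt (2 * s)"
  have c: "c > 0" "c\<^sup>2 = 2 * s" using assms by (auto simp: c_def)
  define t where "t = k / c"
  have "of_real (exp (- (t\<^sup>2) / 2)) = char std_normal_distribution t"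
    by (simp add: char_std_normal_distribution)
  also have "\<dots> = (LINT x|lborel. std_normal_density x *\<^sub>R cis (t * x))"
    unfolding char_def by (subst integral_density) (auto simp: cis_conv_exp normal_density_nonneg)
  also have "\<dots> = c *\<^sub>R (LINT x|lborel. std_normal_density (0 + c * x) *\<^sub>R cis (t * (0 + c * x)))"
    using lborel_integral_real_affine[of c "\<lambda>x. std_normal_density x *\<^sub>R cis (t * x)" 0] c by simp
  also have "(\<lambda>x. std_normal_density (0 + c * x) *\<^sub>R cis (t * (0 + c * x)))
      = (\<lambda>x. (1 / sqrt (2 * pi)) *\<^sub>R (of_real (exp (- s * x\<^sup>2)) * cis (k * x)))"
    unfolding c_def gaussian_affine[OF assms] using c unfolding t_def c_def
    by (simp add: fun_eq_iff scaleR_conv_of_real)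
  also have "c *\<^sub>R (LINT x|lborel. (1 / sqrt (2 * pi)) *\<^sub>R (of_real (exp (- s * x\<^sup>2)) * cis (k * x)))
      = (c / sqrt (2 * pi)) *\<^sub>R (LINT x|lborel. of_real (exp (- s * x\<^sup>2)) * cis (k * x))"
    by simp
  finally have "(LINT x|lborel. of_real (exp (- s * x\<^sup>2)) * cis (k * x))
      = (sqrt (2 * pi) / c) *\<^sub>R of_real (exp (- (t\<^sup>2) / 2))"
    using c by (simp add: field_simps)
  also have "sqrt (2 * pi) / c = sqrt (pi / s)"
    unfolding c_def using assms by (simp add: real_sqrt_divide[symmetric])
  also have "- (t\<^sup>2) / 2 = - k\<^sup>2 / (4 * s)"
    unfolding t_def power_divide c(2) by simp
  finally show ?thesis by (simp add: scaleR_conv_of_real)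
qed

lemma integral_gaussian:
  fixes s :: real
  assumes "s > 0"
  shows "(LINT x|lborel. exp (- s * x\<^sup>2)) = sqrt (pi / s)"
proof -
  have "complex_of_real (LINT x|lborel. exp (- s * x\<^sup>2)) = of_real (sqrt (pi / s))"
    using integral_gaussian_cis[OF assms, of 0] by (simp del: of_real_mult)
  then show ?thesis by (simp only: of_real_eq_iff)
qed

section \<open>Products and Gaussians on the plane\<close>

lemma lborel_prod_integrable:
  fixes f :: "'a::euclidean_space \<Rightarrow> complex" and g :: "'b::euclidean_space \<Rightarrow> complex"
  assumes f: "integrable lborel f" and g: "integrable lborel g"
  shows "integrable lborel (\<lambda>w. f (fst w) * g (snd w))"
    and "(LINT w|lborel. f (fst w) * g (snd w)) = (LINT x|lborel. f x) * (LINT y|lborel. g y)"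
proof -
  have [measurable]: "f \<in> borel_measurable borel" "g \<in> borel_measurable borel"
    using f g by (auto dest: borel_measurable_integrable)
  have i: "integrable (lborel \<Otimes>\<^sub>M lborel) (\<lambda>w. f (fst w) * g (snd w))"
  proof (rule lborel_pair.Fubini_integrable)
    show "integrable lborel (\<lambda>x. LINT y|lborel. norm (f (fst (x, y)) * g (snd (x, y))))"
      using f g by (simp add: norm_mult)
  qed (use g in \<open>auto intro!: AE_I2\<close>)
  then show "integrable lborel (\<lambda>w. f (fst w) * g (snd w))" by (simp add: lborel_prod)
  show "(LINT w|lborel. f (fst w) * g (snd w)) = (LINT x|lborel. f x) * (LINT y|lborel. g y)"
    using lborel_pair.integral_fst'[OF i] by (simp add: lborel_prod)
qed

text \<open>For a non-integrable \<open>f\<close> the Bochner integral is 0 by convention.\<close>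

lemma ennreal_norm_integral_le:
  fixes f :: "'a \<Rightarrow> 'b::{banach, second_countable_topology}"
  shows "ennreal (norm (integral\<^sup>L M f)) \<le> (\<integral>\<^sup>+x. ennreal (norm (f x)) \<partial>M)"
  by (cases "integrable M f") (auto simp: integral_norm_bound_ennreal not_integrable_integral_eq)

lemma nn_integral_lborel_prod:
  fixes f :: "'a::euclidean_space \<times> 'b::euclidean_space \<Rightarrow> ennreal"
  assumes [measurable]: "f \<in> borel_measurable borel"
  shows "(\<integral>\<^sup>+p. f p \<partial>lborel) = (\<integral>\<^sup>+x. \<integral>\<^sup>+y. f (x, y) \<partial>lborel \<partial>lborel)"
    and "(\<integral>\<^sup>+p. f p \<partial>lborel) = (\<integral>\<^sup>+y. \<integral>\<^sup>+x. f (x, y) \<partial>lborel \<partial>lborel)"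
proof -
  have [measurable]: "f \<in> borel_measurable (lborel \<Otimes>\<^sub>M lborel)" by (simp add: lborel_prod)
  show "(\<integral>\<^sup>+p. f p \<partial>lborel) = (\<integral>\<^sup>+x. \<integral>\<^sup>+y. f (x, y) \<partial>lborel \<partial>lborel)"
    using lborel.nn_integral_fst[of f lborel] by (simp add: lborel_prod)
  show "(\<integral>\<^sup>+p. f p \<partial>lborel) = (\<integral>\<^sup>+y. \<integral>\<^sup>+x. f (x, y) \<partial>lborel \<partial>lborel)"
    using lborel_pair.nn_integral_snd[of f] by (simp add: lborel_prod)
qed

lemma norm_prod_square: "(norm (w :: real \<times> real))\<^sup>2 = (fst w)\<^sup>2 + (snd w)\<^sup>2"
  by (cases w) (simp add: norm_Pair)

lemma gaussian2_split:
  "complex_of_real (exp (- s * (norm (w :: real \<times> real))\<^sup>2)) * cis (w \<bullet> y)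
    = (of_real (exp (- s * (fst w)\<^sup>2)) * cis (fst y * fst w)) * (of_real (exp (- s * (snd w)\<^sup>2)) * cis (snd y * snd w))"
  by (cases w; cases y)
    (simp add: norm_prod_square distrib_left exp_diff exp_minus inverse_eq_divide exp_add cis_mult[symmetric] mult_ac)

lemma integrable_gaussian_cis:
  assumes "s > 0"
  shows "integrable lborel (\<lambda>x. of_real (exp (- s * x\<^sup>2)) * cis (k * x))"
  by (rule Bochner_Integration.integrable_bound[OF integrable_gaussian[OF assms]]) (auto simp: norm_mult)

lemma integrable_gaussian2_cis:
  fixes y :: "real \<times> real"
  assumes "s > 0"
  shows "integrable lborel (\<lambda>w. of_real (exp (- s * (norm w)\<^sup>2)) * cis (w \<bullet> y))"
  unfolding gaussian2_split by (intro lborel_prod_integrable integrable_gaussian_cis assms)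

lemma integral_gaussian2_cis:
  fixes y :: "real \<times> real"
  assumes "s > 0"
  shows "(LINT w|lborel. of_real (exp (- s * (norm w)\<^sup>2)) * cis (w \<bullet> y))
    = of_real (pi / s * exp (- (norm y)\<^sup>2 / (4 * s)))"
proof -
  have ee: "exp (- (norm y)\<^sup>2 / (4 * s)) = exp (- (fst y)\<^sup>2 / (4 * s)) * exp (- (snd y)\<^sup>2 / (4 * s))"
    by (simp add: norm_prod_square exp_add[symmetric] add_divide_distrib diff_divide_distrib)
  define r where "r = sqrt (pi / s)"
  have r: "pi / s = r * r" using assms by (simp add: r_def)
  have e: "pi / s * exp (- (norm y)\<^sup>2 / (4 * s))
      = (r * exp (- (fst y)\<^sup>2 / (4 * s))) * (r * exp (- (snd y)\<^sup>2 / (4 * s)))"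
    unfolding r ee by (simp only: mult_ac)
  show ?thesis
    unfolding gaussian2_split e of_real_mult[of "_ * _" "_ * _"] r_def
    by (simp only: lborel_prod_integrable(2)[OF integrable_gaussian_cis[OF assms] integrable_gaussian_cis[OF assms]]
        integral_gaussian_cis[OF assms])
qed

lemma integrable_gaussian2:
  assumes "s > 0"
  shows "integrable lborel (\<lambda>w::real \<times> real. exp (- s * (norm w)\<^sup>2))"
  using integrable_norm[OF integrable_gaussian2_cis[OF assms, of 0]] by (simp add: norm_mult)

lemma integral_gaussian2:
  assumes "s > 0"
  shows "(LINT w|lborel. exp (- s * (norm (w :: real \<times> real))\<^sup>2)) = pi / s"
proof -
  have "complex_of_real (LINT w|lborel. exp (- s * (norm (w :: real \<times> real))\<^sup>2)) = of_real (pi / s)"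
    using integral_gaussian2_cis[OF assms, of 0] by simp
  then show ?thesis by (simp only: of_real_eq_iff)
qed

lemma integrable_gaussian2_shift:
  fixes d :: "real \<times> real"
  assumes "s > 0"
  shows "integrable lborel (\<lambda>w. exp (- s * (norm (w - d))\<^sup>2))"
    "(LINT w|lborel. exp (- s * (norm (w - d))\<^sup>2)) = pi / s"
proof -
  have "(+) (- d) = (\<lambda>w. w - d)" by auto
  then have e: "distr lborel borel (\<lambda>w. w - d) = lborel"
    using lborel_distr_plus[of "- d"] by simp
  have "integrable (distr lborel borel (\<lambda>w. w - d)) (\<lambda>w::real \<times> real. exp (- s * (norm w)\<^sup>2))"
    using integrable_gaussian2[OF assms] unfolding e .
  then show "integrable lborel (\<lambda>w::real \<times> real. exp (- s * (norm (w - d))\<^sup>2))"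
    by (subst (asm) integrable_distr_eq) auto
  have "(LINT w|distr lborel borel (\<lambda>w. w - d). exp (- s * (norm w)\<^sup>2)) = pi / s"
    using integral_gaussian2[OF assms] unfolding e .
  then show "(LINT w|lborel. exp (- s * (norm (w - d))\<^sup>2)) = pi / s"
    by (subst (asm) integral_distr) auto
qed

lemma nn_integral_gaussian2_shift:
  fixes d :: "real \<times> real"
  assumes "s > 0"
  shows "(\<integral>\<^sup>+w. ennreal (exp (- s * (norm (w - d))\<^sup>2)) \<partial>lborel) = ennreal (pi / s)"
  unfolding integrable_gaussian2_shift(2)[OF assms, of d, symmetric]
  by (rule nn_integral_eq_integral[OF integrable_gaussian2_shift(1)[OF assms]]) simp

text \<open>Fatou's lemma along \<open>\<epsilon> = 1 / (n + 1)\<close>. It removes the damping in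
  Plancherel's inequality, in the mass of the Husimi function and in the mass of a Radon
  slice.\<close>

lemma nn_integral_gaussian_limit:
  fixes g :: "'a::euclidean_space \<Rightarrow> ennreal"
  assumes [measurable]: "g \<in> borel_measurable borel"
    and bound: "\<And>\<epsilon>. \<epsilon> > 0 \<Longrightarrow> (\<integral>\<^sup>+y. g y * ennreal (exp (- \<epsilon> * (norm y)\<^sup>2)) \<partial>lborel) \<le> C"
  shows "(\<integral>\<^sup>+y. g y \<partial>lborel) \<le> C"
proof -
  define h where "h n y = g y * ennreal (exp (- (1 / real (Suc n)) * (norm y)\<^sup>2))" for n y
  have "(\<integral>\<^sup>+y. g y \<partial>lborel) = (\<integral>\<^sup>+y. liminf (\<lambda>n. h n y) \<partial>lborel)"
  proof (rule nn_integral_cong)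
    fix y :: 'a
    have "(\<lambda>n. ennreal (exp (- (1 / real (Suc n)) * (norm y)\<^sup>2))) \<longlonglongrightarrow> ennreal (exp (- 0 * (norm y)\<^sup>2))"
      by (intro tendsto_intros LIMSEQ_Suc lim_1_over_n)
    then have "(\<lambda>n. h n y) \<longlonglongrightarrow> g y * 1"
      unfolding h_def by (intro tendsto_mult_ennreal tendsto_const) auto
    then show "g y = liminf (\<lambda>n. h n y)" by (simp add: lim_imp_Liminf)
  qed
  also have "\<dots> \<le> liminf (\<lambda>n. \<integral>\<^sup>+y. h n y \<partial>lborel)"
    by (rule nn_integral_liminf) (simp add: h_def)
  also have "\<dots> \<le> C"
    using bound[of "1 / real (Suc _)"] by (intro Liminf_le[OF _ always_eventually]) (auto simp: h_def)
  finally show ?thesis .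
qed

text \<open>One half of Plancherel's theorem. With damping, the squared transform integrates to a
  double integral of \<open>f w * cnj (f w')\<close> against a Gaussian kernel of constant mass in
  each variable. Schur's test bounds it independently of \<open>\<epsilon>\<close>; the right side
  may be infinite.\<close>

lemma nn_integral_fourier_square_le:
  fixes f :: "real \<times> real \<Rightarrow> complex"
  assumes f: "integrable lborel f"
  shows "(\<integral>\<^sup>+y. ennreal ((cmod (LINT w|lborel. f w * cis (w \<bullet> y)))\<^sup>2) \<partial>lborel)
    \<le> ennreal (4 * pi\<^sup>2) * (\<integral>\<^sup>+w. ennreal ((cmod (f w))\<^sup>2) \<partial>lborel)"
proof (rule nn_integral_gaussian_limit)
  have [measurable]: "f \<in> borel_measurable borel" using f by (auto dest: borel_measurable_integrable)
  show "(\<lambda>y. ennreal ((cmod (LINT w|lborel. f w * cis (w \<bullet> y)))\<^sup>2)) \<in> borel_measurable borel"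
    by measurable
  fix \<epsilon> :: real assume \<epsilon>: "\<epsilon> > 0"
  define Ff where "Ff y = (LINT w|lborel. f w * cis (w \<bullet> y))" for y
  have fi: "integrable lborel (\<lambda>w. f w * cis (w \<bullet> y))" for y
    by (rule Bochner_Integration.integrable_bound[OF f]) (auto simp: norm_mult)
  define K where "K w w' = f w * cnj (f w')" for w w'
  have Ki: "integrable lborel (\<lambda>p. K (fst p) (snd p))"
    using lborel_prod_integrable(1)[OF f, of "\<lambda>w. cnj (f w)"] f by (simp add: K_def)
  \<comment> \<open>The Fourier transform of the damping factor at \<open>w - w'\<close>. Its mass
    is \<open>pi / \<epsilon>\<close> times \<open>4 * pi * \<epsilon>\<close>, free of
    \<open>\<epsilon>\<close>.\<close>
  define G where "G w w' = pi / \<epsilon> * exp (- (1 / (4 * \<epsilon>)) * (norm (w' - w))\<^sup>2)" for w w' :: "real \<times> real"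
  have G0: "G w w' \<ge> 0" "G w w' = G w' w" for w w' using \<epsilon> by (auto simp: G_def norm_minus_commute)
  have [measurable]: "(\<lambda>p. G (fst p) (snd p)) \<in> borel_measurable borel" unfolding G_def by measurable
  have G_int: "(\<integral>\<^sup>+w'. ennreal (G w w') \<partial>lborel) = ennreal (4 * pi\<^sup>2)" for w
  proof -
    have "(\<integral>\<^sup>+w'. ennreal (G w w') \<partial>lborel)
        = (\<integral>\<^sup>+w'. ennreal (pi / \<epsilon>) * ennreal (exp (- (1 / (4 * \<epsilon>)) * (norm (w' - w))\<^sup>2)) \<partial>lborel)"
      unfolding G_def by (intro nn_integral_cong ennreal_mult) (use \<epsilon> in auto)
    also have "\<dots> = ennreal (pi / \<epsilon>) * (\<integral>\<^sup>+w'. ennreal (exp (- (1 / (4 * \<epsilon>)) * (norm (w' - w))\<^sup>2)) \<partial>lborel)"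
      by (rule nn_integral_cmult) measurable
    also have "(\<integral>\<^sup>+w'. ennreal (exp (- (1 / (4 * \<epsilon>)) * (norm (w' - w))\<^sup>2)) \<partial>lborel) = ennreal (pi / (1 / (4 * \<epsilon>)))"
      by (rule nn_integral_gaussian2_shift) (use \<epsilon> in simp)
    also have "ennreal (pi / \<epsilon>) * ennreal (pi / (1 / (4 * \<epsilon>))) = ennreal (4 * pi\<^sup>2)"
      using \<epsilon> by (subst ennreal_mult[symmetric]) (auto simp: power2_eq_square)
    finally show ?thesis .
  qed
  have [measurable]: "G w \<in> borel_measurable borel" for w unfolding G_def by measurable
  have cG: "(\<integral>\<^sup>+w'. ennreal ((cmod (f w))\<^sup>2 * G w w') \<partial>lborel) = ennreal ((cmod (f w))\<^sup>2) * ennreal (4 * pi\<^sup>2)" for w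
    unfolding G_int[of w, symmetric] by (subst nn_integral_cmult[symmetric]) (auto simp: ennreal_mult G0(1))
  have sq: "of_real ((cmod (Ff y))\<^sup>2) = (LINT p|lborel. K (fst p) (snd p) * cis (y \<bullet> (fst p - snd p)))" for y
  proof -
    have "of_real ((cmod (Ff y))\<^sup>2) = Ff y * cnj (Ff y)" by (rule complex_norm_square)
    also have "\<dots> = (LINT w|lborel. f w * cis (w \<bullet> y)) * (LINT w|lborel. cnj (f w * cis (w \<bullet> y)))"
      by (simp only: Ff_def Bochner_Integration.integral_cnj)
    also have "\<dots> = (LINT p|lborel. (f (fst p) * cis (fst p \<bullet> y)) * cnj (f (snd p) * cis (snd p \<bullet> y)))"
      using lborel_prod_integrable(2)[OF fi[of y] integrable_cnj[OF fi[of y]]] by simp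
    also have "\<dots> = (LINT p|lborel. K (fst p) (snd p) * cis (y \<bullet> (fst p - snd p)))"
    proof (intro Bochner_Integration.integral_cong refl)
      fix p
      have "cis (y \<bullet> (fst p - snd p)) = cis (fst p \<bullet> y) * cis (- (snd p \<bullet> y))"
        by (simp add: cis_mult inner_diff_right inner_commute)
      then show "(f (fst p) * cis (fst p \<bullet> y)) * cnj (f (snd p) * cis (snd p \<bullet> y)) = K (fst p) (snd p) * cis (y \<bullet> (fst p - snd p))"
        by (simp add: K_def cis_cnj)
    qed
    finally show ?thesis .
  qed
  define B where "B y p = of_real (exp (- \<epsilon> * (norm y)\<^sup>2)) * (K (fst p) (snd p) * cis (y \<bullet> (fst p - snd p)))" for y p
  have big: "integrable (lborel \<Otimes>\<^sub>M lborel) (\<lambda>(y, p). B y p)"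
  proof (rule Bochner_Integration.integrable_bound)
    show "integrable (lborel \<Otimes>\<^sub>M lborel) (\<lambda>q. of_real (exp (- \<epsilon> * (norm (fst q :: real \<times> real))\<^sup>2)) * K (fst (snd q)) (snd (snd q)))"
      using lborel_prod_integrable(1)[of "\<lambda>y::real \<times> real. of_real (exp (- \<epsilon> * (norm y)\<^sup>2))" "\<lambda>p. K (fst p) (snd p)"]
        integrable_gaussian2[OF \<epsilon>] Ki
      by (simp add: lborel_prod)
    show "(\<lambda>(y, p). B y p) \<in> borel_measurable (lborel \<Otimes>\<^sub>M lborel)"
      unfolding B_def K_def lborel_prod by (simp add: case_prod_beta)
  qed (auto simp: norm_mult case_prod_beta B_def)
  have "(LINT y|lborel. of_real ((cmod (Ff y))\<^sup>2 * exp (- \<epsilon> * (norm y)\<^sup>2))) = (LINT y|lborel. LINT p|lborel. B y p)"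
    by (intro Bochner_Integration.integral_cong refl) (simp add: sq B_def mult.commute del: of_real_power)
  also have "\<dots> = (LINT p|lborel. LINT y|lborel. B y p)"
    by (rule lborel_pair.Fubini_integral[symmetric]) (rule big)
  also have "\<dots> = (LINT p|lborel. K (fst p) (snd p) * of_real (G (fst p) (snd p)))"
  proof (intro Bochner_Integration.integral_cong refl)
    fix p
    have "(LINT y|lborel. B y p) = (LINT y|lborel. K (fst p) (snd p) * (of_real (exp (- \<epsilon> * (norm y)\<^sup>2)) * cis (y \<bullet> (fst p - snd p))))"
      by (intro Bochner_Integration.integral_cong refl) (simp add: B_def)
    also have "\<dots> = K (fst p) (snd p) * of_real (pi / \<epsilon> * exp (- (norm (fst p - snd p))\<^sup>2 / (4 * \<epsilon>)))"
      by (subst integral_mult_right_zero, subst integral_gaussian2_cis[OF \<epsilon>]) simp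
    finally show "(LINT y|lborel. B y p) = K (fst p) (snd p) * of_real (G (fst p) (snd p))"
      by (simp add: G_def norm_minus_commute)
  qed
  finally have eq: "(LINT y|lborel. complex_of_real ((cmod (Ff y))\<^sup>2 * exp (- \<epsilon> * (norm y)\<^sup>2)))
      = (LINT p|lborel. K (fst p) (snd p) * of_real (G (fst p) (snd p)))" .
  have int: "integrable lborel (\<lambda>y. (cmod (Ff y))\<^sup>2 * exp (- \<epsilon> * (norm y)\<^sup>2))"
  proof -
    have "integrable lborel (\<lambda>y. LINT p|lborel. B y p)"
      using lborel_pair.integrable_fst'[OF big] by simp
    also have "(\<lambda>y. LINT p|lborel. B y p) = (\<lambda>y. complex_of_real ((cmod (Ff y))\<^sup>2 * exp (- \<epsilon> * (norm y)\<^sup>2)))"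
      by (simp add: fun_eq_iff sq B_def mult.commute del: of_real_power)
    finally show ?thesis by (simp only: complex_of_real_integrable_eq)
  qed
  have [measurable]: "(\<lambda>p. K (fst p) (snd p)) \<in> borel_measurable borel" unfolding K_def by measurable
  let ?S = "\<integral>\<^sup>+w. ennreal ((cmod (f w))\<^sup>2) \<partial>lborel"
  have half: "(\<integral>\<^sup>+p. ennreal ((cmod (f (fst p)))\<^sup>2 * G (fst p) (snd p)) \<partial>lborel) = ennreal (4 * pi\<^sup>2) * ?S"
  proof -
    have "(\<integral>\<^sup>+p. ennreal ((cmod (f (fst p)))\<^sup>2 * G (fst p) (snd p)) \<partial>lborel)
        = (\<integral>\<^sup>+w. \<integral>\<^sup>+w'. ennreal ((cmod (f w))\<^sup>2 * G w w') \<partial>lborel \<partial>lborel)"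
      by (subst nn_integral_lborel_prod(1)) auto
    also have "\<dots> = (\<integral>\<^sup>+w. ennreal ((cmod (f w))\<^sup>2) * ennreal (4 * pi\<^sup>2) \<partial>lborel)"
      by (intro nn_integral_cong cG)
    finally show ?thesis by (simp add: nn_integral_multc mult.commute)
  qed
  have half': "(\<integral>\<^sup>+p. ennreal ((cmod (f (snd p)))\<^sup>2 * G (fst p) (snd p)) \<partial>lborel) = ennreal (4 * pi\<^sup>2) * ?S"
  proof -
    have "(\<integral>\<^sup>+p. ennreal ((cmod (f (snd p)))\<^sup>2 * G (fst p) (snd p)) \<partial>lborel)
        = (\<integral>\<^sup>+w'. \<integral>\<^sup>+w. ennreal ((cmod (f w'))\<^sup>2 * G w w') \<partial>lborel \<partial>lborel)"
      by (subst nn_integral_lborel_prod(2)) auto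
    also have "\<dots> = (\<integral>\<^sup>+w. ennreal ((cmod (f w))\<^sup>2) * ennreal (4 * pi\<^sup>2) \<partial>lborel)"
      by (intro nn_integral_cong) (subst G0(2), rule cG)
    finally show ?thesis by (simp add: nn_integral_multc mult.commute)
  qed
  have "(\<integral>\<^sup>+y. ennreal ((cmod (Ff y))\<^sup>2) * ennreal (exp (- \<epsilon> * (norm y)\<^sup>2)) \<partial>lborel)
      = ennreal (LINT y|lborel. (cmod (Ff y))\<^sup>2 * exp (- \<epsilon> * (norm y)\<^sup>2))"
    by (subst nn_integral_eq_integral[OF int, symmetric]) (auto simp: ennreal_mult)
  also have "\<dots> = ennreal (cmod (LINT y|lborel. complex_of_real ((cmod (Ff y))\<^sup>2 * exp (- \<epsilon> * (norm y)\<^sup>2))))"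
    by (simp only: integral_complex_of_real norm_of_real) (simp add: abs_of_nonneg)
  also have "\<dots> \<le> (\<integral>\<^sup>+p. ennreal (cmod (K (fst p) (snd p) * of_real (G (fst p) (snd p)))) \<partial>lborel)"
    unfolding eq by (rule ennreal_norm_integral_le)
  \<comment> \<open>The half-sum of squares replaces the product; by the symmetry of
    \<open>G\<close> both halves then have the same integral.\<close>
  also have "\<dots> \<le> (\<integral>\<^sup>+p. ennreal ((cmod (f (fst p)))\<^sup>2 * G (fst p) (snd p)) / 2 + ennreal ((cmod (f (snd p)))\<^sup>2 * G (fst p) (snd p)) / 2 \<partial>lborel)"
  proof (rule nn_integral_mono)
    fix p
    have "cmod (K (fst p) (snd p)) * G (fst p) (snd p) \<le> ((cmod (f (fst p)))\<^sup>2 + (cmod (f (snd p)))\<^sup>2) / 2 * G (fst p) (snd p)"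
      using cmod_mult_le_half_squares[of "f (fst p)" "cnj (f (snd p))"] by (intro mult_right_mono G0) (simp add: K_def)
    then have "ennreal (cmod (K (fst p) (snd p) * of_real (G (fst p) (snd p)))) \<le> ennreal ((cmod (f (fst p)))\<^sup>2 * G (fst p) (snd p) / 2 + (cmod (f (snd p)))\<^sup>2 * G (fst p) (snd p) / 2)"
      by (intro ennreal_leI) (simp add: norm_mult G0 field_simps)
    also have "\<dots> = ennreal ((cmod (f (fst p)))\<^sup>2 * G (fst p) (snd p)) / 2 + ennreal ((cmod (f (snd p)))\<^sup>2 * G (fst p) (snd p)) / 2"
      by (simp add: ennreal_plus G0 divide_ennreal[symmetric])
    finally show "ennreal (cmod (K (fst p) (snd p) * of_real (G (fst p) (snd p)))) \<le> ennreal ((cmod (f (fst p)))\<^sup>2 * G (fst p) (snd p)) / 2 + ennreal ((cmod (f (snd p)))\<^sup>2 * G (fst p) (snd p)) / 2" .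
  qed
  also have "\<dots> = ennreal (4 * pi\<^sup>2) * ?S / 2 + ennreal (4 * pi\<^sup>2) * ?S / 2"
    by (subst nn_integral_add) (auto simp: nn_integral_divide half half')
  also have "\<dots> = ennreal (4 * pi\<^sup>2) * ?S"
    by (simp add: ennreal_divide_times[symmetric] mult_2[symmetric] field_simps)
  finally show "(\<integral>\<^sup>+y. ennreal ((cmod (LINT w|lborel. f w * cis (w \<bullet> y)))\<^sup>2) * ennreal (exp (- \<epsilon> * (norm y)\<^sup>2)) \<partial>lborel)
    \<le> ennreal (4 * pi\<^sup>2) * (\<integral>\<^sup>+w. ennreal ((cmod (f w))\<^sup>2) \<partial>lborel)"
    unfolding Ff_def .
qed

section \<open>Coherent states\<close>

text \<open>A Gaussian wave packet at position \<open>q\<close> and momentum \<open>p\<close>, not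
  normalised: its squared norm is \<open>sqrt pi\<close>.\<close>

definition coherent :: "real \<Rightarrow> real \<Rightarrow> wave" where
  "coherent q p x = of_real (exp (- (x - q)\<^sup>2 / 2)) * cis (p * x)"

lemma coherent_L2: "coherent q p \<in> L2"
proof (rule L2I)
  show "coherent q p \<in> borel_measurable borel" unfolding coherent_def[abs_def] by measurable
  have "integrable lborel (\<lambda>x. exp (- 1 * (- q + 1 * x)\<^sup>2))"
    by (rule lborel_integrable_real_affine[OF integrable_gaussian]) auto
  also have "(\<lambda>x. exp (- 1 * (- q + 1 * x)\<^sup>2)) = (\<lambda>x. (cmod (coherent q p x))\<^sup>2)"
    by (simp add: fun_eq_iff coherent_def norm_mult exp_double[symmetric])
  finally show "integrable lborel (\<lambda>x. (cmod (coherent q p x))\<^sup>2)" .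
qed

text \<open>A Gaussian window around the frequency \<open>d\<close> times a character. The factor
  \<open>1 / 4\<close> is the one in the matrix element of a Weyl operator on a coherent state at
  the origin, which decays like \<open>exp (- (u^2 + v^2) / 4)\<close>; this makes smoothing at
  \<open>d = 0\<close> produce the Husimi function.\<close>

definition gauss_char :: "real \<times> real \<Rightarrow> real \<times> real \<Rightarrow> real \<times> real \<Rightarrow> complex" where
  "gauss_char d z w = of_real (exp (- (1 / 4) * (norm (w - d))\<^sup>2)) * cis (w \<bullet> z)"

lemma gauss_char_measurable [measurable]:
  "(\<lambda>p. gauss_char d (fst p) (snd p)) \<in> borel_measurable borel" "gauss_char d z \<in> borel_measurable borel"
  unfolding gauss_char_def by measurable

lemma norm_gauss_char: "cmod (gauss_char d z w) = exp (- (1 / 4) * (norm (w - d))\<^sup>2)"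
  by (simp add: gauss_char_def norm_mult)

lemma integrable_gauss_char: "integrable lborel (gauss_char d z)"
  by (rule Bochner_Integration.integrable_bound[OF integrable_gaussian2_shift(1)[of "1/4" d]])
    (auto simp: norm_gauss_char)

lemma integral_gaussian_shift_cis:
  "(LINT u|lborel. of_real (exp (- (1 / 4) * (u - d)\<^sup>2)) * cis (u * k)) = of_real (2 * sqrt pi * exp (- k\<^sup>2)) * cis (d * k)"
proof -
  have "(LINT u|lborel. of_real (exp (- (1 / 4) * (u - d)\<^sup>2)) * cis (u * k))
      = (LINT t|lborel. of_real (exp (- (1 / 4) * (d + 1 * t - d)\<^sup>2)) * cis ((d + 1 * t) * k))"
    using lborel_integral_real_affine[of 1 "\<lambda>u. of_real (exp (- (1 / 4) * (u - d)\<^sup>2)) * cis (u * k)" d] by simp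
  also have "\<dots> = (LINT t|lborel. cis (d * k) * (of_real (exp (- (1 / 4) * t\<^sup>2)) * cis (k * t)))"
  proof (intro Bochner_Integration.integral_cong refl)
    fix t
    have "cis ((d + 1 * t) * k) = cis (d * k) * cis (k * t)" by (simp add: cis_mult algebra_simps)
    then show "of_real (exp (- (1 / 4) * (d + 1 * t - d)\<^sup>2)) * cis ((d + 1 * t) * k) = cis (d * k) * (of_real (exp (- (1 / 4) * t\<^sup>2)) * cis (k * t))"
      by simp
  qed
  also have "\<dots> = cis (d * k) * of_real (sqrt (pi / (1 / 4)) * exp (- k\<^sup>2 / (4 * (1 / 4))))"
    by (subst integral_mult_right_zero, subst integral_gaussian_cis) auto
  also have "sqrt (pi / (1 / 4)) = 2 * sqrt pi"
    by (simp add: real_sqrt_mult)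
  finally show ?thesis by (simp add: mult.commute)
qed

text \<open>Integrating out \<open>u\<close> leaves a Gaussian in \<open>k = q - x - v / 2\<close>.
  The identity \<open>(v - d2)^2 / 4 + k^2 = (x - (q - d2 / 2))^2 / 2 + (x + v - (q + d2 / 2))^2 /
  2\<close> separates \<open>x\<close> from \<open>x + v\<close>, so the smoothed Weyl operator has
  rank one.\<close>

lemma weyl_gaussian_kernel:
  "(LINT u|lborel. gauss_char (d1, d2) (q, p) (u, v) * (cnj (weyl (- u) (- v) f x) * h x))
    = of_real (2 * sqrt pi) * cis (d1 * q) * (cnj (coherent (q - d2 / 2) (p + d1 / 2) x) * h x)
       * (cnj (f (x + v)) * coherent (q + d2 / 2) (p - d1 / 2) (x + v))"
proof -
  define k where "k = q - x - v / 2"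
  have "(LINT u|lborel. gauss_char (d1, d2) (q, p) (u, v) * (cnj (weyl (- u) (- v) f x) * h x))
    = (LINT u|lborel. (of_real (exp (- (1 / 4) * (v - d2)\<^sup>2)) * cis (v * p) * cnj (f (x + v)) * h x) *
         (of_real (exp (- (1 / 4) * (u - d1)\<^sup>2)) * cis (u * k)))"
  proof (intro Bochner_Integration.integral_cong refl)
    fix u
    have "exp (- (1 / 4) * (norm ((u, v) - (d1, d2)))\<^sup>2) = exp (- (1 / 4) * (u - d1)\<^sup>2) * exp (- (1 / 4) * (v - d2)\<^sup>2)"
      unfolding norm_prod_square by (simp add: exp_add[symmetric] diff_divide_distrib add_divide_distrib)
    moreover have "cis ((u, v) \<bullet> (q, p)) * cnj (cis (- (- u) * x + (- u) * (- v) / 2)) = cis (v * p) * cis (u * k)"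
      by (simp add: cis_cnj cis_mult k_def algebra_simps)
    ultimately show "gauss_char (d1, d2) (q, p) (u, v) * (cnj (weyl (- u) (- v) f x) * h x)
      = (of_real (exp (- (1 / 4) * (v - d2)\<^sup>2)) * cis (v * p) * cnj (f (x + v)) * h x) *
         (of_real (exp (- (1 / 4) * (u - d1)\<^sup>2)) * cis (u * k))"
      unfolding gauss_char_def weyl_def complex_cnj_mult by (simp add: mult_ac)
  qed
  also have "\<dots> = (of_real (exp (- (1 / 4) * (v - d2)\<^sup>2)) * cis (v * p) * cnj (f (x + v)) * h x) *
         (of_real (2 * sqrt pi * exp (- k\<^sup>2)) * cis (d1 * k))"
    by (subst integral_mult_right_zero) (simp only: integral_gaussian_shift_cis)
  also have "\<dots> = of_real (2 * sqrt pi) * (cnj (f (x + v)) * h x) *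
      (of_real (exp (- (1 / 4) * (v - d2)\<^sup>2) * exp (- k\<^sup>2)) * (cis (v * p) * cis (d1 * k)))"
    by (simp add: mult_ac)
  also have "exp (- (1 / 4) * (v - d2)\<^sup>2) * exp (- k\<^sup>2)
      = exp (- (x - (q - d2 / 2))\<^sup>2 / 2) * exp (- (x + v - (q + d2 / 2))\<^sup>2 / 2)"
    unfolding exp_add[symmetric] k_def by (rule arg_cong[where f = exp]) (simp add: power2_eq_square field_simps)
  also have "cis (v * p) * cis (d1 * k) = cis (d1 * q) * (cis (- ((p + d1 / 2) * x)) * cis ((p - d1 / 2) * (x + v)))"
    unfolding cis_mult k_def by (rule arg_cong[where f = cis]) (simp add: field_simps)
  finally show ?thesis
    by (simp add: coherent_def cis_cnj mult_ac)
qed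

text \<open>By Fubini the smoothing acts on the integrand of \<open>ip\<close> first, and the
  separated kernel then splits into two inner products. A window centred at \<open>d\<close>
  displaces the two coherent states in opposite directions by half of \<open>d\<close>, turned by a
  right angle.\<close>

lemma weyl_gaussian_integral:
  assumes f: "f \<in> L2" and h: "h \<in> L2"
  shows "(LINT w|lborel. gauss_char (d1, d2) (q, p) w * ip (weyl (- fst w) (- snd w) f) h)
    = of_real (2 * sqrt pi) * cis (d1 * q) *
      (ip (coherent (q - d2 / 2) (p + d1 / 2)) h * ip f (coherent (q + d2 / 2) (p - d1 / 2)))"
proof -
  have [measurable]: "f \<in> borel_measurable borel" "h \<in> borel_measurable borel"
    using f h by (auto dest: L2_measurable)
  define g where "g = gauss_char (d1, d2) (q, p)"
  have gi: "integrable lborel g" unfolding g_def by (rule integrable_gauss_char)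
  have [measurable]: "g \<in> borel_measurable borel" unfolding g_def by measurable
  define J where "J w x = g w * (cnj (weyl (- fst w) (- snd w) f x) * h x)" for w x
  define C where "C = complex_of_real (2 * sqrt pi) * cis (d1 * q)"
  define a where "a = coherent (q - d2 / 2) (p + d1 / 2)"
  define b where "b = coherent (q + d2 / 2) (p - d1 / 2)"
  have Ji: "integrable lborel (J w)" for w
    unfolding J_def by (intro integrable_mult_right L2_product_integrable weyl_L2 f h)
  have Jm: "case_prod J \<in> borel_measurable (lborel \<Otimes>\<^sub>M lborel)"
    unfolding J_def weyl_def by measurable
  have big: "integrable (lborel \<Otimes>\<^sub>M lborel) (case_prod J)"
  proof (rule lborel_pair.Fubini_integrable[OF Jm])
    show "integrable lborel (\<lambda>w. LINT x|lborel. norm (case_prod J (w, x)))"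
    proof (rule Bochner_Integration.integrable_bound)
      show "integrable lborel (\<lambda>w. cmod (g w) * (((l2norm f)\<^sup>2 + (l2norm h)\<^sup>2) / 2))"
        using gi by simp
      show "(\<lambda>w. LINT x|lborel. norm (case_prod J (w, x))) \<in> borel_measurable lborel"
        using Jm by measurable
      show "AE w in lborel. norm (LINT x|lborel. norm (case_prod J (w, x))) \<le> norm (cmod (g w) * (((l2norm f)\<^sup>2 + (l2norm h)\<^sup>2) / 2))"
      proof (rule AE_I2)
        fix w
        let ?F = "weyl (- fst w) (- snd w) f"
        have FL: "?F \<in> L2" by (intro weyl_L2 f)
        have "(LINT x|lborel. norm (case_prod J (w, x))) = cmod (g w) * (LINT x|lborel. cmod (cnj (?F x) * h x))"
          by (simp add: J_def norm_mult)
        also have "\<dots> \<le> cmod (g w) * (LINT x|lborel. ((cmod (?F x))\<^sup>2 + (cmod (h x))\<^sup>2) / 2)"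
          using L2_product_integrable[OF FL h] L2_integrable[OF FL] L2_integrable[OF h] cmod_mult_le_half_squares[of "cnj (?F _)" "h _"]
          by (intro mult_left_mono integral_mono integrable_norm) auto
        also have "(LINT x|lborel. ((cmod (?F x))\<^sup>2 + (cmod (h x))\<^sup>2) / 2) = ((l2norm f)\<^sup>2 + (l2norm h)\<^sup>2) / 2"
          using L2_integrable[OF FL] L2_integrable[OF h]
          by (simp add: l2norm_square[symmetric] l2norm_weyl)
        finally show "norm (LINT x|lborel. norm (case_prod J (w, x))) \<le> norm (cmod (g w) * (((l2norm f)\<^sup>2 + (l2norm h)\<^sup>2) / 2))"
          by simp
      qed
    qed
    show "AE w in lborel. integrable lborel (\<lambda>x. case_prod J (w, x))"
      using Ji by simp
  qed
  \<comment> \<open>Iterating the integral over \<open>w\<close> requires integrability of this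
    slice, which Fubini grants for almost every \<open>x\<close>.\<close>
  have inner: "(LINT w|lborel. J w x) = C * (cnj (a x) * h x) * ip f b" if int: "integrable lborel (\<lambda>w. J w x)" for x
  proof -
    have "(LINT w|lborel. J w x) = (LINT v|lborel. LINT u|lborel. J (u, v) x)"
    proof -
      have "(\<lambda>(u, v). J (u, v) x) = (\<lambda>w. J w x)" by auto
      then show ?thesis
        using lborel_pair.integral_snd[of "\<lambda>u v. J (u, v) x"] int by (simp add: lborel_prod)
    qed
    also have "\<dots> = (LINT v|lborel. C * (cnj (a x) * h x) * (cnj (f (x + 1 * v)) * b (x + 1 * v)))"
      unfolding J_def g_def a_def b_def C_def fst_conv snd_conv weyl_gaussian_kernel by simp
    also have "\<dots> = C * (cnj (a x) * h x) * (LINT v|lborel. cnj (f (x + 1 * v)) * b (x + 1 * v))"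
      by (rule integral_mult_right_zero)
    also have "(LINT v|lborel. cnj (f (x + 1 * v)) * b (x + 1 * v)) = ip f b"
      unfolding ip_def using lborel_integral_real_affine[of 1 "\<lambda>y. cnj (f y) * b y" x] by simp
    finally show ?thesis .
  qed
  have "(LINT w|lborel. g w * ip (weyl (- fst w) (- snd w) f) h) = (LINT w|lborel. LINT x|lborel. J w x)"
    unfolding J_def ip_def by simp
  also have "\<dots> = (LINT x|lborel. LINT w|lborel. J w x)"
    by (rule lborel_pair.Fubini_integral[symmetric]) (rule big)
  also have "\<dots> = (LINT x|lborel. C * (cnj (a x) * h x) * ip f b)"
  proof (rule integral_cong_AE)
    show "AE x in lborel. (LINT w|lborel. J w x) = C * (cnj (a x) * h x) * ip f b"
      using lborel_pair.AE_integrable_snd[OF big] by eventually_elim (rule inner)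
    show "(\<lambda>x. LINT w|lborel. J w x) \<in> borel_measurable lborel"
      using lborel_pair.integrable_snd[OF big] by (rule borel_measurable_integrable)
    have "a \<in> borel_measurable borel" unfolding a_def by (rule L2_measurable[OF coherent_L2])
    then show "(\<lambda>x. C * (cnj (a x) * h x) * ip f b) \<in> borel_measurable lborel" by simp
  qed
  also have "\<dots> = (LINT x|lborel. (C * ip f b) * (cnj (a x) * h x))"
    by (simp only: mult_ac)
  also have "\<dots> = (C * ip f b) * ip a h"
    unfolding ip_def[of a h] by (rule integral_mult_right_zero)
  also have "\<dots> = C * (ip a h * ip f b)" by (simp only: mult_ac)
  finally show ?thesis by (simp add: g_def a_def b_def C_def)
qed

text \<open>The finite traces converge uniformly and the window is integrable, so the smoothing may
  be done term by term; Parseval then collapses the sum over the basis to a single matrix element of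
  \<open>\<rho>\<close>.\<close>

lemma W_tilde_gaussian:
  assumes dm: "density_matrix \<rho>" and f: "orthonormal_basis f"
  shows "(LINT w|lborel. W_tilde \<rho> w * gauss_char (d1, d2) (q, p) w)
    = of_real (2 * sqrt pi) * cis (d1 * q) *
       ip (coherent (q - d2 / 2) (p + d1 / 2)) (\<rho> (coherent (q + d2 / 2) (p - d1 / 2)))"
proof (rule LIMSEQ_unique)
  define g where "g = gauss_char (d1, d2) (q, p)"
  have gi: "integrable lborel g" unfolding g_def by (rule integrable_gauss_char)
  have [measurable]: "g \<in> borel_measurable borel" unfolding g_def by measurable
  define C where "C = complex_of_real (2 * sqrt pi) * cis (d1 * q)"
  define a where "a = coherent (q - d2 / 2) (p + d1 / 2)"
  define b where "b = coherent (q + d2 / 2) (p - d1 / 2)"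
  have aL: "a \<in> L2" and bL: "b \<in> L2" unfolding a_def b_def by (rule coherent_L2)+
  define t where "t j w = ip (weyl (- fst w) (- snd w) (f j)) (\<rho> (f j))" for j w
  note fL = onb_L2[OF f] and rL = density_L2[OF dm]
  have [measurable]: "t j \<in> borel_measurable borel" for j
    unfolding t_def[abs_def] by (intro borel_measurable_continuous_onI continuous_on_ip_weyl[OF dm f] fL rL)
  have [measurable]: "W_tilde \<rho> \<in> borel_measurable borel"
    by (intro borel_measurable_continuous_onI W_tilde_continuous[OF dm f])
  have ti: "integrable lborel (\<lambda>w. g w * t j w)" for j
  proof (rule Bochner_Integration.integrable_bound)
    show "integrable lborel (\<lambda>w. (l2norm (f j) * l2norm (\<rho> (f j))) *\<^sub>R g w)" using gi by simp
    show "AE w in lborel. norm (g w * t j w) \<le> norm ((l2norm (f j) * l2norm (\<rho> (f j))) *\<^sub>R g w)"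
    proof (rule AE_I2)
      fix w
      have "cmod (t j w) \<le> l2norm (f j) * l2norm (\<rho> (f j))"
        unfolding t_def using ip_Cauchy_Schwarz[OF weyl_L2[OF fL] rL[OF fL]] by (simp add: l2norm_weyl)
      then show "norm (g w * t j w) \<le> norm ((l2norm (f j) * l2norm (\<rho> (f j))) *\<^sub>R g w)"
        by (simp add: norm_mult l2norm_nonneg abs_mult mult.commute[of "cmod (g w)"] mult_right_mono)
    qed
  qed measurable
  have Fi: "integrable lborel (\<lambda>w. W_tilde \<rho> w * g w)"
    by (rule Bochner_Integration.integrable_bound[OF gi])
      (auto simp: norm_mult W_tilde_bound[OF dm f] intro!: AE_I2 mult_left_le_one_le)
  show "(\<lambda>N. LINT w|lborel. (\<Sum>j<N. g w * t j w)) \<longlonglongrightarrow> (LINT w|lborel. W_tilde \<rho> w * gauss_char (d1, d2) (q, p) w)"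
  proof (rule LIM_zero_cancel, rule Lim_null_comparison)
    show "\<forall>\<^sub>F N in sequentially. norm ((LINT w|lborel. (\<Sum>j<N. g w * t j w)) - (LINT w|lborel. W_tilde \<rho> w * gauss_char (d1, d2) (q, p) w))
      \<le> sqrt (trace_tail \<rho> f N) * (LINT w|lborel. cmod (g w))"
    proof (rule always_eventually, rule allI)
      fix N
      have "(LINT w|lborel. (\<Sum>j<N. g w * t j w)) - (LINT w|lborel. W_tilde \<rho> w * g w)
          = (LINT w|lborel. (\<Sum>j<N. g w * t j w) - W_tilde \<rho> w * g w)"
        by (intro Bochner_Integration.integral_diff[symmetric] Fi Bochner_Integration.integrable_sum ti)
      also have "norm \<dots> \<le> (LINT w|lborel. sqrt (trace_tail \<rho> f N) * cmod (g w))"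
      proof (rule order_trans[OF integral_norm_bound integral_mono[OF integrable_norm]])
        show "integrable lborel (\<lambda>w. (\<Sum>j<N. g w * t j w) - W_tilde \<rho> w * g w)"
          by (intro Bochner_Integration.integrable_diff Fi Bochner_Integration.integrable_sum ti)
        show "integrable lborel (\<lambda>w. sqrt (trace_tail \<rho> f N) * cmod (g w))" using gi by simp
        fix w
        have "(\<Sum>j<N. g w * t j w) - W_tilde \<rho> w * g w = - (W_tilde \<rho> (fst w, snd w) - (\<Sum>j<N. t j w)) * g w"
          by (simp add: algebra_simps sum_distrib_left)
        then show "norm ((\<Sum>j<N. g w * t j w) - W_tilde \<rho> w * g w) \<le> sqrt (trace_tail \<rho> f N) * cmod (g w)"
          using W_tilde_approx[OF dm f, of "fst w" "snd w" N]
          unfolding t_def by (simp only: norm_mult norm_minus_cancel) (rule mult_right_mono, auto)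
      qed
      finally show "norm ((LINT w|lborel. (\<Sum>j<N. g w * t j w)) - (LINT w|lborel. W_tilde \<rho> w * gauss_char (d1, d2) (q, p) w))
        \<le> sqrt (trace_tail \<rho> f N) * (LINT w|lborel. cmod (g w))"
        by (simp add: g_def)
    qed
    show "(\<lambda>N. sqrt (trace_tail \<rho> f N) * (LINT w|lborel. cmod (g w))) \<longlonglongrightarrow> 0"
    proof (rule tendsto_mult_left_zero)
      show "(\<lambda>N. sqrt (trace_tail \<rho> f N)) \<longlonglongrightarrow> 0"
        using tendsto_real_sqrt[OF trace_tail_tendsto[OF dm f]] by simp
    qed
  qed
  have "(\<lambda>j. C * (ip (\<rho> a) (f j) * ip (f j) b)) sums (C * ip (\<rho> a) b)"
    by (intro sums_mult Parseval[OF f] rL aL bL)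
  moreover have "(LINT w|lborel. (\<Sum>j<N. g w * t j w)) = (\<Sum>j<N. C * (ip (\<rho> a) (f j) * ip (f j) b))" for N
  proof -
    have "(LINT w|lborel. (\<Sum>j<N. g w * t j w)) = (\<Sum>j<N. LINT w|lborel. g w * t j w)"
      by (intro Bochner_Integration.integral_sum ti)
    also have "\<dots> = (\<Sum>j<N. C * (ip (\<rho> a) (f j) * ip (f j) b))"
      unfolding g_def t_def weyl_gaussian_integral[OF fL rL[OF fL]]
      by (simp add: C_def a_def b_def density_selfadjoint[OF dm coherent_L2 fL])
    finally show ?thesis .
  qed
  ultimately show "(\<lambda>N. LINT w|lborel. (\<Sum>j<N. g w * t j w)) \<longlonglongrightarrow> of_real (2 * sqrt pi) * cis (d1 * q) *
       ip (coherent (q - d2 / 2) (p + d1 / 2)) (\<rho> (coherent (q + d2 / 2) (p - d1 / 2)))"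
    by (simp add: sums_def C_def a_def b_def density_selfadjoint[OF dm coherent_L2 coherent_L2])
qed

lemma nn_integral_lborel_shift:
  fixes f :: "'a::euclidean_space \<Rightarrow> ennreal"
  assumes [measurable]: "f \<in> borel_measurable borel"
  shows "(\<integral>\<^sup>+x. f (c + x) \<partial>lborel) = (\<integral>\<^sup>+x. f x \<partial>lborel)"
proof -
  have "(\<integral>\<^sup>+x. f x \<partial>lborel) = (\<integral>\<^sup>+x. f x \<partial>distr lborel borel ((+) c))"
    by (simp add: lborel_distr_plus)
  then show ?thesis by (simp add: nn_integral_distr)
qed

text \<open>The smoothed transform at \<open>d = 0\<close> is the Husimi function of the state, a nonnegative function
  of finite mass. It controls all the pieces of the Wigner function with frequencies near \<open>d\<close>.\<close>

lemma W_tilde_gaussian_L1: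
  assumes dm: "density_matrix \<rho>" and f: "orthonormal_basis f"
  shows "(\<integral>\<^sup>+z. ennreal (cmod (LINT w|lborel. W_tilde \<rho> w * gauss_char d z w)) \<partial>lborel) \<le> ennreal (4 * pi\<^sup>2)"
proof -
  have Fm [measurable]: "W_tilde \<rho> \<in> borel_measurable borel"
    by (intro borel_measurable_continuous_onI W_tilde_continuous[OF dm f])
  define I where "I d z = (LINT w|lborel. W_tilde \<rho> w * gauss_char d z w)" for d z
  have Im [measurable]: "I d \<in> borel_measurable borel" for d
    unfolding I_def[abs_def] gauss_char_def by measurable
  have Fi: "integrable lborel (\<lambda>w. W_tilde \<rho> w * gauss_char d z w)" for d z
    by (rule Bochner_Integration.integrable_bound[OF integrable_gauss_char[of d z]])
      (auto simp: norm_mult W_tilde_bound[OF dm f] intro!: AE_I2 mult_left_le_one_le)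
  define H where "H z = 2 * sqrt pi * Re (ip (coherent (fst z) (snd z)) (\<rho> (coherent (fst z) (snd z))))" for z
  have H0: "H z \<ge> 0" for z
    unfolding H_def by (intro mult_nonneg_nonneg density_nonneg[OF dm] coherent_L2) auto
  have IH: "I 0 z = of_real (H z)" for z
  proof -
    have "I 0 z = of_real (2 * sqrt pi) * ip (coherent (fst z) (snd z)) (\<rho> (coherent (fst z) (snd z)))"
      using W_tilde_gaussian[OF dm f, of 0 0 "fst z" "snd z"] by (simp add: I_def zero_prod_def)
    then show ?thesis
      unfolding H_def of_real_mult using density_real[OF dm coherent_L2[of "fst z" "snd z"]] by simp
  qed
  have "H = (\<lambda>z. Re (I 0 z))" by (simp add: IH)
  then have [measurable]: "H \<in> borel_measurable borel" by simp
  have H_int: "(\<integral>\<^sup>+z. ennreal (H z) \<partial>lborel) \<le> ennreal (4 * pi\<^sup>2)"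
  proof (rule nn_integral_gaussian_limit)
    fix \<epsilon> :: real assume \<epsilon>: "\<epsilon> > 0"
    define B where "B z w = of_real (exp (- \<epsilon> * (norm z)\<^sup>2)) * (W_tilde \<rho> w * gauss_char 0 z w)" for z w
    have Bm: "case_prod B \<in> borel_measurable (lborel \<Otimes>\<^sub>M lborel)"
      unfolding B_def gauss_char_def by measurable
    have big: "integrable (lborel \<Otimes>\<^sub>M lborel) (case_prod B)"
    proof (rule Bochner_Integration.integrable_bound[OF _ Bm])
      show "integrable (lborel \<Otimes>\<^sub>M lborel) (\<lambda>p. of_real (exp (- \<epsilon> * (norm (fst p :: real \<times> real))\<^sup>2)) * gauss_char 0 0 (snd p))"
        using lborel_prod_integrable(1)[of "\<lambda>z::real \<times> real. of_real (exp (- \<epsilon> * (norm z)\<^sup>2))" "gauss_char 0 0"]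
          integrable_gaussian2[OF \<epsilon>] integrable_gauss_char by (simp add: lborel_prod)
      show "AE p in lborel \<Otimes>\<^sub>M lborel. norm (case_prod B p)
          \<le> norm (complex_of_real (exp (- \<epsilon> * (norm (fst p))\<^sup>2)) * gauss_char 0 0 (snd p))"
        by (intro AE_I2) (auto simp: B_def norm_mult norm_gauss_char W_tilde_bound[OF dm f] intro!: mult_left_le_one_le)
    qed
    have HB: "of_real (H z * exp (- \<epsilon> * (norm z)\<^sup>2)) = (LINT w|lborel. B z w)" for z
      unfolding B_def by (simp add: IH[symmetric] I_def mult.commute)
    have Hint: "integrable lborel (\<lambda>z. H z * exp (- \<epsilon> * (norm z)\<^sup>2))"
      using lborel_pair.integrable_fst[OF big] unfolding HB[symmetric] complex_of_real_integrable_eq .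
    have "complex_of_real (LINT z|lborel. H z * exp (- \<epsilon> * (norm z)\<^sup>2)) = (LINT z|lborel. LINT w|lborel. B z w)"
      unfolding HB[symmetric] by (rule integral_complex_of_real[symmetric])
    also have "\<dots> = (LINT w|lborel. LINT z|lborel. B z w)"
      by (rule lborel_pair.Fubini_integral[symmetric]) (rule big)
    also have "\<dots> = (LINT w|lborel. W_tilde \<rho> w * of_real (exp (- (1 / 4) * (norm w)\<^sup>2) * (pi / \<epsilon> * exp (- (norm w)\<^sup>2 / (4 * \<epsilon>)))))"
    proof (intro Bochner_Integration.integral_cong refl)
      fix w
      have "(LINT z|lborel. B z w) = (LINT z|lborel. (W_tilde \<rho> w * of_real (exp (- (1 / 4) * (norm w)\<^sup>2))) * (of_real (exp (- \<epsilon> * (norm z)\<^sup>2)) * cis (z \<bullet> w)))"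
        by (intro Bochner_Integration.integral_cong refl) (simp add: B_def gauss_char_def inner_commute mult_ac)
      also have "\<dots> = (W_tilde \<rho> w * of_real (exp (- (1 / 4) * (norm w)\<^sup>2))) * of_real (pi / \<epsilon> * exp (- (norm w)\<^sup>2 / (4 * \<epsilon>)))"
        by (subst integral_mult_right_zero, subst integral_gaussian2_cis[OF \<epsilon>]) simp
      finally show "(LINT z|lborel. B z w) = W_tilde \<rho> w * of_real (exp (- (1 / 4) * (norm w)\<^sup>2) * (pi / \<epsilon> * exp (- (norm w)\<^sup>2 / (4 * \<epsilon>))))"
        by (simp only: of_real_mult mult.assoc)
    qed
    finally have eq: "complex_of_real (LINT z|lborel. H z * exp (- \<epsilon> * (norm z)\<^sup>2))
      = (LINT w|lborel. W_tilde \<rho> w * of_real (exp (- (1 / 4) * (norm w)\<^sup>2) * (pi / \<epsilon> * exp (- (norm w)\<^sup>2 / (4 * \<epsilon>)))))" .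
    have "(\<integral>\<^sup>+z. ennreal (H z) * ennreal (exp (- \<epsilon> * (norm z)\<^sup>2)) \<partial>lborel)
        = ennreal (LINT z|lborel. H z * exp (- \<epsilon> * (norm z)\<^sup>2))"
      by (subst nn_integral_eq_integral[OF Hint, symmetric]) (auto simp: ennreal_mult H0)
    also have "\<dots> = ennreal (cmod (complex_of_real (LINT z|lborel. H z * exp (- \<epsilon> * (norm z)\<^sup>2))))"
      by (simp only: norm_of_real) (simp add: abs_of_nonneg H0)
    also have "\<dots> \<le> (\<integral>\<^sup>+w. ennreal (cmod (W_tilde \<rho> w * of_real (exp (- (1 / 4) * (norm w)\<^sup>2) * (pi / \<epsilon> * exp (- (norm w)\<^sup>2 / (4 * \<epsilon>)))))) \<partial>lborel)"
      unfolding eq by (rule ennreal_norm_integral_le)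
    \<comment> \<open>Only \<open>cmod (W_tilde \<rho> w) \<le> 1\<close> enters: what remains is
      the transform of the damping factor, of mass \<open>4 * pi\<^sup>2\<close> for every
      \<open>\<epsilon>\<close>.\<close>
    also have "\<dots> \<le> (\<integral>\<^sup>+w. ennreal (pi / \<epsilon>) * ennreal (exp (- (1 / (4 * \<epsilon>)) * (norm (w - (0 :: real \<times> real)))\<^sup>2)) \<partial>lborel)"
    proof (rule nn_integral_mono)
      fix w
      have "cmod (W_tilde \<rho> w) * (exp (- (1 / 4) * (norm w)\<^sup>2) * (pi / \<epsilon> * exp (- (norm w)\<^sup>2 / (4 * \<epsilon>))))
          \<le> 1 * (1 * (pi / \<epsilon> * exp (- (norm w)\<^sup>2 / (4 * \<epsilon>))))"
        using \<epsilon> by (intro mult_mono W_tilde_bound[OF dm f] order_refl) auto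
      moreover have "cmod (W_tilde \<rho> w * of_real (exp (- (1 / 4) * (norm w)\<^sup>2) * (pi / \<epsilon> * exp (- (norm w)\<^sup>2 / (4 * \<epsilon>)))))
          = cmod (W_tilde \<rho> w) * (exp (- (1 / 4) * (norm w)\<^sup>2) * (pi / \<epsilon> * exp (- (norm w)\<^sup>2 / (4 * \<epsilon>))))"
        unfolding norm_mult norm_of_real using \<epsilon> by (subst abs_of_nonneg) auto
      ultimately show "ennreal (cmod (W_tilde \<rho> w * of_real (exp (- (1 / 4) * (norm w)\<^sup>2) * (pi / \<epsilon> * exp (- (norm w)\<^sup>2 / (4 * \<epsilon>))))))
          \<le> ennreal (pi / \<epsilon>) * ennreal (exp (- (1 / (4 * \<epsilon>)) * (norm (w - 0))\<^sup>2))"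
        using \<epsilon> by (subst ennreal_mult[symmetric]) (auto intro!: ennreal_leI simp del: of_real_mult of_real_divide)
    qed
    also have "\<dots> = ennreal (pi / \<epsilon>) * ennreal (pi / (1 / (4 * \<epsilon>)))"
      using \<epsilon> nn_integral_gaussian2_shift[of "1 / (4 * \<epsilon>)" 0] by (subst nn_integral_cmult) auto
    also have "\<dots> = ennreal (4 * pi\<^sup>2)"
      using \<epsilon> by (subst ennreal_mult[symmetric]) (auto simp: power2_eq_square)
    finally show "(\<integral>\<^sup>+z. ennreal (H z) * ennreal (exp (- \<epsilon> * (norm z)\<^sup>2)) \<partial>lborel) \<le> ennreal (4 * pi\<^sup>2)" .
  qed measurable
  \<comment> \<open>The two coherent states in \<open>I d z\<close> sit at \<open>z + r\<close> and
    \<open>z - r\<close>. Cauchy-Schwarz for the form of \<open>\<rho>\<close> and the inequality of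
    geometric and arithmetic means bound \<open>I d z\<close> by the Husimi function at these
    points.\<close>
  define r where "r = (- snd d / 2, fst d / 2)"
  have bound: "cmod (I d z) \<le> H (r + z) / 2 + H (- r + z) / 2" for z
  proof -
    define a where "a = coherent (fst z - snd d / 2) (snd z + fst d / 2)"
    define b where "b = coherent (fst z + snd d / 2) (snd z - fst d / 2)"
    have aL: "a \<in> L2" and bL: "b \<in> L2" unfolding a_def b_def by (rule coherent_L2)+
    define A where "A = Re (ip a (\<rho> a))"
    define B where "B = Re (ip b (\<rho> b))"
    have AB: "A \<ge> 0" "B \<ge> 0" unfolding A_def B_def by (intro density_nonneg[OF dm] aL bL)+
    have "(cmod (ip a (\<rho> b)))\<^sup>2 \<le> A * B"
      unfolding A_def B_def by (rule density_Cauchy_Schwarz[OF dm aL bL])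
    also have "\<dots> \<le> ((A + B) / 2)\<^sup>2"
      using zero_le_power2[of "A - B"] by (simp add: power2_eq_square field_simps)
    finally have "cmod (ip a (\<rho> b)) \<le> (A + B) / 2"
      by (rule power2_le_imp_le) (use AB in simp)
    moreover have "I d z = of_real (2 * sqrt pi) * cis (fst d * fst z) * ip a (\<rho> b)"
      using W_tilde_gaussian[OF dm f, of "fst d" "snd d" "fst z" "snd z"] by (simp add: I_def a_def b_def)
    ultimately have "cmod (I d z) \<le> 2 * sqrt pi * ((A + B) / 2)"
      by (simp add: norm_mult mult_left_mono)
    also have "\<dots> = H (r + z) / 2 + H (- r + z) / 2"
      by (simp add: H_def r_def A_def B_def a_def b_def distrib_left add_divide_distrib add.commute)
    finally show ?thesis .
  qed
  have "(\<integral>\<^sup>+z. ennreal (cmod (I d z)) \<partial>lborel) \<le> (\<integral>\<^sup>+z. ennreal (H (r + z)) / 2 + ennreal (H (- r + z)) / 2 \<partial>lborel)"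
  proof (rule nn_integral_mono)
    fix z
    have "ennreal (cmod (I d z)) \<le> ennreal (H (r + z) / 2 + H (- r + z) / 2)"
      by (intro ennreal_leI bound)
    also have "\<dots> = ennreal (H (r + z)) / 2 + ennreal (H (- r + z)) / 2"
      by (simp add: ennreal_plus H0 divide_ennreal[symmetric])
    finally show "ennreal (cmod (I d z)) \<le> ennreal (H (r + z)) / 2 + ennreal (H (- r + z)) / 2" .
  qed
  also have "\<dots> = (\<integral>\<^sup>+z. ennreal (H (r + z)) \<partial>lborel) / 2 + (\<integral>\<^sup>+z. ennreal (H (- r + z)) \<partial>lborel) / 2"
    by (subst nn_integral_add) (auto simp: nn_integral_divide)
  also have "\<dots> = (\<integral>\<^sup>+z. ennreal (H z) \<partial>lborel) / 2 + (\<integral>\<^sup>+z. ennreal (H z) \<partial>lborel) / 2"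
    using nn_integral_lborel_shift[of "\<lambda>z. ennreal (H z)" r] nn_integral_lborel_shift[of "\<lambda>z. ennreal (H z)" "- r"] by simp
  also have "\<dots> = (\<integral>\<^sup>+z. ennreal (H z) \<partial>lborel)"
    by (simp add: ennreal_divide_times[symmetric] mult_2[symmetric] field_simps)
  also have "\<dots> \<le> ennreal (4 * pi\<^sup>2)" by (rule H_int)
  finally show ?thesis by (simp add: I_def)
qed

section \<open>Polar coordinates\<close>

text \<open>Lebesgue measure is determined by its values on boxes, and there the identity is the
  fundamental theorem of calculus for \<open>tan\<close>. As an equality of measures it transports
  every nonnegative integral at once.\<close>

lemma lborel_tan:
  "lborel = distr (density lborel (\<lambda>\<phi>. indicator {- (pi / 2)<..<pi / 2} \<phi> * ennreal (1 / (cos \<phi>)\<^sup>2))) borel tan"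
proof (rule lborel_eqI)
  have tan_m [measurable]: "(tan :: real \<Rightarrow> real) \<in> borel_measurable borel"
    unfolding tan_def by measurable
  fix l u :: real assume "\<And>b. b \<in> Basis \<Longrightarrow> l \<bullet> b \<le> u \<bullet> b"
  then have lu: "l \<le> u" by simp
  have au: "arctan l \<le> arctan u" using lu by (simp add: arctan_le_iff)
  \<comment> \<open>The preimage of an open box is an open interval while the fundamental theorem is
    applied on a closed one; the endpoints are null.\<close>
  have ae: "AE \<phi> in lborel. \<phi> \<noteq> arctan l \<and> \<phi> \<noteq> arctan u"
    by (intro AE_conjI AE_lborel_singleton)
  have "emeasure (distr (density lborel (\<lambda>\<phi>. indicator {- (pi / 2)<..<pi / 2} \<phi> * ennreal (1 / (cos \<phi>)\<^sup>2))) borel tan) (box l u)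
    = (\<integral>\<^sup>+\<phi>. indicator {- (pi / 2)<..<pi / 2} \<phi> * ennreal (1 / (cos \<phi>)\<^sup>2) * indicator (tan -` {l<..<u}) \<phi> \<partial>lborel)"
  proof -
    have "tan -` {l<..<u} \<in> sets lborel"
      using measurable_sets[OF tan_m, of "{l<..<u}"] by simp
    then show ?thesis
      by (subst emeasure_distr) (auto simp: emeasure_density box_real)
  qed
  also have "\<dots> = (\<integral>\<^sup>+\<phi>. ennreal (1 / (cos \<phi>)\<^sup>2) * indicator {arctan l..arctan u} \<phi> \<partial>lborel)"
  proof (rule nn_integral_cong_AE, use ae in eventually_elim)
    case (elim \<phi>)
    have "(- (pi / 2) < \<phi> \<and> \<phi> < pi / 2 \<and> l < tan \<phi> \<and> tan \<phi> < u) \<longleftrightarrow> (arctan l \<le> \<phi> \<and> \<phi> \<le> arctan u)"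
    proof (cases "- (pi / 2) < \<phi> \<and> \<phi> < pi / 2")
      case True
      then have "arctan (tan \<phi>) = \<phi>" by (intro arctan_tan) auto
      then show ?thesis using True elim by (metis arctan_less_iff order_less_le)
    next
      case False
      then show ?thesis using arctan_bounded[of l] arctan_bounded[of u] by linarith
    qed
    then show ?case by (auto simp: indicator_def)
  qed
  also have "\<dots> = ennreal (tan (arctan u) - tan (arctan l))"
  proof (rule nn_integral_FTC_Icc[where F = tan, OF _ _ _ au])
    fix x assume "x \<in> {arctan l..arctan u}"
    then have "cos x \<noteq> 0"
      using arctan_bounded[of l] arctan_bounded[of u] cos_gt_zero_pi[of x] by auto
    then show "DERIV tan x :> 1 / (cos x)\<^sup>2"
      by (auto intro!: derivative_eq_intros simp: divide_inverse)
  qed auto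
  finally show "emeasure (distr (density lborel (\<lambda>\<phi>. indicator {- (pi / 2)<..<pi / 2} \<phi> * ennreal (1 / (cos \<phi>)\<^sup>2))) borel tan) (box l u)
    = (\<Prod>b\<in>Basis. (u - l) \<bullet> b)"
    by (simp add: tan_arctan)
qed simp

lemma tan_measurable [measurable]: "(tan :: real \<Rightarrow> real) \<in> borel_measurable borel"
  unfolding tan_def by measurable

lemma nn_integral_tan:
  fixes g :: "real \<Rightarrow> ennreal"
  assumes [measurable]: "g \<in> borel_measurable borel"
  shows "(\<integral>\<^sup>+s. g s \<partial>lborel)
    = (\<integral>\<^sup>+\<phi>. indicator {- (pi / 2)<..<pi / 2} \<phi> * (ennreal (1 / (cos \<phi>)\<^sup>2) * g (tan \<phi>)) \<partial>lborel)"
  by (subst lborel_tan) (simp add: nn_integral_distr nn_integral_density mult.assoc)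

lemma nn_integral_inverse_1_plus_square: "(\<integral>\<^sup>+s. ennreal (1 / (1 + s\<^sup>2)) \<partial>lborel) = ennreal pi"
proof -
  have "(\<integral>\<^sup>+s. ennreal (1 / (1 + s\<^sup>2)) \<partial>lborel)
    = (\<integral>\<^sup>+\<phi>. indicator {- (pi / 2)<..<pi / 2} \<phi> * (ennreal (1 / (cos \<phi>)\<^sup>2) * ennreal (1 / (1 + (tan \<phi>)\<^sup>2))) \<partial>lborel)"
    by (rule nn_integral_tan) measurable
  also have "\<dots> = (\<integral>\<^sup>+\<phi>. indicator {- (pi / 2)<..<pi / 2} \<phi> \<partial>lborel)"
  proof (rule nn_integral_cong)
    fix \<phi> :: real
    show "indicator {- (pi / 2)<..<pi / 2} \<phi> * (ennreal (1 / (cos \<phi>)\<^sup>2) * ennreal (1 / (1 + (tan \<phi>)\<^sup>2))) = indicator {- (pi / 2)<..<pi / 2} \<phi>"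
    proof (cases "\<phi> \<in> {- (pi / 2)<..<pi / 2}")
      case True
      then have "cos \<phi> > 0" by (intro cos_gt_zero_pi) auto
      then have "1 / (cos \<phi>)\<^sup>2 * (1 / (1 + (tan \<phi>)\<^sup>2)) = 1"
        using tan_sec[of \<phi>] by (simp add: power_inverse divide_inverse)
      then show ?thesis using True by (subst ennreal_mult[symmetric]) auto
    qed simp
  qed
  also have "\<dots> = ennreal pi" by simp
  finally show ?thesis .
qed

lemma nn_integral_periodic_pi:
  fixes G :: "real \<Rightarrow> ennreal"
  assumes [measurable]: "G \<in> borel_measurable borel" and per: "\<And>\<phi>. G (\<phi> + pi) = G \<phi>"
  shows "(\<integral>\<^sup>+\<phi>. indicator {0..pi} \<phi> * G \<phi> \<partial>lborel) = (\<integral>\<^sup>+\<phi>. indicator {- (pi / 2)<..<pi / 2} \<phi> * G \<phi> \<partial>lborel)"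
proof -
  have "(\<integral>\<^sup>+\<phi>. indicator {0..pi} \<phi> * G \<phi> \<partial>lborel)
      = (\<integral>\<^sup>+\<phi>. indicator {0..<pi / 2} \<phi> * G \<phi> + indicator {pi / 2<..<pi} \<phi> * G \<phi> \<partial>lborel)"
  proof (rule nn_integral_cong_AE)
    have "AE \<phi> in lborel. \<phi> \<noteq> pi / 2 \<and> \<phi> \<noteq> pi" by (intro AE_conjI AE_lborel_singleton)
    then show "AE \<phi> in lborel. indicator {0..pi} \<phi> * G \<phi> = indicator {0..<pi / 2} \<phi> * G \<phi> + indicator {pi / 2<..<pi} \<phi> * G \<phi>"
      by eventually_elim (use pi_gt_zero in \<open>auto simp: indicator_def\<close>)
  qed
  also have "\<dots> = (\<integral>\<^sup>+\<phi>. indicator {0..<pi / 2} \<phi> * G \<phi> \<partial>lborel) + (\<integral>\<^sup>+\<phi>. indicator {pi / 2<..<pi} \<phi> * G \<phi> \<partial>lborel)"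
    by (rule nn_integral_add) measurable
  also have "(\<integral>\<^sup>+\<phi>. indicator {pi / 2<..<pi} \<phi> * G \<phi> \<partial>lborel)
      = (\<integral>\<^sup>+\<phi>. indicator {pi / 2<..<pi} (pi + 1 * \<phi>) * G (pi + 1 * \<phi>) \<partial>lborel)"
    by (subst nn_integral_real_affine[where c = 1 and t = pi]) auto
  also have "\<dots> = (\<integral>\<^sup>+\<phi>. indicator {- (pi / 2)<..<0} \<phi> * G \<phi> \<partial>lborel)"
    using per by (intro nn_integral_cong) (auto simp: indicator_def add.commute)
  also have "(\<integral>\<^sup>+\<phi>. indicator {0..<pi / 2} \<phi> * G \<phi> \<partial>lborel) + (\<integral>\<^sup>+\<phi>. indicator {- (pi / 2)<..<0} \<phi> * G \<phi> \<partial>lborel)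
      = (\<integral>\<^sup>+\<phi>. indicator {0..<pi / 2} \<phi> * G \<phi> + indicator {- (pi / 2)<..<0} \<phi> * G \<phi> \<partial>lborel)"
    by (rule nn_integral_add[symmetric]) measurable
  also have "\<dots> = (\<integral>\<^sup>+\<phi>. indicator {- (pi / 2)<..<pi / 2} \<phi> * G \<phi> \<partial>lborel)"
    using pi_gt_zero by (intro nn_integral_cong) (auto simp: indicator_def)
  finally show ?thesis .
qed

lemma nn_integral_reflect:
  fixes f :: "real \<Rightarrow> ennreal"
  assumes [measurable]: "f \<in> borel_measurable borel"
  shows "(\<integral>\<^sup>+x. f (- x) \<partial>lborel) = (\<integral>\<^sup>+x. f x \<partial>lborel)"
  using nn_integral_real_affine[of f "-1" 0] by simp

text \<open>Polar coordinates with a signed radius and a half circle of angles, reached through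
  slopes: \<open>p = q * s\<close>, \<open>s = tan \<phi>\<close>,
  \<open>q = r * cos \<phi>\<close>. The factors \<open>\<bar>q\<bar>\<close>,
  \<open>1 / (cos \<phi>)\<^sup>2\<close> and \<open>cos \<phi>\<close> multiply to
  \<open>\<bar>r\<bar>\<close>.\<close>

lemma nn_integral_polar_half:
  fixes f :: "real \<times> real \<Rightarrow> ennreal"
  assumes [measurable]: "f \<in> borel_measurable borel"
  shows "(\<integral>\<^sup>+w. f w \<partial>lborel) = (\<integral>\<^sup>+\<phi>. indicator {- (pi / 2)<..<pi / 2} \<phi> *
      (\<integral>\<^sup>+r. ennreal \<bar>r\<bar> * f (r * cos \<phi>, r * sin \<phi>) \<partial>lborel) \<partial>lborel)"
proof -
  have "(\<integral>\<^sup>+w. f w \<partial>lborel) = (\<integral>\<^sup>+q. \<integral>\<^sup>+p. f (q, p) \<partial>lborel \<partial>lborel)"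
    by (rule nn_integral_lborel_prod) measurable
  also have "\<dots> = (\<integral>\<^sup>+q. \<integral>\<^sup>+s. ennreal \<bar>q\<bar> * f (q, q * s) \<partial>lborel \<partial>lborel)"
  proof (rule nn_integral_cong_AE)
    have "AE q in lborel. q \<noteq> (0::real)" by (rule AE_lborel_singleton)
    then show "AE q in lborel. (\<integral>\<^sup>+p. f (q, p) \<partial>lborel) = (\<integral>\<^sup>+s. ennreal \<bar>q\<bar> * f (q, q * s) \<partial>lborel)"
    proof eventually_elim
      case (elim q)
      have "(\<integral>\<^sup>+p. f (q, p) \<partial>lborel) = ennreal \<bar>q\<bar> * (\<integral>\<^sup>+s. f (q, 0 + q * s) \<partial>lborel)"
        using elim by (intro nn_integral_real_affine) auto
      then show ?case by (simp add: nn_integral_cmult)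
    qed
  qed
  also have "\<dots> = (\<integral>\<^sup>+s. \<integral>\<^sup>+q. ennreal \<bar>q\<bar> * f (q, q * s) \<partial>lborel \<partial>lborel)"
    by (rule lborel_pair.Fubini') measurable
  also have "\<dots> = (\<integral>\<^sup>+\<phi>. indicator {- (pi / 2)<..<pi / 2} \<phi> * (ennreal (1 / (cos \<phi>)\<^sup>2) *
      (\<integral>\<^sup>+q. ennreal \<bar>q\<bar> * f (q, q * tan \<phi>) \<partial>lborel)) \<partial>lborel)"
    by (rule nn_integral_tan) measurable
  also have "\<dots> = (\<integral>\<^sup>+\<phi>. indicator {- (pi / 2)<..<pi / 2} \<phi> *
      (\<integral>\<^sup>+r. ennreal \<bar>r\<bar> * f (r * cos \<phi>, r * sin \<phi>) \<partial>lborel) \<partial>lborel)"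
  proof (rule nn_integral_cong)
    fix \<phi> :: real
    show "indicator {- (pi / 2)<..<pi / 2} \<phi> * (ennreal (1 / (cos \<phi>)\<^sup>2) * (\<integral>\<^sup>+q. ennreal \<bar>q\<bar> * f (q, q * tan \<phi>) \<partial>lborel))
      = indicator {- (pi / 2)<..<pi / 2} \<phi> * (\<integral>\<^sup>+r. ennreal \<bar>r\<bar> * f (r * cos \<phi>, r * sin \<phi>) \<partial>lborel)"
    proof (cases "\<phi> \<in> {- (pi / 2)<..<pi / 2}")
      case True
      then have c: "cos \<phi> > 0" by (intro cos_gt_zero_pi) auto
      have "(\<integral>\<^sup>+q. ennreal \<bar>q\<bar> * f (q, q * tan \<phi>) \<partial>lborel)
          = ennreal \<bar>cos \<phi>\<bar> * (\<integral>\<^sup>+r. ennreal \<bar>0 + cos \<phi> * r\<bar> * f (0 + cos \<phi> * r, (0 + cos \<phi> * r) * tan \<phi>) \<partial>lborel)"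
        using c by (intro nn_integral_real_affine) auto
      also have "\<dots> = ennreal (cos \<phi>) * (\<integral>\<^sup>+r. ennreal (cos \<phi>) * (ennreal \<bar>r\<bar> * f (r * cos \<phi>, r * sin \<phi>)) \<partial>lborel)"
        using c by (simp add: abs_mult ennreal_mult tan_def mult_ac)
      also have "\<dots> = ennreal ((cos \<phi>)\<^sup>2) * (\<integral>\<^sup>+r. ennreal \<bar>r\<bar> * f (r * cos \<phi>, r * sin \<phi>) \<partial>lborel)"
        using c by (subst nn_integral_cmult) (auto simp: mult.assoc[symmetric] ennreal_mult[symmetric] power2_eq_square)
      finally have "ennreal (1 / (cos \<phi>)\<^sup>2) * (\<integral>\<^sup>+q. ennreal \<bar>q\<bar> * f (q, q * tan \<phi>) \<partial>lborel)
          = (ennreal (1 / (cos \<phi>)\<^sup>2) * ennreal ((cos \<phi>)\<^sup>2)) * (\<integral>\<^sup>+r. ennreal \<bar>r\<bar> * f (r * cos \<phi>, r * sin \<phi>) \<partial>lborel)"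
        by (simp only: mult.assoc)
      also have "ennreal (1 / (cos \<phi>)\<^sup>2) * ennreal ((cos \<phi>)\<^sup>2) = 1"
        using c by (subst ennreal_mult[symmetric]) auto
      finally show ?thesis by simp
    qed simp
  qed
  finally show ?thesis .
qed

lemma nn_integral_polar:
  fixes f :: "real \<times> real \<Rightarrow> ennreal"
  assumes [measurable]: "f \<in> borel_measurable borel"
  shows "(\<integral>\<^sup>+w. f w \<partial>lborel) = (\<integral>\<^sup>+\<phi>. indicator {0..pi} \<phi> *
      (\<integral>\<^sup>+r. ennreal \<bar>r\<bar> * f (r * cos \<phi>, r * sin \<phi>) \<partial>lborel) \<partial>lborel)"
  unfolding nn_integral_polar_half[OF assms]
proof (rule nn_integral_periodic_pi[symmetric])
  fix \<phi> :: real
  show "(\<integral>\<^sup>+r. ennreal \<bar>r\<bar> * f (r * cos (\<phi> + pi), r * sin (\<phi> + pi)) \<partial>lborel)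
      = (\<integral>\<^sup>+r. ennreal \<bar>r\<bar> * f (r * cos \<phi>, r * sin \<phi>) \<partial>lborel)"
    using nn_integral_reflect[of "\<lambda>r. ennreal \<bar>r\<bar> * f (r * cos \<phi>, r * sin \<phi>)"] by simp
qed measurable

lemma nn_integral_quarter_turn:
  fixes f :: "real \<times> real \<Rightarrow> ennreal"
  assumes [measurable]: "f \<in> borel_measurable borel"
  shows "(\<integral>\<^sup>+w. f (- snd w, fst w) \<partial>lborel) = (\<integral>\<^sup>+w. f w \<partial>lborel)"
proof -
  have "(\<integral>\<^sup>+w. f (- snd w, fst w) \<partial>lborel) = (\<integral>\<^sup>+q. \<integral>\<^sup>+p. f (- p, q) \<partial>lborel \<partial>lborel)"
    by (subst nn_integral_lborel_prod(1)) auto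
  also have "\<dots> = (\<integral>\<^sup>+q. \<integral>\<^sup>+p. f (p, q) \<partial>lborel \<partial>lborel)"
    by (intro nn_integral_cong nn_integral_reflect) measurable
  also have "\<dots> = (\<integral>\<^sup>+w. f w \<partial>lborel)"
    by (subst nn_integral_lborel_prod(2)) auto
  finally show ?thesis .
qed

text \<open>The radial direction \<open>(- sin \<phi>, cos \<phi>)\<close> is the one along which
  \<open>radon\<close> integrates at angle \<open>\<phi>\<close>.\<close>

lemma nn_integral_polar_perp:
  fixes f :: "real \<times> real \<Rightarrow> ennreal"
  assumes [measurable]: "f \<in> borel_measurable borel"
  shows "(\<integral>\<^sup>+w. f w \<partial>lborel) = (\<integral>\<^sup>+\<phi>. indicator {0..pi} \<phi> *
      (\<integral>\<^sup>+r. ennreal \<bar>r\<bar> * f (- r * sin \<phi>, r * cos \<phi>) \<partial>lborel) \<partial>lborel)"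
  using nn_integral_polar[of "\<lambda>w. f (- snd w, fst w)"] nn_integral_quarter_turn[OF assms] by simp

text \<open>The polar formula as an image measure, so that it carries over from nonnegative to
  Bochner integrals.\<close>

definition polar_measure :: "(real \<times> real) measure" where
  "polar_measure = density lborel (\<lambda>(\<phi>, r). indicator {0..pi} \<phi> * ennreal \<bar>r\<bar>)"

lemma polar_measure_weight [measurable]:
  "(\<lambda>(\<phi>, r). indicator {0..pi} \<phi> * ennreal \<bar>r\<bar>) \<in> borel_measurable (borel :: (real \<times> real) measure)"
  unfolding borel_prod[symmetric] by measurable

lemma polar_map_measurable [measurable]:
  "(\<lambda>(\<phi>, r). (r * cos \<phi>, r * sin \<phi>)) \<in> borel_measurable (borel :: (real \<times> real) measure)"
  "(\<lambda>(\<phi>, r). (- r * sin \<phi>, r * cos \<phi>)) \<in> borel_measurable (borel :: (real \<times> real) measure)"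
  by (simp_all add: case_prod_beta)

lemma nn_integral_polar_measure:
  assumes [measurable]: "g \<in> borel_measurable borel"
  shows "(\<integral>\<^sup>+p. g p \<partial>polar_measure) = (\<integral>\<^sup>+\<phi>. indicator {0..pi} \<phi> * (\<integral>\<^sup>+r. ennreal \<bar>r\<bar> * g (\<phi>, r) \<partial>lborel) \<partial>lborel)"
  unfolding polar_measure_def
  by (subst nn_integral_density, simp, simp, subst nn_integral_lborel_prod(1))
    (auto simp: nn_integral_cmult[symmetric] mult.assoc)

lemma lborel_polar: "lborel = distr polar_measure borel (\<lambda>(\<phi>, r). (r * cos \<phi>, r * sin \<phi>))"
proof (rule measure_eqI)
  fix A :: "(real \<times> real) set" assume "A \<in> sets lborel"
  then have [measurable]: "A \<in> sets borel" by simp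
  have "emeasure lborel A = (\<integral>\<^sup>+w. indicator A w \<partial>lborel)" by simp
  also have "\<dots> = (\<integral>\<^sup>+p. indicator A (case p of (\<phi>, r) \<Rightarrow> (r * cos \<phi>, r * sin \<phi>)) \<partial>polar_measure)"
    by (subst nn_integral_polar, simp, subst nn_integral_polar_measure) (simp_all add: polar_measure_def)
  also have "\<dots> = (\<integral>\<^sup>+w. indicator A w \<partial>distr polar_measure borel (\<lambda>(\<phi>, r). (r * cos \<phi>, r * sin \<phi>)))"
    by (subst nn_integral_distr) (simp_all add: polar_measure_def)
  finally show "emeasure lborel A = emeasure (distr polar_measure borel (\<lambda>(\<phi>, r). (r * cos \<phi>, r * sin \<phi>))) A"
    by simp
qed simp

lemma lborel_polar_perp: "lborel = distr polar_measure borel (\<lambda>(\<phi>, r). (- r * sin \<phi>, r * cos \<phi>))"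
proof (rule measure_eqI)
  fix A :: "(real \<times> real) set" assume "A \<in> sets lborel"
  then have [measurable]: "A \<in> sets borel" by simp
  have "emeasure lborel A = (\<integral>\<^sup>+w. indicator A w \<partial>lborel)" by simp
  also have "\<dots> = (\<integral>\<^sup>+p. indicator A (case p of (\<phi>, r) \<Rightarrow> (- r * sin \<phi>, r * cos \<phi>)) \<partial>polar_measure)"
    by (subst nn_integral_polar_perp, simp, subst nn_integral_polar_measure) (simp_all add: polar_measure_def)
  also have "\<dots> = (\<integral>\<^sup>+w. indicator A w \<partial>distr polar_measure borel (\<lambda>(\<phi>, r). (- r * sin \<phi>, r * cos \<phi>)))"
    by (subst nn_integral_distr) (simp_all add: polar_measure_def)
  finally show "emeasure lborel A = emeasure (distr polar_measure borel (\<lambda>(\<phi>, r). (- r * sin \<phi>, r * cos \<phi>))) A"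
    by simp
qed simp

lemma polar_Bochner:
  fixes f :: "real \<times> real \<Rightarrow> 'b::{banach, second_countable_topology}"
  assumes f: "integrable lborel f"
    and T: "lborel = distr polar_measure borel T" and T_m [measurable]: "T \<in> borel_measurable borel"
  shows "integrable lborel (\<lambda>p. (indicator {0..pi} (fst p) * \<bar>snd p\<bar>) *\<^sub>R f (T p))"
    and "(LINT w|lborel. f w) = (LINT \<phi>|lborel. indicator {0..pi} \<phi> *\<^sub>R (LINT r|lborel. \<bar>r\<bar> *\<^sub>R f (T (\<phi>, r))))"
proof -
  have fm [measurable]: "f \<in> borel_measurable borel" using f by (auto dest: borel_measurable_integrable)
  have pm: "polar_measure = density lborel (\<lambda>p. ennreal (indicator {0..pi} (fst p) * \<bar>snd p\<bar>))"
    unfolding polar_measure_def by (rule arg_cong[where f = "density lborel"]) (auto simp: fun_eq_iff indicator_def)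
  have Tm' [measurable]: "T \<in> measurable polar_measure borel" by (simp add: polar_measure_def)
  have "integrable (distr polar_measure borel T) f" using f unfolding T[symmetric] .
  then have "integrable polar_measure (\<lambda>p. f (T p))"
    by (subst (asm) integrable_distr_eq) auto
  then show i: "integrable lborel (\<lambda>p. (indicator {0..pi} (fst p) * \<bar>snd p\<bar>) *\<^sub>R f (T p))"
    unfolding pm by (subst (asm) integrable_density) auto
  have "(LINT w|lborel. f w) = (LINT w|distr polar_measure borel T. f w)" unfolding T[symmetric] ..
  also have "\<dots> = (LINT p|polar_measure. f (T p))" by (rule integral_distr) auto
  also have "\<dots> = (LINT p|lborel. (indicator {0..pi} (fst p) * \<bar>snd p\<bar>) *\<^sub>R f (T p))"
    unfolding pm by (subst integral_density) auto
  also have "\<dots> = (LINT \<phi>|lborel. LINT r|lborel. (indicator {0..pi} \<phi> * \<bar>r\<bar>) *\<^sub>R f (T (\<phi>, r)))"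
    using lborel_pair.integral_fst'[of "\<lambda>p. (indicator {0..pi} (fst p) * \<bar>snd p\<bar>) *\<^sub>R f (T p)"] i
    by (simp add: lborel_prod)
  also have "\<dots> = (LINT \<phi>|lborel. indicator {0..pi} \<phi> *\<^sub>R (LINT r|lborel. \<bar>r\<bar> *\<^sub>R f (T (\<phi>, r))))"
    by (simp flip: scaleR_scaleR)
  finally show "(LINT w|lborel. f w) = (LINT \<phi>|lborel. indicator {0..pi} \<phi> *\<^sub>R (LINT r|lborel. \<bar>r\<bar> *\<^sub>R f (T (\<phi>, r))))" .
qed

section \<open>Rotations\<close>

definition rotate :: "real \<Rightarrow> real \<times> real \<Rightarrow> real \<times> real" where
  "rotate \<phi> p = (fst p * cos \<phi> - snd p * sin \<phi>, fst p * sin \<phi> + snd p * cos \<phi>)"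

lemma rotate_measurable [measurable]: "rotate \<phi> \<in> borel_measurable borel"
  unfolding rotate_def[abs_def] by measurable

text \<open>Two one-dimensional substitutions do the rotation; they divide by
  \<open>cos \<phi>\<close>, and the angles excluded thereby are countable.\<close>

lemma nn_integral_rotation:
  fixes f :: "real \<times> real \<Rightarrow> ennreal"
  assumes [measurable]: "f \<in> borel_measurable borel" and c: "cos \<phi> \<noteq> 0"
  shows "(\<integral>\<^sup>+p. f (rotate \<phi> p) \<partial>lborel) = (\<integral>\<^sup>+w. f w \<partial>lborel)"
proof -
  define c s where "c = cos \<phi>" and "s = sin \<phi>"
  have cs: "c \<noteq> 0" "c * c + s * s = 1"
    using assms(2) sin_cos_squared_add[of \<phi>] by (auto simp: c_def s_def power2_eq_square algebra_simps)
  have ac: "ennreal (1 / \<bar>c\<bar>) * ennreal \<bar>c\<bar> = 1" using cs by (subst ennreal_mult[symmetric]) auto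
  have "(\<integral>\<^sup>+p. f (fst p * c - snd p * s, fst p * s + snd p * c) \<partial>lborel)
      = (\<integral>\<^sup>+t. \<integral>\<^sup>+x. f (x * c - t * s, x * s + t * c) \<partial>lborel \<partial>lborel)"
    by (subst nn_integral_lborel_prod(2)) auto
  also have "\<dots> = (\<integral>\<^sup>+t. \<integral>\<^sup>+q. ennreal (1 / \<bar>c\<bar>) * f (q, q * s / c + t / c) \<partial>lborel \<partial>lborel)"
  proof (rule nn_integral_cong)
    fix t
    have "(\<integral>\<^sup>+x. f (x * c - t * s, x * s + t * c) \<partial>lborel)
      = ennreal \<bar>1 / c\<bar> * (\<integral>\<^sup>+q. f ((t * s / c + 1 / c * q) * c - t * s, (t * s / c + 1 / c * q) * s + t * c) \<partial>lborel)"
      using cs by (intro nn_integral_real_affine) auto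
    also have "(\<lambda>q. f ((t * s / c + 1 / c * q) * c - t * s, (t * s / c + 1 / c * q) * s + t * c)) = (\<lambda>q. f (q, q * s / c + t / c))"
    proof
      fix q
      have "(t * s / c + 1 / c * q) * s + t * c = q * s / c + t * (c * c + s * s) / c"
        using cs(1) by (simp add: field_simps)
      then show "f ((t * s / c + 1 / c * q) * c - t * s, (t * s / c + 1 / c * q) * s + t * c) = f (q, q * s / c + t / c)"
        using cs by (simp add: field_simps)
    qed
    finally show "(\<integral>\<^sup>+x. f (x * c - t * s, x * s + t * c) \<partial>lborel) = (\<integral>\<^sup>+q. ennreal (1 / \<bar>c\<bar>) * f (q, q * s / c + t / c) \<partial>lborel)"
      by (simp add: nn_integral_cmult)
  qed
  also have "\<dots> = (\<integral>\<^sup>+q. \<integral>\<^sup>+t. ennreal (1 / \<bar>c\<bar>) * f (q, q * s / c + t / c) \<partial>lborel \<partial>lborel)"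
    by (rule lborel_pair.Fubini') measurable
  also have "\<dots> = (\<integral>\<^sup>+q. \<integral>\<^sup>+p. f (q, p) \<partial>lborel \<partial>lborel)"
  proof (rule nn_integral_cong)
    fix q
    have "(\<integral>\<^sup>+t. ennreal (1 / \<bar>c\<bar>) * f (q, q * s / c + t / c) \<partial>lborel)
        = ennreal \<bar>c\<bar> * (\<integral>\<^sup>+p. ennreal (1 / \<bar>c\<bar>) * f (q, q * s / c + (- q * s + c * p) / c) \<partial>lborel)"
      using cs by (intro nn_integral_real_affine) auto
    also have "(\<lambda>p. ennreal (1 / \<bar>c\<bar>) * f (q, q * s / c + (- q * s + c * p) / c)) = (\<lambda>p. ennreal (1 / \<bar>c\<bar>) * f (q, p))"
      using cs(1) by (simp add: fun_eq_iff add_divide_distrib diff_divide_distrib)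
    also have "ennreal \<bar>c\<bar> * (\<integral>\<^sup>+p. ennreal (1 / \<bar>c\<bar>) * f (q, p) \<partial>lborel) = (\<integral>\<^sup>+p. f (q, p) \<partial>lborel)"
      by (subst nn_integral_cmult) (simp_all add: mult.assoc[symmetric] mult.commute[of "ennreal \<bar>c\<bar>"] ac)
    finally show "(\<integral>\<^sup>+t. ennreal (1 / \<bar>c\<bar>) * f (q, q * s / c + t / c) \<partial>lborel) = (\<integral>\<^sup>+p. f (q, p) \<partial>lborel)" .
  qed
  also have "\<dots> = (\<integral>\<^sup>+w. f w \<partial>lborel)" by (subst nn_integral_lborel_prod(1)) auto
  finally show ?thesis by (simp add: c_def s_def rotate_def)
qed

lemma lborel_rotation:
  assumes "cos \<phi> \<noteq> 0"
  shows "lborel = distr lborel borel (rotate \<phi>)"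
proof (rule measure_eqI)
  fix A :: "(real \<times> real) set" assume "A \<in> sets lborel"
  then have [measurable]: "A \<in> sets borel" by simp
  have "emeasure lborel A = (\<integral>\<^sup>+w. indicator A w \<partial>lborel)" by simp
  also have "\<dots> = (\<integral>\<^sup>+w. indicator A w \<partial>distr lborel borel (rotate \<phi>))"
    by (subst nn_integral_distr) (simp_all add: nn_integral_rotation assms)
  finally show "emeasure lborel A = emeasure (distr lborel borel (rotate \<phi>)) A"
    by simp
qed simp

lemma integral_rotation:
  fixes f :: "real \<times> real \<Rightarrow> 'b::{banach, second_countable_topology}"
  assumes c: "cos \<phi> \<noteq> 0" and [measurable]: "f \<in> borel_measurable borel"
  shows "(LINT p|lborel. f (rotate \<phi> p)) = (LINT w|lborel. f w)"
    and "integrable lborel (\<lambda>p. f (rotate \<phi> p)) \<longleftrightarrow> integrable lborel f"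
proof -
  let ?T = "rotate \<phi>"
  have "(LINT w|lborel. f w) = (LINT w|distr lborel borel ?T. f w)" unfolding lborel_rotation[OF c, symmetric] ..
  then show "(LINT p|lborel. f (rotate \<phi> p)) = (LINT w|lborel. f w)"
    by (simp add: integral_distr)
  have "integrable lborel f = integrable (distr lborel borel ?T) f" unfolding lborel_rotation[OF c, symmetric] ..
  then show "integrable lborel (\<lambda>p. f (rotate \<phi> p)) \<longleftrightarrow> integrable lborel f"
    by (simp add: integrable_distr_eq)
qed

lemma AE_cos_nonzero: "AE \<phi> in lborel. cos \<phi> \<noteq> (0::real)"
proof -
  have "{\<phi>::real. cos \<phi> = 0} \<subseteq> range (\<lambda>k::int. of_int k * (pi / 2))"
    by (auto simp: cos_zero_iff_int)
  then have "countable {\<phi>::real. cos \<phi> = 0}" by (rule countable_subset) simp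
  then have "{\<phi>::real. cos \<phi> = 0} \<in> null_sets lborel" by (rule countable_imp_null_set_lborel)
  from AE_not_in[OF this] show ?thesis by simp
qed

text \<open>The map \<open>s \<mapsto> - 1 / s\<close> is a quarter turn of the angle:
  \<open>tan (\<phi> + pi / 2) = - 1 / tan \<phi>\<close>, and the measure is invariant under
  turns.\<close>

lemma nn_integral_inversion:
  fixes g :: "real \<Rightarrow> ennreal"
  assumes [measurable]: "g \<in> borel_measurable borel"
  shows "(\<integral>\<^sup>+s. ennreal (1 / s\<^sup>2) * g (- 1 / s) \<partial>lborel) = (\<integral>\<^sup>+s. g s \<partial>lborel)"
proof -
  define G where "G \<phi> = ennreal (1 / (cos \<phi>)\<^sup>2) * g (tan \<phi>)" for \<phi>
  have [measurable]: "G \<in> borel_measurable borel" unfolding G_def by measurable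
  have per: "G (\<phi> + pi) = G \<phi>" for \<phi> by (simp add: G_def)
  have "(\<integral>\<^sup>+s. g s \<partial>lborel) = (\<integral>\<^sup>+\<phi>. indicator {- (pi / 2)<..<pi / 2} \<phi> * G \<phi> \<partial>lborel)"
    unfolding G_def by (rule nn_integral_tan) measurable
  also have "\<dots> = (\<integral>\<^sup>+\<phi>. indicator {0..pi} \<phi> * G \<phi> \<partial>lborel)"
    by (rule nn_integral_periodic_pi[symmetric]) (auto simp: per)
  also have "\<dots> = (\<integral>\<^sup>+\<phi>. indicator {0..pi} (pi / 2 + 1 * \<phi>) * G (pi / 2 + 1 * \<phi>) \<partial>lborel)"
    by (subst nn_integral_real_affine[where c = 1 and t = "pi / 2"]) auto
  also have "\<dots> = (\<integral>\<^sup>+\<phi>. indicator {- (pi / 2)<..<pi / 2} \<phi> * (ennreal (1 / (cos \<phi>)\<^sup>2) * (ennreal (1 / (tan \<phi>)\<^sup>2) * g (- 1 / tan \<phi>))) \<partial>lborel)"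
  proof (rule nn_integral_cong_AE)
    have "AE \<phi> in lborel. \<phi> \<noteq> - (pi / 2) \<and> \<phi> \<noteq> pi / 2 \<and> \<phi> \<noteq> 0" by (intro AE_conjI AE_lborel_singleton)
    then show "AE \<phi> in lborel. indicator {0..pi} (pi / 2 + 1 * \<phi>) * G (pi / 2 + 1 * \<phi>)
      = indicator {- (pi / 2)<..<pi / 2} \<phi> * (ennreal (1 / (cos \<phi>)\<^sup>2) * (ennreal (1 / (tan \<phi>)\<^sup>2) * g (- 1 / tan \<phi>)))"
    proof eventually_elim
      case (elim \<phi>)
      show ?case
      proof (cases "\<phi> \<in> {- (pi / 2)<..<pi / 2}")
        case True
        then have c: "cos \<phi> > 0" by (intro cos_gt_zero_pi) auto
        have "sin \<phi> \<noteq> 0"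
        proof
          assume "sin \<phi> = 0"
          then have "\<phi> = 0" using True sin_gt_zero[of \<phi>] sin_gt_zero[of "- \<phi>"] by (cases \<phi> "0::real" rule: linorder_cases) auto
          with elim show False by simp
        qed
        have "cos (pi / 2 + \<phi>) = - sin \<phi>" "sin (pi / 2 + \<phi>) = cos \<phi>"
          by (simp_all add: cos_add sin_add)
        then have "G (pi / 2 + \<phi>) = ennreal (1 / (sin \<phi>)\<^sup>2) * g (- 1 / tan \<phi>)"
          by (simp add: G_def tan_def)
        also have "ennreal (1 / (sin \<phi>)\<^sup>2) = ennreal (1 / (cos \<phi>)\<^sup>2) * ennreal (1 / (tan \<phi>)\<^sup>2)"
          using c by (subst ennreal_mult[symmetric]) (auto simp: tan_def power_divide)
        finally show ?thesis using True by (simp add: mult.assoc indicator_def)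
      qed (use elim in \<open>auto simp: indicator_def\<close>)
    qed
  qed
  also have "\<dots> = (\<integral>\<^sup>+s. ennreal (1 / s\<^sup>2) * g (- 1 / s) \<partial>lborel)"
    by (rule nn_integral_tan[symmetric]) measurable
  finally show ?thesis ..
qed

section \<open>Integrability of the Wigner function along lines\<close>

lemma norm_measurable [measurable]: "norm \<in> borel_measurable (borel :: 'a::real_normed_vector measure)"
  by (intro borel_measurable_continuous_onI continuous_intros)

lemma unit_ball_measurable [measurable]: "cball (0 :: real \<times> real) 1 \<in> sets borel"
  by (simp add: borel_closed)

lemma nn_integral_product_weight:
  "(\<integral>\<^sup>+w. ennreal (1 / ((1 + (fst w)\<^sup>2) * (1 + (snd w)\<^sup>2))) \<partial>lborel) = ennreal (pi\<^sup>2)"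
proof -
  have "(\<integral>\<^sup>+w. ennreal (1 / ((1 + (fst w)\<^sup>2) * (1 + (snd w)\<^sup>2))) \<partial>lborel)
    = (\<integral>\<^sup>+x. \<integral>\<^sup>+y. ennreal (1 / (1 + x\<^sup>2)) * ennreal (1 / (1 + y\<^sup>2)) \<partial>lborel \<partial>lborel)"
    by (subst nn_integral_lborel_prod(1)) (auto simp: ennreal_mult[symmetric])
  also have "\<dots> = ennreal pi * ennreal pi"
    by (simp add: nn_integral_cmult nn_integral_multc nn_integral_inverse_1_plus_square)
  finally show ?thesis by (simp add: ennreal_mult[symmetric] power2_eq_square)
qed

lemma product_weight_le: "(1 + (fst w)\<^sup>2) * (1 + (snd w)\<^sup>2) \<le> (1 + (norm (w :: real \<times> real))\<^sup>2)\<^sup>2"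
  unfolding norm_prod_square power2_eq_square[of "1 + _"] by (intro mult_mono) auto

lemma nn_integral_exp_norm_finite:
  assumes "c > 0"
  shows "(\<integral>\<^sup>+w. ennreal (exp (- c * norm (w :: real \<times> real))) \<partial>lborel) < \<infinity>"
proof -
  \<comment> \<open>From \<open>(1 + r\<^sup>2)\<^sup>2 \<le> 2 + 2 * r ^ 4\<close> and
    \<open>r ^ 4 \<le> (4 / c) ^ 4 * exp (c * r)\<close>.\<close>
  define K where "K = 2 + 2 * (4 / c) ^ 4"
  have K: "K \<ge> 0" by (simp add: K_def)
  have "(\<integral>\<^sup>+w. ennreal (exp (- c * norm (w :: real \<times> real))) \<partial>lborel)
      \<le> (\<integral>\<^sup>+w. ennreal K * ennreal (1 / ((1 + (fst w)\<^sup>2) * (1 + (snd w)\<^sup>2))) \<partial>lborel)"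
  proof (rule nn_integral_mono)
    fix w :: "real \<times> real"
    define r where "r = norm w"
    have r: "r \<ge> 0" by (simp add: r_def)
    have "c * r / 4 \<le> exp (c * r / 4)" using exp_ge_add_one_self[of "c * r / 4"] by linarith
    then have "(c * r / 4) ^ 4 \<le> exp (c * r / 4) ^ 4"
      using assms r by (intro power_mono) auto
    also have "\<dots> = exp (c * r)" by (simp add: exp_of_nat_mult[symmetric])
    finally have "(4 / c) ^ 4 * (c * r / 4) ^ 4 \<le> (4 / c) ^ 4 * exp (c * r)"
      using assms by (intro mult_left_mono) auto
    then have r4: "r ^ 4 \<le> (4 / c) ^ 4 * exp (c * r)"
      using assms by (simp add: power_mult_distrib[symmetric])
    have "(1 + r\<^sup>2)\<^sup>2 \<le> 2 + 2 * r ^ 4"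
      using zero_le_power2[of "1 - r\<^sup>2"] by (simp add: power2_eq_square power4_eq_xxxx algebra_simps)
    also have "\<dots> \<le> 2 * exp (c * r) + 2 * ((4 / c) ^ 4 * exp (c * r))"
      using assms r r4 one_le_exp_iff[of "c * r"] by (intro add_mono) (auto intro: mult_left_mono)
    finally have "(1 + (fst w)\<^sup>2) * (1 + (snd w)\<^sup>2) \<le> K * exp (c * r)"
      using product_weight_le[of w] by (simp add: K_def r_def algebra_simps)
    moreover have "(1 + (fst w)\<^sup>2) * (1 + (snd w)\<^sup>2) > 0"
      by (intro mult_pos_pos add_pos_nonneg) auto
    ultimately have "exp (- c * r) \<le> K * (1 / ((1 + (fst w)\<^sup>2) * (1 + (snd w)\<^sup>2)))"
      by (simp add: exp_minus field_simps)
    then show "ennreal (exp (- c * norm w)) \<le> ennreal K * ennreal (1 / ((1 + (fst w)\<^sup>2) * (1 + (snd w)\<^sup>2)))"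
      using K by (subst ennreal_mult[symmetric]) (auto intro!: ennreal_leI simp: r_def)
  qed
  also have "\<dots> = ennreal K * ennreal (pi\<^sup>2)"
    by (subst nn_integral_cmult) (auto simp: nn_integral_product_weight)
  also have "\<dots> < \<infinity>" by (simp add: ennreal_mult_less_top)
  finally show ?thesis .
qed

lemma nn_integral_norm_weight:
  "(\<integral>\<^sup>+y. ennreal ((1 / (1 + norm (y :: real \<times> real))) ^ 4) \<partial>lborel) \<le> ennreal (pi\<^sup>2)"
  unfolding nn_integral_product_weight[symmetric]
proof (rule nn_integral_mono)
  fix y :: "real \<times> real"
  have "1 + (norm y)\<^sup>2 \<le> (1 + norm y)\<^sup>2" by (simp add: power2_sum)
  then have "(1 + (norm y)\<^sup>2)\<^sup>2 \<le> ((1 + norm y)\<^sup>2)\<^sup>2" by (intro power_mono) auto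
  also have "\<dots> = (1 + norm y) ^ 4" by simp
  finally have "(1 + (fst y)\<^sup>2) * (1 + (snd y)\<^sup>2) \<le> (1 + norm y) ^ 4"
    using product_weight_le[of y] by simp
  moreover have "(1 + (fst y)\<^sup>2) * (1 + (snd y)\<^sup>2) > 0"
    by (intro mult_pos_pos add_pos_nonneg) auto
  ultimately have "1 / (1 + norm y) ^ 4 \<le> 1 / ((1 + (fst y)\<^sup>2) * (1 + (snd y)\<^sup>2))"
    by (intro divide_left_mono mult_pos_pos zero_less_power) (auto intro: add_pos_nonneg)
  then show "ennreal ((1 / (1 + norm y)) ^ 4) \<le> ennreal (1 / ((1 + (fst y)\<^sup>2) * (1 + (snd y)\<^sup>2)))"
    by (intro ennreal_leI) (simp add: power_divide)
qed

text \<open>The polar Jacobian cancels the singularity at the origin.\<close>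

lemma nn_integral_inverse_norm_ball:
  "(\<integral>\<^sup>+y. ennreal (indicator (cball 0 1) y / norm (y :: real \<times> real)) \<partial>lborel) \<le> ennreal (2 * pi)"
proof -
  have "(\<integral>\<^sup>+y. ennreal (indicator (cball 0 1) y / norm (y :: real \<times> real)) \<partial>lborel)
    = (\<integral>\<^sup>+\<phi>. indicator {0..pi} \<phi> * (\<integral>\<^sup>+r. ennreal \<bar>r\<bar> * ennreal (indicator (cball 0 1) (r * cos \<phi>, r * sin \<phi>) / norm (r * cos \<phi>, r * sin \<phi>)) \<partial>lborel) \<partial>lborel)"
    by (rule nn_integral_polar) measurable
  also have "\<dots> \<le> (\<integral>\<^sup>+\<phi>. indicator {0..pi} \<phi> * (\<integral>\<^sup>+r. indicator {-1..1::real} r \<partial>lborel) \<partial>lborel)"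
  proof (intro nn_integral_mono mult_left_mono)
    fix \<phi> r :: real
    have "norm (r * cos \<phi>, r * sin \<phi>) = \<bar>r\<bar>"
      by (simp add: norm_Pair power_mult_distrib distrib_left[symmetric])
    then show "ennreal \<bar>r\<bar> * ennreal (indicator (cball 0 1) (r * cos \<phi>, r * sin \<phi>) / norm (r * cos \<phi>, r * sin \<phi>)) \<le> indicator {-1..1} r"
      by (subst ennreal_mult[symmetric]) (auto simp: indicator_def abs_le_iff)
  qed auto
  also have "\<dots> = ennreal (2 * pi)"
  proof -
    have "(\<integral>\<^sup>+r. indicator {-1..1::real} r \<partial>lborel) = 2" by simp
    then have "(\<integral>\<^sup>+\<phi>. indicator {0..pi} \<phi> * (\<integral>\<^sup>+r. indicator {-1..1::real} r \<partial>lborel) \<partial>lborel) = ennreal pi * 2"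
      by (subst nn_integral_multc) simp_all
    then show ?thesis by (simp add: ennreal_mult mult.commute)
  qed
  finally show ?thesis .
qed

text \<open>The multiplication formula of Fourier analysis. The map \<open>T\<close> allows the
  phase to be read in the original or in rotated coordinates.\<close>

lemma integral_cis_swap:
  fixes F :: "'a::euclidean_space \<Rightarrow> complex" and k :: "'b::euclidean_space \<Rightarrow> complex" and T :: "'b \<Rightarrow> 'a"
  assumes F: "integrable lborel F" and k: "integrable lborel k" and T [measurable]: "T \<in> borel_measurable borel"
  shows "(LINT p|lborel. (LINT w|lborel. F w * cis (w \<bullet> T p)) * k p) = (LINT w|lborel. F w * (LINT p|lborel. k p * cis (w \<bullet> T p)))"
proof -
  have [measurable]: "F \<in> borel_measurable borel" "k \<in> borel_measurable borel"
    using F k by (auto dest: borel_measurable_integrable)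
  have big: "integrable (lborel \<Otimes>\<^sub>M lborel) (\<lambda>(w, p). F w * (k p * cis (w \<bullet> T p)))"
  proof (rule Bochner_Integration.integrable_bound)
    show "integrable (lborel \<Otimes>\<^sub>M lborel) (\<lambda>q. F (fst q) * k (snd q))"
      using lborel_prod_integrable(1)[OF F k] by (simp add: lborel_prod)
    show "(\<lambda>(w, p). F w * (k p * cis (w \<bullet> T p))) \<in> borel_measurable (lborel \<Otimes>\<^sub>M lborel)"
      by measurable
  qed (auto simp: norm_mult)
  have "(LINT p|lborel. (LINT w|lborel. F w * cis (w \<bullet> T p)) * k p) = (LINT p|lborel. LINT w|lborel. F w * (k p * cis (w \<bullet> T p)))"
    by (intro Bochner_Integration.integral_cong refl)
      (subst integral_mult_left_zero[symmetric], simp add: mult_ac)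
  also have "\<dots> = (LINT w|lborel. LINT p|lborel. F w * (k p * cis (w \<bullet> T p)))"
    by (rule lborel_pair.Fubini_integral) (rule big)
  also have "\<dots> = (LINT w|lborel. F w * (LINT p|lborel. k p * cis (w \<bullet> T p)))"
    by simp
  finally show ?thesis .
qed

lemma ennreal_le_mult_add:
  assumes "x \<le> a * b + c * d" "0 \<le> a" "0 \<le> b" "0 \<le> c" "0 \<le> d"
  shows "ennreal x \<le> ennreal a * ennreal b + ennreal c * ennreal d"
  using ennreal_leI[OF assms(1)] assms(2-) by (simp add: ennreal_plus ennreal_mult)

text \<open>Where \<open>b > \<tau>\<close>, the product is at most
  \<open>a * b\<^sup>2 / \<tau>\<close>, the geometric mean of \<open>a\<^sup>2 / \<tau> ^ 3\<close>
  and \<open>\<tau> * b ^ 4\<close>. The fourth power matters: for \<open>b = 1 / (1 + |y|)\<close>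
  the square is not integrable on the plane, but \<open>b ^ 4\<close> is.\<close>

lemma tail_weight_inequality:
  fixes a b \<tau> :: real
  assumes "a \<ge> 0" "b \<ge> 0" "\<tau> > 0"
  shows "a * b \<le> \<tau> * a + (a\<^sup>2 / \<tau> ^ 3 + \<tau> * b ^ 4) / 2"
proof (cases "b \<le> \<tau>")
  case True
  then have "a * b \<le> \<tau> * a" using mult_left_mono[OF True assms(1)] by (simp add: mult.commute)
  moreover have "(a\<^sup>2 / \<tau> ^ 3 + \<tau> * b ^ 4) / 2 \<ge> 0" using assms by auto
  ultimately show ?thesis by linarith
next
  case False
  have "0 \<le> (a - b\<^sup>2 * \<tau>\<^sup>2)\<^sup>2 / \<tau> ^ 3" using assms by auto
  also have "\<dots> = a\<^sup>2 / \<tau> ^ 3 + \<tau> * b ^ 4 - 2 * (a * b\<^sup>2 / \<tau>)"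
    using assms by (simp add: field_simps power2_eq_square power3_eq_cube power4_eq_xxxx)
  finally have *: "0 \<le> a\<^sup>2 / \<tau> ^ 3 + \<tau> * b ^ 4 - 2 * (a * b\<^sup>2 / \<tau>)" .
  have "y \<le> x / 2" if "0 \<le> x - 2 * y" for x y :: real using that by simp
  from this[OF *] have "a * b\<^sup>2 / \<tau> \<le> (a\<^sup>2 / \<tau> ^ 3 + \<tau> * b ^ 4) / 2" .
  moreover have "a * b * 1 \<le> a * b * (b / \<tau>)"
    using assms False by (intro mult_left_mono) auto
  then have "a * b \<le> a * b\<^sup>2 / \<tau>" by (simp add: power2_eq_square)
  ultimately have "a * b \<le> (a\<^sup>2 / \<tau> ^ 3 + \<tau> * b ^ 4) / 2" by (rule order_trans[rotated])
  moreover have "\<tau> * a \<ge> 0" using assms by simp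
  ultimately show ?thesis by (rule add_increasing[rotated])
qed

text \<open>The interface between operators and analysis: what follows uses only these properties of
  \<open>F\<close>. The positivity of \<open>\<rho>\<close> survives in
  \<open>F_gauss_L1\<close>.\<close>

locale wigner_transform =
  fixes F :: "real \<times> real \<Rightarrow> complex" and W :: "real \<times> real \<Rightarrow> real" and \<beta> :: real
  assumes beta_pos: "\<beta> > 0"
    and F_cont: "continuous_on UNIV F"
    and F_bound: "\<And>w. cmod (F w) \<le> 1"
    and F_0: "F 0 = 1"
    and F_decay: "(\<integral>\<^sup>+w. ennreal ((cmod (F w))\<^sup>2 * exp (2 * \<beta> * norm w)) \<partial>lborel) < \<infinity>"
    and F_gauss_L1: "\<And>d. (\<integral>\<^sup>+z. ennreal (cmod (LINT w|lborel. F w * gauss_char d z w)) \<partial>lborel) \<le> ennreal (4 * pi\<^sup>2)"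
    and W_inv: "\<And>z. complex_of_real (W z) = inv_fourier2 F z"
begin

lemma F_measurable [measurable]: "F \<in> borel_measurable borel"
  using F_cont by (rule borel_measurable_continuous_onI)

lemma F_nn_integrable: "(\<integral>\<^sup>+w. ennreal (cmod (F w)) \<partial>lborel) < \<infinity>"
proof -
  have "(\<integral>\<^sup>+w. ennreal (cmod (F w)) \<partial>lborel) \<le> (\<integral>\<^sup>+w. ennreal ((cmod (F w))\<^sup>2 * exp (2 * \<beta> * norm w)) + ennreal (exp (- (2 * \<beta>) * norm w)) \<partial>lborel)"
  proof (rule nn_integral_mono)
    fix w
    define a b where "a = cmod (F w) * exp (\<beta> * norm w)" and "b = exp (- \<beta> * norm w)"
    have "cmod (F w) = a * b" by (simp add: a_def b_def exp_minus)
    also have "\<dots> \<le> a\<^sup>2 + b\<^sup>2"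
    proof -
      have "0 \<le> a * b" by (simp add: a_def b_def)
      moreover have "2 * (a * b) \<le> a\<^sup>2 + b\<^sup>2" using sum_squares_bound[of a b] by (simp add: mult.assoc)
      ultimately show ?thesis by linarith
    qed
    also have "a\<^sup>2 = (cmod (F w))\<^sup>2 * exp (2 * \<beta> * norm w)"
      by (simp add: a_def power_mult_distrib exp_double[symmetric] mult.assoc)
    also have "b\<^sup>2 = exp (- (2 * \<beta>) * norm w)"
      by (simp add: b_def exp_double[symmetric])
    finally have "ennreal (cmod (F w)) \<le> ennreal ((cmod (F w))\<^sup>2 * exp (2 * \<beta> * norm w) + exp (- (2 * \<beta>) * norm w))"
      by (rule ennreal_leI)
    also have "\<dots> = ennreal ((cmod (F w))\<^sup>2 * exp (2 * \<beta> * norm w)) + ennreal (exp (- (2 * \<beta>) * norm w))"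
      by (rule ennreal_plus) auto
    finally show "ennreal (cmod (F w)) \<le> ennreal ((cmod (F w))\<^sup>2 * exp (2 * \<beta> * norm w)) + ennreal (exp (- (2 * \<beta>) * norm w))" .
  qed
  also have "\<dots> = (\<integral>\<^sup>+w. ennreal ((cmod (F w))\<^sup>2 * exp (2 * \<beta> * norm w)) \<partial>lborel) + (\<integral>\<^sup>+w. ennreal (exp (- (2 * \<beta>) * norm (w :: real \<times> real))) \<partial>lborel)"
    by (rule nn_integral_add) measurable
  also have "\<dots> < \<infinity>"
    using F_decay nn_integral_exp_norm_finite[of "2 * \<beta>"] beta_pos by (simp add: ennreal_add_less_top)
  finally show ?thesis .
qed

lemma F_integrable: "integrable lborel F"
  by (rule integrableI_bounded) (use F_nn_integrable in simp_all)

lemma F_cis_integrable: "integrable lborel (\<lambda>w. F w * cis (w \<bullet> y))"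
  by (rule Bochner_Integration.integrable_bound[OF F_integrable]) (auto simp: norm_mult)

lemma W_eq: "complex_of_real (W z) = of_real (1 / (4 * pi\<^sup>2)) * (LINT w|lborel. F w * cis (w \<bullet> z))"
  by (simp add: W_inv inv_fourier2_def cis_conv_exp power_mult_distrib)

lemma W_measurable [measurable]: "W \<in> borel_measurable borel"
proof -
  have "W = (\<lambda>z. Re (of_real (1 / (4 * pi\<^sup>2)) * (LINT w|lborel. F w * cis (w \<bullet> z))))"
    unfolding W_eq[symmetric] by simp
  also have "\<dots> \<in> borel_measurable borel" by measurable
  finally show ?thesis .
qed

definition W_sup :: real where "W_sup = (LINT w|lborel. cmod (F w))"

lemma W_sup_nonneg: "W_sup \<ge> 0" by (simp add: W_sup_def)

lemma W_bound: "\<bar>W z\<bar> \<le> W_sup"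
proof -
  have "\<bar>W z\<bar> = cmod (complex_of_real (W z))" by simp
  also have "\<dots> = 1 / (4 * pi\<^sup>2) * cmod (LINT w|lborel. F w * cis (w \<bullet> z))"
    unfolding W_eq by (simp add: norm_mult norm_divide norm_power)
  also have "\<dots> \<le> 1 * W_sup"
  proof (rule mult_mono)
    have "4 * pi\<^sup>2 \<ge> 4 * 1" using pi_ge_two by (intro mult_left_mono) (auto simp: one_le_power)
    then show "1 / (4 * pi\<^sup>2) \<le> 1" by simp
    have "cmod (LINT w|lborel. F w * cis (w \<bullet> z)) \<le> (LINT w|lborel. cmod (F w * cis (w \<bullet> z)))"
      by (rule integral_norm_bound)
    then show "cmod (LINT w|lborel. F w * cis (w \<bullet> z)) \<le> W_sup" by (simp add: W_sup_def norm_mult)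
  qed auto
  finally show ?thesis by simp
qed

text \<open>The part of \<open>W\<close> with frequencies near \<open>d\<close>, up to a constant
  factor.\<close>

definition piece :: "real \<times> real \<Rightarrow> real \<times> real \<Rightarrow> complex" where
  "piece d y = (LINT w|lborel. F w * gauss_char d y w)"

lemma piece_measurable [measurable]: "(\<lambda>p. piece (fst p) (snd p)) \<in> borel_measurable borel"
  unfolding piece_def gauss_char_def by measurable

lemma piece_measurable' [measurable]: "piece d \<in> borel_measurable borel" "(\<lambda>d. piece d y) \<in> borel_measurable borel"
  unfolding piece_def gauss_char_def by measurable

text \<open>Integrated over its centre the window has mass \<open>4 * pi\<close>, so the pieces add
  up to \<open>16 * pi ^ 3\<close> times \<open>W\<close>, where \<open>4 * pi\<^sup>2\<close> comes
  from the inversion formula. The factor exceeds 1 and is dropped.\<close>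

lemma W_le_pieces: "ennreal \<bar>W y\<bar> \<le> (\<integral>\<^sup>+d. ennreal (cmod (piece d y)) \<partial>lborel)"
proof -
  have gd: "integrable lborel (\<lambda>d. gauss_char d y w)" "(LINT d|lborel. gauss_char d y w) = of_real (4 * pi) * cis (w \<bullet> y)"
    "(LINT d|lborel. cmod (gauss_char d y w)) = 4 * pi" for w
  proof -
    have g: "gauss_char d y w = cis (w \<bullet> y) * of_real (exp (- (1 / 4) * (norm (d - w))\<^sup>2))" for d
      by (simp add: gauss_char_def norm_minus_commute mult.commute)
    show "integrable lborel (\<lambda>d. gauss_char d y w)"
      unfolding g by (intro integrable_mult_right integrable_of_real integrable_gaussian2_shift) auto
    show "(LINT d|lborel. gauss_char d y w) = of_real (4 * pi) * cis (w \<bullet> y)"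
      unfolding g using integrable_gaussian2_shift(2)[of "1 / 4" w] by (simp add: mult.commute)
    show "(LINT d|lborel. cmod (gauss_char d y w)) = 4 * pi"
      unfolding g norm_mult norm_of_real using integrable_gaussian2_shift(2)[of "1 / 4" w] by simp
  qed
  have big: "integrable (lborel \<Otimes>\<^sub>M lborel) (\<lambda>(w, d). F w * gauss_char d y w)"
  proof (rule lborel_pair.Fubini_integrable)
    show "(\<lambda>(w, d). F w * gauss_char d y w) \<in> borel_measurable (lborel \<Otimes>\<^sub>M lborel)"
      unfolding gauss_char_def by measurable
    show "integrable lborel (\<lambda>w. LINT d|lborel. norm (case (w, d) of (w, d) \<Rightarrow> F w * gauss_char d y w))"
      using integrable_norm[OF F_integrable] by (simp add: norm_mult gd)
    show "AE w in lborel. integrable lborel (\<lambda>d. case (w, d) of (w, d) \<Rightarrow> F w * gauss_char d y w)"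
      using gd by auto
  qed
  have "(LINT d|lborel. piece d y) = (LINT w|lborel. LINT d|lborel. F w * gauss_char d y w)"
    unfolding piece_def by (rule lborel_pair.Fubini_integral) (rule big)
  also have "\<dots> = (LINT w|lborel. of_real (4 * pi) * (F w * cis (w \<bullet> y)))"
    by (simp add: gd mult_ac)
  also have "\<dots> = of_real (16 * pi ^ 3) * complex_of_real (W y)"
    unfolding W_eq by (simp add: power3_eq_cube power2_eq_square)
  finally have eq: "cmod (LINT d|lborel. piece d y) = 16 * pi ^ 3 * \<bar>W y\<bar>"
    by (simp add: norm_mult norm_power)
  have "1 \<le> pi ^ 3" by (rule one_le_power) (use pi_ge_two in simp)
  then have "1 \<le> 16 * pi ^ 3" by linarith
  then have "ennreal \<bar>W y\<bar> \<le> ennreal (cmod (LINT d|lborel. piece d y))"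
    unfolding eq using mult_right_mono[of 1 "16 * pi ^ 3" "\<bar>W y\<bar>"] by (intro ennreal_leI) simp
  also have "\<dots> \<le> (\<integral>\<^sup>+d. ennreal (cmod (piece d y)) \<partial>lborel)"
    by (rule ennreal_norm_integral_le)
  finally show ?thesis .
qed

text \<open>The squared mass of \<open>F\<close> in the window at \<open>d\<close>; the exponent
  \<open>1 / 2\<close> is twice that of \<open>gauss_char\<close>.\<close>

definition energy :: "real \<times> real \<Rightarrow> ennreal" where
  "energy d = (\<integral>\<^sup>+w. ennreal ((cmod (F w))\<^sup>2 * exp (- (1 / 2) * (norm (w - d))\<^sup>2)) \<partial>lborel)"

lemma piece_L2: "(\<integral>\<^sup>+y. ennreal ((cmod (piece d y))\<^sup>2) \<partial>lborel) \<le> ennreal (4 * pi\<^sup>2) * energy d"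
proof -
  define f where "f w = F w * of_real (exp (- (1 / 4) * (norm (w - d))\<^sup>2))" for w
  have f: "integrable lborel f"
    unfolding f_def by (rule Bochner_Integration.integrable_bound[OF F_integrable])
      (auto simp: norm_mult mult_le_cancel_left1 intro!: AE_I2 mult_right_le_one_le)
  have "piece d y = (LINT w|lborel. f w * cis (w \<bullet> y))" for y
    by (simp add: piece_def f_def gauss_char_def mult.assoc)
  moreover have "(cmod (f w))\<^sup>2 = (cmod (F w))\<^sup>2 * exp (- (1 / 2) * (norm (w - d))\<^sup>2)" for w
    by (simp add: f_def norm_mult power_mult_distrib exp_double[symmetric])
  ultimately show ?thesis
    using nn_integral_fourier_square_le[OF f] by (simp add: energy_def)
qed

lemma energy_weighted_finite: "(\<integral>\<^sup>+d. ennreal (exp (2 * \<beta> * norm d)) * energy d \<partial>lborel) < \<infinity>"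
proof -
  let ?G = "\<lambda>w d. (cmod (F w))\<^sup>2 * exp (2 * \<beta> * norm w) * exp (4 * \<beta>\<^sup>2)"
  have "(\<integral>\<^sup>+d. ennreal (exp (2 * \<beta> * norm d)) * energy d \<partial>lborel)
    = (\<integral>\<^sup>+d. \<integral>\<^sup>+w. ennreal (exp (2 * \<beta> * norm d) * ((cmod (F w))\<^sup>2 * exp (- (1 / 2) * (norm (w - d))\<^sup>2))) \<partial>lborel \<partial>lborel)"
    unfolding energy_def by (subst nn_integral_cmult[symmetric]) (auto simp: ennreal_mult)
  also have "\<dots> = (\<integral>\<^sup>+w. \<integral>\<^sup>+d. ennreal (exp (2 * \<beta> * norm d) * ((cmod (F w))\<^sup>2 * exp (- (1 / 2) * (norm (w - d))\<^sup>2))) \<partial>lborel \<partial>lborel)"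
    by (rule lborel_pair.Fubini') measurable
  also have "\<dots> \<le> (\<integral>\<^sup>+w. \<integral>\<^sup>+d. ennreal (exp (4 * \<beta>\<^sup>2) * ((cmod (F w))\<^sup>2 * exp (2 * \<beta> * norm w))) * ennreal (exp (- (1 / 4) * (norm (d - w))\<^sup>2)) \<partial>lborel \<partial>lborel)"
  proof (intro nn_integral_mono)
    fix w d :: "real \<times> real"
    define r where "r = norm (d - w)"
    have "norm d \<le> norm w + r" unfolding r_def using norm_triangle_ineq[of w "d - w"] by simp
    then have "2 * \<beta> * norm d \<le> 2 * \<beta> * (norm w + r)" using beta_pos by (intro mult_left_mono) auto
    \<comment> \<open>Half of the Gaussian decay pays for moving the exponential weight from
      \<open>d\<close> to \<open>w\<close>; the other half keeps the integral over \<open>d\<close>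
      finite.\<close>
    moreover have "2 * \<beta> * r \<le> 4 * \<beta>\<^sup>2 + (1 / 4) * r\<^sup>2"
      using zero_le_power2[of "2 * \<beta> - r / 2"] by (simp add: power2_diff power_divide power_mult_distrib)
    ultimately have "2 * \<beta> * norm d + (- (1 / 2) * r\<^sup>2) \<le> 4 * \<beta>\<^sup>2 + 2 * \<beta> * norm w + (- (1 / 4) * r\<^sup>2)"
      by (simp add: distrib_left)
    then have "exp (2 * \<beta> * norm d) * exp (- (1 / 2) * r\<^sup>2) \<le> exp (4 * \<beta>\<^sup>2) * exp (2 * \<beta> * norm w) * exp (- (1 / 4) * r\<^sup>2)"
      unfolding exp_add[symmetric] by simp
    from mult_left_mono[OF this, of "(cmod (F w))\<^sup>2"]
    show "ennreal (exp (2 * \<beta> * norm d) * ((cmod (F w))\<^sup>2 * exp (- (1 / 2) * (norm (w - d))\<^sup>2)))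
      \<le> ennreal (exp (4 * \<beta>\<^sup>2) * ((cmod (F w))\<^sup>2 * exp (2 * \<beta> * norm w))) * ennreal (exp (- (1 / 4) * (norm (d - w))\<^sup>2))"
      by (subst ennreal_mult[symmetric]) (auto intro!: ennreal_leI simp: r_def norm_minus_commute mult_ac)
  qed
  also have "\<dots> = (\<integral>\<^sup>+w. ennreal (exp (4 * \<beta>\<^sup>2)) * ennreal ((cmod (F w))\<^sup>2 * exp (2 * \<beta> * norm w)) * ennreal (pi / (1 / 4)) \<partial>lborel)"
    using nn_integral_gaussian2_shift[of "1 / 4"] by (intro nn_integral_cong) (simp add: nn_integral_cmult ennreal_mult)
  also have "\<dots> = ennreal (exp (4 * \<beta>\<^sup>2)) * (\<integral>\<^sup>+w. ennreal ((cmod (F w))\<^sup>2 * exp (2 * \<beta> * norm w)) \<partial>lborel) * ennreal (pi / (1 / 4))"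
    by (subst nn_integral_multc, simp, subst nn_integral_cmult) auto
  also have "\<dots> < \<infinity>" using F_decay by (auto simp: ennreal_mult_less_top)
  finally show ?thesis .
qed

text \<open>The pieces have bounded \<open>L1\<close> norm and exponentially small \<open>L2\<close> norm; interpolation
  with the scale \<open>exp (- 2 \<beta> |d| / 3)\<close> makes their weighted norms summable in \<open>d\<close>.\<close>

lemma W_weighted_finite: "(\<integral>\<^sup>+y. ennreal (\<bar>W y\<bar> / (1 + norm y)) \<partial>lborel) < \<infinity>"
proof -
  define b where "b y = 1 / (1 + norm (y :: real \<times> real))" for y
  have b0: "b y \<ge> 0" for y by (simp add: b_def)
  have [measurable]: "b \<in> borel_measurable borel" unfolding b_def[abs_def] by measurable
  \<comment> \<open>The exponent is fixed by
    \<open>1 / \<tau> ^ 3 = exp (2 * \<beta> * |d|)\<close>, the weight under which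
    \<open>energy\<close> is integrable, while \<open>\<tau>\<close> itself remains integrable over
    the plane.\<close>
  define \<tau> where "\<tau> d = exp (- (2 * \<beta> / 3) * norm (d :: real \<times> real))" for d
  have \<tau>0: "\<tau> d > 0" for d by (simp add: \<tau>_def)
  have [measurable]: "\<tau> \<in> borel_measurable borel" unfolding \<tau>_def[abs_def] by measurable
  have \<tau>3: "1 / \<tau> d ^ 3 = exp (2 * \<beta> * norm d)" for d
  proof -
    have "\<tau> d ^ 3 = exp (- (2 * \<beta> * norm d))"
      unfolding \<tau>_def by (subst exp_of_nat_mult[symmetric]) simp
    then show ?thesis by (simp add: exp_minus inverse_eq_divide)
  qed
  have [measurable]: "energy \<in> borel_measurable borel" unfolding energy_def[abs_def] by measurable
  have step: "(\<integral>\<^sup>+y. ennreal (cmod (piece d y) * b y) \<partial>lborel)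
    \<le> (ennreal (4 * pi\<^sup>2) + ennreal (pi\<^sup>2)) * ennreal (\<tau> d) + ennreal (4 * pi\<^sup>2) * (ennreal (exp (2 * \<beta> * norm d)) * energy d)" for d
  proof -
    have "(\<integral>\<^sup>+y. ennreal (cmod (piece d y) * b y) \<partial>lborel)
      \<le> (\<integral>\<^sup>+y. (ennreal (\<tau> d) * ennreal (cmod (piece d y)) + ennreal (exp (2 * \<beta> * norm d)) * ennreal ((cmod (piece d y))\<^sup>2))
          + ennreal (\<tau> d) * ennreal (b y ^ 4) \<partial>lborel)"
    proof (rule nn_integral_mono)
      fix y
      have "cmod (piece d y) * b y \<le> \<tau> d * cmod (piece d y) + ((cmod (piece d y))\<^sup>2 / \<tau> d ^ 3 + \<tau> d * b y ^ 4) / 2"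
        by (rule tail_weight_inequality) (auto simp: b0 \<tau>0)
      also have "\<dots> \<le> \<tau> d * cmod (piece d y) + ((cmod (piece d y))\<^sup>2 / \<tau> d ^ 3 + \<tau> d * b y ^ 4)"
      proof -
        have "0 \<le> (cmod (piece d y))\<^sup>2 / \<tau> d ^ 3 + \<tau> d * b y ^ 4"
          using \<tau>0[of d] b0[of y] by auto
        moreover have "u + x / 2 \<le> u + x" if "0 \<le> x" for u x :: real using that by simp
        ultimately show ?thesis by blast
      qed
      also have "(cmod (piece d y))\<^sup>2 / \<tau> d ^ 3 = exp (2 * \<beta> * norm d) * (cmod (piece d y))\<^sup>2"
        unfolding \<tau>3[symmetric] by simp
      finally have "ennreal (cmod (piece d y) * b y) \<le> ennreal (\<tau> d * cmod (piece d y) + (exp (2 * \<beta> * norm d) * (cmod (piece d y))\<^sup>2 + \<tau> d * b y ^ 4))"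
        by (rule ennreal_leI)
      also have "\<dots> = (ennreal (\<tau> d) * ennreal (cmod (piece d y)) + ennreal (exp (2 * \<beta> * norm d)) * ennreal ((cmod (piece d y))\<^sup>2))
          + ennreal (\<tau> d) * ennreal (b y ^ 4)"
        using \<tau>0[of d] b0[of y] by (simp add: ennreal_plus ennreal_mult add.assoc)
      finally show "ennreal (cmod (piece d y) * b y) \<le> (ennreal (\<tau> d) * ennreal (cmod (piece d y)) + ennreal (exp (2 * \<beta> * norm d)) * ennreal ((cmod (piece d y))\<^sup>2))
          + ennreal (\<tau> d) * ennreal (b y ^ 4)" .
    qed
    also have "\<dots> = (ennreal (\<tau> d) * (\<integral>\<^sup>+y. ennreal (cmod (piece d y)) \<partial>lborel)
        + ennreal (exp (2 * \<beta> * norm d)) * (\<integral>\<^sup>+y. ennreal ((cmod (piece d y))\<^sup>2) \<partial>lborel))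
        + ennreal (\<tau> d) * (\<integral>\<^sup>+y. ennreal (b y ^ 4) \<partial>lborel)"
      by (simp add: nn_integral_add nn_integral_cmult)
    also have "\<dots> \<le> (ennreal (\<tau> d) * ennreal (4 * pi\<^sup>2) + ennreal (exp (2 * \<beta> * norm d)) * (ennreal (4 * pi\<^sup>2) * energy d))
        + ennreal (\<tau> d) * ennreal (pi\<^sup>2)"
      using F_gauss_L1[of d] piece_L2[of d] nn_integral_norm_weight
      by (intro add_mono mult_left_mono) (auto simp: piece_def b_def)
    also have "\<dots> = (ennreal (4 * pi\<^sup>2) + ennreal (pi\<^sup>2)) * ennreal (\<tau> d) + ennreal (4 * pi\<^sup>2) * (ennreal (exp (2 * \<beta> * norm d)) * energy d)"
      by (simp only: distrib_left distrib_right mult_ac add_ac)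
    finally show ?thesis .
  qed
  have "(\<integral>\<^sup>+y. ennreal (\<bar>W y\<bar> / (1 + norm y)) \<partial>lborel) \<le> (\<integral>\<^sup>+y. \<integral>\<^sup>+d. ennreal (cmod (piece d y) * b y) \<partial>lborel \<partial>lborel)"
  proof (rule nn_integral_mono)
    fix y
    have "ennreal (\<bar>W y\<bar> / (1 + norm y)) = ennreal \<bar>W y\<bar> * ennreal (b y)"
      by (subst ennreal_mult[symmetric]) (auto simp: b_def)
    also have "\<dots> \<le> (\<integral>\<^sup>+d. ennreal (cmod (piece d y)) \<partial>lborel) * ennreal (b y)"
      by (intro mult_right_mono W_le_pieces) simp
    also have "\<dots> = (\<integral>\<^sup>+d. ennreal (cmod (piece d y) * b y) \<partial>lborel)"
      by (subst nn_integral_multc[symmetric]) (auto simp: ennreal_mult b0)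
    finally show "ennreal (\<bar>W y\<bar> / (1 + norm y)) \<le> (\<integral>\<^sup>+d. ennreal (cmod (piece d y) * b y) \<partial>lborel)" .
  qed
  also have "\<dots> = (\<integral>\<^sup>+d. \<integral>\<^sup>+y. ennreal (cmod (piece d y) * b y) \<partial>lborel \<partial>lborel)"
    by (rule lborel_pair.Fubini') (simp add: piece_def gauss_char_def)
  also have "\<dots> \<le> (\<integral>\<^sup>+d. (ennreal (4 * pi\<^sup>2) + ennreal (pi\<^sup>2)) * ennreal (\<tau> d) + ennreal (4 * pi\<^sup>2) * (ennreal (exp (2 * \<beta> * norm d)) * energy d) \<partial>lborel)"
    by (intro nn_integral_mono step)
  also have "\<dots> = (ennreal (4 * pi\<^sup>2) + ennreal (pi\<^sup>2)) * (\<integral>\<^sup>+d. ennreal (\<tau> d) \<partial>lborel)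
      + ennreal (4 * pi\<^sup>2) * (\<integral>\<^sup>+d. ennreal (exp (2 * \<beta> * norm d)) * energy d \<partial>lborel)"
    by (simp add: nn_integral_add nn_integral_cmult)
  also have "\<dots> < \<infinity>"
    using nn_integral_exp_norm_finite[of "2 * \<beta> / 3"] beta_pos energy_weighted_finite
    by (auto simp: ennreal_add_less_top ennreal_mult_less_top \<tau>_def)
  finally show ?thesis .
qed

text \<open>Within the unit disc boundedness of \<open>W\<close> and local integrability of
  \<open>1 / norm y\<close> suffice; outside it \<open>1 / norm y\<close> is at most
  \<open>2 * (1 + norm z)\<close> times the weight of \<open>W_weighted_finite\<close> at
  \<open>z + y\<close>.\<close>

lemma W_inverse_norm_finite: "(\<integral>\<^sup>+y. ennreal (\<bar>W (z + y)\<bar> / norm y) \<partial>lborel) < \<infinity>"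
proof -
  have "(\<integral>\<^sup>+y. ennreal (\<bar>W (z + y)\<bar> / norm y) \<partial>lborel)
    \<le> (\<integral>\<^sup>+y. ennreal W_sup * ennreal (indicator (cball 0 1) y / norm y) + ennreal (2 * (1 + norm z)) * ennreal (\<bar>W (z + y)\<bar> / (1 + norm (z + y))) \<partial>lborel)"
  proof (rule nn_integral_mono)
    fix y
    have "\<bar>W (z + y)\<bar> / norm y \<le> W_sup * (indicator (cball 0 1) y / norm y) + 2 * (1 + norm z) * (\<bar>W (z + y)\<bar> / (1 + norm (z + y)))"
    proof (cases "norm y \<le> 1")
      case True
      then have "\<bar>W (z + y)\<bar> / norm y \<le> W_sup * (indicator (cball 0 1) y / norm y)"
        using divide_right_mono[OF W_bound, of "norm y" "z + y"] by simp
      moreover have "2 * (1 + norm z) * (\<bar>W (z + y)\<bar> / (1 + norm (z + y))) \<ge> 0" by (auto intro!: mult_nonneg_nonneg divide_nonneg_nonneg)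
      ultimately show ?thesis by linarith
    next
      case False
      have "1 + norm (z + y) \<le> (1 + norm z) * (1 + norm y)"
      proof -
        have "(1 + norm z) * (1 + norm y) = 1 + norm z + norm y + norm z * norm y" by (simp add: algebra_simps)
        moreover have "norm z * norm y \<ge> 0" by simp
        ultimately show ?thesis using norm_triangle_ineq[of z y] by linarith
      qed
      also have "\<dots> \<le> (1 + norm z) * (2 * norm y)"
        using False by (intro mult_left_mono) auto
      finally have "1 + norm (z + y) \<le> 2 * (1 + norm z) * norm y" by (simp add: algebra_simps)
      then have "1 \<le> (2 * (1 + norm z) * norm y) / (1 + norm (z + y))"
        by (subst le_divide_eq_1_pos) (auto intro: add_pos_nonneg)
      then have "1 \<le> 2 * (1 + norm z) * (1 / (1 + norm (z + y))) * norm y" by simp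
      then have "1 / norm y \<le> 2 * (1 + norm z) * (1 / (1 + norm (z + y)))"
        using False by (subst pos_divide_le_eq) auto
      from mult_left_mono[OF this, of "\<bar>W (z + y)\<bar>"]
      have "\<bar>W (z + y)\<bar> / norm y \<le> 2 * (1 + norm z) * (\<bar>W (z + y)\<bar> / (1 + norm (z + y)))"
        by (simp add: mult_ac)
      moreover have "W_sup * (indicator (cball 0 1) y / norm y) \<ge> 0" using W_sup_nonneg by auto
      ultimately show ?thesis by linarith
    qed
    then show "ennreal (\<bar>W (z + y)\<bar> / norm y) \<le> ennreal W_sup * ennreal (indicator (cball 0 1) y / norm y) + ennreal (2 * (1 + norm z)) * ennreal (\<bar>W (z + y)\<bar> / (1 + norm (z + y)))"
      by (rule ennreal_le_mult_add) (auto simp: W_sup_nonneg)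
  qed
  also have "\<dots> = ennreal W_sup * (\<integral>\<^sup>+y. ennreal (indicator (cball 0 1) y / norm (y :: real \<times> real)) \<partial>lborel)
      + ennreal (2 * (1 + norm z)) * (\<integral>\<^sup>+y. ennreal (\<bar>W (z + y)\<bar> / (1 + norm (z + y))) \<partial>lborel)"
    by (simp add: nn_integral_add nn_integral_cmult)
  also have "(\<integral>\<^sup>+y. ennreal (\<bar>W (z + y)\<bar> / (1 + norm (z + y))) \<partial>lborel) = (\<integral>\<^sup>+y. ennreal (\<bar>W y\<bar> / (1 + norm y)) \<partial>lborel)"
    by (rule nn_integral_lborel_shift[of "\<lambda>y. ennreal (\<bar>W y\<bar> / (1 + norm y))"]) measurable
  also have "ennreal W_sup * (\<integral>\<^sup>+y. ennreal (indicator (cball 0 1) y / norm (y :: real \<times> real)) \<partial>lborel)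
      + ennreal (2 * (1 + norm z)) * (\<integral>\<^sup>+y. ennreal (\<bar>W y\<bar> / (1 + norm y)) \<partial>lborel) < \<infinity>"
    using nn_integral_inverse_norm_ball W_weighted_finite
    by (auto simp: ennreal_add_less_top ennreal_mult_less_top intro: le_less_trans)
  finally show ?thesis .
qed

lemma F_inverse_norm_finite: "(\<integral>\<^sup>+w. ennreal (cmod (F w) / norm w) \<partial>lborel) < \<infinity>"
proof -
  have "(\<integral>\<^sup>+w. ennreal (cmod (F w) / norm w) \<partial>lborel) \<le> (\<integral>\<^sup>+w. ennreal (indicator (cball 0 1) w / norm w) + ennreal (cmod (F w)) \<partial>lborel)"
  proof (rule nn_integral_mono)
    fix w
    have "cmod (F w) / norm w \<le> indicator (cball 0 1) w / norm w + cmod (F w)"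
    proof (cases "norm w \<le> 1")
      case True
      then show ?thesis using divide_right_mono[OF F_bound[of w], of "norm w"] by (simp add: add_increasing2)
    next
      case False
      then have "cmod (F w) / norm w \<le> cmod (F w) / 1" by (intro divide_left_mono) auto
      then show ?thesis using False by simp
    qed
    then have "ennreal (cmod (F w) / norm w) \<le> ennreal (indicator (cball 0 1) w / norm w + cmod (F w))"
      by (rule ennreal_leI)
    also have "\<dots> = ennreal (indicator (cball 0 1) w / norm w) + ennreal (cmod (F w))"
      by (rule ennreal_plus) auto
    finally show "ennreal (cmod (F w) / norm w) \<le> ennreal (indicator (cball 0 1) w / norm w) + ennreal (cmod (F w))" .
  qed
  also have "\<dots> = (\<integral>\<^sup>+w. ennreal (indicator (cball 0 1) w / norm (w :: real \<times> real)) \<partial>lborel) + (\<integral>\<^sup>+w. ennreal (cmod (F w)) \<partial>lborel)"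
    by (rule nn_integral_add) measurable
  also have "\<dots> < \<infinity>"
    using nn_integral_inverse_norm_ball F_nn_integrable by (auto simp: ennreal_add_less_top intro: le_less_trans)
  finally show ?thesis .
qed

end

section \<open>Inverted Gaussians and the angular average of the line weight\<close>

lemma nn_integral_gaussian:
  fixes s :: real
  assumes "s > 0"
  shows "(\<integral>\<^sup>+x. ennreal (exp (- s * x\<^sup>2)) \<partial>lborel) = ennreal (sqrt (pi / s))"
  unfolding integral_gaussian[OF assms, symmetric]
  by (rule nn_integral_eq_integral[OF integrable_gaussian[OF assms]]) simp

lemma nn_integral_inverted_gaussian:
  fixes b :: real
  assumes "b > 0"
  shows "(\<integral>\<^sup>+s. ennreal (1 / s\<^sup>2 * exp (- b / s\<^sup>2)) \<partial>lborel) = ennreal (sqrt (pi / b))"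
proof -
  have "(\<integral>\<^sup>+s. ennreal (1 / s\<^sup>2 * exp (- b / s\<^sup>2)) \<partial>lborel) = (\<integral>\<^sup>+s. ennreal (1 / s\<^sup>2) * ennreal (exp (- b * (- 1 / s)\<^sup>2)) \<partial>lborel)"
    by (intro nn_integral_cong) (simp add: ennreal_mult[symmetric] power_divide)
  also have "\<dots> = (\<integral>\<^sup>+s. ennreal (exp (- b * s\<^sup>2)) \<partial>lborel)"
    by (rule nn_integral_inversion) measurable
  finally show ?thesis using nn_integral_gaussian[OF assms] by simp
qed

lemma AE_nonzero_lborel: "AE y in lborel. y \<noteq> (0 :: 'a::euclidean_space)"
  by (rule AE_lborel_singleton)

text \<open>In terms of \<open>s = tan \<phi>\<close> the integrand is the reciprocal of a quadratic
  polynomial, and completing the square reduces it to \<open>1 / (1 + t\<^sup>2)\<close>. The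
  result, comparable to \<open>1 / (1 + |y|)\<close>, is the source of the weight on
  \<open>W\<close>.\<close>

lemma nn_integral_angle_weight:
  "(\<integral>\<^sup>+\<phi>. indicator {0..pi} \<phi> * ennreal (1 / (1 + (q * cos \<phi> + p * sin \<phi>)\<^sup>2)) \<partial>lborel)
    = ennreal (pi / sqrt (1 + q\<^sup>2 + p\<^sup>2))"
proof -
  define D where "D = 1 + q\<^sup>2 + p\<^sup>2"
  define A where "A = 1 + p\<^sup>2"
  have A: "A > 0" and D: "D > 0" unfolding A_def D_def by (intro add_pos_nonneg; simp)+
  \<comment> \<open>The polynomial \<open>1 + s\<^sup>2 + (q + p * s)\<^sup>2\<close> has leading
    coefficient \<open>A\<close> and minimum \<open>D / A\<close> at
    \<open>s = - (p * q) / A\<close>; \<open>c\<close> is the scale that makes both of its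
    coefficients equal to \<open>D / A\<close>.\<close>
  define c where "c = sqrt D / A"
  have c: "c > 0" using A D by (simp add: c_def)
  have "(\<integral>\<^sup>+\<phi>. indicator {0..pi} \<phi> * ennreal (1 / (1 + (q * cos \<phi> + p * sin \<phi>)\<^sup>2)) \<partial>lborel)
      = (\<integral>\<^sup>+\<phi>. indicator {- (pi / 2)<..<pi / 2} \<phi> * ennreal (1 / (1 + (q * cos \<phi> + p * sin \<phi>)\<^sup>2)) \<partial>lborel)"
  proof (rule nn_integral_periodic_pi)
    fix \<phi> :: real
    have "(q * cos (\<phi> + pi) + p * sin (\<phi> + pi))\<^sup>2 = (q * cos \<phi> + p * sin \<phi>)\<^sup>2"
      by (simp add: power2_eq_square algebra_simps)
    then show "ennreal (1 / (1 + (q * cos (\<phi> + pi) + p * sin (\<phi> + pi))\<^sup>2)) = ennreal (1 / (1 + (q * cos \<phi> + p * sin \<phi>)\<^sup>2))"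
      by simp
  qed measurable
  also have "\<dots> = (\<integral>\<^sup>+\<phi>. indicator {- (pi / 2)<..<pi / 2} \<phi> * (ennreal (1 / (cos \<phi>)\<^sup>2) * ennreal (1 / (1 + (tan \<phi>)\<^sup>2 + (q + p * tan \<phi>)\<^sup>2))) \<partial>lborel)"
  proof (rule nn_integral_cong)
    fix \<phi> :: real
    show "indicator {- (pi / 2)<..<pi / 2} \<phi> * ennreal (1 / (1 + (q * cos \<phi> + p * sin \<phi>)\<^sup>2))
      = indicator {- (pi / 2)<..<pi / 2} \<phi> * (ennreal (1 / (cos \<phi>)\<^sup>2) * ennreal (1 / (1 + (tan \<phi>)\<^sup>2 + (q + p * tan \<phi>)\<^sup>2)))"
    proof (cases "\<phi> \<in> {- (pi / 2)<..<pi / 2}")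
      case True
      then have cp: "cos \<phi> > 0" by (intro cos_gt_zero_pi) auto
      have "(cos \<phi>)\<^sup>2 * (1 + (tan \<phi>)\<^sup>2 + (q + p * tan \<phi>)\<^sup>2)
          = ((cos \<phi>)\<^sup>2 + (cos \<phi> * tan \<phi>)\<^sup>2) + (q * cos \<phi> + p * (cos \<phi> * tan \<phi>))\<^sup>2"
        by (simp add: power2_eq_square algebra_simps)
      also have "cos \<phi> * tan \<phi> = sin \<phi>" using cp by (simp add: tan_def)
      finally have "(cos \<phi>)\<^sup>2 * (1 + (tan \<phi>)\<^sup>2 + (q + p * tan \<phi>)\<^sup>2) = 1 + (q * cos \<phi> + p * sin \<phi>)\<^sup>2"
        by simp
      then show ?thesis by (subst ennreal_mult[symmetric]) (auto simp: add_nonneg_nonneg)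
    qed simp
  qed
  also have "\<dots> = (\<integral>\<^sup>+s. ennreal (1 / (1 + s\<^sup>2 + (q + p * s)\<^sup>2)) \<partial>lborel)"
    by (rule nn_integral_tan[symmetric]) measurable
  also have "\<dots> = ennreal \<bar>c\<bar> * (\<integral>\<^sup>+t. ennreal (1 / (1 + (- (p * q) / A + c * t)\<^sup>2 + (q + p * (- (p * q) / A + c * t))\<^sup>2)) \<partial>lborel)"
    using c by (intro nn_integral_real_affine) auto
  also have "\<dots> = ennreal c * (\<integral>\<^sup>+t. ennreal (A / D) * ennreal (1 / (1 + t\<^sup>2)) \<partial>lborel)"
  proof -
    have "1 + (- (p * q) / A + c * t)\<^sup>2 + (q + p * (- (p * q) / A + c * t))\<^sup>2 = D / A * (1 + t\<^sup>2)" for t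
    proof -
      define s where "s = - (p * q) / A + c * t"
      have "A * s + p * q = A * (c * t)" using A by (simp add: s_def field_simps)
      moreover have "A * (1 + s\<^sup>2 + (q + p * s)\<^sup>2) = (A * s + p * q)\<^sup>2 + D"
        by (simp add: A_def D_def power2_eq_square algebra_simps)
      moreover have "(A * (c * t))\<^sup>2 = D * t\<^sup>2" using A D by (simp add: c_def power_mult_distrib power_divide)
      ultimately have "A * (1 + s\<^sup>2 + (q + p * s)\<^sup>2) = D * (1 + t\<^sup>2)" by (simp add: algebra_simps)
      then show ?thesis unfolding s_def[symmetric] using A by (simp add: field_simps)
    qed
    then show ?thesis using A D c by (simp add: ennreal_mult[symmetric])
  qed
  also have "\<dots> = ennreal c * (ennreal (A / D) * ennreal pi)"
    by (simp add: nn_integral_cmult nn_integral_inverse_1_plus_square)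
  also have "\<dots> = ennreal (c * (A / D * pi))"
    using A D c by (simp add: ennreal_mult[symmetric])
  also have "c * (A / D * pi) = pi / sqrt D"
    using A D real_sqrt_mult_self[of D] by (simp add: c_def field_simps)
  finally show ?thesis by (simp add: D_def)
qed

lemma angle_weight_bound:
  "pi / sqrt (1 + (fst y)\<^sup>2 + (snd y)\<^sup>2) \<le> 2 * pi * (1 / (1 + norm (y :: real \<times> real)))"
proof -
  have "(1 + norm y)\<^sup>2 \<le> 2 * (1 + (norm y)\<^sup>2)"
    using zero_le_power2[of "1 - norm y"] by (simp add: power2_eq_square algebra_simps)
  also have "\<dots> \<le> 4 * (1 + (norm y)\<^sup>2)" by simp
  finally have "sqrt ((1 + norm y)\<^sup>2) \<le> sqrt (4 * (1 + (norm y)\<^sup>2))" by (rule real_sqrt_le_mono)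
  then have "1 + norm y \<le> 2 * sqrt (1 + (norm y)\<^sup>2)" unfolding real_sqrt_mult by (simp add: abs_of_nonneg)
  moreover have "0 < sqrt (1 + (norm y)\<^sup>2)" by (simp add: add_pos_nonneg)
  moreover have "0 < 1 + norm y" by (simp add: add_pos_nonneg)
  ultimately have "1 / sqrt (1 + (norm y)\<^sup>2) \<le> 2 * (1 / (1 + norm y))"
    by (simp add: divide_simps)
  from mult_left_mono[OF this, of pi] show ?thesis by (simp add: norm_prod_square add.assoc mult.commute)
qed

lemma gaussian_le_weight:
  fixes \<epsilon> x :: real
  assumes "\<epsilon> > 0" shows "exp (- \<epsilon> * x\<^sup>2) \<le> (1 + 1 / \<epsilon>) / (1 + x\<^sup>2)"
proof -
  have "1 + x\<^sup>2 \<le> (1 + 1 / \<epsilon>) * (1 + \<epsilon> * x\<^sup>2)"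
    using assms by (simp add: algebra_simps)
  also have "\<dots> \<le> (1 + 1 / \<epsilon>) * exp (\<epsilon> * x\<^sup>2)"
    using assms exp_ge_add_one_self[of "\<epsilon> * x\<^sup>2"] by (intro mult_left_mono) auto
  finally have "1 + x\<^sup>2 \<le> (1 + 1 / \<epsilon>) * exp (\<epsilon> * x\<^sup>2)" .
  moreover have "1 + x\<^sup>2 > 0" by (simp add: add_pos_nonneg)
  ultimately show ?thesis by (simp add: exp_minus field_simps)
qed

section \<open>The backprojection\<close>

context wigner_transform
begin

text \<open>The multiplication formula against a Gaussian of width \<open>1 / \<tau>\<close>;
  integrating over \<open>\<tau>\<close> afterwards turns the Gaussians on both sides into inverse
  norms.\<close>

lemma gaussian_average:
  assumes "\<tau> \<noteq> 0"
  shows "(LINT y|lborel. complex_of_real (W (z + y) * exp (- \<tau>\<^sup>2 * (norm y)\<^sup>2)))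
    = of_real (1 / (4 * pi\<^sup>2)) * (LINT w|lborel. F w * cis (w \<bullet> z) * of_real (pi / \<tau>\<^sup>2 * exp (- (norm w)\<^sup>2 / (4 * \<tau>\<^sup>2))))"
proof -
  have t: "\<tau>\<^sup>2 > 0" using assms by simp
  have Wz: "complex_of_real (W (z + y)) = of_real (1 / (4 * pi\<^sup>2)) * (LINT w|lborel. (F w * cis (w \<bullet> z)) * cis (w \<bullet> y))" for y
    unfolding W_eq by (simp add: inner_add_right cis_mult[symmetric] mult.assoc)
  have "(LINT y|lborel. complex_of_real (W (z + y) * exp (- \<tau>\<^sup>2 * (norm y)\<^sup>2)))
      = (LINT y|lborel. of_real (1 / (4 * pi\<^sup>2)) * ((LINT w|lborel. (F w * cis (w \<bullet> z)) * cis (w \<bullet> y)) * of_real (exp (- \<tau>\<^sup>2 * (norm y)\<^sup>2))))"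
    unfolding of_real_mult[of "W _"] Wz by (simp only: mult.assoc)
  also have "\<dots> = of_real (1 / (4 * pi\<^sup>2)) * (LINT y|lborel. (LINT w|lborel. (F w * cis (w \<bullet> z)) * cis (w \<bullet> y)) * of_real (exp (- \<tau>\<^sup>2 * (norm y)\<^sup>2)))"
    by (rule integral_mult_right_zero)
  also have "(LINT y|lborel. (LINT w|lborel. (F w * cis (w \<bullet> z)) * cis (w \<bullet> y)) * of_real (exp (- \<tau>\<^sup>2 * (norm y)\<^sup>2)))
      = (LINT w|lborel. (F w * cis (w \<bullet> z)) * (LINT y|lborel. of_real (exp (- \<tau>\<^sup>2 * (norm y)\<^sup>2)) * cis (w \<bullet> y)))"
    using integral_cis_swap[OF F_cis_integrable integrable_of_real[OF integrable_gaussian2[OF t]], of "\<lambda>y. y" z] by simp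
  also have "\<dots> = (LINT w|lborel. F w * cis (w \<bullet> z) * of_real (pi / \<tau>\<^sup>2 * exp (- (norm w)\<^sup>2 / (4 * \<tau>\<^sup>2))))"
  proof (intro Bochner_Integration.integral_cong refl)
    fix w :: "real \<times> real"
    have "(LINT y|lborel. of_real (exp (- \<tau>\<^sup>2 * (norm y)\<^sup>2)) * cis (w \<bullet> y)) = of_real (pi / \<tau>\<^sup>2 * exp (- (norm w)\<^sup>2 / (4 * \<tau>\<^sup>2)))"
      using integral_gaussian2_cis[OF t, of w] by (simp only: inner_commute[of w])
    then show "(F w * cis (w \<bullet> z)) * (LINT y|lborel. of_real (exp (- \<tau>\<^sup>2 * (norm y)\<^sup>2)) * cis (w \<bullet> y))
        = F w * cis (w \<bullet> z) * of_real (pi / \<tau>\<^sup>2 * exp (- (norm w)\<^sup>2 / (4 * \<tau>\<^sup>2)))"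
      by simp
  qed
  finally show ?thesis .
qed

lemma W_inverse_norm_integrable: "integrable lborel (\<lambda>y. W (z + y) / norm y)"
  using W_inverse_norm_finite[of z] by (intro integrableI_bounded) (auto simp: abs_divide)

lemma F_inverse_norm_integrable: "integrable lborel (\<lambda>w. F w * cis (w \<bullet> z) / of_real (norm w))"
  using F_inverse_norm_finite by (intro integrableI_bounded) (auto simp: norm_divide norm_mult)

text \<open>Subordination: \<open>1 / |y|\<close> is an average of the Gaussians \<open>exp (- \<tau>\<^sup>2 |y|\<^sup>2)\<close>, and the inversion
  \<open>\<tau> \<mapsto> - 1 / \<tau>\<close> shows that the same average of their Fourier transforms is a multiple of \<open>1 / |w|\<close>.\<close>

lemma inverse_norm_identity:
  "complex_of_real (LINT y|lborel. W (z + y) / norm y)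
    = of_real (1 / (2 * pi)) * (LINT w|lborel. F w * cis (w \<bullet> z) / of_real (norm w))"
proof -
  define B1 where "B1 y \<tau> = complex_of_real (W (z + y) * exp (- \<tau>\<^sup>2 * (norm y)\<^sup>2))" for y and \<tau> :: real
  define B2 where "B2 w \<tau> = F w * cis (w \<bullet> z) * of_real (pi / \<tau>\<^sup>2 * exp (- (norm w)\<^sup>2 / (4 * \<tau>\<^sup>2)))" for w \<tau>
  have e1: "(\<lambda>\<tau>. exp (- \<tau>\<^sup>2 * (norm y)\<^sup>2)) = (\<lambda>\<tau>. exp (- (norm y)\<^sup>2 * \<tau>\<^sup>2))" for y :: "real \<times> real"
    by (simp add: mult.commute)
  have g1: "integrable lborel (\<lambda>\<tau>::real. exp (- \<tau>\<^sup>2 * (norm y)\<^sup>2))" "(LINT \<tau>|lborel. exp (- \<tau>\<^sup>2 * (norm y)\<^sup>2)) = sqrt pi / norm y"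
    if "y \<noteq> 0" for y :: "real \<times> real"
    unfolding e1 using that integrable_gaussian[of "(norm y)\<^sup>2"] integral_gaussian[of "(norm y)\<^sup>2"]
    by (auto simp: real_sqrt_divide)
  \<comment> \<open>The averages over \<open>\<tau>\<close> are \<open>sqrt pi / norm y\<close> in
    space and \<open>2 * pi * sqrt pi / norm w\<close> in frequency; together with
    \<open>1 / (4 * pi\<^sup>2)\<close> they give the factor \<open>1 / (2 * pi)\<close>.\<close>
  have g2: "integrable lborel (\<lambda>\<tau>. pi / \<tau>\<^sup>2 * exp (- (norm w)\<^sup>2 / (4 * \<tau>\<^sup>2)))"
     "(LINT \<tau>|lborel. pi / \<tau>\<^sup>2 * exp (- (norm w)\<^sup>2 / (4 * \<tau>\<^sup>2))) = 2 * pi * sqrt pi / norm w"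
    if "w \<noteq> 0" for w :: "real \<times> real"
  proof -
    define b where "b = (norm w)\<^sup>2 / 4"
    have b: "b > 0" using that by (simp add: b_def)
    have nn: "(\<integral>\<^sup>+s. ennreal (1 / s\<^sup>2 * exp (- b / s\<^sup>2)) \<partial>lborel) = ennreal (sqrt (pi / b))"
      by (rule nn_integral_inverted_gaussian[OF b])
    have i: "integrable lborel (\<lambda>s. 1 / s\<^sup>2 * exp (- b / s\<^sup>2)) \<and> (LINT s|lborel. 1 / s\<^sup>2 * exp (- b / s\<^sup>2)) = sqrt (pi / b)"
      using nn b by (subst (asm) nn_integral_eq_integrable) auto
    have e: "(\<lambda>\<tau>. pi / \<tau>\<^sup>2 * exp (- (norm w)\<^sup>2 / (4 * \<tau>\<^sup>2))) = (\<lambda>s. pi * (1 / s\<^sup>2 * exp (- b / s\<^sup>2)))"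
      by (simp add: b_def fun_eq_iff)
    show "integrable lborel (\<lambda>\<tau>. pi / \<tau>\<^sup>2 * exp (- (norm w)\<^sup>2 / (4 * \<tau>\<^sup>2)))"
      unfolding e using i by (intro integrable_mult_right) auto
    show "(LINT \<tau>|lborel. pi / \<tau>\<^sup>2 * exp (- (norm w)\<^sup>2 / (4 * \<tau>\<^sup>2))) = 2 * pi * sqrt pi / norm w"
      unfolding e integral_mult_right_zero using i by (simp add: b_def real_sqrt_divide real_sqrt_mult)
  qed
  \<comment> \<open>Integrating the modulus over \<open>\<tau>\<close> first leaves
    \<open>sqrt pi * \<bar>W (z + y)\<bar> / norm y\<close>: this is where the weighted
    integrability of \<open>W\<close> is spent.\<close>
  have big1: "integrable (lborel \<Otimes>\<^sub>M lborel) (case_prod B1)"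
  proof (rule lborel_pair.Fubini_integrable)
    show "case_prod B1 \<in> borel_measurable (lborel \<Otimes>\<^sub>M lborel)" unfolding B1_def by measurable
    show "AE y in lborel. integrable lborel (\<lambda>\<tau>. case_prod B1 (y, \<tau>))"
      using AE_nonzero_lborel by eventually_elim (unfold B1_def split_conv, intro integrable_of_real integrable_mult_right g1)
    have i: "integrable lborel (\<lambda>y. sqrt pi * \<bar>W (z + y) / norm y\<bar>)"
      by (intro integrable_mult_right integrable_abs W_inverse_norm_integrable)
    have ae: "AE y in lborel. (LINT \<tau>|lborel. norm (case_prod B1 (y, \<tau>))) = sqrt pi * \<bar>W (z + y) / norm y\<bar>"
      using AE_nonzero_lborel
    proof eventually_elim
      case (elim y)
      have "norm (case_prod B1 (y, \<tau>)) = \<bar>W (z + y)\<bar> * exp (- \<tau>\<^sup>2 * (norm y)\<^sup>2)" for \<tau>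
        unfolding B1_def split_conv norm_of_real abs_mult by simp
      then have "(LINT \<tau>|lborel. norm (case_prod B1 (y, \<tau>))) = \<bar>W (z + y)\<bar> * (sqrt pi / norm y)"
        using g1(2)[OF elim] by (simp only: integral_mult_right_zero)
      then show ?case by (simp add: abs_divide)
    qed
    show "integrable lborel (\<lambda>y. LINT \<tau>|lborel. norm (case_prod B1 (y, \<tau>)))"
      by (rule integrable_cong_AE[THEN iffD2, OF _ _ ae i]) (simp_all add: B1_def)
  qed
  have big2: "integrable (lborel \<Otimes>\<^sub>M lborel) (case_prod B2)"
  proof (rule lborel_pair.Fubini_integrable)
    show "case_prod B2 \<in> borel_measurable (lborel \<Otimes>\<^sub>M lborel)" unfolding B2_def by measurable
    show "AE w in lborel. integrable lborel (\<lambda>\<tau>. case_prod B2 (w, \<tau>))"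
      using AE_nonzero_lborel by eventually_elim (unfold B2_def split_conv, intro integrable_of_real integrable_mult_right g2)
    have i: "integrable lborel (\<lambda>w. (2 * pi * sqrt pi) * cmod (F w * cis (w \<bullet> z) / of_real (norm w)))"
      by (intro integrable_mult_right integrable_norm F_inverse_norm_integrable)
    have ae: "AE w in lborel. (LINT \<tau>|lborel. norm (case_prod B2 (w, \<tau>))) = (2 * pi * sqrt pi) * cmod (F w * cis (w \<bullet> z) / of_real (norm w))"
      using AE_nonzero_lborel
    proof eventually_elim
      case (elim w)
      have "cmod (case_prod B2 (w, \<tau>)) = cmod (F w) * (pi / \<tau>\<^sup>2 * exp (- (norm w)\<^sup>2 / (4 * \<tau>\<^sup>2)))" for \<tau>
        unfolding B2_def split_conv norm_mult norm_of_real by (subst abs_of_nonneg) auto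
      then have "(LINT \<tau>|lborel. norm (case_prod B2 (w, \<tau>))) = cmod (F w) * (2 * pi * sqrt pi / norm w)"
        using g2(2)[OF elim] by (simp only: integral_mult_right_zero)
      then show ?case by (simp add: norm_mult norm_divide)
    qed
    show "integrable lborel (\<lambda>w. LINT \<tau>|lborel. norm (case_prod B2 (w, \<tau>)))"
      by (rule integrable_cong_AE[THEN iffD2, OF _ _ ae i]) (simp_all add: B2_def)
  qed
  have "complex_of_real (sqrt pi) * complex_of_real (LINT y|lborel. W (z + y) / norm y)
      = (LINT y|lborel. of_real (sqrt pi * (W (z + y) / norm y)))"
    unfolding integral_complex_of_real integral_mult_right_zero of_real_mult ..
  also have "\<dots> = (LINT y|lborel. LINT \<tau>|lborel. B1 y \<tau>)"
  proof (rule integral_cong_AE)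
    show "AE y in lborel. complex_of_real (sqrt pi * (W (z + y) / norm y)) = (LINT \<tau>|lborel. B1 y \<tau>)"
      using AE_nonzero_lborel
    proof eventually_elim
      case (elim y)
      have "(LINT \<tau>|lborel. B1 y \<tau>) = complex_of_real (LINT \<tau>|lborel. W (z + y) * exp (- \<tau>\<^sup>2 * (norm y)\<^sup>2))"
        unfolding B1_def by (rule integral_complex_of_real)
      then show ?case using g1[OF elim] by simp
    qed
  qed (auto simp: B1_def)
  also have "\<dots> = (LINT \<tau>|lborel. LINT y|lborel. B1 y \<tau>)"
    by (rule lborel_pair.Fubini_integral[symmetric]) (rule big1)
  also have "\<dots> = (LINT \<tau>|lborel. of_real (1 / (4 * pi\<^sup>2)) * (LINT w|lborel. B2 w \<tau>))"
  proof (rule integral_cong_AE)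
    show "AE \<tau> in lborel. (LINT y|lborel. B1 y \<tau>) = of_real (1 / (4 * pi\<^sup>2)) * (LINT w|lborel. B2 w \<tau>)"
      using AE_nonzero_lborel by eventually_elim (unfold B1_def B2_def, rule gaussian_average)
  qed (auto simp: B1_def B2_def)
  also have "\<dots> = of_real (1 / (4 * pi\<^sup>2)) * (LINT \<tau>|lborel. LINT w|lborel. B2 w \<tau>)"
    by (rule integral_mult_right_zero)
  also have "(LINT \<tau>|lborel. LINT w|lborel. B2 w \<tau>) = (LINT w|lborel. LINT \<tau>|lborel. B2 w \<tau>)"
    by (rule lborel_pair.Fubini_integral) (rule big2)
  also have "\<dots> = (LINT w|lborel. of_real (2 * pi * sqrt pi) * (F w * cis (w \<bullet> z) / of_real (norm w)))"
  proof (rule integral_cong_AE)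
    show "AE w in lborel. (LINT \<tau>|lborel. B2 w \<tau>) = of_real (2 * pi * sqrt pi) * (F w * cis (w \<bullet> z) / of_real (norm w))"
      using AE_nonzero_lborel
    proof eventually_elim
      case (elim w)
      have "(LINT \<tau>|lborel. B2 w \<tau>) = F w * cis (w \<bullet> z) * complex_of_real (LINT \<tau>|lborel. pi / \<tau>\<^sup>2 * exp (- (norm w)\<^sup>2 / (4 * \<tau>\<^sup>2)))"
        unfolding B2_def integral_mult_right_zero integral_complex_of_real ..
      then show ?case unfolding g2(2)[OF elim] by simp
    qed
  qed (auto simp: B2_def)
  also have "\<dots> = of_real (2 * pi * sqrt pi) * (LINT w|lborel. F w * cis (w \<bullet> z) / of_real (norm w))"
    by (rule integral_mult_right_zero)
  finally have "complex_of_real (sqrt pi) * complex_of_real (LINT y|lborel. W (z + y) / norm y)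
    = complex_of_real (sqrt pi) * (of_real (1 / (2 * pi)) * (LINT w|lborel. F w * cis (w \<bullet> z) / of_real (norm w)))"
    by (simp add: power2_eq_square mult_ac)
  then show ?thesis by (subst (asm) mult_cancel_left) auto
qed

text \<open>Shifting \<open>t\<close> by the component \<open>c\<close> of \<open>z\<close> along
  the line moves the origin of the parametrisation to \<open>z\<close> itself.\<close>

lemma radon_proj: "radon W (proj z \<phi>) \<phi> = (LINT t|lborel. W (fst z - t * sin \<phi>, snd z + t * cos \<phi>))"
proof -
  define c where "c = - fst z * sin \<phi> + snd z * cos \<phi>"
  have "radon W (proj z \<phi>) \<phi> = (LINT t|lborel. W (proj z \<phi> * cos \<phi> - (c + 1 * t) * sin \<phi>, proj z \<phi> * sin \<phi> + (c + 1 * t) * cos \<phi>))"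
    unfolding radon_def
    using lborel_integral_real_affine[of 1 "\<lambda>t. W (proj z \<phi> * cos \<phi> - t * sin \<phi>, proj z \<phi> * sin \<phi> + t * cos \<phi>)" c] by simp
  also have "\<dots> = (LINT t|lborel. W (fst z - t * sin \<phi>, snd z + t * cos \<phi>))"
  proof (intro Bochner_Integration.integral_cong refl)
    fix t
    have cs: "cos \<phi> * cos \<phi> = 1 - sin \<phi> * sin \<phi>"
      using sin_cos_squared_add[of \<phi>] by (simp add: power2_eq_square)
    have "proj z \<phi> * cos \<phi> - (c + 1 * t) * sin \<phi> = fst z * (cos \<phi> * cos \<phi>) + fst z * (sin \<phi> * sin \<phi>) - t * sin \<phi>"
      "proj z \<phi> * sin \<phi> + (c + 1 * t) * cos \<phi> = snd z * (cos \<phi> * cos \<phi>) + snd z * (sin \<phi> * sin \<phi>) + t * cos \<phi>"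
      by (simp_all add: proj_def c_def algebra_simps)
    then have "proj z \<phi> * cos \<phi> - (c + 1 * t) * sin \<phi> = fst z - t * sin \<phi>"
      "proj z \<phi> * sin \<phi> + (c + 1 * t) * cos \<phi> = snd z + t * cos \<phi>"
      unfolding cs by (simp_all add: right_diff_distrib)
    then show "W (proj z \<phi> * cos \<phi> - (c + 1 * t) * sin \<phi>, proj z \<phi> * sin \<phi> + (c + 1 * t) * cos \<phi>)
        = W (fst z - t * sin \<phi>, snd z + t * cos \<phi>)"
      by simp
  qed
  finally show ?thesis .
qed

lemma radon_measurable [measurable]: "(\<lambda>p. radon W (fst p) (snd p)) \<in> borel_measurable borel"
  unfolding radon_def by measurable

text \<open>The lines through \<open>z\<close> are the rays of polar coordinates centred at
  \<open>z\<close>, and their Jacobian cancels \<open>1 / norm y\<close>. Angles from 0 to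
  \<open>2 * pi\<close> count every line twice.\<close>

lemma dual_radon_eq: "dual_radon (radon W) z = 2 * (LINT y|lborel. W (z + y) / norm y)"
proof -
  define T where "T = (\<lambda>(\<phi>::real, r::real). (- r * sin \<phi>, r * cos \<phi>))"
  define h where "h \<phi> = radon W (proj z \<phi>) \<phi>" for \<phi>
  have Tm [measurable]: "T \<in> borel_measurable borel" unfolding T_def by measurable
  have Tp: "lborel = distr polar_measure borel T" unfolding T_def by (rule lborel_polar_perp)
  have norm_T: "norm (T (\<phi>, r)) = \<bar>r\<bar>" for \<phi> r
    by (simp add: T_def norm_Pair power_mult_distrib distrib_left[symmetric])
  have zT: "z + T (\<phi>, r) = (fst z - r * sin \<phi>, snd z + r * cos \<phi>)" for \<phi> r
    by (cases z) (simp add: T_def)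
  have inner: "(LINT r|lborel. \<bar>r\<bar> *\<^sub>R (W (z + T (\<phi>, r)) / norm (T (\<phi>, r)))) = h \<phi>" for \<phi>
    unfolding h_def radon_proj
  proof (rule integral_cong_AE)
    show "AE r in lborel. \<bar>r\<bar> *\<^sub>R (W (z + T (\<phi>, r)) / norm (T (\<phi>, r))) = W (fst z - r * sin \<phi>, snd z + r * cos \<phi>)"
      using AE_nonzero_lborel by eventually_elim (simp add: norm_T zT)
  qed measurable
  note pB = polar_Bochner[OF W_inverse_norm_integrable[of z] Tp Tm]
  have eq: "(LINT y|lborel. W (z + y) / norm y) = (LINT \<phi>|lborel. indicator {0..pi} \<phi> *\<^sub>R h \<phi>)"
    using pB(2) by (simp only: inner)
  have "integrable (lborel \<Otimes>\<^sub>M lborel) (\<lambda>p. (indicator {0..pi} (fst p) * \<bar>snd p\<bar>) *\<^sub>R (W (z + T p) / norm (T p)))"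
    using pB(1) by (simp add: lborel_prod)
  from lborel_pair.integrable_fst'[OF this]
  have "integrable lborel (\<lambda>\<phi>. LINT r|lborel. indicator {0..pi} \<phi> *\<^sub>R (\<bar>r\<bar> *\<^sub>R (W (z + T (\<phi>, r)) / norm (T (\<phi>, r)))))"
    by (simp add: mult.assoc)
  then have hi: "integrable lborel (\<lambda>\<phi>. indicator {0..pi} \<phi> *\<^sub>R h \<phi>)"
    by (simp only: integral_scaleR_right inner)
  have per: "h (\<phi> + pi) = h \<phi>" for \<phi>
  proof -
    have "h (\<phi> + pi) = (LINT t|lborel. W (fst z - (0 + (-1) * t) * sin \<phi>, snd z + (0 + (-1) * t) * cos \<phi>))"
      unfolding h_def radon_proj by simp
    also have "\<dots> = (LINT t|lborel. W (fst z - t * sin \<phi>, snd z + t * cos \<phi>))"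
      using lborel_integral_real_affine[of "-1" "\<lambda>t. W (fst z - t * sin \<phi>, snd z + t * cos \<phi>)" 0] by simp
    finally show ?thesis by (simp add: h_def radon_proj)
  qed
  have shift: "integrable lborel (\<lambda>\<phi>. indicator {pi..2 * pi} \<phi> *\<^sub>R h \<phi>)"
    "(LINT \<phi>|lborel. indicator {pi..2 * pi} \<phi> *\<^sub>R h \<phi>) = (LINT \<phi>|lborel. indicator {0..pi} \<phi> *\<^sub>R h \<phi>)"
  proof -
    have e: "(\<lambda>\<phi>. indicator {pi..2 * pi} \<phi> *\<^sub>R h \<phi>) = (\<lambda>\<phi>. indicator {0..pi} (- pi + 1 * \<phi>) *\<^sub>R h (- pi + 1 * \<phi>))"
      using per[of "_ - pi"] by (auto simp: fun_eq_iff indicator_def)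
    show "integrable lborel (\<lambda>\<phi>. indicator {pi..2 * pi} \<phi> *\<^sub>R h \<phi>)"
      unfolding e using lborel_integrable_real_affine[OF hi, of 1 "- pi"] by simp
    show "(LINT \<phi>|lborel. indicator {pi..2 * pi} \<phi> *\<^sub>R h \<phi>) = (LINT \<phi>|lborel. indicator {0..pi} \<phi> *\<^sub>R h \<phi>)"
      unfolding e using lborel_integral_real_affine[of 1 "\<lambda>\<phi>. indicator {0..pi} \<phi> *\<^sub>R h \<phi>" "- pi"] by simp
  qed
  have [measurable]: "h \<in> borel_measurable borel" unfolding h_def radon_def proj_def by measurable
  have "dual_radon (radon W) z = (LINT \<phi>|lborel. indicator {0..2 * pi} \<phi> *\<^sub>R h \<phi>)"
    by (simp add: dual_radon_def set_lebesgue_integral_def h_def)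
  also have "\<dots> = (LINT \<phi>|lborel. indicator {0..pi} \<phi> *\<^sub>R h \<phi> + indicator {pi..2 * pi} \<phi> *\<^sub>R h \<phi>)"
  proof (rule integral_cong_AE)
    have "AE \<phi> in lborel. \<phi> \<noteq> pi" by (rule AE_lborel_singleton)
    then show "AE \<phi> in lborel. indicator {0..2 * pi} \<phi> *\<^sub>R h \<phi> = indicator {0..pi} \<phi> *\<^sub>R h \<phi> + indicator {pi..2 * pi} \<phi> *\<^sub>R h \<phi>"
      by eventually_elim (use pi_gt_zero in \<open>auto simp: indicator_def\<close>)
  qed measurable
  also have "\<dots> = 2 * (LINT y|lborel. W (z + y) / norm y)"
    unfolding Bochner_Integration.integral_add[OF hi shift(1)] shift(2) eq by simp
  finally show ?thesis .
qed

text \<open>\<open>F\<close> along a line through the origin; the slice identity will make it the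
  Fourier transform of the Radon transform at angle \<open>\<phi>\<close>.\<close>

definition ray :: "real \<Rightarrow> real \<Rightarrow> complex" where
  "ray \<phi> t = F (t * cos \<phi>, t * sin \<phi>)"

lemma ray_measurable [measurable]: "(\<lambda>p. ray (fst p) (snd p)) \<in> borel_measurable borel" "ray \<phi> \<in> borel_measurable borel"
  "(\<lambda>\<phi>. ray \<phi> t) \<in> borel_measurable borel"
  unfolding ray_def by measurable

text \<open>On the frequency side of \<open>inverse_norm_identity\<close> the polar Jacobian cancels
  \<open>1 / norm w\<close> as well. The joint integrability in angle and radius is what later makes
  \<open>psi\<close> integrable.\<close>

lemma ray_polar:
  "integrable lborel (\<lambda>p. indicator {0..pi} (fst p) *\<^sub>R (ray (fst p) (snd p) * cis (snd p * proj z (fst p))))"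
  "complex_of_real (dual_radon (radon W) z)
     = of_real (1 / pi) * (LINT \<phi>|lborel. indicator {0..pi} \<phi> *\<^sub>R (LINT r|lborel. ray \<phi> r * cis (r * proj z \<phi>)))"
proof -
  define T where "T = (\<lambda>(\<phi>::real, r::real). (r * cos \<phi>, r * sin \<phi>))"
  have Tm [measurable]: "T \<in> borel_measurable borel" unfolding T_def by measurable
  have Tp: "lborel = distr polar_measure borel T" unfolding T_def by (rule lborel_polar)
  have norm_T: "norm (T (\<phi>, r)) = \<bar>r\<bar>" for \<phi> r
    by (simp add: T_def norm_Pair power_mult_distrib distrib_left[symmetric])
  have inner_T: "T (\<phi>, r) \<bullet> z = r * proj z \<phi>" for \<phi> r
    by (cases z) (simp add: T_def proj_def algebra_simps)
  let ?f = "\<lambda>w. F w * cis (w \<bullet> z) / of_real (norm w)"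
  have f_T: "\<bar>r\<bar> *\<^sub>R ?f (T (\<phi>, r)) = ray \<phi> r * cis (r * proj z \<phi>)" if "r \<noteq> 0" for r \<phi>
  proof -
    have "F (T (\<phi>, r)) = ray \<phi> r" by (simp add: ray_def T_def)
    then show ?thesis using that by (simp add: norm_T inner_T scaleR_conv_of_real)
  qed
  note pB = polar_Bochner[OF F_inverse_norm_integrable[of z] Tp Tm]
  have m: "{p \<in> space (lborel \<Otimes>\<^sub>M lborel). snd p \<noteq> (0::real)} \<in> sets ((lborel :: real measure) \<Otimes>\<^sub>M lborel)"
    by measurable
  have "AE p in (lborel :: real measure) \<Otimes>\<^sub>M lborel. snd p \<noteq> (0::real)"
    by (rule lborel_pair.AE_pair_measure[OF m]) (use AE_nonzero_lborel in auto)
  then have ae: "AE p in (lborel :: (real \<times> real) measure). snd p \<noteq> 0" unfolding lborel_prod .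
  have pm [measurable]: "proj z \<in> borel_measurable borel" unfolding proj_def[abs_def] by measurable
  have "AE p in lborel. indicator {0..pi} (fst p) *\<^sub>R (ray (fst p) (snd p) * cis (snd p * proj z (fst p)))
        = (indicator {0..pi} (fst p) * \<bar>snd p\<bar>) *\<^sub>R ?f (T p)"
    using ae
  proof eventually_elim
    case (elim p)
    then show ?case using f_T[of "snd p" "fst p"] by (simp flip: scaleR_scaleR)
  qed
  moreover have "(\<lambda>p. indicator {0..pi} (fst p) *\<^sub>R (ray (fst p) (snd p) * cis (snd p * proj z (fst p)))) \<in> borel_measurable lborel"
    unfolding proj_def by measurable
  ultimately show "integrable lborel (\<lambda>p. indicator {0..pi} (fst p) *\<^sub>R (ray (fst p) (snd p) * cis (snd p * proj z (fst p))))"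
    using integrable_cong_AE[THEN iffD2, OF _ borel_measurable_integrable[OF pB(1)] _ pB(1)] by blast
  have "(LINT w|lborel. ?f w) = (LINT \<phi>|lborel. indicator {0..pi} \<phi> *\<^sub>R (LINT r|lborel. \<bar>r\<bar> *\<^sub>R ?f (T (\<phi>, r))))"
    by (rule pB(2))
  also have "(\<lambda>\<phi>. LINT r|lborel. \<bar>r\<bar> *\<^sub>R ?f (T (\<phi>, r))) = (\<lambda>\<phi>. LINT r|lborel. ray \<phi> r * cis (r * proj z \<phi>))"
  proof
    fix \<phi>
    show "(LINT r|lborel. \<bar>r\<bar> *\<^sub>R ?f (T (\<phi>, r))) = (LINT r|lborel. ray \<phi> r * cis (r * proj z \<phi>))"
    proof (rule integral_cong_AE)
      show "AE r in lborel. \<bar>r\<bar> *\<^sub>R ?f (T (\<phi>, r)) = ray \<phi> r * cis (r * proj z \<phi>)"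
        using AE_nonzero_lborel by eventually_elim (rule f_T)
    qed measurable
  qed
  finally show "complex_of_real (dual_radon (radon W) z)
     = of_real (1 / pi) * (LINT \<phi>|lborel. indicator {0..pi} \<phi> *\<^sub>R (LINT r|lborel. ray \<phi> r * cis (r * proj z \<phi>)))"
    using inverse_norm_identity[of z] by (simp add: dual_radon_eq)
qed

end

section \<open>The Radon transform along almost every direction\<close>

lemma integrable_gaussian_shift:
  fixes s \<tau> :: real
  assumes "s > 0"
  shows "integrable lborel (\<lambda>t. exp (- s * (t - \<tau>)\<^sup>2))" "(LINT t|lborel. exp (- s * (t - \<tau>)\<^sup>2)) = sqrt (pi / s)"
proof -
  have e: "(\<lambda>t. exp (- s * (t - \<tau>)\<^sup>2)) = (\<lambda>t. exp (- s * (- \<tau> + 1 * t)\<^sup>2))" by simp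
  show "integrable lborel (\<lambda>t. exp (- s * (t - \<tau>)\<^sup>2))"
    unfolding e by (rule lborel_integrable_real_affine[OF integrable_gaussian[OF assms]]) simp
  show "(LINT t|lborel. exp (- s * (t - \<tau>)\<^sup>2)) = sqrt (pi / s)"
    unfolding e integral_gaussian[OF assms, symmetric]
    using lborel_integral_real_affine[of 1 "\<lambda>t. exp (- s * t\<^sup>2)" "- \<tau>"] by simp
qed

text \<open>The Fourier transform of \<open>exp (- \<epsilon> * x\<^sup>2)\<close>, a Gaussian of
  mass \<open>2 * pi\<close> instead of 1.\<close>

definition heat_kernel :: "real \<Rightarrow> real \<Rightarrow> real" where
  "heat_kernel \<epsilon> t = sqrt (pi / \<epsilon>) * exp (- t\<^sup>2 / (4 * \<epsilon>))"

lemma heat_kernel_measurable [measurable]: "heat_kernel \<epsilon> \<in> borel_measurable borel"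
  unfolding heat_kernel_def[abs_def] by measurable

lemma heat_kernel_nonneg: "\<epsilon> > 0 \<Longrightarrow> heat_kernel \<epsilon> t \<ge> 0"
  by (simp add: heat_kernel_def)

lemma heat_kernel_integrable:
  assumes "\<epsilon> > 0"
  shows "integrable lborel (\<lambda>t. heat_kernel \<epsilon> (t - \<tau>))"
proof -
  have "integrable lborel (\<lambda>t. sqrt (pi / \<epsilon>) * exp (- (1 / (4 * \<epsilon>)) * (t - \<tau>)\<^sup>2))"
    using assms by (intro integrable_mult_right integrable_gaussian_shift) auto
  then show ?thesis by (simp add: heat_kernel_def)
qed

lemma heat_kernel_scale:
  assumes "\<epsilon> > 0"
  shows "(2 * sqrt \<epsilon>) * heat_kernel \<epsilon> (2 * sqrt \<epsilon> * s) = 2 * sqrt pi * exp (- s\<^sup>2)"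
proof -
  have "(2 * sqrt \<epsilon> * s)\<^sup>2 / (4 * \<epsilon>) = s\<^sup>2" using assms by (simp add: power_mult_distrib)
  then show ?thesis using assms by (simp add: heat_kernel_def real_sqrt_divide)
qed

text \<open>In units of \<open>2 * sqrt \<epsilon>\<close> the Gaussian no longer depends on
  \<open>\<epsilon>\<close>, so limits as \<open>\<epsilon>\<close> tends to 0 become dominated
  convergence with a fixed majorant.\<close>

lemma integral_heat_kernel_substitution:
  fixes f :: "real \<Rightarrow> complex"
  assumes "\<epsilon> > 0"
  shows "(LINT t|lborel. f t * of_real (heat_kernel \<epsilon> (t - \<tau>)))
    = (LINT s|lborel. f (\<tau> + 2 * sqrt \<epsilon> * s) * of_real (2 * sqrt pi * exp (- s\<^sup>2)))"
proof -
  have "(LINT t|lborel. f t * of_real (heat_kernel \<epsilon> (t - \<tau>)))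
    = \<bar>2 * sqrt \<epsilon>\<bar> *\<^sub>R (LINT s|lborel. f (\<tau> + 2 * sqrt \<epsilon> * s) * of_real (heat_kernel \<epsilon> (\<tau> + 2 * sqrt \<epsilon> * s - \<tau>)))"
    using assms by (intro lborel_integral_real_affine) simp
  also have "\<dots> = (LINT s|lborel. (2 * sqrt \<epsilon>) *\<^sub>R (f (\<tau> + 2 * sqrt \<epsilon> * s) * of_real (heat_kernel \<epsilon> (2 * sqrt \<epsilon> * s))))"
    using assms by simp
  also have "\<dots> = (LINT s|lborel. f (\<tau> + 2 * sqrt \<epsilon> * s) * of_real ((2 * sqrt \<epsilon>) * heat_kernel \<epsilon> (2 * sqrt \<epsilon> * s)))"
    by (intro Bochner_Integration.integral_cong refl) (simp add: scaleR_conv_of_real mult_ac)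
  finally show ?thesis unfolding heat_kernel_scale[OF assms] .
qed

lemma integrable_standard_gaussian: "integrable lborel (\<lambda>s::real. 2 * sqrt pi * exp (- s\<^sup>2))"
  and integral_standard_gaussian: "(LINT s|lborel. 2 * sqrt pi * exp (- (s::real)\<^sup>2)) = 2 * pi"
  using integrable_gaussian[of 1] integral_gaussian[of 1] by simp_all

lemma inner_rotate:
  "w \<bullet> rotate \<phi> p = fst p * (w \<bullet> (cos \<phi>, sin \<phi>)) + snd p * (w \<bullet> (- sin \<phi>, cos \<phi>))"
  by (cases w) (simp add: rotate_def algebra_simps)

lemma rotate_inner_axes:
  "rotate \<phi> p \<bullet> (cos \<phi>, sin \<phi>) = fst p" "rotate \<phi> p \<bullet> (- sin \<phi>, cos \<phi>) = snd p"
proof -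
  have cs: "cos \<phi> * cos \<phi> = 1 - sin \<phi> * sin \<phi>"
    using sin_cos_squared_add[of \<phi>] by (simp add: power2_eq_square)
  have "rotate \<phi> p \<bullet> (cos \<phi>, sin \<phi>) = fst p * (cos \<phi> * cos \<phi>) + fst p * (sin \<phi> * sin \<phi>)"
    "rotate \<phi> p \<bullet> (- sin \<phi>, cos \<phi>) = snd p * (cos \<phi> * cos \<phi>) + snd p * (sin \<phi> * sin \<phi>)"
    by (simp_all add: rotate_def algebra_simps)
  then show "rotate \<phi> p \<bullet> (cos \<phi>, sin \<phi>) = fst p" "rotate \<phi> p \<bullet> (- sin \<phi>, cos \<phi>) = snd p"
    unfolding cs by (simp_all add: right_diff_distrib)
qed

context wigner_transform
begin

text \<open>The directions in which Fubini can be applied to \<open>W\<close> in rotated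
  coordinates. The weight depends on the offset of the line only, so integrability along almost
  every single line is included.\<close>

definition good_angle :: "real \<Rightarrow> bool" where
  "good_angle \<phi> \<longleftrightarrow> cos \<phi> \<noteq> 0 \<and> integrable lborel (\<lambda>p. W (rotate \<phi> p) / (1 + (fst p)\<^sup>2))"

text \<open>By Tonelli the average over \<open>\<phi>\<close> falls on the weight alone, and
  \<open>nn_integral_angle_weight\<close> turns it into the weight of
  \<open>W_weighted_finite\<close>; a finite integral over the angles is finite at almost every
  angle.\<close>

lemma AE_good_angle: "AE \<phi> in lborel. \<phi> \<in> {0..pi} \<longrightarrow> good_angle \<phi>"
proof -
  define I where "I \<phi> = (\<integral>\<^sup>+p. ennreal (\<bar>W (rotate \<phi> p)\<bar> / (1 + (fst p)\<^sup>2)) \<partial>lborel)" for \<phi>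
  have Im [measurable]: "I \<in> borel_measurable borel"
    unfolding I_def[abs_def] rotate_def by measurable
  have I_eq: "I \<phi> = (\<integral>\<^sup>+y. ennreal (\<bar>W y\<bar> / (1 + (fst y * cos \<phi> + snd y * sin \<phi>)\<^sup>2)) \<partial>lborel)" if "cos \<phi> \<noteq> 0" for \<phi>
  proof -
    have "fst (rotate \<phi> p) * cos \<phi> + snd (rotate \<phi> p) * sin \<phi> = fst p" for p
      using rotate_inner_axes(1)[of \<phi> p] by (simp add: inner_prod_def)
    then show ?thesis
      unfolding I_def
      using nn_integral_rotation[of "\<lambda>y. ennreal (\<bar>W y\<bar> / (1 + (fst y * cos \<phi> + snd y * sin \<phi>)\<^sup>2))" \<phi>] that by simp
  qed
  have "(\<integral>\<^sup>+\<phi>. indicator {0..pi} \<phi> * I \<phi> \<partial>lborel)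
      = (\<integral>\<^sup>+\<phi>. \<integral>\<^sup>+y. indicator {0..pi} \<phi> * ennreal (\<bar>W y\<bar> / (1 + (fst y * cos \<phi> + snd y * sin \<phi>)\<^sup>2)) \<partial>lborel \<partial>lborel)"
    by (rule nn_integral_cong_AE, use AE_cos_nonzero in eventually_elim) (simp add: I_eq nn_integral_cmult)
  also have "\<dots> = (\<integral>\<^sup>+y. \<integral>\<^sup>+\<phi>. indicator {0..pi} \<phi> * ennreal (\<bar>W y\<bar> / (1 + (fst y * cos \<phi> + snd y * sin \<phi>)\<^sup>2)) \<partial>lborel \<partial>lborel)"
    by (rule lborel_pair.Fubini') measurable
  also have "\<dots> \<le> (\<integral>\<^sup>+y. ennreal (2 * pi) * ennreal (\<bar>W y\<bar> / (1 + norm y)) \<partial>lborel)"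
  proof (rule nn_integral_mono)
    fix y
    have "(\<integral>\<^sup>+\<phi>. indicator {0..pi} \<phi> * ennreal (\<bar>W y\<bar> / (1 + (fst y * cos \<phi> + snd y * sin \<phi>)\<^sup>2)) \<partial>lborel)
        = (\<integral>\<^sup>+\<phi>. ennreal \<bar>W y\<bar> * (indicator {0..pi} \<phi> * ennreal (1 / (1 + (fst y * cos \<phi> + snd y * sin \<phi>)\<^sup>2))) \<partial>lborel)"
    proof (rule nn_integral_cong)
      fix \<phi> :: real
      have "ennreal (\<bar>W y\<bar> / (1 + (fst y * cos \<phi> + snd y * sin \<phi>)\<^sup>2)) = ennreal \<bar>W y\<bar> * ennreal (1 / (1 + (fst y * cos \<phi> + snd y * sin \<phi>)\<^sup>2))"
        by (subst ennreal_mult[symmetric]) auto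
      then show "indicator {0..pi} \<phi> * ennreal (\<bar>W y\<bar> / (1 + (fst y * cos \<phi> + snd y * sin \<phi>)\<^sup>2))
        = ennreal \<bar>W y\<bar> * (indicator {0..pi} \<phi> * ennreal (1 / (1 + (fst y * cos \<phi> + snd y * sin \<phi>)\<^sup>2)))"
        by (simp add: mult_ac)
    qed
    also have "\<dots> = ennreal \<bar>W y\<bar> * ennreal (pi / sqrt (1 + (fst y)\<^sup>2 + (snd y)\<^sup>2))"
      by (subst nn_integral_cmult) (simp_all add: nn_integral_angle_weight)
    also have "\<dots> \<le> ennreal \<bar>W y\<bar> * ennreal (2 * pi * (1 / (1 + norm y)))"
      by (intro mult_left_mono ennreal_leI angle_weight_bound) simp
    also have "\<dots> = ennreal (2 * pi) * ennreal (\<bar>W y\<bar> / (1 + norm y))"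
      by (subst ennreal_mult[symmetric], simp, simp, subst ennreal_mult[symmetric]) (simp_all add: mult.commute)
    finally show "(\<integral>\<^sup>+\<phi>. indicator {0..pi} \<phi> * ennreal (\<bar>W y\<bar> / (1 + (fst y * cos \<phi> + snd y * sin \<phi>)\<^sup>2)) \<partial>lborel)
      \<le> ennreal (2 * pi) * ennreal (\<bar>W y\<bar> / (1 + norm y))" .
  qed
  also have "\<dots> = ennreal (2 * pi) * (\<integral>\<^sup>+y. ennreal (\<bar>W y\<bar> / (1 + norm y)) \<partial>lborel)"
    by (rule nn_integral_cmult) measurable
  also have "\<dots> < \<infinity>" using W_weighted_finite by (simp add: ennreal_mult_less_top)
  finally have "AE \<phi> in lborel. indicator {0..pi} \<phi> * I \<phi> \<noteq> \<infinity>"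
    by (intro nn_integral_PInf_AE) auto
  with AE_cos_nonzero show ?thesis
  proof eventually_elim
    case (elim \<phi>)
    show ?case
    proof
      assume "\<phi> \<in> {0..pi}"
      then have "I \<phi> < \<infinity>" using elim by (simp add: top.not_eq_extremum)
      then have "integrable lborel (\<lambda>p. W (rotate \<phi> p) / (1 + (fst p)\<^sup>2))"
        unfolding I_def by (intro integrableI_bounded) (simp_all add: abs_divide)
      then show "good_angle \<phi>" using elim by (simp add: good_angle_def)
    qed
  qed
qed

lemma radon_rotate: "radon W x \<phi> = (LINT t|lborel. W (rotate \<phi> (x, t)))"
  by (simp add: radon_def rotate_def)

lemma radon_measurable' [measurable]: "(\<lambda>x. radon W x \<phi>) \<in> borel_measurable borel"
  unfolding radon_def by measurable

lemma good_gaussian_integrable: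
  assumes "good_angle \<phi>" "\<epsilon> > 0"
  shows "integrable lborel (\<lambda>p. W (rotate \<phi> p) * exp (- \<epsilon> * (fst p)\<^sup>2))"
proof (rule Bochner_Integration.integrable_bound)
  show "integrable lborel (\<lambda>p. (1 + 1 / \<epsilon>) * (W (rotate \<phi> p) / (1 + (fst p)\<^sup>2)))"
    using assms by (intro integrable_mult_right) (simp add: good_angle_def)
  show "AE p in lborel. norm (W (rotate \<phi> p) * exp (- \<epsilon> * (fst p)\<^sup>2)) \<le> norm ((1 + 1 / \<epsilon>) * (W (rotate \<phi> p) / (1 + (fst p)\<^sup>2)))"
  proof (rule AE_I2)
    fix p :: "real \<times> real"
    have "\<bar>W (rotate \<phi> p)\<bar> * exp (- \<epsilon> * (fst p)\<^sup>2) \<le> \<bar>W (rotate \<phi> p)\<bar> * ((1 + 1 / \<epsilon>) / (1 + (fst p)\<^sup>2))"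
      by (intro mult_left_mono gaussian_le_weight assms) simp
    also have "\<dots> = norm ((1 + 1 / \<epsilon>) * (W (rotate \<phi> p) / (1 + (fst p)\<^sup>2)))"
      using assms(2) by (simp add: abs_mult abs_divide)
    finally show "norm (W (rotate \<phi> p) * exp (- \<epsilon> * (fst p)\<^sup>2)) \<le> norm ((1 + 1 / \<epsilon>) * (W (rotate \<phi> p) / (1 + (fst p)\<^sup>2)))"
      by (simp add: abs_mult)
  qed
qed measurable

lemma radon_gaussian_integrable:
  assumes "good_angle \<phi>" "\<epsilon> > 0"
  shows "integrable lborel (\<lambda>x. radon W x \<phi> * exp (- \<epsilon> * x\<^sup>2))"
proof -
  have "integrable (lborel \<Otimes>\<^sub>M lborel) (\<lambda>p. W (rotate \<phi> p) * exp (- \<epsilon> * (fst p)\<^sup>2))"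
    using good_gaussian_integrable[OF assms] by (simp add: lborel_prod)
  from lborel_pair.integrable_fst'[OF this] show ?thesis
    by (simp add: radon_rotate)
qed

text \<open>A probability average of \<open>ray \<phi>\<close> around \<open>\<tau>\<close> at scale
  \<open>sqrt \<epsilon>\<close>; the prefactor cancels the mass of the heat kernel.\<close>

definition ray_average :: "real \<Rightarrow> real \<Rightarrow> real \<Rightarrow> complex" where
  "ray_average \<epsilon> \<phi> \<tau> = of_real (1 / (2 * pi)) * (LINT t|lborel. ray \<phi> t * of_real (heat_kernel \<epsilon> (t - \<tau>)))"

lemma ray_continuous: "continuous_on UNIV (ray \<phi>)"
  unfolding ray_def by (intro continuous_on_compose2[OF F_cont] continuous_intros) auto

lemma ray_bound: "cmod (ray \<phi> t) \<le> 1"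
  unfolding ray_def by (rule F_bound)

lemma ray_average_bound:
  assumes "\<epsilon> > 0" shows "cmod (ray_average \<epsilon> \<phi> \<tau>) \<le> 1"
proof -
  have "cmod (LINT t|lborel. ray \<phi> t * of_real (heat_kernel \<epsilon> (t - \<tau>)))
      = cmod (LINT s|lborel. ray \<phi> (\<tau> + 2 * sqrt \<epsilon> * s) * of_real (2 * sqrt pi * exp (- s\<^sup>2)))"
    unfolding integral_heat_kernel_substitution[OF assms] ..
  also have "\<dots> \<le> (LINT s|lborel. 2 * sqrt pi * exp (- (s::real)\<^sup>2))"
  proof (rule Bochner_Integration.integral_norm_bound_integral)
    show "integrable lborel (\<lambda>s. ray \<phi> (\<tau> + 2 * sqrt \<epsilon> * s) * of_real (2 * sqrt pi * exp (- s\<^sup>2)))"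
      by (rule Bochner_Integration.integrable_bound[OF integrable_standard_gaussian])
        (auto simp: norm_mult ray_bound intro!: AE_I2 mult_left_le_one_le)
    show "cmod (ray \<phi> (\<tau> + 2 * sqrt \<epsilon> * s) * of_real (2 * sqrt pi * exp (- s\<^sup>2))) \<le> 2 * sqrt pi * exp (- s\<^sup>2)" for s
      using mult_right_mono[OF ray_bound, of "2 * sqrt pi * exp (- s\<^sup>2)"] by (simp add: norm_mult)
  qed (rule integrable_standard_gaussian)
  also have "\<dots> = 2 * pi" by (rule integral_standard_gaussian)
  finally show ?thesis by (simp add: ray_average_def norm_mult norm_divide field_simps)
qed

lemma ray_average_tendsto: "(\<lambda>n. ray_average (1 / real (Suc n)) \<phi> \<tau>) \<longlonglongrightarrow> ray \<phi> \<tau>"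
proof -
  have "(\<lambda>n. LINT s|lborel. ray \<phi> (\<tau> + 2 * sqrt (1 / real (Suc n)) * s) * of_real (2 * sqrt pi * exp (- s\<^sup>2)))
      \<longlonglongrightarrow> (LINT s|lborel. ray \<phi> \<tau> * of_real (2 * sqrt pi * exp (- s\<^sup>2)))"
  proof (rule integral_dominated_convergence[OF _ _ integrable_standard_gaussian])
    show "AE s in lborel. (\<lambda>n. ray \<phi> (\<tau> + 2 * sqrt (1 / real (Suc n)) * s) * of_real (2 * sqrt pi * exp (- s\<^sup>2)))
      \<longlonglongrightarrow> ray \<phi> \<tau> * of_real (2 * sqrt pi * exp (- s\<^sup>2))"
    proof (rule AE_I2)
      fix s :: real
      have "(\<lambda>n. \<tau> + 2 * sqrt (1 / real (Suc n)) * s) \<longlonglongrightarrow> \<tau> + 2 * sqrt 0 * s"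
        by (intro tendsto_intros LIMSEQ_Suc[OF lim_1_over_n])
      then have "(\<lambda>n. ray \<phi> (\<tau> + 2 * sqrt (1 / real (Suc n)) * s)) \<longlonglongrightarrow> ray \<phi> \<tau>"
        using ray_continuous[of \<phi>] by (intro isCont_tendsto_compose[of _ "ray \<phi>"]) (auto simp: continuous_on_eq_continuous_at)
      then show "(\<lambda>n. ray \<phi> (\<tau> + 2 * sqrt (1 / real (Suc n)) * s) * of_real (2 * sqrt pi * exp (- s\<^sup>2)))
        \<longlonglongrightarrow> ray \<phi> \<tau> * of_real (2 * sqrt pi * exp (- s\<^sup>2))"
        by (intro tendsto_intros)
    qed
    show "AE s in lborel. norm (ray \<phi> (\<tau> + 2 * sqrt (1 / real (Suc n)) * s) * of_real (2 * sqrt pi * exp (- s\<^sup>2))) \<le> 2 * sqrt pi * exp (- s\<^sup>2)" for n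
    proof (rule AE_I2)
      fix s :: real
      show "norm (ray \<phi> (\<tau> + 2 * sqrt (1 / real (Suc n)) * s) * of_real (2 * sqrt pi * exp (- s\<^sup>2))) \<le> 2 * sqrt pi * exp (- s\<^sup>2)"
        using mult_right_mono[OF ray_bound, of "2 * sqrt pi * exp (- s\<^sup>2)"] by (simp add: norm_mult)
    qed
  qed measurable
  also have "(LINT s|lborel. ray \<phi> \<tau> * of_real (2 * sqrt pi * exp (- s\<^sup>2))) = ray \<phi> \<tau> * of_real (2 * pi)"
  proof -
    have "(LINT s|lborel. complex_of_real (2 * sqrt pi * exp (- s\<^sup>2))) = of_real (2 * pi)"
      unfolding integral_complex_of_real integral_standard_gaussian ..
    then show ?thesis by (subst integral_mult_right_zero) (rule arg_cong)
  qed
  finally have "(\<lambda>n. of_real (1 / (2 * pi)) * (LINT s|lborel. ray \<phi> (\<tau> + 2 * sqrt (1 / real (Suc n)) * s) * of_real (2 * sqrt pi * exp (- s\<^sup>2))))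
      \<longlonglongrightarrow> of_real (1 / (2 * pi)) * (ray \<phi> \<tau> * of_real (2 * pi))"
    by (rule tendsto_mult_left)
  moreover have "of_real (1 / (2 * pi)) * (ray \<phi> \<tau> * of_real (2 * pi)) = ray \<phi> \<tau>" by simp
  moreover have "ray_average (1 / real (Suc n)) \<phi> \<tau>
      = of_real (1 / (2 * pi)) * (LINT s|lborel. ray \<phi> (\<tau> + 2 * sqrt (1 / real (Suc n)) * s) * of_real (2 * sqrt pi * exp (- s\<^sup>2)))" for n
    unfolding ray_average_def by (subst integral_heat_kernel_substitution) auto
  ultimately show ?thesis by simp
qed

text \<open>The slice identity with damping in the offset \<open>x\<close>. Expressing
  \<open>W\<close> through \<open>F\<close> and exchanging the integrals requires a kernel
  integrable over the plane, so a second damping along the line is inserted and removed in the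
  limit. On the frequency side it concentrates on the line \<open>ray \<phi>\<close>.\<close>

lemma radon_gaussian:
  assumes good: "good_angle \<phi>" and \<epsilon>: "\<epsilon> > 0"
  shows "(LINT x|lborel. of_real (radon W x \<phi> * exp (- \<epsilon> * x\<^sup>2)) * cis (- \<tau> * x)) = ray_average \<epsilon> \<phi> \<tau>"
proof (rule LIMSEQ_unique)
  have c: "cos \<phi> \<noteq> 0" using good by (simp add: good_angle_def)
  define \<sigma> where "\<sigma> n = 1 / real (Suc n)" for n
  have \<sigma>: "\<sigma> n > 0" for n by (simp add: \<sigma>_def)
  have \<sigma>0: "\<sigma> \<longlonglongrightarrow> 0" unfolding \<sigma>_def by (rule LIMSEQ_Suc[OF lim_1_over_n])
  define g where "g p = complex_of_real (W (rotate \<phi> p) * exp (- \<epsilon> * (fst p)\<^sup>2)) * cis (- \<tau> * fst p)" for p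
  have gi: "integrable lborel g"
    unfolding g_def by (rule Bochner_Integration.integrable_bound[OF good_gaussian_integrable[OF good \<epsilon>]]) (auto simp: norm_mult)
  have [measurable]: "g \<in> borel_measurable borel" using gi by (auto dest: borel_measurable_integrable)
  \<comment> \<open>Its limit is computed twice: here by dominated convergence in space, below in
    frequency.\<close>
  define A where "A n = (LINT p|lborel. g p * of_real (exp (- \<sigma> n * (snd p)\<^sup>2)))" for n
  have "A \<longlonglongrightarrow> (LINT p|lborel. g p)"
    unfolding A_def
  proof (rule integral_dominated_convergence[OF _ _ integrable_norm[OF gi]])
    show "AE p in lborel. (\<lambda>n. g p * of_real (exp (- \<sigma> n * (snd p)\<^sup>2))) \<longlonglongrightarrow> g p"
    proof (rule AE_I2)
      fix p :: "real \<times> real"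
      have "(\<lambda>n. g p * of_real (exp (- \<sigma> n * (snd p)\<^sup>2))) \<longlonglongrightarrow> g p * of_real (exp (- 0 * (snd p)\<^sup>2))"
        by (intro tendsto_intros \<sigma>0)
      then show "(\<lambda>n. g p * of_real (exp (- \<sigma> n * (snd p)\<^sup>2))) \<longlonglongrightarrow> g p" by simp
    qed
    show "AE p in lborel. norm (g p * of_real (exp (- \<sigma> n * (snd p)\<^sup>2))) \<le> norm (g p)" for n
      using \<sigma>[of n] by (intro AE_I2) (simp add: norm_mult mult_right_le_one_le)
  qed measurable
  also have "(LINT p|lborel. g p) = (LINT x|lborel. of_real (radon W x \<phi> * exp (- \<epsilon> * x\<^sup>2)) * cis (- \<tau> * x))"
  proof -
    have "(LINT p|lborel. g p) = (LINT x|lborel. LINT t|lborel. g (x, t))"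
      using lborel_pair.integral_fst'[of g] gi by (simp add: lborel_prod)
    also have "(\<lambda>x. LINT t|lborel. g (x, t)) = (\<lambda>x. of_real (radon W x \<phi> * exp (- \<epsilon> * x\<^sup>2)) * cis (- \<tau> * x))"
    proof
      fix x
      have "(LINT t|lborel. g (x, t)) = (LINT t|lborel. complex_of_real (W (rotate \<phi> (x, t)) * exp (- \<epsilon> * x\<^sup>2))) * cis (- \<tau> * x)"
        unfolding g_def fst_conv by (rule integral_mult_left_zero)
      also have "(LINT t|lborel. complex_of_real (W (rotate \<phi> (x, t)) * exp (- \<epsilon> * x\<^sup>2))) = of_real (radon W x \<phi> * exp (- \<epsilon> * x\<^sup>2))"
        unfolding radon_rotate integral_complex_of_real integral_mult_left_zero ..
      finally show "(LINT t|lborel. g (x, t)) = of_real (radon W x \<phi> * exp (- \<epsilon> * x\<^sup>2)) * cis (- \<tau> * x)" .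
    qed
    finally show ?thesis .
  qed
  finally show "A \<longlonglongrightarrow> (LINT x|lborel. of_real (radon W x \<phi> * exp (- \<epsilon> * x\<^sup>2)) * cis (- \<tau> * x))" .

  define K where "K t = heat_kernel \<epsilon> (t - \<tau>)" for t
  have Km [measurable]: "K \<in> borel_measurable borel" unfolding K_def[abs_def] by measurable
  have K0: "K t \<ge> 0" for t unfolding K_def by (rule heat_kernel_nonneg[OF \<epsilon>])
  have Ki: "integrable lborel K" unfolding K_def[abs_def] by (rule heat_kernel_integrable[OF \<epsilon>])
  define k where "k n p = (of_real (exp (- \<epsilon> * (fst p)\<^sup>2)) * cis (- \<tau> * fst p)) * complex_of_real (exp (- \<sigma> n * (snd p)\<^sup>2))" for n and p :: "real \<times> real"
  have ki: "integrable lborel (k n)" for n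
    unfolding k_def using lborel_prod_integrable(1)[OF integrable_gaussian_cis[OF \<epsilon>, of "- \<tau>"] integrable_of_real[OF integrable_gaussian[OF \<sigma>[of n]]]] .
  \<comment> \<open>The transform of the doubly damped kernel, a product in the frequency
    coordinates parallel and perpendicular to the direction \<open>\<phi>\<close>.\<close>
  define Q where "Q n w = K (w \<bullet> (cos \<phi>, sin \<phi>)) * heat_kernel (\<sigma> n) (w \<bullet> (- sin \<phi>, cos \<phi>))" for n and w :: "real \<times> real"
  have [measurable]: "Q n \<in> borel_measurable borel" for n unfolding Q_def[abs_def] by measurable
  have kQ: "(LINT p|lborel. k n p * cis (w \<bullet> rotate \<phi> p)) = of_real (Q n w)" for n w
  proof -
    define a b where "a = w \<bullet> (cos \<phi>, sin \<phi>)" and "b = w \<bullet> (- sin \<phi>, cos \<phi>)"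
    have "(LINT p|lborel. k n p * cis (w \<bullet> rotate \<phi> p))
      = (LINT p|lborel. (of_real (exp (- \<epsilon> * (fst p)\<^sup>2)) * cis ((a - \<tau>) * fst p)) * (of_real (exp (- \<sigma> n * (snd p)\<^sup>2)) * cis (b * snd p)))"
    proof (intro Bochner_Integration.integral_cong refl)
      fix p :: "real \<times> real"
      have "cis (- \<tau> * fst p) * cis (w \<bullet> rotate \<phi> p) = cis ((a - \<tau>) * fst p) * cis (b * snd p)"
        unfolding inner_rotate a_def[symmetric] b_def[symmetric] cis_mult by (simp add: algebra_simps)
      moreover have "k n p * cis (w \<bullet> rotate \<phi> p)
        = (of_real (exp (- \<epsilon> * (fst p)\<^sup>2)) * of_real (exp (- \<sigma> n * (snd p)\<^sup>2))) * (cis (- \<tau> * fst p) * cis (w \<bullet> rotate \<phi> p))"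
        unfolding k_def by (simp only: mult.assoc mult.left_commute[of "complex_of_real (exp (- \<sigma> n * (snd p)\<^sup>2))" "cis (- \<tau> * fst p)"])
      ultimately show "k n p * cis (w \<bullet> rotate \<phi> p)
        = (of_real (exp (- \<epsilon> * (fst p)\<^sup>2)) * cis ((a - \<tau>) * fst p)) * (of_real (exp (- \<sigma> n * (snd p)\<^sup>2)) * cis (b * snd p))"
        by (simp only: mult.assoc mult.left_commute[of "complex_of_real (exp (- \<sigma> n * (snd p)\<^sup>2))" "cis ((a - \<tau>) * fst p)"])
    qed
    also have "\<dots> = of_real (sqrt (pi / \<epsilon>) * exp (- (a - \<tau>)\<^sup>2 / (4 * \<epsilon>))) * of_real (sqrt (pi / \<sigma> n) * exp (- b\<^sup>2 / (4 * \<sigma> n)))"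
      unfolding lborel_prod_integrable(2)[OF integrable_gaussian_cis[OF \<epsilon>] integrable_gaussian_cis[OF \<sigma>]]
        integral_gaussian_cis[OF \<epsilon>] integral_gaussian_cis[OF \<sigma>] ..
    finally show ?thesis
      by (simp add: Q_def K_def heat_kernel_def a_def b_def)
  qed
  have A_eq: "A n = of_real (1 / (4 * pi\<^sup>2)) * (LINT p|lborel. F (rotate \<phi> (fst p, 2 * sqrt (\<sigma> n) * snd p)) * of_real (K (fst p) * (2 * sqrt pi * exp (- (snd p)\<^sup>2))))" for n
  proof -
    have "A n = (LINT p|lborel. of_real (1 / (4 * pi\<^sup>2)) * ((LINT w|lborel. F w * cis (w \<bullet> rotate \<phi> p)) * k n p))"
      unfolding A_def
    proof (intro Bochner_Integration.integral_cong refl)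
      fix p
      show "g p * of_real (exp (- \<sigma> n * (snd p)\<^sup>2)) = of_real (1 / (4 * pi\<^sup>2)) * ((LINT w|lborel. F w * cis (w \<bullet> rotate \<phi> p)) * k n p)"
        unfolding g_def k_def of_real_mult[of "W _"] W_eq by (simp only: mult_ac)
    qed
    also have "\<dots> = of_real (1 / (4 * pi\<^sup>2)) * (LINT p|lborel. (LINT w|lborel. F w * cis (w \<bullet> rotate \<phi> p)) * k n p)"
      by (rule integral_mult_right_zero)
    also have "(LINT p|lborel. (LINT w|lborel. F w * cis (w \<bullet> rotate \<phi> p)) * k n p) = (LINT w|lborel. F w * of_real (Q n w))"
      unfolding kQ[symmetric] by (rule integral_cis_swap[OF F_integrable ki]) measurable
    also have "\<dots> = (LINT p|lborel. F (rotate \<phi> p) * of_real (Q n (rotate \<phi> p)))"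
      by (rule integral_rotation(1)[OF c, symmetric]) measurable
    also have "\<dots> = (LINT p|lborel. F (rotate \<phi> p) * of_real (K (fst p) * heat_kernel (\<sigma> n) (snd p)))"
      unfolding Q_def rotate_inner_axes ..
    also have "\<dots> = (LINT t|lborel. LINT s|lborel. F (rotate \<phi> (t, s)) * of_real (K t * heat_kernel (\<sigma> n) s))"
    proof -
      have "integrable lborel (\<lambda>p. F (rotate \<phi> p) * of_real (K (fst p) * heat_kernel (\<sigma> n) (snd p)))"
      proof (rule Bochner_Integration.integrable_bound)
        show "integrable lborel (\<lambda>p. complex_of_real (K (fst p)) * of_real (heat_kernel (\<sigma> n) (snd p)))"
          using lborel_prod_integrable(1)[OF integrable_of_real[OF Ki] integrable_of_real[OF heat_kernel_integrable[OF \<sigma>[of n], of 0]]] by simp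
        show "AE p in lborel. norm (F (rotate \<phi> p) * of_real (K (fst p) * heat_kernel (\<sigma> n) (snd p)))
          \<le> norm (complex_of_real (K (fst p)) * of_real (heat_kernel (\<sigma> n) (snd p)))"
          by (intro AE_I2) (simp add: norm_mult F_bound mult_left_le_one_le)
      qed measurable
      then have "integrable (lborel \<Otimes>\<^sub>M lborel) (\<lambda>p. F (rotate \<phi> p) * of_real (K (fst p) * heat_kernel (\<sigma> n) (snd p)))"
        unfolding lborel_prod .
      from lborel_pair.integral_fst'[OF this] show ?thesis
        unfolding lborel_prod fst_conv snd_conv by (rule sym)
    qed
    \<comment> \<open>Rescaling \<open>s\<close> keeps the Gaussian fixed and moves the dependence
      on \<open>\<sigma> n\<close> into the argument of \<open>F\<close>, where continuity takes
      care of the limit.\<close>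
    also have "\<dots> = (LINT t|lborel. LINT s|lborel. F (rotate \<phi> (t, 2 * sqrt (\<sigma> n) * s)) * of_real (K t * (2 * sqrt pi * exp (- s\<^sup>2))))"
    proof (rule Bochner_Integration.integral_cong[OF refl])
      fix t
      have "(LINT s|lborel. F (rotate \<phi> (t, s)) * of_real (K t * heat_kernel (\<sigma> n) s))
          = (LINT s|lborel. (F (rotate \<phi> (t, s)) * of_real (K t)) * of_real (heat_kernel (\<sigma> n) (s - 0)))"
        by (simp add: mult.assoc)
      also have "\<dots> = (LINT s|lborel. (F (rotate \<phi> (t, 0 + 2 * sqrt (\<sigma> n) * s)) * of_real (K t)) * of_real (2 * sqrt pi * exp (- s\<^sup>2)))"
        by (rule integral_heat_kernel_substitution[OF \<sigma>])
      finally show "(LINT s|lborel. F (rotate \<phi> (t, s)) * of_real (K t * heat_kernel (\<sigma> n) s))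
        = (LINT s|lborel. F (rotate \<phi> (t, 2 * sqrt (\<sigma> n) * s)) * of_real (K t * (2 * sqrt pi * exp (- s\<^sup>2))))"
        by (simp add: mult.assoc)
    qed
    also have "\<dots> = (LINT p|lborel. F (rotate \<phi> (fst p, 2 * sqrt (\<sigma> n) * snd p)) * of_real (K (fst p) * (2 * sqrt pi * exp (- (snd p)\<^sup>2))))"
    proof -
      have "integrable lborel (\<lambda>p. F (rotate \<phi> (fst p, 2 * sqrt (\<sigma> n) * snd p)) * of_real (K (fst p) * (2 * sqrt pi * exp (- (snd p)\<^sup>2))))"
      proof (rule Bochner_Integration.integrable_bound)
        show "integrable lborel (\<lambda>p. complex_of_real (K (fst p)) * of_real (2 * sqrt pi * exp (- (snd p)\<^sup>2)))"
          using lborel_prod_integrable(1)[OF integrable_of_real[OF Ki] integrable_of_real[OF integrable_standard_gaussian]] by simp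
        show "AE p in lborel. norm (F (rotate \<phi> (fst p, 2 * sqrt (\<sigma> n) * snd p)) * of_real (K (fst p) * (2 * sqrt pi * exp (- (snd p)\<^sup>2))))
          \<le> norm (complex_of_real (K (fst p)) * of_real (2 * sqrt pi * exp (- (snd p)\<^sup>2)))"
          by (intro AE_I2) (simp add: norm_mult F_bound mult_left_le_one_le)
      qed measurable
      then have "integrable (lborel \<Otimes>\<^sub>M lborel) (\<lambda>p. F (rotate \<phi> (fst p, 2 * sqrt (\<sigma> n) * snd p)) * of_real (K (fst p) * (2 * sqrt pi * exp (- (snd p)\<^sup>2))))"
        unfolding lborel_prod .
      from lborel_pair.integral_fst'[OF this] show ?thesis
        unfolding lborel_prod fst_conv snd_conv .
    qed
    finally show ?thesis .
  qed
  have "(\<lambda>n. LINT p|lborel. F (rotate \<phi> (fst p, 2 * sqrt (\<sigma> n) * snd p)) * of_real (K (fst p) * (2 * sqrt pi * exp (- (snd p)\<^sup>2))))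
      \<longlonglongrightarrow> (LINT p|lborel. (ray \<phi> (fst p) * of_real (K (fst p))) * of_real (2 * sqrt pi * exp (- (snd p)\<^sup>2)))"
  proof (rule integral_dominated_convergence)
    show "integrable lborel (\<lambda>p. norm (complex_of_real (K (fst p)) * of_real (2 * sqrt pi * exp (- (snd p)\<^sup>2))))"
      using integrable_norm[OF lborel_prod_integrable(1)[OF integrable_of_real[OF Ki] integrable_of_real[OF integrable_standard_gaussian]]] .
    show "AE p in lborel. (\<lambda>n. F (rotate \<phi> (fst p, 2 * sqrt (\<sigma> n) * snd p)) * of_real (K (fst p) * (2 * sqrt pi * exp (- (snd p)\<^sup>2))))
      \<longlonglongrightarrow> (ray \<phi> (fst p) * of_real (K (fst p))) * of_real (2 * sqrt pi * exp (- (snd p)\<^sup>2))"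
    proof (rule AE_I2)
      fix p :: "real \<times> real"
      have "(\<lambda>n. rotate \<phi> (fst p, 2 * sqrt (\<sigma> n) * snd p)) \<longlonglongrightarrow> rotate \<phi> (fst p, 2 * sqrt 0 * snd p)"
        unfolding rotate_def fst_conv snd_conv by (intro tendsto_intros \<sigma>0)
      then have "(\<lambda>n. F (rotate \<phi> (fst p, 2 * sqrt (\<sigma> n) * snd p))) \<longlonglongrightarrow> F (rotate \<phi> (fst p, 2 * sqrt 0 * snd p))"
        using F_cont by (intro isCont_tendsto_compose[of _ F]) (metis UNIV_I continuous_on_eq_continuous_at open_UNIV)
      moreover have "F (rotate \<phi> (fst p, 2 * sqrt 0 * snd p)) = ray \<phi> (fst p)"
        by (simp add: rotate_def ray_def)
      ultimately have "(\<lambda>n. F (rotate \<phi> (fst p, 2 * sqrt (\<sigma> n) * snd p)) * of_real (K (fst p) * (2 * sqrt pi * exp (- (snd p)\<^sup>2))))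
        \<longlonglongrightarrow> ray \<phi> (fst p) * of_real (K (fst p) * (2 * sqrt pi * exp (- (snd p)\<^sup>2)))"
        by (simp only:) (intro tendsto_intros)
      then show "(\<lambda>n. F (rotate \<phi> (fst p, 2 * sqrt (\<sigma> n) * snd p)) * of_real (K (fst p) * (2 * sqrt pi * exp (- (snd p)\<^sup>2))))
        \<longlonglongrightarrow> (ray \<phi> (fst p) * of_real (K (fst p))) * of_real (2 * sqrt pi * exp (- (snd p)\<^sup>2))"
        by (simp add: mult.assoc)
    qed
    show "AE p in lborel. norm (F (rotate \<phi> (fst p, 2 * sqrt (\<sigma> n) * snd p)) * of_real (K (fst p) * (2 * sqrt pi * exp (- (snd p)\<^sup>2))))
      \<le> norm (complex_of_real (K (fst p)) * of_real (2 * sqrt pi * exp (- (snd p)\<^sup>2)))" for n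
      by (intro AE_I2) (simp add: norm_mult F_bound mult_left_le_one_le)
  qed measurable
  also have "(LINT p|lborel. (ray \<phi> (fst p) * of_real (K (fst p))) * of_real (2 * sqrt pi * exp (- (snd p)\<^sup>2)))
      = (LINT t|lborel. ray \<phi> t * of_real (K t)) * of_real (2 * pi)"
  proof -
    have "integrable lborel (\<lambda>t. ray \<phi> t * of_real (K t))"
      by (rule Bochner_Integration.integrable_bound[OF Ki]) (auto simp: norm_mult ray_bound K0 intro!: AE_I2 mult_left_le_one_le)
    from lborel_prod_integrable(2)[OF this integrable_of_real[OF integrable_standard_gaussian]]
    show ?thesis unfolding integral_complex_of_real integral_standard_gaussian .
  qed
  finally have "A \<longlonglongrightarrow> of_real (1 / (4 * pi\<^sup>2)) * ((LINT t|lborel. ray \<phi> t * of_real (K t)) * of_real (2 * pi))"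
    unfolding A_eq by (rule tendsto_mult_left)
  moreover have "of_real (1 / (4 * pi\<^sup>2)) * ((LINT t|lborel. ray \<phi> t * of_real (K t)) * of_real (2 * pi)) = ray_average \<epsilon> \<phi> \<tau>"
    by (simp add: ray_average_def K_def power2_eq_square)
  ultimately show "A \<longlonglongrightarrow> ray_average \<epsilon> \<phi> \<tau>" by simp
qed

end

section \<open>Nonnegativity of the Radon transform and the slice identity without damping\<close>

context wigner_transform
begin

lemma radon_gaussian_0:
  assumes "good_angle \<phi>" "\<epsilon> > 0"
  shows "(LINT x|lborel. radon W x \<phi> * exp (- \<epsilon> * x\<^sup>2)) = Re (ray_average \<epsilon> \<phi> 0)"
proof -
  have "complex_of_real (LINT x|lborel. radon W x \<phi> * exp (- \<epsilon> * x\<^sup>2)) = ray_average \<epsilon> \<phi> 0"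
    using radon_gaussian[OF assms, of 0] unfolding integral_complex_of_real[symmetric] by (simp del: of_real_mult)
  then show ?thesis by (metis Re_complex_of_real)
qed

text \<open>The damped integral is the difference of the damped positive and negative parts and
  tends to \<open>F 0 = 1\<close>. The positive parts are bounded by \<open>?P\<close>, the negative
  ones from below by \<open>?N\<close>. Nothing guarantees that \<open>?P\<close> is finite, so the
  inequality is stated additively.\<close>

lemma radon_positive_part_ge:
  assumes "good_angle \<phi>"
  shows "(\<integral>\<^sup>+x. ennreal (- (radon W x \<phi> * exp (- 1 * x\<^sup>2))) \<partial>lborel) + 1 \<le> (\<integral>\<^sup>+x. ennreal (radon W x \<phi>) \<partial>lborel)"
    (is "?N + 1 \<le> ?P")
proof -
  define m where "m n = Re (ray_average (1 / real (Suc n)) \<phi> 0)" for n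
  have "?N + ennreal (1 + m n) \<le> ?P + 1" for n
  proof -
    define \<epsilon> where "\<epsilon> = 1 / real (Suc n)"
    have \<epsilon>: "\<epsilon> > 0" "\<epsilon> \<le> 1" by (simp_all add: \<epsilon>_def)
    define f where "f x = radon W x \<phi> * exp (- \<epsilon> * x\<^sup>2)" for x
    have fi: "integrable lborel f"
      unfolding f_def[abs_def] by (rule radon_gaussian_integrable[OF assms \<epsilon>(1)])
    have "(\<integral>\<^sup>+x. ennreal (f x) \<partial>lborel) < \<infinity>" "(\<integral>\<^sup>+x. ennreal (- f x) \<partial>lborel) < \<infinity>"
      using fi by (auto simp: real_integrable_def top.not_eq_extremum)
    then obtain p q where p: "(\<integral>\<^sup>+x. ennreal (f x) \<partial>lborel) = ennreal p" "p \<ge> 0"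
      and q: "(\<integral>\<^sup>+x. ennreal (- f x) \<partial>lborel) = ennreal q" "q \<ge> 0"
      by (metis ennreal_cases infinity_ennreal_def less_irrefl)
    have "integral\<^sup>L lborel f = p - q"
      using real_lebesgue_integral_def[OF fi] p q by simp
    then have m: "m n = p - q"
      using radon_gaussian_0[OF assms \<epsilon>(1)] unfolding m_def f_def[abs_def] \<epsilon>_def by (metis (no_types))
    \<comment> \<open>Adding 1 keeps the real number nonnegative, so \<open>ennreal\<close> does not
      truncate it.\<close>
    have "m n \<ge> - 1"
      unfolding m_def using ray_average_bound[of "1 / real (Suc n)" \<phi> 0] abs_Re_le_cmod[of "ray_average (1 / real (Suc n)) \<phi> 0"] by simp
    then have "ennreal q + ennreal (1 + m n) = ennreal (q + (1 + m n))"
      using q by (simp add: ennreal_plus)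
    also have "\<dots> = ennreal p + 1"
      using p by (simp add: m ennreal_plus[symmetric] del: ennreal_plus flip: ennreal_1)
    finally have e: "ennreal q + ennreal (1 + m n) = ennreal p + 1" .
    \<comment> \<open>As \<open>\<epsilon> \<le> 1\<close>, the fixed damping in \<open>?N\<close>
      is the stronger one.\<close>
    have "?N \<le> ennreal q"
      unfolding q(1)[symmetric]
    proof (rule nn_integral_mono)
      fix x
      show "ennreal (- (radon W x \<phi> * exp (- 1 * x\<^sup>2))) \<le> ennreal (- f x)"
      proof (cases "radon W x \<phi> \<le> 0")
        case True
        have "\<epsilon> * x\<^sup>2 \<le> 1 * x\<^sup>2" by (rule mult_right_mono) (use \<epsilon> in auto)
        then have "exp (- 1 * x\<^sup>2) \<le> exp (- \<epsilon> * x\<^sup>2)" by simp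
        then have "radon W x \<phi> * exp (- \<epsilon> * x\<^sup>2) \<le> radon W x \<phi> * exp (- 1 * x\<^sup>2)"
          by (rule mult_left_mono_neg) (rule True)
        then show ?thesis unfolding f_def by (intro ennreal_leI) linarith
      next
        case False
        then have "- (radon W x \<phi> * exp (- 1 * x\<^sup>2)) \<le> 0" by simp
        then show ?thesis by (simp only: ennreal_neg) simp
      qed
    qed
    moreover have "ennreal p \<le> ?P"
      unfolding p(1)[symmetric]
    proof (rule nn_integral_mono)
      fix x
      show "ennreal (f x) \<le> ennreal (radon W x \<phi>)"
      proof (cases "radon W x \<phi> \<ge> 0")
        case True
        then have "radon W x \<phi> * exp (- \<epsilon> * x\<^sup>2) \<le> radon W x \<phi> * 1"
          using \<epsilon> by (intro mult_left_mono) auto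
        then show ?thesis unfolding f_def by (intro ennreal_leI) simp
      next
        case False
        then have "f x \<le> 0" unfolding f_def by (simp add: mult_nonpos_nonneg)
        then show ?thesis by (simp only: ennreal_neg) simp
      qed
    qed
    ultimately have "?N + ennreal (1 + m n) \<le> ennreal q + ennreal (1 + m n)" "ennreal p + 1 \<le> ?P + 1"
      by (auto intro: add_mono)
    then show ?thesis unfolding e by (rule order_trans)
  qed
  moreover have "(\<lambda>n. ?N + ennreal (1 + m n)) \<longlonglongrightarrow> ?N + ennreal (1 + 1)"
  proof -
    have "m \<longlonglongrightarrow> Re (ray \<phi> 0)" unfolding m_def by (intro tendsto_Re ray_average_tendsto)
    moreover have "Re (ray \<phi> 0) = 1" using F_0 by (simp add: ray_def zero_prod_def)
    ultimately show ?thesis by (intro tendsto_add tendsto_ennrealI tendsto_const) simp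
  qed
  ultimately have "?N + ennreal (1 + 1) \<le> ?P + 1" by (intro LIMSEQ_le_const2) auto
  moreover have "?N + ennreal (1 + 1) = 1 + (?N + 1)"
    by (subst ennreal_plus) (auto simp: add_ac)
  ultimately have "1 + (?N + 1) \<le> 1 + ?P" by (simp only: add.commute)
  then show ?thesis by (simp only: ennreal_add_left_cancel_le) simp
qed

text \<open>Almost every angle contributes at least 1 plus the damped negative part, and the angles
  have total length \<open>pi\<close>. The assumed mass forces the negative parts to vanish almost
  everywhere.\<close>

lemma AE_radon_nonneg:
  assumes mass: "(\<integral>\<^sup>+\<phi>. indicator {0..pi} \<phi> * (\<integral>\<^sup>+x. ennreal (radon W x \<phi>) \<partial>lborel) \<partial>lborel) \<le> ennreal pi"
  shows "AE \<phi> in lborel. \<phi> \<in> {0..pi} \<longrightarrow> (AE x in lborel. 0 \<le> radon W x \<phi>)"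
proof -
  have [measurable]: "(\<lambda>(\<phi>, x). radon W x \<phi>) \<in> borel_measurable (borel \<Otimes>\<^sub>M borel)"
    unfolding radon_def by measurable
  define N where "N \<phi> = (\<integral>\<^sup>+x. ennreal (- (radon W x \<phi> * exp (- 1 * x\<^sup>2))) \<partial>lborel)" for \<phi>
  define P where "P \<phi> = (\<integral>\<^sup>+x. ennreal (radon W x \<phi>) \<partial>lborel)" for \<phi>
  have Nm [measurable]: "N \<in> borel_measurable borel" unfolding N_def[abs_def] by measurable
  have "(\<integral>\<^sup>+\<phi>. indicator {0..pi} \<phi> * N \<phi> \<partial>lborel) + ennreal pi
      = (\<integral>\<^sup>+\<phi>. indicator {0..pi} \<phi> * N \<phi> + indicator {0..pi} \<phi> \<partial>lborel)"
    by (subst nn_integral_add) simp_all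
  also have "\<dots> \<le> (\<integral>\<^sup>+\<phi>. indicator {0..pi} \<phi> * P \<phi> \<partial>lborel)"
  proof (rule nn_integral_mono_AE, use AE_good_angle in eventually_elim)
    case (elim \<phi>)
    then show ?case
      using radon_positive_part_ge[of \<phi>] by (auto simp: indicator_def N_def P_def)
  qed
  also have "\<dots> \<le> 0 + ennreal pi" using mass by (simp add: P_def)
  finally have "(\<integral>\<^sup>+\<phi>. indicator {0..pi} \<phi> * N \<phi> \<partial>lborel) \<le> 0"
    by (simp add: ennreal_add_left_cancel_le add.commute[of _ "ennreal pi"])
  then have "AE \<phi> in lborel. indicator {0..pi} \<phi> * N \<phi> = 0"
    by (subst (asm) le_zero_eq, subst (asm) nn_integral_0_iff_AE) measurable
  then show ?thesis
  proof eventually_elim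
    case (elim \<phi>)
    show ?case
    proof
      assume "\<phi> \<in> {0..pi}"
      then have "N \<phi> = 0" using elim by simp
      then have "AE x in lborel. ennreal (- (radon W x \<phi> * exp (- 1 * x\<^sup>2))) = 0"
        unfolding N_def by (subst (asm) nn_integral_0_iff_AE) measurable
      then show "AE x in lborel. 0 \<le> radon W x \<phi>"
      proof eventually_elim
        case (elim x)
        then have "0 \<le> radon W x \<phi> * exp (- 1 * x\<^sup>2)" by (simp only: ennreal_eq_0_iff)
        then show ?case by (simp add: zero_le_mult_iff)
      qed
    qed
  qed
qed

text \<open>For a nonnegative slice the damped masses, at most 1, bound the undamped mass by Fatou;
  the slice then serves as its own majorant when the damping is removed.\<close>

lemma radon_char:
  assumes good: "good_angle \<phi>" and nonneg: "AE x in lborel. 0 \<le> radon W x \<phi>"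
  shows "integrable lborel (\<lambda>x. radon W x \<phi>)"
    "(LINT x|lborel. of_real (radon W x \<phi>) * cis (- \<tau> * x)) = ray \<phi> \<tau>"
proof -
  have "(\<integral>\<^sup>+x. ennreal (radon W x \<phi>) \<partial>lborel) \<le> 1"
  proof (rule nn_integral_gaussian_limit)
    fix \<epsilon> :: real assume \<epsilon>: "\<epsilon> > 0"
    have "(\<integral>\<^sup>+x. ennreal (radon W x \<phi>) * ennreal (exp (- \<epsilon> * (norm x)\<^sup>2)) \<partial>lborel)
        = (\<integral>\<^sup>+x. ennreal (radon W x \<phi> * exp (- \<epsilon> * x\<^sup>2)) \<partial>lborel)"
      by (rule nn_integral_cong) (simp add: ennreal_mult'')
    also have "\<dots> = ennreal (Re (ray_average \<epsilon> \<phi> 0))"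
      unfolding radon_gaussian_0[OF good \<epsilon>, symmetric]
      by (rule nn_integral_eq_integral[OF radon_gaussian_integrable[OF good \<epsilon>]]) (use nonneg in eventually_elim, simp)
    also have "\<dots> \<le> 1"
      using ray_average_bound[OF \<epsilon>, of \<phi> 0] abs_Re_le_cmod[of "ray_average \<epsilon> \<phi> 0"]
      by simp
    finally show "(\<integral>\<^sup>+x. ennreal (radon W x \<phi>) * ennreal (exp (- \<epsilon> * (norm x)\<^sup>2)) \<partial>lborel) \<le> 1" .
  qed measurable
  also have "(1::ennreal) < \<infinity>" by simp
  finally show i: "integrable lborel (\<lambda>x. radon W x \<phi>)"
    by (intro integrableI_nonneg nonneg) auto
  show "(LINT x|lborel. of_real (radon W x \<phi>) * cis (- \<tau> * x)) = ray \<phi> \<tau>"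
  proof (rule LIMSEQ_unique)
    show "(\<lambda>n. ray_average (1 / real (Suc n)) \<phi> \<tau>) \<longlonglongrightarrow> ray \<phi> \<tau>" by (rule ray_average_tendsto)
    have "(\<lambda>n. LINT x|lborel. of_real (radon W x \<phi> * exp (- (1 / real (Suc n)) * x\<^sup>2)) * cis (- \<tau> * x))
        \<longlonglongrightarrow> (LINT x|lborel. of_real (radon W x \<phi>) * cis (- \<tau> * x))"
    proof (rule integral_dominated_convergence[OF _ _ integrable_norm[OF i]])
      show "AE x in lborel. (\<lambda>n. of_real (radon W x \<phi> * exp (- (1 / real (Suc n)) * x\<^sup>2)) * cis (- \<tau> * x))
        \<longlonglongrightarrow> of_real (radon W x \<phi>) * cis (- \<tau> * x)"
      proof (rule AE_I2)
        fix x :: real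
        have "(\<lambda>n. of_real (radon W x \<phi> * exp (- (1 / real (Suc n)) * x\<^sup>2)) * cis (- \<tau> * x))
          \<longlonglongrightarrow> of_real (radon W x \<phi> * exp (- 0 * x\<^sup>2)) * cis (- \<tau> * x)"
          by (intro tendsto_intros LIMSEQ_Suc[OF lim_1_over_n])
        then show "(\<lambda>n. of_real (radon W x \<phi> * exp (- (1 / real (Suc n)) * x\<^sup>2)) * cis (- \<tau> * x))
          \<longlonglongrightarrow> of_real (radon W x \<phi>) * cis (- \<tau> * x)" by simp
      qed
      show "AE x in lborel. norm (of_real (radon W x \<phi> * exp (- (1 / real (Suc n)) * x\<^sup>2)) * cis (- \<tau> * x)) \<le> norm (radon W x \<phi>)" for n
        by (intro AE_I2) (simp add: norm_mult mult_right_le_one_le)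
    qed measurable
    then show "(\<lambda>n. ray_average (1 / real (Suc n)) \<phi> \<tau>) \<longlonglongrightarrow> (LINT x|lborel. of_real (radon W x \<phi>) * cis (- \<tau> * x))"
      by (subst radon_gaussian[OF good, symmetric]) auto
  qed
qed

end

section \<open>Moments of the kernel\<close>

text \<open>Twice the Fourier transform of the kernel with bandwidth \<open>1 / D\<close>.\<close>

definition cut :: "real \<Rightarrow> real \<Rightarrow> real" where
  "cut D r = indicator {- D..D} r * \<bar>r\<bar>"

definition cut_conv :: "real \<Rightarrow> real \<Rightarrow> real" where
  "cut_conv D t = (LINT r|lborel. cut D r * cut D (t - r))"

lemma cut_measurable [measurable]: "cut D \<in> borel_measurable borel"
  unfolding cut_def[abs_def] by measurable

lemma cut_eq: "cut D r = (if \<bar>r\<bar> \<le> D then \<bar>r\<bar> else 0)"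
  by (auto simp: cut_def indicator_def abs_le_iff)

lemma cut_nonneg: "0 \<le> cut D r"
  by (simp add: cut_def)

lemma cut_le: "cut D r \<le> D * indicator {- D..D} r"
  by (auto simp: cut_eq indicator_def abs_le_iff)

lemma cut_integrable: "integrable lborel (cut D)"
proof (rule Bochner_Integration.integrable_bound)
  show "integrable lborel (\<lambda>r. D * indicator {- D..D} r :: real)" by (intro integrable_mult_right integrable_real_indicator) (auto simp: emeasure_lborel_Icc_eq)
  show "AE r in lborel. norm (cut D r) \<le> norm (D * indicator {- D..D} r :: real)"
    by (rule AE_I2) (use cut_le[of D] cut_nonneg[of D] in \<open>simp add: abs_of_nonneg order_trans[OF _ abs_ge_self]\<close>)
qed simp

lemma cut_scale: "D > 0 \<Longrightarrow> cut D (D * r) = D * cut 1 r"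
  using mult_le_cancel_left_pos[of D "\<bar>r\<bar>" 1] by (auto simp: cut_eq abs_mult)

lemma cut_pair_integrable:
  "integrable (lborel \<Otimes>\<^sub>M lborel) (\<lambda>p. cut D (fst p) * cut D (snd p - fst p))"
proof (rule Bochner_Integration.integrable_bound)
  have i: "integrable lborel (\<lambda>r. complex_of_real (c * indicator {- a..a} r))" for a c :: real
    by (intro integrable_of_real integrable_mult_right integrable_real_indicator) (auto simp: emeasure_lborel_Icc_eq)
  show "integrable (lborel \<Otimes>\<^sub>M lborel) (\<lambda>p. complex_of_real (D * indicator {- D..D} (fst p)) * of_real (D * indicator {- (2 * D)..2 * D} (snd p)))"
    using lborel_prod_integrable(1)[OF i[of D D] i[of D "2 * D"]] unfolding lborel_prod .
  show "AE p in lborel \<Otimes>\<^sub>M lborel. norm (cut D (fst p) * cut D (snd p - fst p))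
    \<le> norm (complex_of_real (D * indicator {- D..D} (fst p)) * of_real (D * indicator {- (2 * D)..2 * D} (snd p)))"
  proof (rule AE_I2)
    fix p :: "real \<times> real"
    have "cut D (fst p) * cut D (snd p - fst p) \<le> \<bar>D * indicator {- D..D} (fst p)\<bar> * \<bar>D * indicator {- (2 * D)..2 * D} (snd p)\<bar>"
    proof (cases "fst p \<in> {- D..D} \<and> snd p - fst p \<in> {- D..D}")
      case True
      then have "snd p \<in> {- (2 * D)..2 * D}" by auto
      then show ?thesis using True by (auto simp: cut_def intro!: mult_mono)
    qed (auto simp: cut_def)
    then show "norm (cut D (fst p) * cut D (snd p - fst p))
      \<le> norm (complex_of_real (D * indicator {- D..D} (fst p)) * of_real (D * indicator {- (2 * D)..2 * D} (snd p)))"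
      using cut_nonneg[of D "fst p"] cut_nonneg[of D "snd p - fst p"] unfolding norm_mult norm_of_real real_norm_def by (simp add: abs_of_nonneg)
  qed
qed measurable

lemma cut_conv_integrable: "integrable lborel (cut_conv D)"
  using lborel_pair.integrable_snd[of "\<lambda>r t. cut D r * cut D (t - r)"] cut_pair_integrable[of D]
  by (simp add: cut_conv_def[abs_def] case_prod_beta')

lemma cut_conv_measurable [measurable]: "cut_conv D \<in> borel_measurable borel"
  unfolding cut_conv_def[abs_def] by measurable

lemma cut_fourier_square:
  "(LINT r|lborel. of_real (cut D r) * cis (r * u))\<^sup>2 = (LINT t|lborel. of_real (cut_conv D t) * cis (t * u))"
proof -
  define a where "a r = of_real (cut D r) * cis (r * u)" for r
  have am [measurable]: "a \<in> borel_measurable borel" unfolding a_def[abs_def] by measurable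
  have a_conv: "a r * a (t - r) = of_real (cut D r * cut D (t - r)) * cis (t * u)" for r t
  proof -
    have "cis (r * u) * cis ((t - r) * u) = cis (t * u)" by (simp add: cis_mult algebra_simps)
    then show ?thesis unfolding a_def of_real_mult by (metis (no_types, lifting) mult.assoc mult.left_commute)
  qed
  have "(LINT r|lborel. a r)\<^sup>2 = (LINT r|lborel. a r * (LINT s|lborel. a s))"
    by (simp add: power2_eq_square)
  also have "\<dots> = (LINT r|lborel. LINT t|lborel. a r * a (t - r))"
  proof (rule Bochner_Integration.integral_cong[OF refl])
    fix r
    have "(LINT s|lborel. a s) = (LINT t|lborel. a (t - r))"
      using lborel_integral_real_affine[of 1 a "- r"] by simp
    then show "a r * (LINT s|lborel. a s) = (LINT t|lborel. a r * a (t - r))" by simp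
  qed
  also have "\<dots> = (LINT t|lborel. LINT r|lborel. a r * a (t - r))"
  proof (rule lborel_pair.Fubini_integral[symmetric])
    show "integrable (lborel \<Otimes>\<^sub>M lborel) (\<lambda>(r, t). a r * a (t - r))"
      by (rule Bochner_Integration.integrable_bound[OF cut_pair_integrable[of D]]) (auto simp: a_conv norm_mult)
  qed
  also have "\<dots> = (LINT t|lborel. of_real (cut_conv D t) * cis (t * u))"
  proof (rule Bochner_Integration.integral_cong[OF refl])
    fix t
    have "(LINT r|lborel. a r * a (t - r)) = (LINT r|lborel. complex_of_real (cut D r * cut D (t - r))) * cis (t * u)"
      unfolding a_conv by (rule integral_mult_left_zero)
    also have "(LINT r|lborel. complex_of_real (cut D r * cut D (t - r))) = of_real (cut_conv D t)"
      unfolding cut_conv_def by (rule integral_complex_of_real)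
    finally show "(LINT r|lborel. a r * a (t - r)) = of_real (cut_conv D t) * cis (t * u)" .
  qed
  finally show ?thesis unfolding a_def .
qed

lemma kern_eq: "complex_of_real (kern \<delta> u) = of_real (1 / (4 * pi)) * (LINT r|lborel. of_real (cut (1 / \<delta>) r) * cis (r * u))"
  unfolding of_real_kern set_lebesgue_integral_def cut_def cis_conv_exp
  by (simp add: scaleR_conv_of_real mult.assoc)

lemma kern_square_eq:
  "complex_of_real ((kern \<delta> u)\<^sup>2) = of_real (1 / (16 * pi\<^sup>2)) * (LINT t|lborel. of_real (cut_conv (1 / \<delta>) t) * cis (t * u))"
  unfolding cut_fourier_square[symmetric] of_real_power kern_eq power_mult_distrib by (simp add: power_divide power_mult_distrib)

lemma kern_measurable [measurable]: "kern \<delta> \<in> borel_measurable borel"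
  unfolding kern_def[abs_def] set_lebesgue_integral_def by measurable

lemma kern_bounded: "\<bar>kern \<delta> u\<bar> \<le> 1 / (4 * pi) * (LINT r|lborel. cut (1 / \<delta>) r)"
proof -
  have "\<bar>kern \<delta> u\<bar> = cmod (of_real (1 / (4 * pi)) * (LINT r|lborel. of_real (cut (1 / \<delta>) r) * cis (r * u)))"
    unfolding kern_eq[symmetric] by simp
  also have "\<dots> = 1 / (4 * pi) * cmod (LINT r|lborel. of_real (cut (1 / \<delta>) r) * cis (r * u))"
    by (simp add: norm_mult norm_divide)
  also have "cmod (LINT r|lborel. of_real (cut (1 / \<delta>) r) * cis (r * u)) \<le> (LINT r|lborel. cut (1 / \<delta>) r)"
  proof (rule Bochner_Integration.integral_norm_bound_integral)
    show "integrable lborel (\<lambda>r. of_real (cut (1 / \<delta>) r) * cis (r * u))"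
      by (rule Bochner_Integration.integrable_bound[OF cut_integrable[of "1 / \<delta>"]]) (auto simp: norm_mult)
  qed (auto simp: norm_mult cut_nonneg cut_integrable)
  finally show ?thesis by (simp add: divide_right_mono)
qed

section \<open>Expectations of the kernel and of its square\<close>

lemma (in prob_space) fourier_expectation:
  fixes f :: "real \<Rightarrow> complex"
  assumes f: "integrable lborel f" and Y [measurable]: "Y \<in> borel_measurable M"
  shows "expectation (\<lambda>\<omega>. LINT t|lborel. f t * cis (t * Y \<omega>)) = (LINT t|lborel. f t * (LINT \<omega>|M. cis (t * Y \<omega>)))"
proof -
  interpret pair_sigma_finite M "lborel :: real measure" ..
  have [measurable]: "f \<in> borel_measurable borel" using f by (auto dest: borel_measurable_integrable)
  have "integrable (M \<Otimes>\<^sub>M lborel) (\<lambda>(\<omega>, t). f t * cis (t * Y \<omega>))"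
  proof (rule Fubini_integrable)
    show "AE \<omega> in M. integrable lborel (\<lambda>t. case (\<omega>, t) of (\<omega>, t) \<Rightarrow> f t * cis (t * Y \<omega>))"
      by (rule AE_I2, simp) (rule Bochner_Integration.integrable_bound[OF f], auto simp: norm_mult)
  qed (auto simp: norm_mult)
  from Fubini_integral[OF this] show ?thesis by simp
qed

text \<open>The kernel and its square are Fourier integrals, so by Fubini their expectations depend
  on the law of \<open>Y\<close> only through its characteristic function.\<close>

lemma (in prob_space) kern_moments:
  assumes Y [measurable]: "Y \<in> borel_measurable M"
    and char: "\<And>t. (LINT \<omega>|M. cis (t * Y \<omega>)) = \<psi> t"
  shows "complex_of_real (expectation (\<lambda>\<omega>. kern \<delta> (Y \<omega>))) = of_real (1 / (4 * pi)) * (LINT t|lborel. of_real (cut (1 / \<delta>) t) * \<psi> t)"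
    and "complex_of_real (expectation (\<lambda>\<omega>. (kern \<delta> (Y \<omega>))\<^sup>2)) = of_real (1 / (16 * pi\<^sup>2)) * (LINT t|lborel. of_real (cut_conv (1 / \<delta>) t) * \<psi> t)"
  unfolding integral_complex_of_real[symmetric] kern_eq kern_square_eq integral_mult_right_zero
    fourier_expectation[OF integrable_of_real[OF cut_integrable] Y]
    fourier_expectation[OF integrable_of_real[OF cut_conv_integrable] Y] char by (rule refl)+

text \<open>Two factors \<open>\<bar>r\<bar>\<close> and one \<open>dr\<close> make the convolution
  homogeneous of degree three, the origin of the cubed logarithm.\<close>

lemma cut_conv_scale:
  assumes "D > 0" shows "cut_conv D t = D ^ 3 * cut_conv 1 (t / D)"
proof -
  have "cut_conv D t = D * (LINT s|lborel. cut D (D * s) * cut D (t - D * s))"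
    unfolding cut_conv_def using assms lborel_integral_real_affine[of D "\<lambda>r. cut D r * cut D (t - r)" 0] by simp
  also have "(\<lambda>s. cut D (D * s) * cut D (t - D * s)) = (\<lambda>s. D\<^sup>2 * (cut 1 s * cut 1 (t / D - s)))"
  proof
    fix s
    have "t - D * s = D * (t / D - s)" using assms by (simp add: field_simps)
    then show "cut D (D * s) * cut D (t - D * s) = D\<^sup>2 * (cut 1 s * cut 1 (t / D - s))"
      using assms by (simp add: cut_scale power2_eq_square)
  qed
  finally show ?thesis by (simp add: cut_conv_def power2_eq_square power3_eq_cube)
qed

lemma cut_conv_1_bounds: "0 \<le> cut_conv 1 t" "cut_conv 1 t \<le> 2"
proof -
  show "0 \<le> cut_conv 1 t" unfolding cut_conv_def by (simp add: cut_nonneg)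
  have le1: "cut 1 s \<le> 1" for s by (simp add: cut_eq)
  have "cut_conv 1 t \<le> (LINT r|lborel. indicator {- 1..1 :: real} r)"
    unfolding cut_conv_def
  proof (rule Bochner_Integration.integral_mono')
    show "integrable lborel (indicator {- 1..1} :: real \<Rightarrow> real)" by (rule integrable_real_indicator) auto
    fix r :: real
    have "cut 1 r * cut 1 (t - r) \<le> (1 * indicator {- 1..1} r) * 1"
      by (intro mult_mono cut_le le1 cut_nonneg) auto
    then show "cut 1 r * cut 1 (t - r) \<le> indicator {- 1..1} r" by simp
  qed auto
  then show "cut_conv 1 t \<le> 2" by simp
qed

text \<open>At 0 the self-convolution is the integral of \<open>r\<^sup>2\<close> over
  \<open>{- 1..1}\<close>.\<close>

lemma cut_conv_1_tendsto:
  assumes "x \<longlonglongrightarrow> 0"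
  shows "(\<lambda>n. cut_conv 1 (x n)) \<longlonglongrightarrow> 2 / 3"
proof -
  have le1: "cut 1 s \<le> 1" for s by (simp add: cut_eq)
  have "(\<lambda>n. cut_conv 1 (x n)) \<longlonglongrightarrow> (LINT r|lborel. cut 1 r * cut 1 (- r))"
    unfolding cut_conv_def
  proof (rule integral_dominated_convergence)
    show "integrable lborel (indicator {- 1..1} :: real \<Rightarrow> real)" by (rule integrable_real_indicator) auto
    \<comment> \<open>The cut jumps at \<open>r = 1\<close> and \<open>r = - 1\<close>; elsewhere it
      is continuous.\<close>
    have "AE r in lborel. r \<noteq> (1::real)" "AE r in lborel. r \<noteq> (- 1::real)" by (rule AE_lborel_singleton)+
    then show "AE r in lborel. (\<lambda>n. cut 1 r * cut 1 (x n - r)) \<longlonglongrightarrow> cut 1 r * cut 1 (- r)"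
    proof eventually_elim
      case (elim r)
      have x: "(\<lambda>n. x n - r) \<longlonglongrightarrow> - r" using tendsto_diff[OF assms tendsto_const[of r]] by simp
      have "(\<lambda>n. cut 1 (x n - r)) \<longlonglongrightarrow> cut 1 (- r)"
      proof (cases "\<bar>r\<bar> < 1")
        case True
        have "eventually (\<lambda>n. \<bar>x n - r\<bar> < 1) sequentially"
          using order_tendstoD(2)[OF tendsto_rabs[OF x], of 1] True by simp
        then have "eventually (\<lambda>n. \<bar>x n - r\<bar> = cut 1 (x n - r)) sequentially"
          by eventually_elim (auto simp: cut_def indicator_def)
        then show ?thesis
          by (rule Lim_transform_eventually[rotated]) (use tendsto_rabs[OF x] True in \<open>auto simp: cut_def indicator_def\<close>)
      next
        case False
        then have "\<bar>r\<bar> > 1" using elim by (auto simp: abs_if split: if_splits)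
        then have "eventually (\<lambda>n. \<bar>x n - r\<bar> > 1) sequentially"
          using order_tendstoD(1)[OF tendsto_rabs[OF x], of 1] by simp
        then have "eventually (\<lambda>n. 0 = cut 1 (x n - r)) sequentially"
          by eventually_elim (auto simp: cut_def indicator_def)
        then show ?thesis
          by (rule Lim_transform_eventually[rotated]) (use \<open>\<bar>r\<bar> > 1\<close> in \<open>auto simp: cut_def indicator_def\<close>)
      qed
      then show ?case by (intro tendsto_intros)
    qed
    show "AE r in lborel. norm (cut 1 r * cut 1 (x n - r)) \<le> indicator {- 1..1} r" for n
    proof (rule AE_I2)
      fix r :: real
      have "cut 1 r * cut 1 (x n - r) \<le> (1 * indicator {- 1..1} r) * 1"
        by (intro mult_mono cut_le le1 cut_nonneg) auto
      then show "norm (cut 1 r * cut 1 (x n - r)) \<le> indicator {- 1..1} r" by (simp add: cut_nonneg abs_mult)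
    qed
  qed measurable
  also have "(LINT r|lborel. cut 1 r * cut 1 (- r)) = (LINT r|lborel. r ^ 2 * indicator {- 1..1} r)"
    by (intro Bochner_Integration.integral_cong refl) (auto simp: cut_def indicator_def power2_eq_square)
  also have "\<dots> = 2 / 3" by (subst integral_power) auto
  finally show ?thesis .
qed

lemma cut_conv_limit:
  fixes \<psi> :: "real \<Rightarrow> complex"
  assumes \<psi>: "integrable lborel \<psi>" and D: "filterlim D at_top sequentially"
  shows "(\<lambda>n. (LINT t|lborel. of_real (cut_conv (D n) t) * \<psi> t) / of_real (D n ^ 3)) \<longlonglongrightarrow> of_real (2 / 3) * (LINT t|lborel. \<psi> t)"
proof -
  have [measurable]: "\<psi> \<in> borel_measurable borel" using \<psi> by (auto dest: borel_measurable_integrable)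
  have "(\<lambda>n. LINT t|lborel. of_real (cut_conv 1 (t / D n)) * \<psi> t) \<longlonglongrightarrow> (LINT t|lborel. of_real (2 / 3) * \<psi> t)"
  proof (rule integral_dominated_convergence)
    show "integrable lborel (\<lambda>t. 2 * norm (\<psi> t))" using \<psi> by simp
    show "AE t in lborel. (\<lambda>n. of_real (cut_conv 1 (t / D n)) * \<psi> t) \<longlonglongrightarrow> of_real (2 / 3) * \<psi> t"
      by (intro AE_I2 tendsto_mult tendsto_of_real tendsto_const cut_conv_1_tendsto
          tendsto_divide_0[OF tendsto_const] filterlim_at_top_imp_at_infinity[OF D])
    show "AE t in lborel. norm (of_real (cut_conv 1 (t / D n)) * \<psi> t) \<le> 2 * norm (\<psi> t)" for n
      by (intro AE_I2) (use cut_conv_1_bounds in \<open>auto simp: norm_mult intro!: mult_right_mono\<close>)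
  qed measurable
  then have lim: "(\<lambda>n. LINT t|lborel. of_real (cut_conv 1 (t / D n)) * \<psi> t) \<longlonglongrightarrow> of_real (2 / 3) * (LINT t|lborel. \<psi> t)"
    by (simp only: integral_mult_right_zero)
  have "eventually (\<lambda>n. D n > 0) sequentially" using D by (rule filterlim_at_top_dense[THEN iffD1, rule_format])
  then have "eventually (\<lambda>n. (LINT t|lborel. of_real (cut_conv 1 (t / D n)) * \<psi> t)
      = (LINT t|lborel. of_real (cut_conv (D n) t) * \<psi> t) / of_real (D n ^ 3)) sequentially"
  proof eventually_elim
    case (elim n)
    have "(LINT t|lborel. of_real (cut_conv (D n) t) * \<psi> t) = (LINT t|lborel. of_real (D n ^ 3) * (of_real (cut_conv 1 (t / D n)) * \<psi> t))"
      by (simp only: cut_conv_scale[OF elim] of_real_mult mult.assoc)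
    also have "\<dots> = of_real (D n ^ 3) * (LINT t|lborel. of_real (cut_conv 1 (t / D n)) * \<psi> t)"
      by (rule integral_mult_right_zero)
    finally show ?case using elim by simp
  qed
  from Lim_transform_eventually[OF lim this] show ?thesis .
qed

section \<open>Bias of the estimator\<close>

lemma nn_integral_radial:
  fixes g :: "real \<Rightarrow> ennreal"
  assumes [measurable]: "g \<in> borel_measurable borel"
  shows "(\<integral>\<^sup>+w. g (norm (w :: real \<times> real)) \<partial>lborel) = ennreal pi * (\<integral>\<^sup>+r. ennreal \<bar>r\<bar> * g \<bar>r\<bar> \<partial>lborel)"
proof -
  have [simp]: "norm (r * cos \<phi>, r * sin \<phi>) = \<bar>r\<bar>" for r \<phi> :: real
    by (simp add: norm_Pair power_mult_distrib distrib_left[symmetric])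
  have "(\<integral>\<^sup>+w. g (norm (w :: real \<times> real)) \<partial>lborel) = (\<integral>\<^sup>+\<phi>. indicator {0..pi} \<phi> * (\<integral>\<^sup>+r. ennreal \<bar>r\<bar> * g \<bar>r\<bar> \<partial>lborel) \<partial>lborel)"
    by (subst nn_integral_polar) simp_all
  also have "\<dots> = ennreal pi * (\<integral>\<^sup>+r. ennreal \<bar>r\<bar> * g \<bar>r\<bar> \<partial>lborel)"
    by (subst nn_integral_multc) simp_all
  finally show ?thesis .
qed

lemma nn_integral_exp_tail:
  fixes c D :: real
  assumes c: "c > 0" and D: "D \<ge> 0"
  shows "(\<integral>\<^sup>+r. ennreal (r * exp (- c * r)) * indicator {D..} r \<partial>lborel) = ennreal ((D / c + 1 / c\<^sup>2) * exp (- c * D))"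
proof -
  define G where "G r = - (r / c + 1 / c\<^sup>2) * exp (- c * r)" for r
  have "(G \<longlongrightarrow> 0) at_top"
  proof -
    have l: "filterlim (\<lambda>r. c * r) at_top at_top"
      by (rule filterlim_tendsto_pos_mult_at_top[OF tendsto_const c filterlim_ident])
    have "((\<lambda>r. - (1 / c\<^sup>2) * ((c * r) ^ 1 / exp (c * r) + (c * r) ^ 0 / exp (c * r))) \<longlongrightarrow> - (1 / c\<^sup>2) * (0 + 0)) at_top"
      by (intro tendsto_intros filterlim_compose[OF tendsto_power_div_exp_0 l])
    moreover have "(\<lambda>r. - (1 / c\<^sup>2) * ((c * r) ^ 1 / exp (c * r) + (c * r) ^ 0 / exp (c * r))) = G"
      using c by (auto simp: G_def exp_minus power2_eq_square field_simps)
    ultimately show ?thesis by simp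
  qed
  moreover have "DERIV G r :> r * exp (- c * r)" for r
    unfolding G_def using c by (auto intro!: derivative_eq_intros simp: power2_eq_square field_simps)
  ultimately have "(\<integral>\<^sup>+r. ennreal (r * exp (- c * r)) * indicator {D..} r \<partial>lborel) = ennreal (0 - G D)"
    using D by (intro nn_integral_FTC_atLeast) auto
  moreover have "0 - G D = (D / c + 1 / c\<^sup>2) * exp (- c * D)" unfolding G_def by (simp add: algebra_simps)
  ultimately show ?thesis by (simp only:)
qed

lemma exp_norm_tail:
  fixes c D :: real
  assumes c: "c > 0" and D: "D \<ge> 1"
  shows "(\<integral>\<^sup>+w. ennreal (indicator {D<..} (norm w) * exp (- c * norm (w :: real \<times> real))) \<partial>lborel)
    \<le> ennreal (2 * pi * (1 / c + 1 / c\<^sup>2) * D * exp (- c * D))"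
proof -
  define f where "f r = ennreal (r * exp (- c * r)) * indicator {D..} r" for r :: real
  have [measurable]: "f \<in> borel_measurable borel" unfolding f_def[abs_def] by measurable
  have "(\<integral>\<^sup>+w. ennreal (indicator {D<..} (norm w) * exp (- c * norm (w :: real \<times> real))) \<partial>lborel)
      = ennreal pi * (\<integral>\<^sup>+r. ennreal \<bar>r\<bar> * ennreal (indicator {D<..} \<bar>r\<bar> * exp (- c * \<bar>r\<bar>)) \<partial>lborel)"
    by (rule nn_integral_radial) measurable
  also have "(\<integral>\<^sup>+r. ennreal \<bar>r\<bar> * ennreal (indicator {D<..} \<bar>r\<bar> * exp (- c * \<bar>r\<bar>)) \<partial>lborel) \<le> (\<integral>\<^sup>+r. f r + f (- r) \<partial>lborel)"
  proof (rule nn_integral_mono)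
    fix r :: real
    have "ennreal \<bar>r\<bar> * ennreal (exp (- c * \<bar>r\<bar>)) = ennreal (\<bar>r\<bar> * exp (- c * \<bar>r\<bar>))"
      by (simp add: ennreal_mult)
    then show "ennreal \<bar>r\<bar> * ennreal (indicator {D<..} \<bar>r\<bar> * exp (- c * \<bar>r\<bar>)) \<le> f r + f (- r)"
      using D by (cases "r \<ge> 0") (auto simp: f_def indicator_def)
  qed
  also have "\<dots> = (\<integral>\<^sup>+r. f r \<partial>lborel) + (\<integral>\<^sup>+r. f (- r) \<partial>lborel)"
    by (rule nn_integral_add) measurable
  also have "(\<integral>\<^sup>+r. f (- r) \<partial>lborel) = (\<integral>\<^sup>+r. f r \<partial>lborel)"
    by (rule nn_integral_reflect) measurable
  also have "(\<integral>\<^sup>+r. f r \<partial>lborel) + (\<integral>\<^sup>+r. f r \<partial>lborel) = ennreal (2 * ((D / c + 1 / c\<^sup>2) * exp (- c * D)))"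
    unfolding f_def using nn_integral_exp_tail[OF c, of D] D c
    by (simp add: ennreal_plus[symmetric] del: ennreal_plus)
  also have "ennreal pi * \<dots> \<le> ennreal (2 * pi * (1 / c + 1 / c\<^sup>2) * D * exp (- c * D))"
  proof -
    have "1 / c\<^sup>2 \<le> D / c\<^sup>2" using D by (intro divide_right_mono) auto
    then have "D / c + 1 / c\<^sup>2 \<le> (1 / c + 1 / c\<^sup>2) * D" by (simp add: distrib_right)
    then have "pi * (2 * ((D / c + 1 / c\<^sup>2) * exp (- c * D))) \<le> pi * (2 * (((1 / c + 1 / c\<^sup>2) * D) * exp (- c * D)))"
      by (intro mult_left_mono mult_right_mono) auto
    then have "ennreal (pi * (2 * ((D / c + 1 / c\<^sup>2) * exp (- c * D)))) \<le> ennreal (2 * pi * (1 / c + 1 / c\<^sup>2) * D * exp (- c * D))"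
      by (intro ennreal_leI) (simp only: mult_ac)
    then show ?thesis by (simp only: ennreal_mult'[OF pi_ge_zero])
  qed
  finally show ?thesis by (simp add: mult_left_mono)
qed

context wigner_transform
begin

text \<open>The characteristic function of \<open>proj z \<Phi> - X\<close>, written through
  \<open>F\<close> so that it is available without the data; the identification is
  \<open>data_char\<close>.\<close>

definition psi :: "real \<times> real \<Rightarrow> real \<Rightarrow> complex" where
  "psi z t = of_real (1 / pi) * (LINT \<phi>|lborel. indicator {0..pi} \<phi> *\<^sub>R (ray \<phi> t * cis (t * proj z \<phi>)))"

lemma psi_integrable: "integrable lborel (psi z)"
  and integral_psi: "(LINT t|lborel. psi z t) = of_real (dual_radon (radon W) z)"
proof -
  define h where "h \<phi> t = indicator {0..pi} \<phi> *\<^sub>R (ray \<phi> t * cis (t * proj z \<phi>))" for \<phi> t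
  have i: "integrable (lborel \<Otimes>\<^sub>M lborel) (case_prod h)"
    using ray_polar(1)[of z] by (simp add: lborel_prod h_def case_prod_beta')
  show "integrable lborel (psi z)"
    unfolding psi_def[abs_def] using lborel_pair.integrable_snd[OF i] by (simp add: h_def)
  have "(LINT t|lborel. psi z t) = of_real (1 / pi) * (LINT t|lborel. LINT \<phi>|lborel. h \<phi> t)"
    unfolding psi_def h_def by (rule integral_mult_right_zero)
  also have "(LINT t|lborel. LINT \<phi>|lborel. h \<phi> t) = (LINT \<phi>|lborel. LINT t|lborel. h \<phi> t)"
    by (rule lborel_pair.Fubini_integral[OF i])
  also have "\<dots> = (LINT \<phi>|lborel. indicator {0..pi} \<phi> *\<^sub>R (LINT r|lborel. ray \<phi> r * cis (r * proj z \<phi>)))"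
    unfolding h_def by simp
  finally show "(LINT t|lborel. psi z t) = of_real (dual_radon (radon W) z)"
    unfolding ray_polar(2) .
qed

lemma proj_measurable [measurable]: "proj z \<in> borel_measurable borel"
  unfolding proj_def[abs_def] by measurable

text \<open>The principle of filtered backprojection: the factor \<open>\<bar>r\<bar>\<close> of the
  kernel is the polar Jacobian, so the mean of the estimator is the inversion integral of
  \<open>F\<close> truncated to the disc of radius \<open>D\<close>.\<close>

lemma cut_psi:
  "of_real (1 / (4 * pi)) * (LINT t|lborel. of_real (cut D t) * psi z t)
     = of_real (1 / (4 * pi\<^sup>2)) * (LINT w|lborel. indicator {..D} (norm w) *\<^sub>R (F w * cis (w \<bullet> z)))"
proof -
  define T where "T = (\<lambda>(\<phi>::real, r::real). (r * cos \<phi>, r * sin \<phi>))"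
  have Tm [measurable]: "T \<in> borel_measurable borel" unfolding T_def by measurable
  have Tp: "lborel = distr polar_measure borel T" unfolding T_def by (rule lborel_polar)
  have norm_T: "norm (T (\<phi>, r)) = \<bar>r\<bar>" for \<phi> r
    by (simp add: T_def norm_Pair power_mult_distrib distrib_left[symmetric])
  have inner_T: "T (\<phi>, r) \<bullet> z = r * proj z \<phi>" for \<phi> r
    by (cases z) (simp add: T_def proj_def algebra_simps)
  define f where "f w = indicator {..D} (norm w) *\<^sub>R (F w * cis (w \<bullet> z))" for w
  have fi: "integrable lborel f"
    unfolding f_def[abs_def]
    by (rule Bochner_Integration.integrable_bound[OF F_integrable]) (auto simp: norm_mult indicator_def)
  have f_T: "\<bar>r\<bar> *\<^sub>R f (T (\<phi>, r)) = cut D r *\<^sub>R (ray \<phi> r * cis (r * proj z \<phi>))" for \<phi> r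
    unfolding f_def norm_T inner_T by (auto simp: cut_eq T_def ray_def indicator_def)
  define h where "h \<phi> r = indicator {0..pi} \<phi> *\<^sub>R (cut D r *\<^sub>R (ray \<phi> r * cis (r * proj z \<phi>)))" for \<phi> r
  have hi: "integrable (lborel \<Otimes>\<^sub>M lborel) (case_prod h)"
    using polar_Bochner(1)[OF fi Tp Tm] unfolding lborel_prod
    by (rule back_subst[where P = "integrable lborel"]) (simp add: fun_eq_iff h_def f_T flip: scaleR_scaleR)
  have "(LINT w|lborel. f w) = (LINT \<phi>|lborel. LINT r|lborel. h \<phi> r)"
    unfolding polar_Bochner(2)[OF fi Tp Tm] f_T h_def by (simp only: integral_scaleR_right)
  also have "\<dots> = (LINT r|lborel. LINT \<phi>|lborel. h \<phi> r)"
    by (rule lborel_pair.Fubini_integral[OF hi, symmetric])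
  also have "\<dots> = (LINT r|lborel. of_real pi * (of_real (cut D r) * psi z r))"
  proof (rule Bochner_Integration.integral_cong[OF refl])
    fix r
    have "(LINT \<phi>|lborel. h \<phi> r) = (LINT \<phi>|lborel. cut D r *\<^sub>R (indicator {0..pi} \<phi> *\<^sub>R (ray \<phi> r * cis (r * proj z \<phi>))))"
      by (simp only: h_def scaleR_left_commute)
    also have "\<dots> = cut D r *\<^sub>R (LINT \<phi>|lborel. indicator {0..pi} \<phi> *\<^sub>R (ray \<phi> r * cis (r * proj z \<phi>)))"
      by (rule integral_scaleR_right)
    also have "\<dots> = of_real pi * (of_real (cut D r) * psi z r)"
      by (simp add: psi_def scaleR_conv_of_real)
    finally show "(LINT \<phi>|lborel. h \<phi> r) = of_real pi * (of_real (cut D r) * psi z r)" .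
  qed
  also have "\<dots> = of_real pi * (LINT t|lborel. of_real (cut D t) * psi z t)"
    by (rule integral_mult_right_zero)
  finally show ?thesis unfolding f_def by (simp add: power2_eq_square)
qed

text \<open>The bias is the inversion integral of \<open>F\<close> outside the disc. Writing
  \<open>cmod (F w)\<close> as the weighted function times \<open>exp (- \<beta> * norm w)\<close>,
  a weighted inequality of means separates the constant of the class from an explicit exponential
  tail.\<close>

lemma bias_bound:
  "\<exists>B\<ge>0. \<forall>D\<ge>1. cmod (of_real (1 / (4 * pi)) * (LINT t|lborel. of_real (cut D t) * psi z t) - of_real (W z)) \<le> B * D * exp (- \<beta> * D)"
proof -
  define A where "A = enn2real (\<integral>\<^sup>+w. ennreal ((cmod (F w))\<^sup>2 * exp (2 * \<beta> * norm w)) \<partial>lborel)"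
  have A: "A \<ge> 0" "(\<integral>\<^sup>+w. ennreal ((cmod (F w))\<^sup>2 * exp (2 * \<beta> * norm w)) \<partial>lborel) = ennreal A"
    using F_decay by (simp_all add: A_def)
  define C where "C = 2 * pi * (1 / (2 * \<beta>) + 1 / (2 * \<beta>)\<^sup>2)"
  have C: "C \<ge> 0" using beta_pos by (simp add: C_def)
  have "cmod (of_real (1 / (4 * pi)) * (LINT t|lborel. of_real (cut D t) * psi z t) - of_real (W z))
      \<le> 1 / (4 * pi\<^sup>2) * ((A + C) / 2) * D * exp (- \<beta> * D)" if D: "D \<ge> 1" for D
  proof -
    \<comment> \<open>The balance between the two means. The optimal power of \<open>D\<close> would
      be \<open>1 / 2\<close>; the integer power avoids a root and still leaves the squared bias a
      factor \<open>D\<close> below the variance.\<close>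
    define l where "l = D * exp (- \<beta> * D)"
    have l: "l > 0" using D by (simp add: l_def)
    have lm: "ennreal (l / 2 * x) = ennreal (l / 2) * ennreal x" "ennreal (1 / (2 * l) * x) = ennreal (1 / (2 * l)) * ennreal x" for x
      by (rule ennreal_mult', use l in simp)+
    define t where "t w = indicator {D<..} (norm w) *\<^sub>R (F w * cis (w \<bullet> z))" for w
    have ci: "integrable lborel (\<lambda>w. indicator {..D} (norm w) *\<^sub>R (F w * cis (w \<bullet> z)))"
      by (rule Bochner_Integration.integrable_bound[OF F_integrable]) (auto simp: norm_mult indicator_def)
    have tn: "cmod (t w) = indicator {D<..} (norm w) * cmod (F w)" for w
      by (auto simp: t_def norm_mult indicator_def)
    have "(LINT w|lborel. indicator {..D} (norm w) *\<^sub>R (F w * cis (w \<bullet> z))) - (LINT w|lborel. F w * cis (w \<bullet> z))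
        = (LINT w|lborel. - t w)"
      by (subst Bochner_Integration.integral_diff[OF ci F_cis_integrable, symmetric])
        (intro Bochner_Integration.integral_cong refl, auto simp: t_def indicator_def)
    then have "of_real (1 / (4 * pi)) * (LINT t|lborel. of_real (cut D t) * psi z t) - of_real (W z)
        = of_real (1 / (4 * pi\<^sup>2)) * (LINT w|lborel. - t w)"
      unfolding cut_psi W_eq by (simp only: right_diff_distrib[symmetric])
    then have "cmod (of_real (1 / (4 * pi)) * (LINT t|lborel. of_real (cut D t) * psi z t) - of_real (W z))
        = 1 / (4 * pi\<^sup>2) * cmod (LINT w|lborel. t w)"
      by (simp add: norm_mult norm_divide norm_power)
    also have "cmod (LINT w|lborel. t w) \<le> (A + C) / 2 * l"
    proof -
      have "ennreal (cmod (LINT w|lborel. t w)) \<le> (\<integral>\<^sup>+w. ennreal (cmod (t w)) \<partial>lborel)"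
        by (rule ennreal_norm_integral_le)
      also have "\<dots> \<le> (\<integral>\<^sup>+w. ennreal (l / 2) * ennreal ((cmod (F w))\<^sup>2 * exp (2 * \<beta> * norm w))
          + ennreal (1 / (2 * l)) * ennreal (indicator {D<..} (norm w) * exp (- (2 * \<beta>) * norm w)) \<partial>lborel)"
      proof (rule nn_integral_mono)
        fix w :: "real \<times> real"
        define a b where "a = cmod (F w) * exp (\<beta> * norm w)" and "b = exp (- \<beta> * norm w)"
        have ab: "cmod (F w) = a * b" by (simp add: a_def b_def exp_minus)
        have a2: "a\<^sup>2 = (cmod (F w))\<^sup>2 * exp (2 * \<beta> * norm w)"
          by (simp add: a_def power_mult_distrib exp_double[symmetric] mult.assoc)
        have b2: "b\<^sup>2 = exp (- (2 * \<beta>) * norm w)"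
          by (simp add: b_def exp_double[symmetric])
        have "0 \<le> (l * a - b)\<^sup>2 / (2 * l)" using l by simp
        also have "\<dots> = l / 2 * a\<^sup>2 + 1 / (2 * l) * b\<^sup>2 - a * b"
          using l by (simp add: power2_eq_square field_simps)
        finally have "a * b \<le> l / 2 * a\<^sup>2 + 1 / (2 * l) * b\<^sup>2" by simp
        then have "cmod (t w) \<le> l / 2 * a\<^sup>2 + 1 / (2 * l) * (indicator {D<..} (norm w) * b\<^sup>2)"
          using l by (cases "norm w > D") (simp_all add: tn ab)
        then have "ennreal (cmod (t w)) \<le> ennreal (l / 2 * a\<^sup>2 + 1 / (2 * l) * (indicator {D<..} (norm w) * b\<^sup>2))"
          by (rule ennreal_leI)
        also have "\<dots> = ennreal (l / 2) * ennreal (a\<^sup>2) + ennreal (1 / (2 * l)) * ennreal (indicator {D<..} (norm w) * b\<^sup>2)"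
          unfolding lm[symmetric] using l by (intro ennreal_plus) auto
        finally show "ennreal (cmod (t w)) \<le> ennreal (l / 2) * ennreal ((cmod (F w))\<^sup>2 * exp (2 * \<beta> * norm w))
          + ennreal (1 / (2 * l)) * ennreal (indicator {D<..} (norm w) * exp (- (2 * \<beta>) * norm w))"
          unfolding a2 b2 .
      qed
      also have "\<dots> = ennreal (l / 2) * ennreal A
          + ennreal (1 / (2 * l)) * (\<integral>\<^sup>+w. ennreal (indicator {D<..} (norm (w :: real \<times> real)) * exp (- (2 * \<beta>) * norm w)) \<partial>lborel)"
        unfolding A(2)[symmetric] by (subst nn_integral_add, measurable, subst nn_integral_cmult, measurable, subst nn_integral_cmult) simp_all
      also have "\<dots> \<le> ennreal (l / 2) * ennreal A + ennreal (1 / (2 * l)) * ennreal (C * D * exp (- (2 * \<beta>) * D))"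
        unfolding C_def using beta_pos D by (intro add_left_mono mult_left_mono exp_norm_tail) auto
      also have "\<dots> = ennreal (l / 2 * A + 1 / (2 * l) * (C * D * exp (- (2 * \<beta>) * D)))"
        unfolding lm[symmetric] using l A C D by (intro ennreal_plus[symmetric]) auto
      finally have "cmod (LINT w|lborel. t w) \<le> l / 2 * A + 1 / (2 * l) * (C * D * exp (- (2 * \<beta>) * D))"
        using l A C D by (subst (asm) ennreal_le_iff) auto
      also have "1 / (2 * l) * (C * D * exp (- (2 * \<beta>) * D)) = C / 2 * exp (- \<beta> * D)"
      proof -
        have "exp (- (2 * \<beta>) * D) = exp (- \<beta> * D) * exp (- \<beta> * D)" by (simp flip: exp_add)
        then show ?thesis using D by (simp add: l_def)
      qed
      also have "\<dots> \<le> C / 2 * l"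
        unfolding l_def using C D by (intro mult_left_mono) auto
      finally show ?thesis by (simp add: field_simps)
    qed
    finally show ?thesis by (simp add: l_def mult_left_mono divide_right_mono mult.assoc)
  qed
  then show ?thesis using A C by (intro exI[of _ "1 / (4 * pi\<^sup>2) * ((A + C) / 2)"]) auto
qed

end

section \<open>The mean square error\<close>

text \<open>The decomposition into variance and squared bias. Products of distinct samples have mean
  \<open>\<mu>\<^sup>2\<close> and squares have mean \<open>s\<close>, so the double sum is
  \<open>n\<^sup>2 * \<mu>\<^sup>2 + n * (s - \<mu>\<^sup>2)\<close>; boundedness provides all
  integrability.\<close>

lemma (in prob_space) mean_square_error:
  fixes \<xi> :: "nat \<Rightarrow> 'a \<Rightarrow> real"
  assumes indep: "indep_vars (\<lambda>_. borel) \<xi> {1..n}" and n: "n \<ge> 1"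
    and bound: "\<And>i \<omega>. \<bar>\<xi> i \<omega>\<bar> \<le> B"
    and mean: "\<And>i. i \<in> {1..n} \<Longrightarrow> expectation (\<xi> i) = \<mu>"
    and sq: "\<And>i. i \<in> {1..n} \<Longrightarrow> expectation (\<lambda>\<omega>. (\<xi> i \<omega>)\<^sup>2) = s"
  shows "expectation (\<lambda>\<omega>. ((1 / real n) * (\<Sum>i=1..n. \<xi> i \<omega>) - w)\<^sup>2) = (s - \<mu>\<^sup>2) / real n + (\<mu> - w)\<^sup>2"
proof -
  have m [measurable]: "\<xi> i \<in> borel_measurable M" if "i \<in> {1..n}" for i
    using indep that unfolding indep_vars_def by blast
  have i1: "integrable M (\<xi> i)" if "i \<in> {1..n}" for i
    using that by (intro integrable_const_bound[of _ B] AE_I2) (auto simp: bound)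
  have B: "B \<ge> 0" using order_trans[OF abs_ge_zero bound] .
  have i2: "integrable M (\<lambda>\<omega>. \<xi> i \<omega> * \<xi> j \<omega>)" if "i \<in> {1..n}" "j \<in> {1..n}" for i j
    using that B by (intro integrable_const_bound[of _ "B * B"] AE_I2 borel_measurable_times m)
      (auto simp: abs_mult intro!: mult_mono bound)
  have e2: "expectation (\<lambda>\<omega>. \<xi> i \<omega> * \<xi> j \<omega>) = \<mu>\<^sup>2 + (if i = j then s - \<mu>\<^sup>2 else 0)" if "i \<in> {1..n}" "j \<in> {1..n}" for i j
  proof (cases "i = j")
    case True
    then show ?thesis using sq[OF that(1)] by (simp add: power2_eq_square)
  next
    case False
    have "indep_vars (\<lambda>_. borel) \<xi> {i, j}" by (rule indep_vars_subset[OF indep]) (use that in auto)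
    then have "expectation (\<lambda>\<omega>. \<Prod>k\<in>{i, j}. \<xi> k \<omega>) = (\<Prod>k\<in>{i, j}. expectation (\<xi> k))"
      by (intro indep_vars_lebesgue_integral) (use i1 that in auto)
    then show ?thesis
      using False that mean by (simp add: power2_eq_square)
  qed
  define S where "S \<omega> = (\<Sum>i=1..n. \<xi> i \<omega>)" for \<omega>
  define Q where "Q \<omega> = (\<Sum>i=1..n. \<Sum>j=1..n. \<xi> i \<omega> * \<xi> j \<omega>)" for \<omega>
  have S: "integrable M S" "expectation S = (\<Sum>i=1..n. expectation (\<xi> i))"
    unfolding S_def[abs_def] using i1 by (auto intro: Bochner_Integration.integral_sum)
  have Q: "integrable M Q"
    unfolding Q_def[abs_def] by (intro Bochner_Integration.integrable_sum i2)
  have "expectation Q = (\<Sum>i=1..n. expectation (\<lambda>\<omega>. \<Sum>j=1..n. \<xi> i \<omega> * \<xi> j \<omega>))"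
    unfolding Q_def[abs_def] by (intro Bochner_Integration.integral_sum Bochner_Integration.integrable_sum i2)
  also have "\<dots> = (\<Sum>i=1..n. \<Sum>j=1..n. expectation (\<lambda>\<omega>. \<xi> i \<omega> * \<xi> j \<omega>))"
    by (intro sum.cong refl Bochner_Integration.integral_sum i2)
  finally have EQ: "expectation Q = (\<Sum>i=1..n. \<Sum>j=1..n. expectation (\<lambda>\<omega>. \<xi> i \<omega> * \<xi> j \<omega>))" .
  have "((1 / real n) * S \<omega> - w)\<^sup>2 = 1 / (real n)\<^sup>2 * Q \<omega> - 2 * w / real n * S \<omega> + w\<^sup>2" for \<omega>
  proof -
    have "Q \<omega> = S \<omega> * S \<omega>" unfolding Q_def S_def by (rule sum_product[symmetric])
    then show ?thesis by (simp add: power2_eq_square algebra_simps)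
  qed
  then have "expectation (\<lambda>\<omega>. ((1 / real n) * (\<Sum>i=1..n. \<xi> i \<omega>) - w)\<^sup>2)
      = 1 / (real n)\<^sup>2 * expectation Q - 2 * w / real n * expectation S + w\<^sup>2"
    unfolding S_def[symmetric] using S(1) Q by (simp add: prob_space)
  also note EQ
  also note S(2)
  also have "(\<Sum>i=1..n. \<Sum>j=1..n. expectation (\<lambda>\<omega>. \<xi> i \<omega> * \<xi> j \<omega>)) = (\<Sum>i=1..n. \<Sum>j=1..n. \<mu>\<^sup>2 + (if i = j then s - \<mu>\<^sup>2 else 0))"
    by (intro sum.cong refl e2) auto
  also have "\<dots> = (real n)\<^sup>2 * \<mu>\<^sup>2 + real n * (s - \<mu>\<^sup>2)"
    by (simp add: sum.distrib power2_eq_square algebra_simps)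
  also have "(\<Sum>i=1..n. expectation (\<xi> i)) = real n * \<mu>" by (simp add: mean)
  finally show ?thesis using n by (simp add: power2_eq_square field_simps)
qed

section \<open>The distribution of the data\<close>

lemma data_measure_eq: "data_measure = density lborel (\<lambda>p. ennreal (indicator {0..pi} (snd p) / pi))"
proof -
  have u: "uniform_measure lborel {0..pi} = density lborel (\<lambda>\<phi>. ennreal (indicator {0..pi} \<phi> / pi))"
    unfolding uniform_measure_def
    by (intro density_cong AE_I2) (auto simp: indicator_def divide_ennreal simp flip: ennreal_1)
  have "prob_space (uniform_measure lborel {0..pi})" by (rule prob_space_uniform_measure) simp_all
  then have sf: "sigma_finite_measure (density lborel (\<lambda>\<phi>. ennreal (indicator {0..pi} \<phi> / pi)))"
    unfolding u by (simp add: prob_space_def finite_measure_def)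
  have "data_measure = density lborel (\<lambda>_. 1) \<Otimes>\<^sub>M density lborel (\<lambda>\<phi>. ennreal (indicator {0..pi} \<phi> / pi))"
    unfolding data_measure_def u density_1 ..
  also have "\<dots> = density (lborel \<Otimes>\<^sub>M lborel) (\<lambda>(x, \<phi>). 1 * ennreal (indicator {0..pi} \<phi> / pi))"
    by (rule pair_measure_density[OF _ _ _ sf]) (auto intro: lborel.sigma_finite_measure_axioms)
  finally show ?thesis by (simp add: lborel_prod case_prod_beta')
qed

lemma sets_data_measure [simp, measurable_cong]: "sets data_measure = sets borel"
  by (simp add: data_measure_eq)

context wigner_transform
begin

text \<open>Total probability 1, rewritten for Lebesgue measure in the angle. Since
  \<open>ennreal\<close> sends negative numbers to 0, this is the mass of the positive part of the
  Radon transform.\<close>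

lemma radon_mass:
  assumes "prob_space M" "distributed M data_measure Y (\<lambda>(x, \<phi>). ennreal (radon W x \<phi>))"
  shows "(\<integral>\<^sup>+\<phi>. indicator {0..pi} \<phi> * (\<integral>\<^sup>+x. ennreal (radon W x \<phi>) \<partial>lborel) \<partial>lborel) = ennreal pi"
proof -
  interpret prob_space M by fact
  have "1 = (\<integral>\<^sup>+\<omega>. 1 \<partial>M)" by (simp add: emeasure_space_1)
  also have "\<dots> = (\<integral>\<^sup>+p. (case p of (x, \<phi>) \<Rightarrow> ennreal (radon W x \<phi>)) * 1 \<partial>data_measure)"
    using distributed_nn_integral[OF assms(2), of "\<lambda>_. 1"] by simp
  also have "\<dots> = (\<integral>\<^sup>+p. ennreal (indicator {0..pi} (snd p) / pi) * ennreal (radon W (fst p) (snd p)) \<partial>lborel)"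
    unfolding data_measure_eq by (subst nn_integral_density) (auto simp: case_prod_beta')
  also have "\<dots> = (\<integral>\<^sup>+\<phi>. \<integral>\<^sup>+x. ennreal (indicator {0..pi} \<phi> / pi) * ennreal (radon W x \<phi>) \<partial>lborel \<partial>lborel)"
    by (subst nn_integral_lborel_prod(2)) auto
  also have "\<dots> = (\<integral>\<^sup>+\<phi>. ennreal (1 / pi) * (indicator {0..pi} \<phi> * (\<integral>\<^sup>+x. ennreal (radon W x \<phi>) \<partial>lborel)) \<partial>lborel)"
    by (intro nn_integral_cong) (auto simp: nn_integral_cmult indicator_def)
  also have "\<dots> = ennreal (1 / pi) * (\<integral>\<^sup>+\<phi>. indicator {0..pi} \<phi> * (\<integral>\<^sup>+x. ennreal (radon W x \<phi>) \<partial>lborel) \<partial>lborel)"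
    (is "_ = _ * ?I")
  proof (rule nn_integral_cmult)
    have [measurable]: "(\<lambda>(\<phi>, x). radon W x \<phi>) \<in> borel_measurable (borel \<Otimes>\<^sub>M borel)"
      unfolding radon_def by measurable
    show "(\<lambda>\<phi>. indicator {0..pi} \<phi> * (\<integral>\<^sup>+x. ennreal (radon W x \<phi>) \<partial>lborel)) \<in> borel_measurable lborel"
      by measurable
  qed
  finally have "ennreal pi * 1 = ennreal pi * (ennreal (1 / pi) * ?I)" by (rule arg_cong)
  also have "\<dots> = ?I" by (simp add: mult.assoc[symmetric] ennreal_mult[symmetric])
  finally show ?thesis by simp
qed

text \<open>Conditionally on the angle the offset has the Radon slice as its density, so
  \<open>cis (- t * x)\<close> integrates to \<open>ray \<phi> t\<close> by the slice identity;
  averaging over the uniform angle gives \<open>psi\<close>.\<close>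

lemma data_char:
  assumes "prob_space M" and dist: "distributed M data_measure (\<lambda>\<omega>. (X \<omega>, \<Phi> \<omega>)) (\<lambda>(x, \<phi>). ennreal (radon W x \<phi>))"
  shows "(\<lambda>\<omega>. proj z (\<Phi> \<omega>) - X \<omega>) \<in> borel_measurable M"
    and "(LINT \<omega>|M. cis (t * (proj z (\<Phi> \<omega>) - X \<omega>))) = psi z t"
proof -
  interpret prob_space M by fact
  define Y where "Y \<omega> = (X \<omega>, \<Phi> \<omega>)" for \<omega>
  have Ym: "Y \<in> measurable M data_measure" using dist by (auto simp: distributed_def Y_def[abs_def])
  then have Ym' [measurable]: "Y \<in> borel_measurable M"
    by (subst measurable_cong_sets[OF refl sets_data_measure[symmetric]])
  have "(\<lambda>\<omega>. proj z (snd (Y \<omega>)) - fst (Y \<omega>)) \<in> borel_measurable M" by measurable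
  then show "(\<lambda>\<omega>. proj z (\<Phi> \<omega>) - X \<omega>) \<in> borel_measurable M" by (simp add: Y_def)
  define g where "g p = cis (t * (proj z (snd p) - fst p))" for p
  have gm [measurable]: "g \<in> borel_measurable borel" unfolding g_def[abs_def] by measurable
  \<comment> \<open>The density of the data contains \<open>ennreal (radon W x \<phi>)\<close>,
    hence the truncation at 0; it is undone once nonnegativity is available.\<close>
  define w where "w p = indicator {0..pi} (snd p) / pi * max 0 (radon W (fst p) (snd p))" for p
  have wm [measurable]: "w \<in> borel_measurable borel" unfolding w_def[abs_def] by measurable
  have w0: "w p \<ge> 0" for p by (simp add: w_def)
  have "distr M data_measure Y = density data_measure (\<lambda>(x, \<phi>). ennreal (radon W x \<phi>))"
    using dist by (simp add: distributed_def Y_def[abs_def])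
  also have "\<dots> = density lborel (\<lambda>p. ennreal (indicator {0..pi} (snd p) / pi) * (case p of (x, \<phi>) \<Rightarrow> ennreal (radon W x \<phi>)))"
    unfolding data_measure_eq by (rule density_density_eq) (auto simp: case_prod_beta')
  also have "\<dots> = density lborel (\<lambda>p. ennreal (w p))"
    by (rule arg_cong[where f = "density lborel"]) (auto simp: fun_eq_iff w_def indicator_def max_def ennreal_neg simp flip: ennreal_mult)
  finally have D: "distr M data_measure Y = density lborel (\<lambda>p. ennreal (w p))" .
  have "integrable M (\<lambda>\<omega>. g (Y \<omega>))"
    by (rule integrable_const_bound[of _ 1]) (auto simp: g_def)
  then have "integrable (distr M data_measure Y) g"
    using Ym by (subst integrable_distr_eq) auto
  then have wi: "integrable lborel (\<lambda>p. w p *\<^sub>R g p)"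
    unfolding D by (subst (asm) integrable_density) (auto simp: w0)
  have "(LINT \<omega>|M. g (Y \<omega>)) = (LINT p|distr M data_measure Y. g p)"
    using Ym by (intro integral_distr[symmetric]) auto
  also have "\<dots> = (LINT p|lborel. w p *\<^sub>R g p)"
    unfolding D by (rule integral_density) (auto simp: w0)
  also have "\<dots> = (LINT \<phi>|lborel. LINT x|lborel. w (x, \<phi>) *\<^sub>R g (x, \<phi>))"
    using lborel_pair.integral_snd[of "\<lambda>x \<phi>. w (x, \<phi>) *\<^sub>R g (x, \<phi>)"] wi by (simp add: lborel_prod case_prod_beta')
  also have "\<dots> = (LINT \<phi>|lborel. of_real (1 / pi) * (indicator {0..pi} \<phi> *\<^sub>R (ray \<phi> t * cis (t * proj z \<phi>))))"
  proof (rule integral_cong_AE)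
    have "AE \<phi> in lborel. \<phi> \<in> {0..pi} \<longrightarrow> (AE x in lborel. 0 \<le> radon W x \<phi>)"
      by (rule AE_radon_nonneg) (simp add: radon_mass[OF assms])
    then show "AE \<phi> in lborel. (LINT x|lborel. w (x, \<phi>) *\<^sub>R g (x, \<phi>)) = of_real (1 / pi) * (indicator {0..pi} \<phi> *\<^sub>R (ray \<phi> t * cis (t * proj z \<phi>)))"
      using AE_good_angle
    proof eventually_elim
      case (elim \<phi>)
      show ?case
      proof (cases "\<phi> \<in> {0..pi}")
        case True
        have nn: "AE x in lborel. 0 \<le> radon W x \<phi>" and good: "good_angle \<phi>" using elim True by auto
        have "(LINT x|lborel. w (x, \<phi>) *\<^sub>R g (x, \<phi>)) = (LINT x|lborel. (of_real (radon W x \<phi>) * cis (- t * x)) * (of_real (1 / pi) * cis (t * proj z \<phi>)))"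
        proof (rule integral_cong_AE)
          show "AE x in lborel. w (x, \<phi>) *\<^sub>R g (x, \<phi>) = (of_real (radon W x \<phi>) * cis (- t * x)) * (of_real (1 / pi) * cis (t * proj z \<phi>))"
            using nn
          proof eventually_elim
            case (elim x)
            have "cis (t * (proj z \<phi> - x)) = cis (- t * x) * cis (t * proj z \<phi>)" by (simp add: cis_mult algebra_simps)
            then show ?case using True elim by (simp add: w_def g_def scaleR_conv_of_real)
          qed
        qed measurable
        also have "\<dots> = ray \<phi> t * (of_real (1 / pi) * cis (t * proj z \<phi>))"
          unfolding integral_mult_left_zero radon_char(2)[OF good nn] ..
        finally show ?thesis using True by simp
      qed (simp add: w_def)
    qed
  qed measurable
  also have "\<dots> = psi z t" unfolding psi_def by (rule integral_mult_right_zero)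
  finally show "(LINT \<omega>|M. cis (t * (proj z (\<Phi> \<omega>) - X \<omega>))) = psi z t" by (simp add: g_def Y_def)
qed

section \<open>Moments as functions of the cutoff, risk and asymptotics\<close>

definition first_moment :: "real \<times> real \<Rightarrow> real \<Rightarrow> real" where
  "first_moment z D = Re (of_real (1 / (4 * pi)) * (LINT t|lborel. of_real (cut D t) * psi z t))"

definition second_moment :: "real \<times> real \<Rightarrow> real \<Rightarrow> real" where
  "second_moment z D = Re (of_real (1 / (16 * pi\<^sup>2)) * (LINT t|lborel. of_real (cut_conv D t) * psi z t))"

lemma risk_eq:
  fixes M :: "'a measure" and X \<Phi> :: "nat \<Rightarrow> 'a \<Rightarrow> real"
  assumes "prob_space M" and n: "n \<ge> 1"
    and indep: "prob_space.indep_vars M (\<lambda>_. borel) (\<lambda>i \<omega>. (X i \<omega>, \<Phi> i \<omega>)) {1..n}"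
    and dist: "\<And>i. i \<in> {1..n} \<Longrightarrow> distributed M data_measure (\<lambda>\<omega>. (X i \<omega>, \<Phi> i \<omega>)) (\<lambda>(x, \<phi>). ennreal (radon W x \<phi>))"
  shows "(LINT \<omega>|M. (W_hat \<beta> n X \<Phi> z \<omega> - W z)\<^sup>2)
     = (second_moment z (ln n / (2 * \<beta>)) - (first_moment z (ln n / (2 * \<beta>)))\<^sup>2) / n + (first_moment z (ln n / (2 * \<beta>)) - W z)\<^sup>2"
proof -
  interpret prob_space M by fact
  define \<delta> where "\<delta> = bandwidth \<beta> n"
  \<comment> \<open>For \<open>n = 1\<close> the bandwidth is \<open>2 * \<beta> / 0 = 0\<close>,
    and both sides are 0 by the convention for division.\<close>
  have \<delta>: "1 / \<delta> = ln n / (2 * \<beta>)" by (simp add: \<delta>_def bandwidth_def)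
  define \<xi> where "\<xi> i \<omega> = kern \<delta> (proj z (\<Phi> i \<omega>) - X i \<omega>)" for i \<omega>
  have "indep_vars (\<lambda>_. borel) (\<lambda>i \<omega>. kern \<delta> (proj z (snd (X i \<omega>, \<Phi> i \<omega>)) - fst (X i \<omega>, \<Phi> i \<omega>))) {1..n}"
    by (rule indep_vars_compose2[OF indep]) measurable
  then have "indep_vars (\<lambda>_. borel) \<xi> {1..n}" by (simp add: \<xi>_def[abs_def])
  moreover have "\<bar>\<xi> i \<omega>\<bar> \<le> 1 / (4 * pi) * (LINT r|lborel. cut (1 / \<delta>) r)" for i \<omega>
    unfolding \<xi>_def by (rule kern_bounded)
  moreover have "expectation (\<xi> i) = first_moment z (ln n / (2 * \<beta>))" if "i \<in> {1..n}" for i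
    using arg_cong[OF kern_moments(1)[OF data_char[OF assms(1) dist[OF that]]], of Re \<delta> z]
    by (simp only: \<xi>_def[abs_def] first_moment_def \<delta> Re_complex_of_real)
  moreover have "expectation (\<lambda>\<omega>. (\<xi> i \<omega>)\<^sup>2) = second_moment z (ln n / (2 * \<beta>))" if "i \<in> {1..n}" for i
    using arg_cong[OF kern_moments(2)[OF data_char[OF assms(1) dist[OF that]]], of Re \<delta> z]
    by (simp only: \<xi>_def[abs_def] second_moment_def \<delta> Re_complex_of_real)
  ultimately have "expectation (\<lambda>\<omega>. ((1 / real n) * (\<Sum>i=1..n. \<xi> i \<omega>) - W z)\<^sup>2)
     = (second_moment z (ln n / (2 * \<beta>)) - (first_moment z (ln n / (2 * \<beta>)))\<^sup>2) / n + (first_moment z (ln n / (2 * \<beta>)) - W z)\<^sup>2"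
    using n by (intro mean_square_error)
  then show ?thesis by (simp add: W_hat_def \<xi>_def \<delta>_def)
qed

lemma second_moment_limit:
  assumes "filterlim D at_top sequentially"
  shows "(\<lambda>n. second_moment z (D n) / D n ^ 3) \<longlonglongrightarrow> dual_radon (radon W) z / (24 * pi\<^sup>2)"
proof -
  have "(\<lambda>n. Re (of_real (1 / (16 * pi\<^sup>2)) * ((LINT t|lborel. of_real (cut_conv (D n) t) * psi z t) / of_real (D n ^ 3))))
      \<longlonglongrightarrow> Re (of_real (1 / (16 * pi\<^sup>2)) * (of_real (2 / 3) * (LINT t|lborel. psi z t)))"
    by (intro tendsto_intros cut_conv_limit psi_integrable assms)
  \<comment> \<open>The constant is \<open>2 / 3\<close> from the self-convolution at 0 times
    \<open>1 / (16 * pi\<^sup>2)\<close> from the squared kernel.\<close>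
  moreover have "Re (of_real (1 / (16 * pi\<^sup>2)) * (of_real (2 / 3) * (LINT t|lborel. psi z t))) = dual_radon (radon W) z / (24 * pi\<^sup>2)"
    unfolding integral_psi by (simp flip: of_real_mult)
  moreover have "Re (of_real (1 / (16 * pi\<^sup>2)) * ((LINT t|lborel. of_real (cut_conv (D n) t) * psi z t) / of_real (D n ^ 3)))
      = second_moment z (D n) / D n ^ 3" for n
    unfolding second_moment_def times_divide_eq_right Re_divide_of_real ..
  ultimately show ?thesis by simp
qed

text \<open>Divided by \<open>ln (real n) ^ 3 / real n\<close>, the risk is the second moment over
  the cubed logarithm, which converges, minus the squared mean over the cubed logarithm, plus
  \<open>real n\<close> times the squared bias over the cubed logarithm. The last two are at most a
  constant over \<open>D n\<close>.\<close>

lemma risk_asymptotics: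
  assumes "dual_radon (radon W) z > 0"
    and risk: "\<And>n. n \<ge> 1 \<Longrightarrow> R n = (second_moment z (ln (real n) / (2 * \<beta>)) - (first_moment z (ln (real n) / (2 * \<beta>)))\<^sup>2) / real n
      + (first_moment z (ln (real n) / (2 * \<beta>)) - W z)\<^sup>2"
  shows "R \<sim>[at_top] (\<lambda>n. C_star \<beta> * dual_radon (radon W) z * (ln (real n) ^ 3 / real n))"
proof (rule asymp_equivI'_const)
  define D where "D n = ln (real n) / (2 * \<beta>)" for n :: nat
  have D: "filterlim D at_top sequentially"
    unfolding D_def using beta_pos
    by (simp add: divide_inverse mult.commute[of _ "inverse (2 * \<beta>)"] del: inverse_mult_distrib)
      (rule filterlim_tendsto_pos_mult_at_top[OF tendsto_const _ filterlim_compose[OF ln_at_top filterlim_real_sequentially]], simp)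
  have inv: "(\<lambda>n. c / D n) \<longlonglongrightarrow> 0" for c
    by (intro tendsto_divide_0[OF tendsto_const] filterlim_at_top_imp_at_infinity[OF D])
  have ln_eq: "ln (real n) = 2 * \<beta> * D n" for n using beta_pos by (simp add: D_def)
  obtain B where B: "B \<ge> 0" and bias: "\<And>d. d \<ge> 1 \<Longrightarrow> \<bar>first_moment z d - W z\<bar> \<le> B * d * exp (- \<beta> * d)"
  proof -
    obtain B where B: "B \<ge> 0" "\<forall>D\<ge>1. cmod (of_real (1 / (4 * pi)) * (LINT t|lborel. of_real (cut D t) * psi z t) - of_real (W z)) \<le> B * D * exp (- \<beta> * D)"
      using bias_bound by blast
    have "\<bar>first_moment z d - W z\<bar> \<le> B * d * exp (- \<beta> * d)" if "d \<ge> 1" for d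
    proof -
      have "first_moment z d - W z = Re (of_real (1 / (4 * pi)) * (LINT t|lborel. of_real (cut d t) * psi z t) - of_real (W z))"
        by (simp add: first_moment_def)
      then show ?thesis using B(2) that abs_Re_le_cmod order_trans by metis
    qed
    then show ?thesis using B(1) that by blast
  qed
  have ev: "eventually (\<lambda>n. D n \<ge> 1 \<and> n \<ge> 1) sequentially"
    using filterlim_at_top[THEN iffD1, OF D, rule_format, of 1] eventually_ge_at_top[of "1::nat"] by eventually_elim simp
  have l1: "(\<lambda>n. second_moment z (D n) / ln (real n) ^ 3) \<longlonglongrightarrow> C_star \<beta> * dual_radon (radon W) z"
  proof -
    have "(\<lambda>n. 1 / (2 * \<beta>) ^ 3 * (second_moment z (D n) / D n ^ 3)) \<longlonglongrightarrow> 1 / (2 * \<beta>) ^ 3 * (dual_radon (radon W) z / (24 * pi\<^sup>2))"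
      by (intro tendsto_mult_left second_moment_limit D)
    \<comment> \<open>Both constants are
      \<open>1 / (192 * pi\<^sup>2 * \<beta> ^ 3)\<close>.\<close>
    moreover have "1 / (2 * \<beta>) ^ 3 * (dual_radon (radon W) z / (24 * pi\<^sup>2)) = C_star \<beta> * dual_radon (radon W) z"
      using beta_pos by (simp add: C_star_def power_mult_distrib power2_eq_square power3_eq_cube)
    moreover have "1 / (2 * \<beta>) ^ 3 * (second_moment z (D n) / D n ^ 3) = second_moment z (D n) / ln (real n) ^ 3" for n
      unfolding ln_eq by (simp add: power_mult_distrib)
    ultimately show ?thesis by (simp only:)
  qed
  have l2: "(\<lambda>n. (first_moment z (D n))\<^sup>2 / ln (real n) ^ 3) \<longlonglongrightarrow> 0"
  proof (rule tendsto_sandwich[OF _ _ tendsto_const inv])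
    show "eventually (\<lambda>n. (first_moment z (D n))\<^sup>2 / ln (real n) ^ 3 \<le> ((\<bar>W z\<bar> + B / \<beta>)\<^sup>2 / (2 * \<beta>) ^ 3) / D n) sequentially"
      using ev
    proof eventually_elim
      case (elim n)
      have "\<beta> * D n \<le> exp (\<beta> * D n)" using exp_ge_add_one_self[of "\<beta> * D n"] by linarith
      then have "D n * exp (- \<beta> * D n) \<le> 1 / \<beta>" using beta_pos by (simp add: exp_minus field_simps)
      then have "B * (D n * exp (- \<beta> * D n)) \<le> B * (1 / \<beta>)" using B by (rule mult_left_mono)
      then have "\<bar>first_moment z (D n)\<bar> \<le> \<bar>W z\<bar> + B / \<beta>" using bias[of "D n"] elim by (simp add: mult.assoc)
      then have "(first_moment z (D n))\<^sup>2 \<le> (\<bar>W z\<bar> + B / \<beta>)\<^sup>2" by (rule power2_le_iff_abs_le[THEN iffD2, rotated]) (use B beta_pos in auto)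
      moreover have "(2 * \<beta>) ^ 3 * D n \<le> ln (real n) ^ 3"
      proof -
        have "D n ^ 1 \<le> D n ^ 3" using elim by (intro power_increasing) auto
        then show ?thesis unfolding ln_eq power_mult_distrib[of "2 * \<beta>"] using beta_pos by (intro mult_left_mono) auto
      qed
      ultimately have "(first_moment z (D n))\<^sup>2 / ln (real n) ^ 3 \<le> (\<bar>W z\<bar> + B / \<beta>)\<^sup>2 / ((2 * \<beta>) ^ 3 * D n)"
        using elim beta_pos by (intro frac_le) auto
      then show ?case by simp
    qed
    show "eventually (\<lambda>n. 0 \<le> (first_moment z (D n))\<^sup>2 / ln (real n) ^ 3) sequentially"
      using eventually_ge_at_top[of "1::nat"] by eventually_elim simp
  qed
  have l3: "(\<lambda>n. (first_moment z (D n) - W z)\<^sup>2 * real n / ln (real n) ^ 3) \<longlonglongrightarrow> 0"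
  proof (rule tendsto_sandwich[OF _ _ tendsto_const inv])
    show "eventually (\<lambda>n. (first_moment z (D n) - W z)\<^sup>2 * real n / ln (real n) ^ 3 \<le> (B\<^sup>2 / (2 * \<beta>) ^ 3) / D n) sequentially"
      using ev
    proof eventually_elim
      case (elim n)
      have "(first_moment z (D n) - W z)\<^sup>2 \<le> (B * D n * exp (- \<beta> * D n))\<^sup>2"
        using bias[of "D n"] elim B by (intro power2_le_iff_abs_le[THEN iffD2]) auto
      \<comment> \<open>The squared exponential is \<open>exp (- 2 * \<beta> * D n)\<close>, which
        the choice of bandwidth makes equal to \<open>1 / real n\<close>.\<close>
      also have "\<dots> = (B * D n)\<^sup>2 * exp (- ln (real n))"
        unfolding ln_eq by (simp add: power_mult_distrib exp_double[symmetric] mult.assoc)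
      also have "exp (- ln (real n)) = 1 / real n" using elim by (simp add: exp_minus inverse_eq_divide)
      finally have "(first_moment z (D n) - W z)\<^sup>2 * real n \<le> (B * D n)\<^sup>2"
        using elim by (simp add: field_simps)
      then have "(first_moment z (D n) - W z)\<^sup>2 * real n / ln (real n) ^ 3 \<le> (B * D n)\<^sup>2 / ln (real n) ^ 3"
        using elim by (intro divide_right_mono) auto
      also have "\<dots> = (B\<^sup>2 / (2 * \<beta>) ^ 3) / D n"
        unfolding ln_eq using elim beta_pos by (simp add: power_mult_distrib power2_eq_square power3_eq_cube)
      finally show ?case .
    qed
    show "eventually (\<lambda>n. 0 \<le> (first_moment z (D n) - W z)\<^sup>2 * real n / ln (real n) ^ 3) sequentially"
      using eventually_ge_at_top[of "1::nat"] by eventually_elim simp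
  qed
  have lim: "(\<lambda>n. second_moment z (D n) / ln (real n) ^ 3 - (first_moment z (D n))\<^sup>2 / ln (real n) ^ 3 + (first_moment z (D n) - W z)\<^sup>2 * real n / ln (real n) ^ 3)
      \<longlonglongrightarrow> C_star \<beta> * dual_radon (radon W) z"
    using tendsto_add[OF tendsto_diff[OF l1 l2] l3] by simp
  show "(\<lambda>n. R n / (ln (real n) ^ 3 / real n)) \<longlonglongrightarrow> C_star \<beta> * dual_radon (radon W) z"
  proof (rule Lim_transform_eventually[OF lim])
    show "eventually (\<lambda>n. second_moment z (D n) / ln (real n) ^ 3 - (first_moment z (D n))\<^sup>2 / ln (real n) ^ 3 + (first_moment z (D n) - W z)\<^sup>2 * real n / ln (real n) ^ 3
      = R n / (ln (real n) ^ 3 / real n)) sequentially"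
      using ev
    proof eventually_elim
      case (elim n)
      then have "ln (real n) > 0" "real n > 0" using beta_pos by (simp_all add: ln_eq del: ln_gt_zero_iff)
      then show ?case unfolding risk[OF conjunct2[OF elim]] D_def[symmetric] by (simp add: field_simps)
    qed
  qed
  \<comment> \<open>Strict positivity of the backprojection is what turns convergence of the
    quotient into asymptotic equivalence.\<close>
  show "C_star \<beta> * dual_radon (radon W) z \<noteq> 0"
    using assms(1) beta_pos by (simp add: C_star_def)
qed

end

text \<open>Without an orthonormal basis \<open>has_trace\<close> would hold vacuously and \<open>op_trace\<close> would be constant.\<close>

lemma orthonormal_basis_exists:
  assumes "\<beta> > 0" "is_wigner_function_of \<rho> W" "dual_radon (radon W) z > 0"
    and decay: "(\<integral>\<^sup>+w. ennreal ((cmod (W_tilde \<rho> w))\<^sup>2 * exp (2 * \<beta> * norm w)) \<partial>lborel) < \<infinity>"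
  shows "\<exists>f. orthonormal_basis f"
proof (rule ccontr)
  assume "\<nexists>f. orthonormal_basis f"
  then have const: "W_tilde \<rho> w = (THE \<tau>. True)" for w
    by (simp add: W_tilde_def op_trace_def has_trace_def)
  \<comment> \<open>Without a basis the transform is a single constant. A nonzero constant
    contradicts the exponential weight, and 0 would make \<open>W\<close> and its backprojection
    vanish.\<close>
  define c where "c = (THE \<tau>::complex. True)"
  have "c = 0"
  proof (rule ccontr)
    assume "c \<noteq> 0"
    have "\<infinity> = (\<integral>\<^sup>+w. ennreal ((cmod c)\<^sup>2) \<partial>(lborel :: (real \<times> real) measure))"
      using \<open>c \<noteq> 0\<close> by (simp add: ennreal_mult_top)
    also have "\<dots> \<le> (\<integral>\<^sup>+w. ennreal ((cmod (W_tilde \<rho> w))\<^sup>2 * exp (2 * \<beta> * norm w)) \<partial>lborel)"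
      unfolding const c_def[symmetric] using assms(1) by (intro nn_integral_mono ennreal_leI) (simp add: mult_le_cancel_left1)
    finally show False using decay by simp
  qed
  then have "complex_of_real (W y) = 0" for y
    using assms(2) by (cases y) (simp add: is_wigner_function_of_def inv_fourier2_def const c_def)
  then have "W y = 0" for y by (simp only: of_real_eq_0_iff)
  then have "dual_radon (radon W) z = 0" by (simp add: dual_radon_def radon_def)
  then show False using assms(3) by simp
qed

theorem theorem1:
  fixes \<beta> L :: real
    and W :: "real \<times> real \<Rightarrow> real"
    and z :: "real \<times> real"
    and M :: "nat \<Rightarrow> 'a measure"
    and X \<Phi> :: "nat \<Rightarrow> nat \<Rightarrow> 'a \<Rightarrow> real"
  assumes "\<beta> > 0" and "L > 0"
    and "W \<in> wigner_class \<beta> L"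
    and "dual_radon (radon W) z > 0"
    and "\<And>n. prob_space (M n)"
    and "\<And>n. prob_space.indep_vars (M n) (\<lambda>_. borel) (\<lambda>i \<omega>. (X n i \<omega>, \<Phi> n i \<omega>)) {1..n}"
    and "\<And>n i. i \<in> {1..n} \<Longrightarrow>
           distributed (M n) data_measure (\<lambda>\<omega>. (X n i \<omega>, \<Phi> n i \<omega>)) (\<lambda>(x, \<phi>). ennreal (radon W x \<phi>))"
  shows "(\<lambda>n. LINT \<omega>|M n. (W_hat \<beta> n (X n) (\<Phi> n) z \<omega> - W z)\<^sup>2)
           \<sim>[at_top] (\<lambda>n. C_star \<beta> * dual_radon (radon W) z * (ln (real n) ^ 3 / real n))"
proof -
  obtain \<rho> where \<rho>: "density_matrix \<rho>" "is_wigner_function_of \<rho> W"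
    and le: "ennreal (1 / (4 * pi\<^sup>2)) * (\<integral>\<^sup>+ w. ennreal ((cmod (W_tilde \<rho> w))\<^sup>2 * exp (2 * \<beta> * norm w)) \<partial>lborel) \<le> ennreal L"
    using assms(3) unfolding wigner_class_def by blast
  have decay: "(\<integral>\<^sup>+w. ennreal ((cmod (W_tilde \<rho> w))\<^sup>2 * exp (2 * \<beta> * norm w)) \<partial>lborel) < \<infinity>"
    using order_le_less_trans[OF le ennreal_less_top] by (auto simp: ennreal_mult_less_top)
  obtain f where f: "orthonormal_basis f"
    using orthonormal_basis_exists[OF assms(1) \<rho>(2) assms(4) decay] by blast
  interpret wigner_transform "W_tilde \<rho>" W \<beta>
    by unfold_locales
      (use assms(1) \<rho> f decay in \<open>auto simp: is_wigner_function_of_def intro: W_tilde_continuous W_tilde_bound W_tilde_0 W_tilde_gaussian_L1\<close>)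
  show ?thesis
    by (rule risk_asymptotics[OF assms(4)]) (rule risk_eq[OF assms(5) _ assms(6,7)])
qed

end
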